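(* Let $N\in\mathbb N$, $\alpha\in(0,N)$, $p>1$ and $q>1$. Assume that $$\text{either}\quad \frac1p>\frac{(N-2)_+}{N+\alpha}\quad\text{and}\quad \frac1q\notin\Bigl(\frac12-\frac1N,\ \frac1{2p}+\frac{\alpha}{2Np}\Bigr),$$ $$\text{or}\quad \frac1p<\frac{(N-2)_+}{N+\alpha}\quad\text{and}\quad \frac1q\notin\Bigl(\frac1{2p}+\frac{\alpha}{2Np},\ \frac12-\frac1N\Bigr).$$ Then the equation $$-\Delta u+(I_\alpha*|u|^p)|u|^{p-2}u=|u|^{q-2}u\quad\text{in }\mathbb R^N$$ has no nontrivial weak solutions $u\in E^{\alpha,p}(\mathbb R^N)\cap L^q(\mathbb R^N)$ such that $Du\in E^{\alpha,p}_{\mathrm{loc}}(\mathbb R^N)\cap L^q_{\mathrm{loc}}(\mathbb R^N)$.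
   Context: $\mathbb N$ denotes the positive integers and $t_+=\max\{t,0\}$. For $\alpha\in(0,N)$ the Riesz potential is $I_\alpha(x)=A_\alpha|x|^{-(N-\alpha)}$ for $x\in\mathbb R^N\setminus\{0\}$, with $A_\alpha=\frac{\Gamma((N-\alpha)/2)}{\Gamma(\alpha/2)\pi^{N/2}2^\alpha}$. For $p\ge1$, the Coulomb--Sobolev space $E^{\alpha,p}(\mathbb R^N)$ is the vector space of (a.e. classes of) measurable functions $u:\mathbb R^N\to\mathbb R$ with $\int_{\mathbb R^N}|I_{\alpha/2}*|u|^p|^2<\infty$ that are weakly differentiable with $Du\in L^2(\mathbb R^N)$. The condition $Du\in E^{\alpha,p}_{\mathrm{loc}}(\mathbb R^N)\cap L^q_{\mathrm{loc}}(\mathbb R^N)$ means that for every $\psi\in C^\infty_c(\mathbb R^N;\mathbb R^N)$, $\psi\cdot\nabla u\in E^{\alpha,p}(\mathbb R^N)\cap L^q(\mathbb R^N)$. A weak solution is a function $u$ satisfying $\int\nabla u\cdot\nabla\varphi+\int(I_\alpha*|u|^p)|u|^{p-2}u\varphi=\int|u|^{q-2}u\varphi$ for all $\varphi\in C^\infty_c(\mathbb R^N)$. *)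

theory Defs
  imports "HOL-Analysis.Analysis"
begin

text \<open>
  \<open>\<real>\<^sup>N\<close> is an arbitrary type \<open>'a::euclidean_space\<close>, with \<open>N = DIM('a)\<close>. Almost-everywhere
  classes of functions are handled through representatives.
\<close>

definition riesz_const :: "nat \<Rightarrow> real \<Rightarrow> real" where
  "riesz_const N \<alpha> =
     Gamma ((real N - \<alpha>) / 2) / (Gamma (\<alpha> / 2) * pi powr (real N / 2) * 2 powr \<alpha>)"

text \<open>At the origin, where the kernel is singular, this takes the irrelevant value \<open>0\<close>.\<close>

definition riesz_kernel :: "real \<Rightarrow> 'a::euclidean_space \<Rightarrow> real" where
  "riesz_kernel \<alpha> x = riesz_const DIM('a) \<alpha> / norm x powr (real DIM('a) - \<alpha>)"

text \<open>The convolution \<open>I\<^sub>\<alpha> * f\<close>, for nonnegative \<open>f\<close> only; it may take the value \<open>\<infinity>\<close>.\<close>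

definition riesz_potential ::
    "real \<Rightarrow> ('a::euclidean_space \<Rightarrow> real) \<Rightarrow> 'a \<Rightarrow> ennreal" where
  "riesz_potential \<alpha> f x = (\<integral>\<^sup>+ y. ennreal (riesz_kernel \<alpha> (x - y) * f y) \<partial>lebesgue)"

definition Lp :: "real \<Rightarrow> ('a::euclidean_space \<Rightarrow> 'b::euclidean_space) set" where
  "Lp r = {f. f \<in> borel_measurable lebesgue \<and> integrable lebesgue (\<lambda>x. norm (f x) powr r)}"

definition locally_integrable :: "('a::euclidean_space \<Rightarrow> 'b::euclidean_space) \<Rightarrow> bool" where
  "locally_integrable f \<longleftrightarrow>
     f \<in> borel_measurable lebesgue \<and> (\<forall>K. compact K \<longrightarrow> f absolutely_integrable_on K)"

text \<open>
  \<open>C\<^sup>k\<close> by recursion on \<open>k\<close>; continuity of the lower-order derivatives is implied by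
  differentiability.
\<close>

fun Ck :: "nat \<Rightarrow> ('a::euclidean_space \<Rightarrow> 'b::euclidean_space) \<Rightarrow> bool" where
  "Ck 0 f \<longleftrightarrow> continuous_on UNIV f"
| "Ck (Suc k) f \<longleftrightarrow>
     (\<forall>x. f differentiable (at x)) \<and> (\<forall>v. Ck k (\<lambda>x. frechet_derivative f (at x) v))"

definition test_functions :: "('a::euclidean_space \<Rightarrow> 'b::euclidean_space) set" where
  "test_functions = {\<phi>. (\<forall>k. Ck k \<phi>) \<and> compact (closure {x. \<phi> x \<noteq> 0})}"

definition gradient :: "('a::euclidean_space \<Rightarrow> real) \<Rightarrow> 'a \<Rightarrow> 'a" where
  "gradient f x = (\<Sum>b\<in>Basis. frechet_derivative f (at x) b *\<^sub>R b)"

definition has_weak_gradient ::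
    "('a::euclidean_space \<Rightarrow> real) \<Rightarrow> ('a \<Rightarrow> 'a) \<Rightarrow> bool" where
  "has_weak_gradient u g \<longleftrightarrow> locally_integrable u \<and> locally_integrable g \<and>
     (\<forall>\<phi>\<in>test_functions.
        (LINT x|lebesgue. u x *\<^sub>R gradient \<phi> x) = - (LINT x|lebesgue. \<phi> x *\<^sub>R g x))"

definition weakly_differentiable :: "('a::euclidean_space \<Rightarrow> real) \<Rightarrow> bool" where
  "weakly_differentiable u \<longleftrightarrow> (\<exists>g. has_weak_gradient u g)"

text \<open>
  A representative of the weak gradient, which is unique up to a null set. It is meaningful
  only for weakly differentiable functions.
\<close>

definition weak_grad :: "('a::euclidean_space \<Rightarrow> real) \<Rightarrow> 'a \<Rightarrow> 'a" where
  "weak_grad u = (SOME g. has_weak_gradient u g)"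

definition coulomb_sobolev :: "real \<Rightarrow> real \<Rightarrow> ('a::euclidean_space \<Rightarrow> real) set" where
  "coulomb_sobolev \<alpha> p = {u. u \<in> borel_measurable lebesgue \<and>
     (\<integral>\<^sup>+ x. (riesz_potential (\<alpha> / 2) (\<lambda>y. \<bar>u y\<bar> powr p) x)\<^sup>2 \<partial>lebesgue) < \<infinity> \<and>
     weakly_differentiable u \<and> weak_grad u \<in> Lp 2}"

definition grad_loc_in ::
    "('a::euclidean_space \<Rightarrow> real) \<Rightarrow> ('a \<Rightarrow> real) set \<Rightarrow> bool" where
  "grad_loc_in u X \<longleftrightarrow> weakly_differentiable u \<and>
     (\<forall>\<psi>\<in>test_functions. (\<lambda>x. \<psi> x \<bullet> weak_grad u x) \<in> X)"

text \<open>
  Weak solutions of \<open>- \<Delta>u + (I\<^sub>\<alpha> * |u|\<^sup>p) |u|\<^sup>p\<^sup>-\<^sup>2 u = |u|\<^sup>q\<^sup>-\<^sup>2 u\<close>. Integrability of the three terms is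
  part of the notion, since the Bochner integral of a non-integrable function is \<open>0\<close> by convention;
  for \<open>u\<close> in \<open>coulomb_sobolev \<alpha> p \<inter> Lp q\<close> with \<open>0 < \<alpha> < N\<close>, \<open>p, q > 1\<close> it holds automatically
  (and \<open>I\<^sub>\<alpha> * |u|\<^sup>p\<close> is then finite almost everywhere).
\<close>

definition weak_solution ::
    "real \<Rightarrow> real \<Rightarrow> real \<Rightarrow> ('a::euclidean_space \<Rightarrow> real) \<Rightarrow> bool" where
  "weak_solution \<alpha> p q u \<longleftrightarrow> weakly_differentiable u \<and>
     (\<forall>\<phi>\<in>test_functions.
        let D = (\<lambda>x. weak_grad u x \<bullet> gradient \<phi> x);
            V = (\<lambda>x. enn2real (riesz_potential \<alpha> (\<lambda>y. \<bar>u y\<bar> powr p) x)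
                      * \<bar>u x\<bar> powr (p - 2) * u x * \<phi> x);
            F = (\<lambda>x. \<bar>u x\<bar> powr (q - 2) * u x * \<phi> x)
        in integrable lebesgue D \<and> integrable lebesgue V \<and> integrable lebesgue F \<and>
           (LINT x|lebesgue. D x) + (LINT x|lebesgue. V x) = (LINT x|lebesgue. F x))"

end

theory Submission
  imports Defs "HOL-Probability.Probability_Measure"
begin

text \<open>
  Write \<open>A\<close> for the Dirichlet integral of \<open>u\<close>, \<open>B\<close> for the integral of \<open>(I\<^sub>\<alpha> * |u|\<^sup>p) |u|\<^sup>p\<close> and
  \<open>C\<close> for the integral of \<open>|u|\<^sup>q\<close>. Testing the equation with \<open>u\<close> gives the Nehari identity
  \<open>A + B = C\<close> (\<open>nehari\<close>). Testing it with \<open>x \<cdot> \<nabla>u\<close>, the derivative of the dilates of \<open>u\<close>, gives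
  the Pohozaev identity \<open>(1 - N/2) A - (N + \<alpha>)/(2p) B = - (N/q) C\<close> (\<open>pohozaev\<close>). Eliminating
  \<open>C\<close> leaves \<open>(a - 1/q) A + (b - 1/q) B = 0\<close> with \<open>a = 1/2 - 1/N\<close> and \<open>b = 1/(2p) + \<alpha>/(2Np)\<close>.
  The two cases of the hypothesis are \<open>a < b\<close> and \<open>b < a\<close>, and \<open>1/q\<close> does not lie strictly between
  the two numbers, so both coefficients have the same weak sign and at least one of them is nonzero.
  Hence \<open>A = 0\<close> or \<open>B = 0\<close>. If \<open>B = 0\<close>, then \<open>u = 0\<close> because the kernel is positive. If \<open>A = 0\<close>,
  then \<open>u\<close> is invariant under translations and \<open>q\<close>-integrable, so again \<open>u = 0\<close>.

  The work lies in justifying the two test functions, as the equation is only known for smooth ones.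
  The main tool is \<open>sgn_powr_weak_limit\<close>: in each of the three terms one may pass to the limit along
  a sequence of test functions that converges almost everywhere and is bounded in the energy space.
  Compactly supported elements of that space are reached by mollification, which is an average of
  translates and by Jensen's inequality increases none of the norms. Square integrable
  elements are reached by cutting off. The solution \<open>u\<close> itself need not be square integrable,
  but \<open>u - u(\<cdot> + t)\<close> is, since \<open>\<nabla>u\<close> is, and \<open>u(\<cdot> + t)\<close> disappears as \<open>t\<close> runs to infinity along
  a suitable sequence (\<open>testable_solution\<close>). The Coulomb energy controls the nonlocal term because
  \<open>I\<^sub>\<alpha>\<close> is bounded by a multiple of \<open>I\<^bsub>\<alpha>/2\<^esub> * I\<^bsub>\<alpha>/2\<^esub>\<close> (\<open>riesz_kernel_le_convolution\<close>).

  For the Pohozaev identity the field \<open>x\<close> is replaced by compactly supported fields \<open>Y\<close>, which are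
  rescalings of one cut-off of it. The regularity hypothesis says that \<open>Y \<cdot> \<nabla>u\<close> belongs to the
  energy space, hence is a test function. Each of the three terms is then computed by the chain rule
  for \<open>|u|\<^sup>r\<close> (\<open>weak_chain_rule\<close>), which holds as soon as \<open>|u|\<^sup>r\<close> and the \<open>r\<close>-th power
  of the derivative are locally integrable. In the nonlocal term the kernel is made smooth first, and symmetrising in
  the two variables turns its singular gradient into a bounded difference quotient of \<open>Y\<close>
  (\<open>nonlocal_term\<close>). Finally the cut-off is removed by dominated convergence.
\<close>

section \<open>Directional derivatives and functions of class \<open>C\<^sup>k\<close>\<close>

definition dir_deriv :: "'a::euclidean_space \<Rightarrow> ('a \<Rightarrow> 'b::euclidean_space) \<Rightarrow> 'a \<Rightarrow> 'b" where
  "dir_deriv e f x = frechet_derivative f (at x) e"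

lemma dir_derivI: "(f has_derivative f') (at x) \<Longrightarrow> dir_deriv e f x = f' e"
  unfolding dir_deriv_def by (metis frechet_derivative_at)

lemma Ck_Suc_iff: "Ck (Suc k) f \<longleftrightarrow> (\<forall>x. f differentiable (at x)) \<and> (\<forall>v. Ck k (dir_deriv v f))"
  by (simp add: dir_deriv_def[abs_def])

declare Ck.simps(2) [simp del]

lemma Ck_differentiable: "Ck (Suc k) f \<Longrightarrow> f differentiable (at x)"
  by (simp add: Ck_Suc_iff)

lemma Ck_dir_deriv: "Ck (Suc k) f \<Longrightarrow> Ck k (dir_deriv v f)"
  by (simp add: Ck_Suc_iff)

lemma linear_dir_deriv: "f differentiable (at x) \<Longrightarrow> linear (\<lambda>v. dir_deriv v f x)"
  unfolding dir_deriv_def by (simp add: linear_frechet_derivative eta_contract_eq)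

lemma Ck_Suc_has_derivative:
  "Ck (Suc k) f \<Longrightarrow> (f has_derivative (\<lambda>v. dir_deriv v f x)) (at x)"
  using frechet_derivative_works[of f "at x"] Ck_differentiable[of k f x] by (simp add: dir_deriv_def eta_contract_eq)

lemma Ck_SucI:
  assumes "\<And>x. (f has_derivative f' x) (at x)" and "\<And>v. Ck k (\<lambda>x. f' x v)"
  shows "Ck (Suc k) f"
proof -
  have "dir_deriv v f = (\<lambda>x. f' x v)" for v
    using assms(1) dir_derivI by blast
  then show ?thesis
    using assms by (auto simp: differentiable_def Ck_Suc_iff)
qed

lemma Ck_mono: "Ck (Suc k) f \<Longrightarrow> Ck k f"
proof (induction k arbitrary: f)
  case 0
  then show ?case
    by (auto intro!: differentiable_imp_continuous_on simp: differentiable_on_def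
        intro: differentiable_at_withinI Ck_differentiable)
next
  case (Suc k)
  then show ?case by (metis Ck_Suc_iff)
qed

lemma Ck_le: "Ck n f \<Longrightarrow> k \<le> n \<Longrightarrow> Ck k f"
  by (induction n) (auto simp: le_Suc_eq simp del: Ck.simps intro: Ck_mono)

lemma Ck_imp_continuous: "Ck k f \<Longrightarrow> continuous_on UNIV f"
  using Ck_le[of k f 0] by simp

lemma Ck_const [simp]: "Ck k (\<lambda>x. c)"
proof (induction k arbitrary: c)
  case (Suc k)
  show ?case by (rule Ck_SucI[of _ "\<lambda>_ _. 0"]) (auto intro!: derivative_eq_intros Suc)
qed auto

lemma Ck_bounded_linear: "bounded_linear L \<Longrightarrow> Ck k L"
proof (cases k)
  case 0
  then show "bounded_linear L \<Longrightarrow> Ck k L" by (auto simp: linear_continuous_on)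
next
  case (Suc n)
  assume L: "bounded_linear L"
  show "Ck k L" unfolding Suc
    by (rule Ck_SucI[of _ "\<lambda>_. L"]) (auto intro!: bounded_linear_imp_has_derivative L)
qed

lemma Ck_add: "Ck k f \<Longrightarrow> Ck k g \<Longrightarrow> Ck k (\<lambda>x. f x + g x)"
proof (induction k arbitrary: f g)
  case 0
  then show ?case by (auto intro: continuous_intros)
next
  case (Suc k)
  have "((\<lambda>x. f x + g x) has_derivative (\<lambda>v. dir_deriv v f x + dir_deriv v g x)) (at x)" for x
    using Suc.prems by (intro has_derivative_add Ck_Suc_has_derivative)
  then show ?case
    by (rule Ck_SucI) (intro Suc.IH Ck_dir_deriv Suc.prems)
qed

lemma Ck_bilinear:
  assumes "bounded_bilinear h"
  shows "Ck k f \<Longrightarrow> Ck k g \<Longrightarrow> Ck k (\<lambda>x. h (f x) (g x))"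
proof (induction k arbitrary: f g)
  case 0
  then show ?case
    by (auto intro: bounded_bilinear.continuous_on[OF assms])
next
  case (Suc k)
  have "((\<lambda>x. h (f x) (g x)) has_derivative
      (\<lambda>v. h (f x) (dir_deriv v g x) + h (dir_deriv v f x) (g x))) (at x)" for x
    using Suc.prems by (intro bounded_bilinear.FDERIV[OF assms] Ck_Suc_has_derivative)
  then show ?case
    by (rule Ck_SucI) (intro Ck_add Suc.IH Ck_dir_deriv Ck_mono[OF Suc.prems(1)] Ck_mono[OF Suc.prems(2)] Suc.prems)
qed

lemmas Ck_scaleR = Ck_bilinear[OF bounded_bilinear_scaleR]
lemmas Ck_mult = Ck_bilinear[OF bounded_bilinear_mult]
lemmas Ck_inner = Ck_bilinear[OF bounded_bilinear_inner]

lemma Ck_diff: "Ck k f \<Longrightarrow> Ck k g \<Longrightarrow> Ck k (\<lambda>x. f x - g x)" for f g :: "'a::euclidean_space \<Rightarrow> 'b::euclidean_space"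
  using Ck_add[of k f "\<lambda>x. (-1) *\<^sub>R g x"] Ck_scaleR[of k "\<lambda>_. -1" g] by simp

lemma Ck_compose_real:
  fixes \<theta> :: "real \<Rightarrow> real" and f :: "'a::euclidean_space \<Rightarrow> real"
  shows "Ck k \<theta> \<Longrightarrow> Ck k f \<Longrightarrow> Ck k (\<lambda>x. \<theta> (f x))"
proof (induction k arbitrary: \<theta> f)
  case 0
  then show ?case by (auto intro: continuous_on_compose2)
next
  case (Suc k)
  have "((\<lambda>x. \<theta> (f x)) has_derivative (\<lambda>v. dir_deriv (dir_deriv v f x) \<theta> (f x))) (at x)" for x
    using diff_chain_at[OF Ck_Suc_has_derivative[OF Suc.prems(2)] Ck_Suc_has_derivative[OF Suc.prems(1)]]
    by (simp add: o_def)
  moreover have "dir_deriv (dir_deriv v f x) \<theta> (f x) = dir_deriv v f x * dir_deriv 1 \<theta> (f x)" for v x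
  proof -
    have "linear (\<lambda>v. dir_deriv v \<theta> (f x))"
      using Suc.prems by (auto intro: linear_dir_deriv Ck_differentiable)
    from linear_scale[OF this, of "dir_deriv v f x" 1] show ?thesis by simp
  qed
  ultimately have "((\<lambda>x. \<theta> (f x)) has_derivative (\<lambda>v. dir_deriv v f x * dir_deriv 1 \<theta> (f x))) (at x)" for x
    by simp
  then show ?case
  proof (rule Ck_SucI)
    fix v
    show "Ck k (\<lambda>x. dir_deriv v f x * dir_deriv 1 \<theta> (f x))"
    proof (rule Ck_mult)
      show "Ck k (\<lambda>x. dir_deriv v f x)"
        using Ck_dir_deriv[OF Suc.prems(2)] by (simp add: eta_contract_eq)
      show "Ck k (\<lambda>x. dir_deriv 1 \<theta> (f x))"
        by (rule Suc.IH[OF Ck_dir_deriv[OF Suc.prems(1)] Ck_mono[OF Suc.prems(2)]])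
    qed
  qed
qed

lemma Ck_affine:
  fixes f :: "'a::euclidean_space \<Rightarrow> 'b::euclidean_space"
  shows "Ck k f \<Longrightarrow> Ck k (\<lambda>x. f (a + c *\<^sub>R x))"
proof (induction k arbitrary: f)
  case 0
  then show ?case by (auto intro!: continuous_on_compose2[of UNIV f] continuous_intros)
next
  case (Suc k)
  have *: "((\<lambda>x. f (a + c *\<^sub>R x)) has_derivative (\<lambda>v. dir_deriv (c *\<^sub>R v) f (a + c *\<^sub>R x))) (at x)" for x
  proof -
    have "((\<lambda>x. a + c *\<^sub>R x) has_derivative (\<lambda>v. c *\<^sub>R v)) (at x)"
      by (auto intro!: derivative_eq_intros)
    from diff_chain_at[OF this Ck_Suc_has_derivative[OF Suc.prems]] show ?thesis
      by (simp add: o_def)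
  qed
  then show ?case
    by (rule Ck_SucI) (rule Suc.IH[OF Ck_dir_deriv[OF Suc.prems]])
qed

lemma dir_deriv_affine:
  assumes "Ck (Suc k) f"
  shows "dir_deriv e (\<lambda>x. f (a + c *\<^sub>R x)) x = c *\<^sub>R dir_deriv e f (a + c *\<^sub>R x)"
proof -
  have "((\<lambda>x. a + c *\<^sub>R x) has_derivative (\<lambda>v. c *\<^sub>R v)) (at x)"
    by (auto intro!: derivative_eq_intros)
  from diff_chain_at[OF this Ck_Suc_has_derivative[OF assms]]
  have "((\<lambda>x. f (a + c *\<^sub>R x)) has_derivative (\<lambda>v. dir_deriv (c *\<^sub>R v) f (a + c *\<^sub>R x))) (at x)"
    by (simp add: o_def)
  then show ?thesis
    using linear_scale[OF linear_dir_deriv[of f "a + c *\<^sub>R x"]] Ck_differentiable[OF assms]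
    by (auto simp: dir_derivI)
qed

lemma dir_deriv_bilinear:
  assumes "bounded_bilinear h" "Ck (Suc k) f" "Ck (Suc l) g"
  shows "dir_deriv e (\<lambda>x. h (f x) (g x)) x = h (f x) (dir_deriv e g x) + h (dir_deriv e f x) (g x)"
  using bounded_bilinear.FDERIV[OF assms(1) Ck_Suc_has_derivative[OF assms(2)] Ck_Suc_has_derivative[OF assms(3)]]
  by (rule dir_derivI)

text \<open>
  In Euclidean space this says that the support is compact; as an explicit vanishing condition it is
  easier to transport through derivatives, products and convolutions.
\<close>

definition bounded_support :: "('a::real_normed_vector \<Rightarrow> 'b::zero) \<Rightarrow> bool" where
  "bounded_support f \<longleftrightarrow> (\<exists>R. \<forall>x. norm x > R \<longrightarrow> f x = 0)"

lemma test_functions_iff: "\<phi> \<in> test_functions \<longleftrightarrow> (\<forall>k. Ck k \<phi>) \<and> bounded_support \<phi>"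
proof -
  have "compact (closure {x. \<phi> x \<noteq> 0}) \<longleftrightarrow> bounded {x. \<phi> x \<noteq> 0}"
    by (meson bounded_closure bounded_subset closure_subset compact_closure)
  also have "\<dots> \<longleftrightarrow> bounded_support \<phi>"
    unfolding bounded_support_def bounded_iff by (simp, metis linorder_not_le)
  finally show ?thesis by (simp add: test_functions_def)
qed

lemma test_functions_Ck: "\<phi> \<in> test_functions \<Longrightarrow> Ck k \<phi>"
  by (simp add: test_functions_iff)

lemma dir_deriv_eq_0_outside:
  fixes f :: "'a::euclidean_space \<Rightarrow> 'b::euclidean_space"
  assumes R: "\<And>x. norm x > R \<Longrightarrow> f x = 0" and x: "norm x > R"
  shows "dir_deriv e f x = 0"
proof -
  have "open {x::'a. norm x > R}"
    by (intro open_Collect_less continuous_intros)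
  from has_derivative_transform_within_open[OF has_derivative_const[of 0] this, of x f]
  have "(f has_derivative (\<lambda>_. 0)) (at x)"
    using x R by simp
  then show ?thesis by (rule dir_derivI)
qed

lemma bounded_support_dir_deriv: "bounded_support f \<Longrightarrow> bounded_support (dir_deriv e f)"
  unfolding bounded_support_def using dir_deriv_eq_0_outside by blast

lemma test_functions_dir_deriv:
  "\<phi> \<in> test_functions \<Longrightarrow> dir_deriv e \<phi> \<in> test_functions"
  unfolding test_functions_iff using bounded_support_dir_deriv[of \<phi> e] Ck_Suc_iff by blast

lemma test_functions_bilinear:
  assumes "bounded_bilinear h" "\<And>k. Ck k f" "\<And>k. Ck k g" "bounded_support f \<or> bounded_support g"
  shows "(\<lambda>x. h (f x) (g x)) \<in> test_functions"
proof -
  from assms(4) obtain R where R: "(\<forall>x. norm x > R \<longrightarrow> f x = 0) \<or> (\<forall>x. norm x > R \<longrightarrow> g x = 0)"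
    by (auto simp: bounded_support_def)
  have "h (f x) (g x) = 0" if "norm x > R" for x
    using R that bounded_bilinear.zero_left[OF assms(1)] bounded_bilinear.zero_right[OF assms(1)] by auto
  then have "bounded_support (\<lambda>x. h (f x) (g x))" by (auto simp: bounded_support_def)
  then show ?thesis using Ck_bilinear[OF assms(1) assms(2,3)] unfolding test_functions_iff by blast
qed

lemma test_functions_affine:
  assumes "\<phi> \<in> test_functions" "c \<noteq> 0"
  shows "(\<lambda>x. \<phi> (a + c *\<^sub>R x)) \<in> test_functions"
proof -
  from assms obtain R where R: "\<And>x. norm x > R \<Longrightarrow> \<phi> x = 0"
    by (auto simp: bounded_support_def test_functions_iff)
  have "\<phi> (a + c *\<^sub>R x) = 0" if "norm x > (R + norm a) / \<bar>c\<bar>" for x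
  proof (rule R)
    have "R + norm a < norm (c *\<^sub>R x)" using that assms by (simp add: field_simps)
    then show "R < norm (a + c *\<^sub>R x)"
      using norm_triangle_ineq2[of "c *\<^sub>R x" "- a"] by (simp add: add.commute)
  qed
  then show ?thesis
    using assms Ck_affine unfolding test_functions_iff bounded_support_def by blast
qed

section \<open>Symmetry of second derivatives\<close>

text \<open>
  Two applications of the mean value theorem, first in direction \<open>a\<close> and then in direction \<open>b\<close>. The
  left-hand side is symmetric in \<open>a\<close> and \<open>b\<close> while the right-hand side prefers an order of
  differentiation, which yields the symmetry of second derivatives in the limit \<open>t \<rightarrow> 0\<close>.
\<close>

lemma second_difference:
  fixes f :: "'a::euclidean_space \<Rightarrow> real"
  assumes f: "Ck 2 f" and t: "t > 0"
  shows "\<exists>r s. 0 < r \<and> r < t \<and> 0 < s \<and> s < t \<and>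
    f (x + t *\<^sub>R a + t *\<^sub>R b) - f (x + t *\<^sub>R a) - f (x + t *\<^sub>R b) + f x =
    t\<^sup>2 * dir_deriv b (dir_deriv a f) (x + r *\<^sub>R a + s *\<^sub>R b)"
proof -
  have Ck2: "Ck (Suc (Suc 0)) f" using f by (simp add: numeral_2_eq_2)
  have d: "((\<lambda>r. g (y + r *\<^sub>R c)) has_real_derivative dir_deriv c g (y + r *\<^sub>R c)) (at r)"
    if "Ck (Suc k) g" for g :: "'a \<Rightarrow> real" and k y c r
  proof -
    have "((\<lambda>r. y + r *\<^sub>R c) has_derivative (\<lambda>s. s *\<^sub>R c)) (at r)"
      using has_derivative_add[OF has_derivative_const[of y] bounded_linear_imp_has_derivative[OF bounded_linear_scaleR_left[of c]]]
      by simp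
    from diff_chain_at[OF this Ck_Suc_has_derivative[OF that]]
    have "((\<lambda>r. g (y + r *\<^sub>R c)) has_derivative (\<lambda>s. dir_deriv (s *\<^sub>R c) g (y + r *\<^sub>R c))) (at r)"
      unfolding o_def .
    moreover have "(\<lambda>s. dir_deriv (s *\<^sub>R c) g (y + r *\<^sub>R c)) = (*) (dir_deriv c g (y + r *\<^sub>R c))"
    proof
      fix s
      have "dir_deriv (s *\<^sub>R c) g (y + r *\<^sub>R c) = s *\<^sub>R dir_deriv c g (y + r *\<^sub>R c)"
        by (rule linear_scale[OF linear_dir_deriv[OF Ck_differentiable[OF that]]])
      then show "dir_deriv (s *\<^sub>R c) g (y + r *\<^sub>R c) = dir_deriv c g (y + r *\<^sub>R c) * s"
        by (simp only: real_scaleR_def mult.commute)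
    qed
    ultimately show ?thesis unfolding has_field_derivative_def by (simp only:)
  qed
  define h where "h r = f ((x + t *\<^sub>R b) + r *\<^sub>R a) - f (x + r *\<^sub>R a)" for r
  have "(h has_real_derivative (dir_deriv a f ((x + t *\<^sub>R b) + r *\<^sub>R a) - dir_deriv a f (x + r *\<^sub>R a))) (at r)" for r
    unfolding h_def by (rule DERIV_diff[OF d[OF Ck2] d[OF Ck2]])
  then have "\<exists>r>0. r < t \<and> h t - h 0 =
      (t - 0) * (dir_deriv a f ((x + t *\<^sub>R b) + r *\<^sub>R a) - dir_deriv a f (x + r *\<^sub>R a))"
    using t by (rule_tac MVT2) blast+
  then obtain r where r: "0 < r" "r < t" "h t - h 0 =
      t * (dir_deriv a f ((x + t *\<^sub>R b) + r *\<^sub>R a) - dir_deriv a f (x + r *\<^sub>R a))"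
    unfolding diff_zero by blast
  define k where "k s = dir_deriv a f ((x + r *\<^sub>R a) + s *\<^sub>R b)" for s
  have "(k has_real_derivative
      dir_deriv b (dir_deriv a f) ((x + r *\<^sub>R a) + s *\<^sub>R b)) (at s)" for s
    unfolding k_def by (rule d[OF Ck_dir_deriv[OF Ck2]])
  then have "\<exists>s>0. s < t \<and> k t - k 0 =
      (t - 0) * dir_deriv b (dir_deriv a f) ((x + r *\<^sub>R a) + s *\<^sub>R b)"
    using t by (rule_tac MVT2) blast+
  then obtain s where s: "0 < s" "s < t"
    "k t - k 0 = t * dir_deriv b (dir_deriv a f) ((x + r *\<^sub>R a) + s *\<^sub>R b)"
    unfolding diff_zero by blast
  have "f (x + t *\<^sub>R a + t *\<^sub>R b) - f (x + t *\<^sub>R a) - f (x + t *\<^sub>R b) + f x = h t - h 0"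
    by (simp add: h_def add_ac)
  also have "\<dots> = t * (k t - k 0)"
    unfolding r(3) k_def by (simp add: add_ac)
  also have "\<dots> = t\<^sup>2 * dir_deriv b (dir_deriv a f) (x + r *\<^sub>R a + s *\<^sub>R b)"
    unfolding s(3) by (simp add: power2_eq_square)
  finally show ?thesis
    using r(1,2) s(1,2) by blast
qed

lemma second_derivative_symmetric:
  fixes f :: "'a::euclidean_space \<Rightarrow> real"
  assumes f: "Ck 2 f"
  shows "dir_deriv b (dir_deriv a f) x = dir_deriv a (dir_deriv b f) x"
proof -
  define D where "D t = (f (x + t *\<^sub>R a + t *\<^sub>R b) - f (x + t *\<^sub>R a) - f (x + t *\<^sub>R b) + f x) / t\<^sup>2" for t
  have lim: "(\<lambda>n. D (inverse (real (Suc n)))) \<longlonglongrightarrow> dir_deriv b (dir_deriv a f) x"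
    if D: "D = (\<lambda>t. (f (x + t *\<^sub>R a + t *\<^sub>R b) - f (x + t *\<^sub>R a) - f (x + t *\<^sub>R b) + f x) / t\<^sup>2)"
    for a b D
  proof -
    have "\<exists>r s. 0 < r \<and> r < inverse (real (Suc n)) \<and> 0 < s \<and> s < inverse (real (Suc n)) \<and>
      D (inverse (real (Suc n))) = dir_deriv b (dir_deriv a f) (x + r *\<^sub>R a + s *\<^sub>R b)" for n
      using second_difference[OF f, of "inverse (real (Suc n))" x a b] by (fastforce simp: D)
    then obtain r s where rs: "\<And>n. 0 < r n" "\<And>n. r n < inverse (real (Suc n))" "\<And>n. 0 < s n"
      "\<And>n. s n < inverse (real (Suc n))"
      "\<And>n. D (inverse (real (Suc n))) = dir_deriv b (dir_deriv a f) (x + r n *\<^sub>R a + s n *\<^sub>R b)"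
      by metis
    have "r \<longlonglongrightarrow> 0" "s \<longlonglongrightarrow> 0"
      by (rule real_tendsto_sandwich[OF _ _ tendsto_const LIMSEQ_inverse_real_of_nat];
        use rs in \<open>auto intro!: always_eventually less_imp_le\<close>)+
    then have *: "(\<lambda>n. x + r n *\<^sub>R a + s n *\<^sub>R b) \<longlonglongrightarrow> x + 0 *\<^sub>R a + 0 *\<^sub>R b"
      by (intro tendsto_intros)
    have "continuous_on UNIV (dir_deriv b (dir_deriv a f))"
      using f by (simp add: numeral_2_eq_2 Ck_Suc_iff)
    then have "isCont (\<lambda>y. dir_deriv b (dir_deriv a f) y) x"
      by (simp add: continuous_on_eq_continuous_at)
    then show ?thesis
      using * unfolding rs(5) by (auto intro: isCont_tendsto_compose)
  qed
  have "D = (\<lambda>t. (f (x + t *\<^sub>R b + t *\<^sub>R a) - f (x + t *\<^sub>R b) - f (x + t *\<^sub>R a) + f x) / t\<^sup>2)"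
    by (auto simp: D_def algebra_simps)
  from lim[OF this] have "(\<lambda>n. D (inverse (real (Suc n)))) \<longlonglongrightarrow> dir_deriv a (dir_deriv b f) x" .
  moreover have "(\<lambda>n. D (inverse (real (Suc n)))) \<longlonglongrightarrow> dir_deriv b (dir_deriv a f) x"
    by (rule lim) (simp add: D_def fun_eq_iff)
  ultimately show ?thesis by (rule LIMSEQ_unique[THEN sym])
qed

section \<open>Smooth bump functions\<close>

text \<open>
  The derivatives of \<open>exp (- 1 / s)\<close>, extended by \<open>0\<close> to the left, are linear combinations of these
  functions; the family is closed under differentiation, so all its members are smooth.
\<close>

definition flat_exp :: "nat \<Rightarrow> real \<Rightarrow> real" where
  "flat_exp n s = (if s > 0 then inverse s ^ n * exp (- inverse s) else 0)"

lemma flat_exp_deriv: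
  "(flat_exp n has_real_derivative (flat_exp (n + 2) s - real n * flat_exp (n + 1) s)) (at s)"
proof -
  consider "s > 0" | "s < 0" | "s = 0" by linarith
  then show ?thesis
  proof cases
    case 1
    have pow: "((\<lambda>s. inverse s ^ n) has_real_derivative - (real n * inverse s ^ (n + 1))) (at s)"
    proof (cases n)
      case (Suc m)
      have "((\<lambda>s. inverse s ^ n) has_real_derivative
          real n * ((- (inverse s * 1 * inverse s)) * inverse s ^ (n - Suc 0))) (at s)"
        by (rule DERIV_power[OF DERIV_inverse'[OF DERIV_ident]]) (use 1 in auto)
      then show ?thesis by (simp add: Suc algebra_simps)
    qed auto
    have "((\<lambda>s. exp (- inverse s)) has_real_derivative exp (- inverse s) * (inverse s * inverse s)) (at s)"
      using 1 by (auto intro!: derivative_eq_intros)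
    from DERIV_mult[OF pow this]
    have "((\<lambda>s. inverse s ^ n * exp (- inverse s)) has_real_derivative
        (flat_exp (n + 2) s - real n * flat_exp (n + 1) s)) (at s)"
      using 1 by (simp add: flat_exp_def algebra_simps)
    then show ?thesis
      by (rule has_field_derivative_transform_within_open[of _ _ _ "{0<..}"])
        (use 1 in \<open>auto simp: flat_exp_def\<close>)
  next
    case 2
    have "((\<lambda>s. 0) has_real_derivative 0) (at s)" by simp
    then have "(flat_exp n has_real_derivative 0) (at s)"
      by (rule has_field_derivative_transform_within_open[of _ _ _ "{..<0}"])
        (use 2 in \<open>auto simp: flat_exp_def\<close>)
    then show ?thesis using 2 by (simp add: flat_exp_def)
  next
    case 3
    have "((\<lambda>h. flat_exp n h / h) \<longlongrightarrow> 0) (at 0)"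
    proof (rule filterlim_split_at)
      have "\<forall>\<^sub>F h in at_left 0. 0 = flat_exp n h / h"
        by (auto simp: flat_exp_def eventually_at_filter)
      then show "((\<lambda>h. flat_exp n h / h) \<longlongrightarrow> 0) (at_left 0)"
        by (rule Lim_transform_eventually[OF tendsto_const])
      have "((\<lambda>x. x ^ (n + 1) / exp x) \<longlongrightarrow> (0::real)) at_top"
        by (rule tendsto_power_div_exp_0)
      then have "((\<lambda>h. inverse h ^ (n + 1) / exp (inverse h)) \<longlongrightarrow> (0::real)) (at_right 0)"
        by (rule filterlim_compose) (rule filterlim_inverse_at_top_right)
      then show "((\<lambda>h. flat_exp n h / h) \<longlongrightarrow> 0) (at_right 0)"
      proof (rule Lim_transform_eventually)
        have "inverse h ^ (n + 1) / exp (inverse h) = flat_exp n h / h" if "h > 0" for h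
          using that unfolding flat_exp_def exp_minus divide_inverse by (simp only: if_True power_add power_one_right mult_ac)
        then show "\<forall>\<^sub>F h in at_right 0. inverse h ^ (n + 1) / exp (inverse h) = flat_exp n h / h"
          by (intro eventually_at_rightI[of 0 1]) auto
      qed
    qed
    moreover have z: "flat_exp m 0 = 0" for m by (simp add: flat_exp_def)
    ultimately show ?thesis
      unfolding 3 DERIV_def z by simp
  qed
qed

lemma Ck_flat_exp: "Ck k (flat_exp n)"
proof (induction k arbitrary: n)
  case 0
  show ?case using flat_exp_deriv by (auto intro!: continuous_at_imp_continuous_on DERIV_isCont)
next
  case (Suc k)
  show ?case
  proof (rule Ck_SucI[where f' = "\<lambda>s v. v * (flat_exp (n + 2) s - real n * flat_exp (n + 1) s)"])
    show "(flat_exp n has_derivative (\<lambda>v. v * (flat_exp (n + 2) s - real n * flat_exp (n + 1) s))) (at s)" for s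
      using flat_exp_deriv[of n s] by (simp add: has_field_derivative_def mult_commute_abs)
    show "Ck k (\<lambda>s. v * (flat_exp (n + 2) s - real n * flat_exp (n + 1) s))" for v
    proof (rule Ck_mult)
      have "Ck k (\<lambda>s. real n * flat_exp (n + 1) s)"
        by (rule Ck_mult) (rule Ck_const, rule Suc)
      with Suc show "Ck k (\<lambda>s. flat_exp (n + 2) s - real n * flat_exp (n + 1) s)"
        by (rule Ck_diff)
    qed (rule Ck_const)
  qed
qed

lemma Ck_norm_sq: "Ck k (\<lambda>x::'a::euclidean_space. x \<bullet> x)"
  by (rule Ck_inner; rule Ck_bounded_linear; rule bounded_linear_ident)

lemma bump_exists:
  fixes \<delta> :: real
  assumes "\<delta> > 0"
  shows "\<exists>\<rho>\<in>test_functions. (\<forall>x::'a::euclidean_space. (0::real) \<le> \<rho> x) \<and>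
    (\<forall>x. \<rho> x \<noteq> 0 \<longleftrightarrow> norm x < \<delta>)"
proof -
  define \<rho> where "\<rho> x = flat_exp 0 (\<delta>\<^sup>2 - x \<bullet> x)" for x :: 'a
  have nz: "\<rho> x \<noteq> 0 \<longleftrightarrow> norm x < \<delta>" for x
  proof -
    have "x \<bullet> x < \<delta>\<^sup>2 \<longleftrightarrow> norm x < \<delta>"
      using assms power2_less_imp_less[of "norm x" \<delta>] power_strict_mono[of "norm x" \<delta> 2]
      by (auto simp: dot_square_norm)
    then show ?thesis by (simp add: \<rho>_def flat_exp_def)
  qed
  have Ck: "Ck k \<rho>" for k
    unfolding \<rho>_def by (rule Ck_compose_real[OF Ck_flat_exp Ck_diff[OF Ck_const Ck_norm_sq]])
  have nonneg: "0 \<le> \<rho> x" for x by (simp add: \<rho>_def flat_exp_def)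
  have "\<rho> x = 0" if "norm x > \<delta>" for x using nz[of x] that by simp
  then have "\<rho> \<in> test_functions"
    unfolding test_functions_iff bounded_support_def using Ck by blast
  with nz nonneg show ?thesis by blast
qed

section \<open>Translations and continuity in \<open>L\<^sup>1\<close>\<close>

lemma nn_integral_lborel_translate:
  fixes f :: "'a::euclidean_space \<Rightarrow> ennreal"
  assumes [measurable]: "f \<in> borel_measurable borel"
  shows "(\<integral>\<^sup>+x. f (x + a) \<partial>lborel) = (\<integral>\<^sup>+x. f x \<partial>lborel)"
proof -
  have "(\<integral>\<^sup>+x. f x \<partial>lborel) = (\<integral>\<^sup>+x. f x \<partial>distr lborel borel ((+) a))"
    by (simp add: lborel_distr_plus)
  also have "\<dots> = (\<integral>\<^sup>+x. f (x + a) \<partial>lborel)"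
    by (subst nn_integral_distr) (auto simp: add.commute)
  finally show ?thesis by simp
qed

lemma lborel_distr_reflect: "distr lborel borel (\<lambda>x::'a::euclidean_space. a - x) = lborel"
  using lborel_affine[of "-1" a] by (simp add: density_1)

lemma integral_lborel_translate:
  fixes f :: "'a::euclidean_space \<Rightarrow> real"
  assumes [measurable]: "f \<in> borel_measurable borel"
  shows "(LINT x|lborel. f (x + a)) = (LINT x|lborel. f x)"
    and "integrable lborel (\<lambda>x. f (x + a)) \<longleftrightarrow> integrable lborel f"
proof -
  have "(LINT x|lborel. f x) = (LINT x|distr lborel borel ((+) a). f x)"
    by (simp add: lborel_distr_plus)
  also have "\<dots> = (LINT x|lborel. f (x + a))"
    by (subst integral_distr) (auto simp: add.commute)
  finally show "(LINT x|lborel. f (x + a)) = (LINT x|lborel. f x)" by simp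
  have "integrable lborel f \<longleftrightarrow> integrable (distr lborel borel ((+) a)) f"
    by (simp add: lborel_distr_plus)
  also have "\<dots> \<longleftrightarrow> integrable lborel (\<lambda>x. f (x + a))"
    by (subst integrable_distr_eq) (auto simp: add.commute)
  finally show "integrable lborel (\<lambda>x. f (x + a)) \<longleftrightarrow> integrable lborel f" by simp
qed

lemma integral_lborel_reflect:
  fixes f :: "'a::euclidean_space \<Rightarrow> real"
  assumes [measurable]: "f \<in> borel_measurable borel"
  shows "(LINT x|lborel. f (a - x)) = (LINT x|lborel. f x)"
    and "integrable lborel (\<lambda>x. f (a - x)) \<longleftrightarrow> integrable lborel f"
proof -
  have "(LINT x|lborel. f x) = (LINT x|distr lborel borel (\<lambda>x. a - x). f x)"
    by (simp add: lborel_distr_reflect)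
  also have "\<dots> = (LINT x|lborel. f (a - x))"
    by (subst integral_distr) auto
  finally show "(LINT x|lborel. f (a - x)) = (LINT x|lborel. f x)" by simp
  have "integrable lborel f \<longleftrightarrow> integrable (distr lborel borel (\<lambda>x. a - x)) f"
    by (simp add: lborel_distr_reflect)
  also have "\<dots> \<longleftrightarrow> integrable lborel (\<lambda>x. f (a - x))"
    by (subst integrable_distr_eq) auto
  finally show "integrable lborel (\<lambda>x. f (a - x)) \<longleftrightarrow> integrable lborel f" by simp
qed

lemma integral_dominated_convergence_zero:
  fixes s :: "nat \<Rightarrow> 'a \<Rightarrow> real"
  assumes "\<And>i. s i \<in> borel_measurable M" "integrable M w"
    and "AE x in M. (\<lambda>i. s i x) \<longlonglongrightarrow> 0" "\<And>i. AE x in M. norm (s i x) \<le> w x"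
  shows "(\<lambda>i. integral\<^sup>L M (s i)) \<longlonglongrightarrow> 0"
  using integral_dominated_convergence[of "\<lambda>_. 0" M s w] assms by simp

text \<open>
  Stated as a property of \<open>g\<close> because the proof shows that the class of such functions is closed under
  \<open>L\<^sup>1\<close> limits and contains the indicators of open sets of finite measure.
\<close>

definition L1_translation_continuous :: "('a::euclidean_space \<Rightarrow> real) \<Rightarrow> bool" where
  "L1_translation_continuous g \<longleftrightarrow>
     (\<forall>h. h \<longlonglongrightarrow> 0 \<longrightarrow> (\<lambda>n. LINT x|lborel. \<bar>g (x + h n) - g x\<bar>) \<longlonglongrightarrow> 0)"

text \<open>
  The usual three-term argument: the error \<open>f - g\<close> and its translate have the same integral.
\<close>

lemma L1_translation_continuous_approx:
  fixes g :: "'a::euclidean_space \<Rightarrow> real"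
  assumes g: "integrable lborel g"
    and approx: "\<And>\<epsilon>. \<epsilon> > 0 \<Longrightarrow> \<exists>f. integrable lborel f \<and> L1_translation_continuous f \<and>
      (LINT x|lborel. \<bar>f x - g x\<bar>) \<le> \<epsilon>"
  shows "L1_translation_continuous g"
  unfolding L1_translation_continuous_def
proof (intro allI impI)
  fix h :: "nat \<Rightarrow> 'a" assume h: "h \<longlonglongrightarrow> 0"
  show "(\<lambda>n. LINT x|lborel. \<bar>g (x + h n) - g x\<bar>) \<longlonglongrightarrow> 0"
  proof (rule LIMSEQ_I)
    fix \<epsilon> :: real assume "\<epsilon> > 0"
    then obtain f where f: "integrable lborel f" "L1_translation_continuous f"
      "(LINT x|lborel. \<bar>f x - g x\<bar>) \<le> \<epsilon> / 4"
      using approx[of "\<epsilon> / 4"] by auto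
    from f(2) h have "(\<lambda>n. LINT x|lborel. \<bar>f (x + h n) - f x\<bar>) \<longlonglongrightarrow> 0"
      by (auto simp: L1_translation_continuous_def)
    from LIMSEQ_D[OF this, of "\<epsilon> / 4"] \<open>\<epsilon> > 0\<close> obtain N where
      N: "\<And>n. n \<ge> N \<Longrightarrow> (LINT x|lborel. \<bar>f (x + h n) - f x\<bar>) < \<epsilon> / 4"
      by auto
    have [measurable]: "f \<in> borel_measurable borel" "g \<in> borel_measurable borel"
      using f(1) g by auto
    have ft: "integrable lborel (\<lambda>x. f (x + a))" and gt: "integrable lborel (\<lambda>x. g (x + a))" for a
      using f(1) g integral_lborel_translate(2)[of f] integral_lborel_translate(2)[of g] by simp_all
    have "norm ((LINT x|lborel. \<bar>g (x + h n) - g x\<bar>) - 0) < \<epsilon>" if "n \<ge> N" for n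
    proof -
      have "(LINT x|lborel. \<bar>g (x + h n) - g x\<bar>) \<le>
        (LINT x|lborel. \<bar>f (x + h n) - g (x + h n)\<bar> + \<bar>f (x + h n) - f x\<bar> + \<bar>f x - g x\<bar>)"
        by (rule integral_mono) (auto intro!: Bochner_Integration.integrable_add integrable_abs
            Bochner_Integration.integrable_diff f(1) g ft gt)
      also have "\<dots> = (LINT x|lborel. \<bar>f (x + h n) - g (x + h n)\<bar>) +
          (LINT x|lborel. \<bar>f (x + h n) - f x\<bar>) + (LINT x|lborel. \<bar>f x - g x\<bar>)"
        by (subst Bochner_Integration.integral_add | rule Bochner_Integration.integrable_add integrable_abs
            Bochner_Integration.integrable_diff f(1) g ft gt refl)+
      also have "(LINT x|lborel. \<bar>f (x + h n) - g (x + h n)\<bar>) = (LINT x|lborel. \<bar>f x - g x\<bar>)"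
        by (rule integral_lborel_translate(1)[of "\<lambda>x. \<bar>f x - g x\<bar>"]) measurable
      finally show ?thesis using f(3) N[OF that] \<open>\<epsilon> > 0\<close> by simp
    qed
    then show "\<exists>N. \<forall>n\<ge>N. norm ((LINT x|lborel. \<bar>g (x + h n) - g x\<bar>) - 0) < \<epsilon>" by blast
  qed
qed

text \<open>
  If \<open>x \<in> U\<close>, then \<open>x + h n \<in> U\<close> from some index on, since \<open>U\<close> is open. This gives convergence of the
  positive part of \<open>g - g(\<cdot> + h n)\<close> for the indicator \<open>g\<close> only; the negative part follows because
  \<open>g\<close> and its translates have equal integrals.
\<close>

lemma L1_translation_continuous_open:
  fixes U :: "'a::euclidean_space set"
  assumes U: "open U" "emeasure lborel U < \<infinity>"
  shows "L1_translation_continuous (\<lambda>x. indicator U x * c)"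
  unfolding L1_translation_continuous_def
proof (intro allI impI)
  fix h :: "nat \<Rightarrow> 'a" assume h: "h \<longlonglongrightarrow> 0"
  define g :: "'a \<Rightarrow> real" where "g = indicator U"
  have [measurable]: "U \<in> sets borel" "g \<in> borel_measurable borel"
    using U by (auto simp: g_def)
  have g: "integrable lborel g" using U by (simp add: g_def)
  have gt: "integrable lborel (\<lambda>x. g (x + a))" for a
    using g integral_lborel_translate(2)[of g] by simp
  have "(\<lambda>n. LINT x|lborel. max 0 (g x - g (x + h n))) \<longlonglongrightarrow> 0"
  proof (rule integral_dominated_convergence_zero[where w = g])
    show "AE x in lborel. (\<lambda>n. max 0 (g x - g (x + h n))) \<longlonglongrightarrow> 0"
    proof (rule AE_I2)
      fix x :: 'a
      show "(\<lambda>n. max 0 (g x - g (x + h n))) \<longlonglongrightarrow> 0"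
      proof (cases "x \<in> U")
        case True
        have "(\<lambda>n. x + h n) \<longlonglongrightarrow> x" using tendsto_add[OF tendsto_const h, of x] by simp
        then have "\<forall>\<^sub>F n in sequentially. x + h n \<in> U"
          using U(1) True by (auto simp: tendsto_def)
        then have "\<forall>\<^sub>F n in sequentially. 0 = max 0 (g x - g (x + h n))"
          by eventually_elim (use True in \<open>auto simp: g_def\<close>)
        then show ?thesis by (rule Lim_transform_eventually[OF tendsto_const])
      qed (auto simp: g_def indicator_def)
    qed
  qed (use g in \<open>auto simp: g_def indicator_def\<close>)
  then have lim: "(\<lambda>n. 2 * \<bar>c\<bar> * (LINT x|lborel. max 0 (g x - g (x + h n)))) \<longlonglongrightarrow> 2 * \<bar>c\<bar> * 0"
    by (intro tendsto_mult tendsto_const)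
  \<comment> \<open>\<open>|a - b| = 2 (a - b)\<^sup>+ - (a - b)\<close>, and the last term integrates to \<open>0\<close>.\<close>
  have "(LINT x|lborel. \<bar>indicator U (x + h n) * c - indicator U x * c\<bar>) =
     2 * \<bar>c\<bar> * (LINT x|lborel. max 0 (g x - g (x + h n)))" for n
  proof -
    have i: "integrable lborel (\<lambda>x. g x - g (x + h n))" by (intro Bochner_Integration.integrable_diff g gt)
    have "(LINT x|lborel. \<bar>indicator U (x + h n) * c - indicator U x * c\<bar>) =
      (LINT x|lborel. 2 * \<bar>c\<bar> * max 0 (g x - g (x + h n)) - \<bar>c\<bar> * (g x - g (x + h n)))"
      by (intro Bochner_Integration.integral_cong) (auto simp: g_def indicator_def)
    also have "\<dots> = (LINT x|lborel. 2 * \<bar>c\<bar> * max 0 (g x - g (x + h n))) -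
        (LINT x|lborel. \<bar>c\<bar> * (g x - g (x + h n)))"
      by (intro Bochner_Integration.integral_diff integrable_mult_right integrable_max i) auto
    also have "(LINT x|lborel. \<bar>c\<bar> * (g x - g (x + h n))) = 0"
      using integral_lborel_translate(1)[of g "h n"] g gt by simp
    finally show ?thesis by simp
  qed
  then show "(\<lambda>n. LINT x|lborel. \<bar>indicator U (x + h n) * c - indicator U x * c\<bar>) \<longlonglongrightarrow> 0"
    using lim by simp
qed

lemma integrable_imp_L1_translation_continuous:
  fixes g :: "'a::euclidean_space \<Rightarrow> real"
  assumes "integrable lborel g"
  shows "L1_translation_continuous g"
  using assms
proof (induction rule: integrable_induct)
  case (base A c)
  then have [measurable]: "A \<in> sets borel" by simp
  show ?case
  proof (rule L1_translation_continuous_approx)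
    show "integrable lborel (\<lambda>x. indicator A x *\<^sub>R c)"
      using base by simp
    fix \<epsilon> :: real assume "\<epsilon> > 0"
    define \<delta> where "\<delta> = \<epsilon> / (\<bar>c\<bar> + 1)"
    have "\<delta> > 0" using \<open>\<epsilon> > 0\<close> by (simp add: \<delta>_def)
    \<comment> \<open>Outer regularity replaces \<open>A\<close> by an open set at an arbitrarily small \<open>L\<^sup>1\<close> cost.\<close>
    from outer_regular_lborel_le[OF \<open>A \<in> sets borel\<close> this] obtain U where
      U: "open U" "A \<subseteq> U" "emeasure lborel (U - A) \<le> \<delta>" by blast
    then have [measurable]: "U \<in> sets borel" by simp
    have fin: "emeasure lborel (U - A) < \<infinity>"
      using U(3) by (simp add: le_less_trans)
    have "emeasure lborel U = emeasure lborel A + emeasure lborel (U - A)"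
      using U(2) by (subst plus_emeasure) (auto simp: Un_absorb1)
    then have finU: "emeasure lborel U < \<infinity>" using base fin by simp
    have "(LINT x|lborel. \<bar>indicator U x * c - indicator A x *\<^sub>R c\<bar>) = (LINT x|lborel. \<bar>c\<bar> * indicator (U - A) x)"
      using U(2) by (intro Bochner_Integration.integral_cong) (auto simp: indicator_def)
    also have "\<dots> = \<bar>c\<bar> * measure lborel (U - A)" by simp
    also have "\<dots> \<le> \<bar>c\<bar> * \<delta>"
      using U(3) \<open>\<delta> > 0\<close> by (intro mult_left_mono) (auto simp: measure_def enn2real_leI)
    also have "\<dots> \<le> \<epsilon>" using \<open>\<epsilon> > 0\<close> by (simp add: \<delta>_def field_simps)
    finally show "\<exists>f. integrable lborel f \<and> L1_translation_continuous f \<and>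
        (LINT x|lborel. \<bar>f x - indicator A x *\<^sub>R c\<bar>) \<le> \<epsilon>"
      using L1_translation_continuous_open[OF U(1) finU, of c] finU
      by (intro exI[of _ "\<lambda>x. indicator U x * c"]) simp
  qed
next
  case (add f g)
  have ft: "integrable lborel (\<lambda>x. f (x + a))" and gt: "integrable lborel (\<lambda>x. g (x + a))" for a
    using add integral_lborel_translate(2)[of f] integral_lborel_translate(2)[of g] by simp_all
  show ?case
    unfolding L1_translation_continuous_def
  proof (intro allI impI)
    fix h :: "nat \<Rightarrow> 'a" assume h: "h \<longlonglongrightarrow> 0"
    have lim: "(\<lambda>n. (LINT x|lborel. \<bar>f (x + h n) - f x\<bar>) + (LINT x|lborel. \<bar>g (x + h n) - g x\<bar>)) \<longlonglongrightarrow> 0 + 0"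
      using add h by (intro tendsto_add) (auto simp: L1_translation_continuous_def)
    have "(LINT x|lborel. \<bar>f (x + h n) + g (x + h n) - (f x + g x)\<bar>) \<le>
      (LINT x|lborel. \<bar>f (x + h n) - f x\<bar>) + (LINT x|lborel. \<bar>g (x + h n) - g x\<bar>)" for n
    proof -
      have "(LINT x|lborel. \<bar>f (x + h n) + g (x + h n) - (f x + g x)\<bar>) \<le>
        (LINT x|lborel. \<bar>f (x + h n) - f x\<bar> + \<bar>g (x + h n) - g x\<bar>)"
        by (rule integral_mono) (auto intro!: Bochner_Integration.integrable_add integrable_abs
            Bochner_Integration.integrable_diff add ft gt)
      also have "\<dots> = (LINT x|lborel. \<bar>f (x + h n) - f x\<bar>) + (LINT x|lborel. \<bar>g (x + h n) - g x\<bar>)"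
        by (rule Bochner_Integration.integral_add) (auto intro!: integrable_abs
            Bochner_Integration.integrable_diff add ft gt)
      finally show ?thesis .
    qed
    with lim show "(\<lambda>n. LINT x|lborel. \<bar>f (x + h n) + g (x + h n) - (f x + g x)\<bar>) \<longlonglongrightarrow> 0"
      by (intro tendsto_sandwich[OF _ _ tendsto_const lim[simplified]]) (auto intro!: always_eventually)
  qed
next
  case (lim f s)
  show ?case
  proof (rule L1_translation_continuous_approx)
    fix \<epsilon> :: real assume "\<epsilon> > 0"
    have "(\<lambda>i. LINT x|lborel. \<bar>s i x - f x\<bar>) \<longlonglongrightarrow> 0"
    proof (rule integral_dominated_convergence_zero[where w = "\<lambda>x. 3 * \<bar>f x\<bar>"])
      show "AE x in lborel. (\<lambda>i. \<bar>s i x - f x\<bar>) \<longlonglongrightarrow> 0"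
        using lim(2) by (intro AE_I2 tendsto_rabs_zero LIM_zero) simp
      show "AE x in lborel. norm \<bar>s i x - f x\<bar> \<le> 3 * \<bar>f x\<bar>" for i
      proof (rule AE_I2)
        fix x :: 'a
        have "\<bar>s i x\<bar> \<le> 2 * \<bar>f x\<bar>" using lim(3) by simp
        then show "norm \<bar>s i x - f x\<bar> \<le> 3 * \<bar>f x\<bar>" by simp
      qed
    qed (use lim in auto)
    from LIMSEQ_D[OF this \<open>\<epsilon> > 0\<close>] obtain i where "(LINT x|lborel. \<bar>s i x - f x\<bar>) \<le> \<epsilon>"
      using abs_le_iff less_imp_le by (metis diff_zero real_norm_def order_refl)
    then show "\<exists>f'. integrable lborel f' \<and> L1_translation_continuous f' \<and> (LINT x|lborel. \<bar>f' x - f x\<bar>) \<le> \<epsilon>"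
      using lim by blast
  qed (use lim in auto)
qed

lemma L1_translation_small:
  fixes g :: "'a::euclidean_space \<Rightarrow> real"
  assumes g: "integrable lborel g" and \<epsilon>: "\<epsilon> > 0"
  shows "\<exists>\<delta>>0. \<forall>a. norm a \<le> \<delta> \<longrightarrow> (LINT x|lborel. \<bar>g (x + a) - g x\<bar>) \<le> \<epsilon>"
proof -
  define m where "m a = (LINT x|lborel. \<bar>g (x + a) - g x\<bar>)" for a
  have "continuous (at 0) m"
    unfolding continuous_at_sequentially o_def
    using integrable_imp_L1_translation_continuous[OF g]
    by (simp add: L1_translation_continuous_def m_def)
  then obtain \<delta> where \<delta>: "\<delta> > 0" "\<And>a. dist a 0 < \<delta> \<Longrightarrow> dist (m a) (m 0) < \<epsilon>"
    using \<epsilon> unfolding continuous_at_eps_delta by blast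
  have "m a \<le> \<epsilon>" if "norm a \<le> \<delta> / 2" for a
    using \<delta>(2)[of a] that \<delta>(1) by (simp add: m_def dist_norm)
  with \<delta>(1) show ?thesis
    by (intro exI[of _ "\<delta> / 2"]) (auto simp: m_def)
qed

section \<open>Averages over random translations\<close>

text \<open>
  The average of \<open>g\<close> over the random translate \<open>x + Y\<close>. Mollifications and the averages along a segment
  that represent difference quotients are both of this form, so Jensen's inequality bounds them at once
  in every \<open>L\<^sup>r\<close> norm and in the Coulomb energy.
\<close>

definition avg :: "'w measure \<Rightarrow> ('w \<Rightarrow> 'a::euclidean_space) \<Rightarrow> ('a \<Rightarrow> real) \<Rightarrow> 'a \<Rightarrow> real" where
  "avg M Y g x = (LINT \<omega>|M. g (x + Y \<omega>))"

locale random_shift = prob_space M for M :: "'w measure" +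
  fixes Y :: "'w \<Rightarrow> 'a::euclidean_space"
  assumes Y [measurable]: "Y \<in> borel_measurable M"
begin

lemma avg_measurable [measurable]:
  assumes [measurable]: "g \<in> borel_measurable borel"
  shows "avg M Y g \<in> borel_measurable borel"
  unfolding avg_def[abs_def] by measurable

text \<open>
  If the difference is not integrable, then the right-hand side is infinite.
\<close>

lemma avg_diff_le:
  assumes [measurable]: "g \<in> borel_measurable borel"
  shows "ennreal \<bar>avg M Y g x - g x\<bar> \<le> (\<integral>\<^sup>+\<omega>. ennreal \<bar>g (x + Y \<omega>) - g x\<bar> \<partial>M)"
proof (cases "integrable M (\<lambda>\<omega>. g (x + Y \<omega>) - g x)")
  case True
  then have "integrable M (\<lambda>\<omega>. (g (x + Y \<omega>) - g x) + g x)"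
    by (intro Bochner_Integration.integrable_add) auto
  then have "avg M Y g x - g x = (LINT \<omega>|M. g (x + Y \<omega>) - g x)"
    by (simp add: avg_def prob_space)
  then show ?thesis
    using integral_norm_bound_ennreal[OF True] by simp
next
  case False
  then have "(\<integral>\<^sup>+\<omega>. ennreal \<bar>g (x + Y \<omega>) - g x\<bar> \<partial>M) = \<infinity>"
    by (auto simp: integrable_iff_bounded less_top[symmetric])
  then show ?thesis by simp
qed

lemma nn_integral_avg_weighted:
  fixes f k :: "'a \<Rightarrow> ennreal"
  assumes [measurable]: "f \<in> borel_measurable borel" "k \<in> borel_measurable borel"
  shows "(\<integral>\<^sup>+x. k x * (\<integral>\<^sup>+\<omega>. f (x + Y \<omega>) \<partial>M) \<partial>lborel) =
    (\<integral>\<^sup>+\<omega>. (\<integral>\<^sup>+x. k x * f (x + Y \<omega>) \<partial>lborel) \<partial>M)"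
proof -
  interpret P: pair_sigma_finite M "lborel :: 'a measure" ..
  have "(\<integral>\<^sup>+x. k x * (\<integral>\<^sup>+\<omega>. f (x + Y \<omega>) \<partial>M) \<partial>lborel) =
      (\<integral>\<^sup>+x. (\<integral>\<^sup>+\<omega>. k x * f (x + Y \<omega>) \<partial>M) \<partial>lborel)"
    by (intro nn_integral_cong nn_integral_cmult[symmetric]) measurable
  also have "\<dots> = (\<integral>\<^sup>+\<omega>. (\<integral>\<^sup>+x. k x * f (x + Y \<omega>) \<partial>lborel) \<partial>M)"
    by (rule P.Fubini') measurable
  finally show ?thesis .
qed

lemma nn_integral_avg:
  fixes f :: "'a \<Rightarrow> ennreal"
  assumes [measurable]: "f \<in> borel_measurable borel"
  shows "(\<integral>\<^sup>+x. (\<integral>\<^sup>+\<omega>. f (x + Y \<omega>) \<partial>M) \<partial>lborel) = (\<integral>\<^sup>+x. f x \<partial>lborel)"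
  using nn_integral_avg_weighted[of f "\<lambda>_. 1"]
  by (simp add: nn_integral_lborel_translate emeasure_space_1)

lemma nn_integral_avg_diff_le:
  assumes g: "integrable lborel g"
    and small: "AE \<omega> in M. (LINT x|lborel. \<bar>g (x + Y \<omega>) - g x\<bar>) \<le> \<epsilon>"
  shows "(\<integral>\<^sup>+x. ennreal \<bar>avg M Y g x - g x\<bar> \<partial>lborel) \<le> ennreal \<epsilon>"
proof -
  have [measurable]: "g \<in> borel_measurable borel" using g by auto
  interpret P: pair_sigma_finite M "lborel :: 'a measure" ..
  have "(\<integral>\<^sup>+x. ennreal \<bar>avg M Y g x - g x\<bar> \<partial>lborel) \<le>
    (\<integral>\<^sup>+x. (\<integral>\<^sup>+\<omega>. ennreal \<bar>g (x + Y \<omega>) - g x\<bar> \<partial>M) \<partial>lborel)"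
    by (intro nn_integral_mono avg_diff_le) measurable
  also have "\<dots> = (\<integral>\<^sup>+\<omega>. (\<integral>\<^sup>+x. ennreal \<bar>g (x + Y \<omega>) - g x\<bar> \<partial>lborel) \<partial>M)"
    by (rule P.Fubini') measurable
  also have "\<dots> \<le> (\<integral>\<^sup>+\<omega>. ennreal \<epsilon> \<partial>M)"
  proof (rule nn_integral_mono_AE, use small in eventually_elim)
    fix \<omega> assume "(LINT x|lborel. \<bar>g (x + Y \<omega>) - g x\<bar>) \<le> \<epsilon>"
    moreover have "integrable lborel (\<lambda>x. \<bar>g (x + Y \<omega>) - g x\<bar>)"
      using g integral_lborel_translate(2)[of g] by simp
    ultimately show "(\<integral>\<^sup>+x. ennreal \<bar>g (x + Y \<omega>) - g x\<bar> \<partial>lborel) \<le> ennreal \<epsilon>"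
      by (subst nn_integral_eq_integral) (auto intro: ennreal_leI)
  qed
  finally show ?thesis by (simp add: emeasure_space_1)
qed

end

section \<open>Powers and Jensen's inequality\<close>

text \<open>
  The derivative of \<open>|a|\<^sup>r / r\<close>; for \<open>r = 2\<close> it is the identity.
\<close>

definition sgn_powr :: "real \<Rightarrow> real \<Rightarrow> real" where
  "sgn_powr r a = \<bar>a\<bar> powr (r - 2) * a"

lemma sgn_powr_measurable [measurable]: "sgn_powr r \<in> borel_measurable borel"
  unfolding sgn_powr_def[abs_def] by measurable

lemma abs_sgn_powr: "\<bar>sgn_powr r a\<bar> = \<bar>a\<bar> powr (r - 1)"
proof (cases "a = 0")
  case False
  then have "\<bar>a\<bar> powr (r - 2) * \<bar>a\<bar> = \<bar>a\<bar> powr (r - 2) * \<bar>a\<bar> powr 1" by simp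
  also have "\<dots> = \<bar>a\<bar> powr (r - 1)" by (subst powr_add[symmetric]) simp
  finally show ?thesis by (simp add: sgn_powr_def abs_mult)
qed (simp add: sgn_powr_def)

lemma sgn_powr_mult_self: "sgn_powr r a * a = \<bar>a\<bar> powr r"
proof (cases "a = 0")
  case False
  then have "\<bar>a\<bar> powr (r - 2) * (\<bar>a\<bar> * \<bar>a\<bar>) = \<bar>a\<bar> powr (r - 2) * \<bar>a\<bar> powr 2"
    by (simp add: power2_eq_square)
  also have "\<dots> = \<bar>a\<bar> powr r" by (subst powr_add[symmetric]) simp
  finally show ?thesis by (simp add: sgn_powr_def mult.assoc)
qed (simp add: sgn_powr_def)

lemma sgn_powr_2 [simp]: "sgn_powr 2 a = a"
  by (simp add: sgn_powr_def)

lemma sgn_powr_0 [simp]: "sgn_powr r 0 = 0"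
  by (simp add: sgn_powr_def)

text \<open>
  The tangent inequality for the convex function \<open>|\<cdot>|\<^sup>r\<close>, equivalent to Young's inequality for the product
  \<open>|a|\<^sup>r\<^sup>-\<^sup>1 |b|\<close>.
\<close>

lemma abs_powr_convex:
  assumes r: "r > 1"
  shows "\<bar>b\<bar> powr r \<ge> \<bar>a\<bar> powr r + r * sgn_powr r a * (b - a)"
proof -
  have "sgn_powr r a * b \<le> \<bar>a\<bar> powr (r - 1) * \<bar>b\<bar>"
    using abs_ge_self[of "sgn_powr r a * b"] by (simp add: abs_mult abs_sgn_powr)
  also have "\<dots> \<le> (\<bar>a\<bar> powr (r - 1)) powr (r / (r - 1)) / (r / (r - 1)) + \<bar>b\<bar> powr r / r"
    using r by (intro Youngs_inequality) (auto simp: field_simps)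
  also have "(\<bar>a\<bar> powr (r - 1)) powr (r / (r - 1)) = \<bar>a\<bar> powr r"
    using r by (simp add: powr_powr)
  finally have "r * (sgn_powr r a * b) \<le> r * (\<bar>a\<bar> powr r / (r / (r - 1)) + \<bar>b\<bar> powr r / r)"
    using r by (intro mult_left_mono) auto
  also have "\<dots> = (r - 1) * \<bar>a\<bar> powr r + \<bar>b\<bar> powr r"
    using r by (simp add: field_simps)
  finally show ?thesis
    using sgn_powr_mult_self[of r a] by (simp add: algebra_simps)
qed

lemma abs_sgn_powr_mult_le:
  assumes "r > 1"
  shows "\<bar>sgn_powr r a * b\<bar> \<le> \<bar>a\<bar> powr r + \<bar>b\<bar> powr r"
proof (cases "\<bar>b\<bar> \<le> \<bar>a\<bar>")
  case True
  have "\<bar>sgn_powr r a * b\<bar> \<le> \<bar>sgn_powr r a\<bar> * \<bar>a\<bar>"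
    using True by (simp add: abs_mult mult_left_mono)
  also have "\<dots> = \<bar>a\<bar> powr r" by (simp flip: abs_mult add: sgn_powr_mult_self)
  finally show ?thesis by (simp add: add_increasing2)
next
  case False
  have "\<bar>sgn_powr r a * b\<bar> \<le> \<bar>b\<bar> powr (r - 1) * \<bar>b\<bar>"
    using False assms by (auto simp: abs_mult abs_sgn_powr intro!: mult_right_mono powr_mono2)
  also have "\<dots> = \<bar>b\<bar> powr r" using abs_sgn_powr[of r b]
    by (metis abs_mult abs_of_nonneg powr_ge_zero sgn_powr_mult_self)
  finally show ?thesis by (simp add: add_increasing)
qed

lemma abs_le_one_plus_powr:
  fixes a r :: real
  assumes "r \<ge> 1" shows "\<bar>a\<bar> \<le> 1 + \<bar>a\<bar> powr r"
proof (cases "\<bar>a\<bar> \<le> 1")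
  case False
  then have "\<bar>a\<bar> powr 1 \<le> \<bar>a\<bar> powr r" using assms by (intro powr_mono) auto
  then show ?thesis using False by simp
qed (simp add: add_increasing2)

text \<open>
  Integrate the tangent inequality at the mean value.
\<close>

lemma (in prob_space) jensen_powr:
  fixes f :: "'a \<Rightarrow> real"
  assumes [measurable]: "f \<in> borel_measurable M" and r: "r > 1"
  shows "ennreal (\<bar>LINT \<omega>|M. f \<omega>\<bar> powr r) \<le> (\<integral>\<^sup>+\<omega>. ennreal (\<bar>f \<omega>\<bar> powr r) \<partial>M)"
proof (cases "(\<integral>\<^sup>+\<omega>. ennreal (\<bar>f \<omega>\<bar> powr r) \<partial>M) = \<infinity>")
  case False
  then have p: "integrable M (\<lambda>\<omega>. \<bar>f \<omega>\<bar> powr r)"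
    by (intro integrableI_bounded) (auto simp: top.not_eq_extremum)
  have f: "integrable M f"
  proof (rule Bochner_Integration.integrable_bound)
    show "integrable M (\<lambda>\<omega>. 1 + \<bar>f \<omega>\<bar> powr r)" using p by simp
    show "AE \<omega> in M. norm (f \<omega>) \<le> norm (1 + \<bar>f \<omega>\<bar> powr r)"
      using abs_le_one_plus_powr[of r] r by (intro AE_I2) (simp add: order_trans[OF _ abs_ge_self])
  qed simp
  define a where "a = (LINT \<omega>|M. f \<omega>)"
  have "\<bar>a\<bar> powr r = (LINT \<omega>|M. \<bar>a\<bar> powr r + r * sgn_powr r a * (f \<omega> - a))"
    using f by (simp add: prob_space a_def)
  also have "\<dots> \<le> (LINT \<omega>|M. \<bar>f \<omega>\<bar> powr r)"
    using f p abs_powr_convex[OF r] by (intro integral_mono) auto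
  finally show ?thesis
    using p by (subst nn_integral_eq_integral) (auto simp: a_def intro: ennreal_leI)
qed simp

lemma (in random_shift) jensen_avg:
  assumes [measurable]: "g \<in> borel_measurable borel" and r: "r > 1"
  shows "ennreal (\<bar>avg M Y g x\<bar> powr r) \<le> (\<integral>\<^sup>+\<omega>. ennreal (\<bar>g (x + Y \<omega>)\<bar> powr r) \<partial>M)"
  unfolding avg_def by (rule jensen_powr[OF _ r]) measurable

lemma L1_imp_AE_subseq:
  fixes f :: "nat \<Rightarrow> 'a::euclidean_space \<Rightarrow> real"
  assumes [measurable]: "\<And>n. f n \<in> borel_measurable lborel"
    and lim: "(\<lambda>n. \<integral>\<^sup>+x. ennreal \<bar>f n x\<bar> \<partial>lborel) \<longlonglongrightarrow> 0"
  shows "\<exists>s::nat \<Rightarrow> nat. strict_mono s \<and> (AE x in lborel. (\<lambda>n. f (s n) x) \<longlonglongrightarrow> 0)"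
proof -
  have "\<forall>\<^sub>F n in sequentially. (\<integral>\<^sup>+x. ennreal \<bar>f n x\<bar> \<partial>lborel) < 1"
    using lim by (rule order_tendstoD) simp
  then obtain N where N: "\<And>n. n \<ge> N \<Longrightarrow> (\<integral>\<^sup>+x. ennreal \<bar>f n x\<bar> \<partial>lborel) < 1"
    by (auto simp: eventually_sequentially)
  have int: "integrable lborel (f (n + N))" for n
    using N[of "n + N"] by (intro integrableI_bounded) (auto intro: less_trans)
  have "(\<lambda>n. \<integral>\<^sup>+x. ennreal (norm (f (n + N) x)) \<partial>lborel) \<longlonglongrightarrow> 0"
    using LIMSEQ_ignore_initial_segment[OF lim, of N] by simp
  then have "(\<lambda>n. ennreal (LINT x|lborel. norm (f (n + N) x))) \<longlonglongrightarrow> 0"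
    by (subst (asm) nn_integral_eq_integral) (auto intro: int integrable_norm)
  then have "(\<lambda>n. LINT x|lborel. norm (f (n + N) x)) \<longlonglongrightarrow> 0"
    by (simp add: ennreal_0[symmetric] tendsto_ennreal_iff del: ennreal_0)
  from tendsto_L1_AE_subseq[OF int this] obtain s where s: "strict_mono s"
    "AE x in lborel. (\<lambda>n. f (s n + N) x) \<longlonglongrightarrow> 0" by blast
  then show ?thesis
    by (intro exI[of _ "\<lambda>n. s n + N"]) (auto simp: strict_mono_def)
qed

text \<open>
  By Fubini the \<open>L\<^sup>1\<close> distance of \<open>g\<close> and its average is at most the average of the \<open>L\<^sup>1\<close> distances of
  \<open>g\<close> and its translates, and these are uniformly small for small shifts.
\<close>

lemma avg_tendsto_L1:
  fixes M :: "nat \<Rightarrow> 'w measure" and Y :: "nat \<Rightarrow> 'w \<Rightarrow> 'a::euclidean_space"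
  assumes sh: "\<And>n. random_shift (M n) (Y n)"
    and small: "\<And>n. AE \<omega> in M n. norm (Y n \<omega>) \<le> d n" and d: "d \<longlonglongrightarrow> 0"
    and g: "integrable lborel g"
  shows "(\<lambda>n. \<integral>\<^sup>+x. ennreal \<bar>avg (M n) (Y n) g x - g x\<bar> \<partial>lborel) \<longlonglongrightarrow> 0"
proof (rule tendsto_zero_ennreal)
  fix \<epsilon> :: real assume "\<epsilon> > 0"
  then obtain \<delta> where \<delta>: "\<delta> > 0"
    "\<And>a. norm a \<le> \<delta> \<Longrightarrow> (LINT x|lborel. \<bar>g (x + a) - g x\<bar>) \<le> \<epsilon> / 2"
    using L1_translation_small[OF g, of "\<epsilon> / 2"] by auto
  have "\<forall>\<^sub>F n in sequentially. d n < \<delta>"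
    using d \<delta>(1) by (rule order_tendstoD)
  then show "\<forall>\<^sub>F n in sequentially. (\<integral>\<^sup>+x. ennreal \<bar>avg (M n) (Y n) g x - g x\<bar> \<partial>lborel) < ennreal \<epsilon>"
  proof eventually_elim
    fix n assume n: "d n < \<delta>"
    interpret random_shift "M n" "Y n" by (rule sh)
    have "(\<integral>\<^sup>+x. ennreal \<bar>avg (M n) (Y n) g x - g x\<bar> \<partial>lborel) \<le> ennreal (\<epsilon> / 2)"
    proof (rule nn_integral_avg_diff_le[OF g])
      show "AE \<omega> in M n. (LINT x|lborel. \<bar>g (x + Y n \<omega>) - g x\<bar>) \<le> \<epsilon> / 2"
        using small[of n] by eventually_elim (intro \<delta>(2), use n in linarith)
    qed
    also have "\<dots> < ennreal \<epsilon>" using \<open>\<epsilon> > 0\<close> by (simp add: ennreal_lessI)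
    finally show "(\<integral>\<^sup>+x. ennreal \<bar>avg (M n) (Y n) g x - g x\<bar> \<partial>lborel) < ennreal \<epsilon>" .
  qed
qed

section \<open>Locally integrable functions and mollification\<close>

lemma cball_measurable [measurable]: "cball (a::'a::euclidean_space) R \<in> sets borel"
  by simp

lemma integrable_indicator_cball [simp]:
  "integrable lborel (indicator (cball (a::'a::euclidean_space) R) :: 'a \<Rightarrow> real)"
  by (rule integrable_real_indicator) (simp, rule emeasure_lborel_cball_finite)

text \<open>
  Borel rather than Lebesgue measurability is required, so that functions such as \<open>(x, y) \<mapsto> u (x + y)\<close> are
  measurable with respect to the product sigma-algebra, as needed for Fubini's theorem.
\<close>

definition loc_int :: "('a::euclidean_space \<Rightarrow> real) \<Rightarrow> bool" where
  "loc_int u \<longleftrightarrow> u \<in> borel_measurable borel \<and>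
     (\<forall>R. integrable lborel (\<lambda>x. indicator (cball 0 R) x * u x))"

lemma loc_int_measurable: "loc_int u \<Longrightarrow> u \<in> borel_measurable borel"
  by (simp add: loc_int_def)

lemma loc_int_mult_integrable:
  assumes u: "loc_int u" and [measurable]: "\<eta> \<in> borel_measurable borel"
    and C: "\<And>x. \<bar>\<eta> x\<bar> \<le> C" and \<eta>: "bounded_support \<eta>"
  shows "integrable lborel (\<lambda>x. \<eta> x * u x)"
proof -
  obtain R where R: "\<And>x. norm x > R \<Longrightarrow> \<eta> x = 0"
    using \<eta> by (auto simp: bounded_support_def)
  have [measurable]: "u \<in> borel_measurable borel" using u by (rule loc_int_measurable)
  have "C \<ge> 0" using C[of 0] by linarith
  show ?thesis
  proof (rule Bochner_Integration.integrable_bound)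
    show "integrable lborel (\<lambda>x. C * (indicator (cball 0 R) x * u x))"
      using u by (intro integrable_mult_right) (simp add: loc_int_def)
    have "\<bar>\<eta> x * u x\<bar> \<le> \<bar>C * (indicator (cball 0 R) x * u x)\<bar>" for x
      using R[of x] C[of x] \<open>C \<ge> 0\<close> by (cases "norm x > R") (auto simp: abs_mult intro!: mult_right_mono)
    then show "AE x in lborel. norm (\<eta> x * u x) \<le> norm (C * (indicator (cball 0 R) x * u x))"
      by simp
  qed measurable
qed

lemma integrable_imp_loc_int: "integrable lborel u \<Longrightarrow> loc_int u"
  unfolding loc_int_def by (auto intro!: integrable_mult_indicator[where 'b=real, simplified])

lemma loc_int_cmult: "loc_int u \<Longrightarrow> loc_int (\<lambda>x. c * u x)"
  unfolding loc_int_def by (auto simp: mult.left_commute)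

lemma loc_int_add: "loc_int u \<Longrightarrow> loc_int v \<Longrightarrow> loc_int (\<lambda>x. u x + v x)"
  unfolding loc_int_def by (auto simp: distrib_left)

text \<open>
  A translate of a ball lies in a larger ball around the origin.
\<close>

lemma loc_int_translate:
  fixes u :: "'a::euclidean_space \<Rightarrow> real"
  assumes u: "loc_int u" shows "loc_int (\<lambda>x. u (x + a))"
proof -
  have [measurable]: "u \<in> borel_measurable borel" using u by (rule loc_int_measurable)
  have "integrable lborel (\<lambda>x. indicator (cball a R) x * u x)" for R
  proof -
    have "bounded_support (indicator (cball a R) :: 'a \<Rightarrow> real)"
      unfolding bounded_support_def
    proof (intro exI[of _ "norm a + R"] allI impI)
      fix x :: 'a assume "norm x > norm a + R"
      then show "indicator (cball a R) x = (0::real)"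
        using norm_triangle_ineq2[of x a] by (auto simp: indicator_def dist_norm norm_minus_commute)
    qed
    then show ?thesis
      by (intro loc_int_mult_integrable[OF u, where C = 1]) auto
  qed
  then have "integrable lborel (\<lambda>x. indicator (cball a R) (x + a) * u (x + a))" for R
    by (subst integral_lborel_translate(2)) auto
  moreover have "indicator (cball a R) (x + a) = (indicator (cball 0 R) x :: real)" for R x
    by (auto simp: indicator_def dist_norm)
  ultimately show ?thesis unfolding loc_int_def by auto
qed

lemma Ck_measurable [measurable_dest]: "Ck k f \<Longrightarrow> f \<in> borel_measurable borel"
  by (intro borel_measurable_continuous_onI Ck_imp_continuous)

lemma test_functions_measurable [measurable_dest]: "\<phi> \<in> test_functions \<Longrightarrow> \<phi> \<in> borel_measurable borel"
  using test_functions_Ck Ck_measurable by blast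

lemma continuous_bounded_support_bounded:
  fixes f :: "'a::euclidean_space \<Rightarrow> 'b::real_normed_vector"
  assumes "continuous_on UNIV f" "bounded_support f"
  shows "\<exists>C\<ge>0. \<forall>x. norm (f x) \<le> C"
proof -
  obtain R where R: "\<And>x. norm x > R \<Longrightarrow> f x = 0"
    using assms by (auto simp: bounded_support_def)
  have "compact (f ` cball 0 R)"
    by (intro compact_continuous_image continuous_on_subset[OF assms(1)]) auto
  then obtain C where "\<And>x. norm x \<le> R \<Longrightarrow> norm (f x) \<le> C"
    by (metis bounded_iff compact_imp_bounded image_eqI mem_cball_0)
  then have "norm (f x) \<le> max 0 C" for x
    using R[of x] by (cases "norm x \<le> R") (auto simp: le_max_iff_disj not_le)
  then show ?thesis by (intro exI[of _ "max 0 C"]) auto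
qed

lemma test_functions_bounded:
  assumes "\<phi> \<in> test_functions" shows "\<exists>C\<ge>0. \<forall>x. norm (\<phi> x) \<le> C"
  using assms continuous_bounded_support_bounded[of \<phi>] Ck_imp_continuous[of 0 \<phi>]
  unfolding test_functions_iff by blast

lemma loc_int_test_integrable:
  assumes "loc_int u" "\<phi> \<in> test_functions"
  shows "integrable lborel (\<lambda>x. \<phi> x * u x)"
proof -
  obtain C where "\<And>x. norm (\<phi> x) \<le> C" using test_functions_bounded[OF assms(2)] by auto
  then show ?thesis
    using assms by (intro loc_int_mult_integrable[where C = C]) (auto simp: test_functions_iff Ck_measurable)
qed

lemma integrable_test: "\<phi> \<in> test_functions \<Longrightarrow> integrable lborel (\<phi> :: _ \<Rightarrow> real)"
  using loc_int_test_integrable[of "\<lambda>_. 1" \<phi>]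
  by (simp add: loc_int_def)

text \<open>
  The directional derivative is linear in the direction and its values on the basis are continuous with
  bounded support; the Lipschitz bound follows by the mean value inequality.
\<close>

lemma Ck1_bounded_derivative:
  fixes f :: "'a::euclidean_space \<Rightarrow> real"
  assumes f: "Ck (Suc 0) f" "bounded_support f"
  shows "\<exists>K\<ge>0. (\<forall>x v. \<bar>dir_deriv v f x\<bar> \<le> K * norm v) \<and> (\<forall>x h. \<bar>f (x + h) - f x\<bar> \<le> K * norm h)"
proof -
  have "\<exists>C\<ge>0. \<forall>x. norm (dir_deriv b f x) \<le> C" for b
    using Ck_dir_deriv[OF f(1), of b] bounded_support_dir_deriv[OF f(2), of b]
    by (intro continuous_bounded_support_bounded) auto
  then obtain C where C: "\<And>b. C b \<ge> 0" "\<And>b x. \<bar>dir_deriv b f x\<bar> \<le> C b"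
    by (metis real_norm_def)
  define K where "K = (\<Sum>b\<in>Basis. C b)"
  have K: "\<bar>dir_deriv v f x\<bar> \<le> K * norm v" for x v
  proof -
    have lin: "linear (\<lambda>v. dir_deriv v f x)" by (rule linear_dir_deriv[OF Ck_differentiable[OF f(1)]])
    have "dir_deriv v f x = dir_deriv (\<Sum>b\<in>Basis. (v \<bullet> b) *\<^sub>R b) f x"
      by (simp add: euclidean_representation)
    also have "\<dots> = (\<Sum>b\<in>Basis. (v \<bullet> b) *\<^sub>R dir_deriv b f x)"
      by (simp only: linear_sum[OF lin] linear_scale[OF lin])
    finally have "\<bar>dir_deriv v f x\<bar> \<le> (\<Sum>b\<in>Basis. \<bar>v \<bullet> b\<bar> * \<bar>dir_deriv b f x\<bar>)"
      using sum_abs[of "\<lambda>b. (v \<bullet> b) *\<^sub>R dir_deriv b f x" Basis] by (simp add: abs_mult)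
    also have "\<dots> \<le> (\<Sum>b\<in>Basis. norm v * C b)"
      by (intro sum_mono mult_mono C Basis_le_norm) auto
    finally show ?thesis by (simp add: K_def sum_distrib_left mult.commute)
  qed
  have "\<bar>f (x + h) - f x\<bar> \<le> K * norm h" for x h
  proof -
    have "norm (f (x + h) - f x) \<le> K * norm ((x + h) - x)"
    proof (rule differentiable_bound[of UNIV f "\<lambda>y v. dir_deriv v f y"])
      show "(f has_derivative (\<lambda>v. dir_deriv v f y)) (at y within UNIV)" for y
        using Ck_Suc_has_derivative[OF f(1)] by simp
      show "onorm (\<lambda>v. dir_deriv v f y) \<le> K" for y
        by (rule onorm_le) (use K in simp)
    qed auto
    then show ?thesis by simp
  qed
  moreover have "K \<ge> 0" by (auto simp: K_def intro!: sum_nonneg C)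
  ultimately show ?thesis using K by blast
qed

definition moll :: "('a::euclidean_space \<Rightarrow> real) \<Rightarrow> ('a \<Rightarrow> real) \<Rightarrow> 'a \<Rightarrow> real" where
  "moll \<phi> g x = (LINT y|lborel. \<phi> (x - y) * g y)"

lemma moll_integrable:
  assumes \<phi>: "Ck k \<phi>" "bounded_support \<phi>" and g: "loc_int g"
  shows "integrable lborel (\<lambda>y. \<phi> (x - y) * g y)"
proof -
  have [measurable]: "\<phi> \<in> borel_measurable borel" by (rule Ck_measurable[OF \<phi>(1)])
  obtain C where C: "\<And>x. \<bar>\<phi> x\<bar> \<le> C"
    using continuous_bounded_support_bounded[OF Ck_imp_continuous[OF \<phi>(1)] \<phi>(2)] by auto
  obtain R where R: "\<And>x. norm x > R \<Longrightarrow> \<phi> x = 0"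
    using \<phi> by (auto simp: bounded_support_def)
  have "\<phi> (x - y) = 0" if "norm y > R + norm x" for y
    using that norm_triangle_ineq2[of y x] by (intro R) (simp add: norm_minus_commute)
  then have "bounded_support (\<lambda>y. \<phi> (x - y))" by (auto simp: bounded_support_def)
  then show ?thesis
    by (intro loc_int_mult_integrable[OF g, where C = C]) (auto intro: C)
qed

text \<open>
  Differentiation under the integral sign. The remainder quotient of \<open>\<phi>\<close> tends to \<open>0\<close> pointwise and is bounded
  by \<open>2 K\<close> for a Lipschitz constant \<open>K\<close>, so dominated convergence applies for integrable \<open>g\<close>.
\<close>

lemma moll_has_derivative:
  assumes \<phi>: "Ck (Suc 0) \<phi>" "bounded_support \<phi>" and g: "integrable lborel g"
  shows "(moll \<phi> g has_derivative (\<lambda>v. moll (dir_deriv v \<phi>) g x)) (at x)"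
proof -
  obtain K where K: "K \<ge> 0" "\<And>x v. \<bar>dir_deriv v \<phi> x\<bar> \<le> K * norm v"
    "\<And>x h. \<bar>\<phi> (x + h) - \<phi> x\<bar> \<le> K * norm h"
    using Ck1_bounded_derivative[OF \<phi>] by blast
  have [measurable]: "g \<in> borel_measurable borel" "\<phi> \<in> borel_measurable borel" using g \<phi> Ck_measurable by auto
  have [measurable]: "dir_deriv v \<phi> \<in> borel_measurable borel" for v
    using Ck_measurable[OF Ck_dir_deriv[OF \<phi>(1)]] .
  have i0: "integrable lborel (\<lambda>y. \<phi> (x - y) * g y)" for x
    using moll_integrable[OF \<phi> integrable_imp_loc_int[OF g]] .
  have i1: "integrable lborel (\<lambda>y. dir_deriv v \<phi> (x - y) * g y)" for x v
    using moll_integrable[OF Ck_dir_deriv[OF \<phi>(1)] bounded_support_dir_deriv[OF \<phi>(2)] integrable_imp_loc_int[OF g]] .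
  have lin: "linear (\<lambda>v. dir_deriv v \<phi> z)" for z
    by (rule linear_dir_deriv[OF Ck_differentiable[OF \<phi>(1)]])
  have "linear (\<lambda>v. moll (dir_deriv v \<phi>) g x)"
  proof (rule linearI)
    show "moll (dir_deriv (v + w) \<phi>) g x = moll (dir_deriv v \<phi>) g x + moll (dir_deriv w \<phi>) g x" for v w
      unfolding moll_def linear_add[OF lin] distrib_right by (rule Bochner_Integration.integral_add[OF i1 i1])
    show "moll (dir_deriv (c *\<^sub>R v) \<phi>) g x = c *\<^sub>R moll (dir_deriv v \<phi>) g x" for c v
      unfolding moll_def linear_scale[OF lin] by (simp add: mult.assoc)
  qed
  then have bl: "bounded_linear (\<lambda>v. moll (dir_deriv v \<phi>) g x)" by (rule linear_conv_bounded_linear[THEN iffD1])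
  define q where "q h y = (\<phi> (x - y + h) - \<phi> (x - y) - dir_deriv h \<phi> (x - y)) / norm h * g y" for h y
  have rest: "(moll \<phi> g (x + h) - moll \<phi> g x - moll (dir_deriv h \<phi>) g x) / norm h = (LINT y|lborel. q h y)" for h
  proof -
    have "moll \<phi> g (x + h) - moll \<phi> g x - moll (dir_deriv h \<phi>) g x =
      (LINT y|lborel. \<phi> (x + h - y) * g y - \<phi> (x - y) * g y - dir_deriv h \<phi> (x - y) * g y)"
      unfolding moll_def
      by (subst Bochner_Integration.integral_diff | rule Bochner_Integration.integrable_diff i0 i1 refl)+
    then show ?thesis
      by (simp add: q_def algebra_simps diff_divide_distrib flip: Bochner_Integration.integral_divide_zero)
  qed
  have "((\<lambda>h. norm (moll \<phi> g (x + h) - moll \<phi> g x - moll (dir_deriv h \<phi>) g x) / norm h) \<longlongrightarrow> 0) (at 0)"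
    unfolding tendsto_at_iff_sequentially o_def
  proof (intro allI impI)
    fix h :: "nat \<Rightarrow> 'a" assume nz: "\<forall>i. h i \<in> UNIV - {0}" and h: "h \<longlonglongrightarrow> 0"
    have "(\<lambda>n. LINT y|lborel. q (h n) y) \<longlonglongrightarrow> 0"
    proof (rule integral_dominated_convergence_zero[where w = "\<lambda>y. 2 * K * \<bar>g y\<bar>"])
      show "(\<lambda>y. q (h i) y) \<in> borel_measurable lborel" for i unfolding q_def by measurable
      show "integrable lborel (\<lambda>y. 2 * K * \<bar>g y\<bar>)" using g by simp
      show "AE y in lborel. (\<lambda>n. q (h n) y) \<longlonglongrightarrow> 0"
      proof (rule AE_I2)
        fix y
        have "(\<phi> has_derivative (\<lambda>v. dir_deriv v \<phi> (x - y))) (at (x - y))"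
          by (rule Ck_Suc_has_derivative[OF \<phi>(1)])
        then have "((\<lambda>h. norm (\<phi> (x - y + h) - \<phi> (x - y) - dir_deriv h \<phi> (x - y)) / norm h) \<longlongrightarrow> 0) (at 0)"
          by (simp add: has_derivative_at)
        then have "(\<lambda>n. norm (\<phi> (x - y + h n) - \<phi> (x - y) - dir_deriv (h n) \<phi> (x - y)) / norm (h n)) \<longlonglongrightarrow> 0"
          unfolding tendsto_at_iff_sequentially o_def using nz h by blast
        then have "(\<lambda>n. norm ((\<phi> (x - y + h n) - \<phi> (x - y) - dir_deriv (h n) \<phi> (x - y)) / norm (h n))) \<longlonglongrightarrow> 0"
          by simp
        then have "(\<lambda>n. (\<phi> (x - y + h n) - \<phi> (x - y) - dir_deriv (h n) \<phi> (x - y)) / norm (h n)) \<longlonglongrightarrow> 0"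
          by (rule tendsto_norm_zero_cancel)
        then show "(\<lambda>n. q (h n) y) \<longlonglongrightarrow> 0"
          unfolding q_def using tendsto_mult[OF _ tendsto_const[of "g y"]] by fastforce
      qed
      show "AE y in lborel. norm (q (h i) y) \<le> 2 * K * \<bar>g y\<bar>" for i
      proof (rule AE_I2)
        fix y
        have "norm (h i) > 0" using nz by auto
        moreover have "\<bar>\<phi> (x - y + h i) - \<phi> (x - y) - dir_deriv (h i) \<phi> (x - y)\<bar> \<le> 2 * K * norm (h i)"
          using K(2)[of "h i" "x - y"] K(3)[of "x - y" "h i"] by linarith
        ultimately have *: "\<bar>\<phi> (x - y + h i) - \<phi> (x - y) - dir_deriv (h i) \<phi> (x - y)\<bar> / norm (h i) \<le> 2 * K"
          by (simp add: field_simps)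
        then show "norm (q (h i) y) \<le> 2 * K * \<bar>g y\<bar>"
          using mult_right_mono[OF * abs_ge_zero[of "g y"]] by (simp add: q_def abs_mult)
      qed
    qed
    then have "(\<lambda>n. norm (LINT y|lborel. q (h n) y)) \<longlonglongrightarrow> 0" by (rule tendsto_norm_zero)
    then show "(\<lambda>n. norm (moll \<phi> g (x + h n) - moll \<phi> g x - moll (dir_deriv (h n) \<phi>) g x) / norm (h n)) \<longlonglongrightarrow> 0"
      by (simp flip: rest)
  qed
  with bl show ?thesis by (simp add: has_derivative_at)
qed

lemma moll_Ck:
  assumes "\<phi> \<in> test_functions" and g: "integrable lborel g"
  shows "Ck k (moll \<phi> g)"
  using assms(1)
proof (induction k arbitrary: \<phi>)
  case 0
  then have "(moll \<phi> g has_derivative (\<lambda>v. moll (dir_deriv v \<phi>) g x)) (at x)" for x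
    by (intro moll_has_derivative g) (auto simp: test_functions_iff simp del: Ck.simps)
  then show ?case
    by (auto intro!: continuous_at_imp_continuous_on has_derivative_continuous)
next
  case (Suc k)
  show ?case
  proof (rule Ck_SucI)
    show "(moll \<phi> g has_derivative (\<lambda>v. moll (dir_deriv v \<phi>) g x)) (at x)" for x
      using Suc.prems by (intro moll_has_derivative g) (auto simp: test_functions_iff simp del: Ck.simps)
    show "Ck k (\<lambda>x. moll (dir_deriv v \<phi>) g x)" for v
      using Suc.IH[OF test_functions_dir_deriv[OF Suc.prems]] .
  qed
qed

lemma dir_deriv_moll:
  assumes "\<phi> \<in> test_functions" and "integrable lborel g"
  shows "dir_deriv e (moll \<phi> g) x = moll (dir_deriv e \<phi>) g x"
  using assms by (intro dir_derivI moll_has_derivative) (auto simp: test_functions_iff simp del: Ck.simps)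

lemma moll_test_functions:
  assumes \<phi>: "\<phi> \<in> test_functions" and g: "integrable lborel g" "bounded_support g"
  shows "moll \<phi> g \<in> test_functions"
proof -
  obtain R where R: "\<And>x. norm x > R \<Longrightarrow> \<phi> x = 0"
    using \<phi> by (auto simp: bounded_support_def test_functions_iff)
  obtain S where S: "\<And>x. norm x > S \<Longrightarrow> g x = 0"
    using g by (auto simp: bounded_support_def)
  have "moll \<phi> g x = 0" if "norm x > R + S" for x
  proof -
    have "\<phi> (x - y) * g y = 0" for y
    proof (cases "norm y > S")
      case False
      then have "norm (x - y) > R" using that norm_triangle_ineq2[of x y] by simp
      then show ?thesis using R by simp
    qed (simp add: S)
    then show ?thesis unfolding moll_def by (simp only: Bochner_Integration.integral_zero)
  qed
  then have "bounded_support (moll \<phi> g)" by (auto simp: bounded_support_def)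
  with moll_Ck[OF \<phi> g(1)] show ?thesis by (simp add: test_functions_iff)
qed

section \<open>Weak limits of bounded sequences\<close>

text \<open>
  The pairing of \<open>|u|\<^sup>r\<^sup>-\<^sup>2 u\<close> with \<open>w\<close> in the weighted space \<open>L\<^sup>r\<close> is finite by Young's inequality.
\<close>

lemma weighted_sgn_powr_integrable:
  fixes k u w :: "'x \<Rightarrow> real"
  assumes r: "r > 1" and [measurable]: "k \<in> borel_measurable M" "u \<in> borel_measurable M" "w \<in> borel_measurable M"
    and k: "\<And>x. k x \<ge> 0" and u: "integrable M (\<lambda>x. k x * \<bar>u x\<bar> powr r)"
    and w: "(\<integral>\<^sup>+x. ennreal (k x * \<bar>w x\<bar> powr r) \<partial>M) < \<infinity>"
  shows "integrable M (\<lambda>x. k x * sgn_powr r (u x) * w x)"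
proof (rule Bochner_Integration.integrable_bound)
  have "integrable M (\<lambda>x. k x * \<bar>w x\<bar> powr r)"
    using w k by (intro integrableI_bounded) auto
  with u show "integrable M (\<lambda>x. k x * \<bar>u x\<bar> powr r + k x * \<bar>w x\<bar> powr r)"
    by (rule Bochner_Integration.integrable_add)
  have "\<bar>k x * sgn_powr r (u x) * w x\<bar> \<le> k x * \<bar>u x\<bar> powr r + k x * \<bar>w x\<bar> powr r" for x
    using mult_left_mono[OF abs_sgn_powr_mult_le[OF r, of "u x" "w x"] k[of x]] k[of x]
    by (simp add: abs_mult distrib_left mult.assoc)
  then show "AE x in M. norm (k x * sgn_powr r (u x) * w x) \<le> norm (k x * \<bar>u x\<bar> powr r + k x * \<bar>w x\<bar> powr r)"
    by (intro AE_I2) (simp add: order_trans[OF _ abs_ge_self])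
qed measurable

text \<open>
  Truncating \<open>b\<close> to \<open>[- L |a|, L |a|]\<close> changes it only where \<open>|a| < |b| / L\<close>, and there
  \<open>|a|\<^sup>r\<^sup>-\<^sup>1 |b| \<le> L\<^sup>1\<^sup>-\<^sup>r |b|\<^sup>r\<close>. As \<open>r > 1\<close>, the factor is small for large \<open>L\<close>.
\<close>

lemma clamp_error:
  fixes a b L :: real
  assumes r: "r > 1" and L: "L > 0"
  shows "\<bar>sgn_powr r a * (b - max (- (L * \<bar>a\<bar>)) (min (L * \<bar>a\<bar>) b))\<bar> \<le> L powr (1 - r) * \<bar>b\<bar> powr r"
proof (cases "\<bar>b\<bar> \<le> L * \<bar>a\<bar>")
  case True
  then have "max (- (L * \<bar>a\<bar>)) (min (L * \<bar>a\<bar>) b) = b" by linarith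
  then show ?thesis by simp
next
  case False
  have "L * \<bar>a\<bar> \<ge> 0" using L by simp
  then have "\<bar>b - max (- (L * \<bar>a\<bar>)) (min (L * \<bar>a\<bar>) b)\<bar> \<le> \<bar>b\<bar>" using False by linarith
  moreover have "\<bar>a\<bar> powr (r - 1) \<le> (\<bar>b\<bar> / L) powr (r - 1)"
    using False L r by (intro powr_mono2) (auto simp: field_simps)
  ultimately have "\<bar>sgn_powr r a * (b - max (- (L * \<bar>a\<bar>)) (min (L * \<bar>a\<bar>) b))\<bar> \<le> (\<bar>b\<bar> / L) powr (r - 1) * \<bar>b\<bar>"
    by (auto simp: abs_mult abs_sgn_powr intro!: mult_mono)
  also have "\<dots> = (\<bar>b\<bar> powr (r - 1) * \<bar>b\<bar>) / L powr (r - 1)"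
    using L by (simp add: powr_divide)
  also have "\<bar>b\<bar> powr (r - 1) * \<bar>b\<bar> = \<bar>b\<bar> powr r"
    using sgn_powr_mult_self[of r b] abs_sgn_powr[of r b] by (metis abs_mult abs_of_nonneg powr_ge_zero)
  also have "\<bar>b\<bar> powr r / L powr (r - 1) = L powr (1 - r) * \<bar>b\<bar> powr r"
    using powr_minus_divide[of L "r - 1"] by simp
  finally show ?thesis .
qed

text \<open>
  Bounded sequences in the weighted space \<open>L\<^sup>r\<close> that converge almost everywhere converge weakly, here against
  the element \<open>|u|\<^sup>r\<^sup>-\<^sup>2 u\<close> of the dual. The truncation of \<open>w' n\<close> to \<open>[- L |u|, L |u|]\<close> is
  dominated by the integrable function \<open>L |u|\<^sup>r\<close>, and the error made is at most \<open>L\<^sup>1\<^sup>-\<^sup>r B\<close>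
  uniformly in \<open>n\<close>.

  The weight \<open>k\<close> is \<open>1\<close> for the gradient and power terms of the equation, \<open>I\<^sub>\<alpha> * |u|\<^sup>p\<close> for its nonlocal term
  and a test function in the chain rule; convergence is required only where \<open>k\<close> does not vanish.
\<close>

lemma sgn_powr_weak_limit:
  fixes k u w :: "'x \<Rightarrow> real" and w' :: "nat \<Rightarrow> 'x \<Rightarrow> real"
  assumes r: "r > 1" and m [measurable]: "k \<in> borel_measurable M" "u \<in> borel_measurable M"
      "\<And>n. w' n \<in> borel_measurable M" "w \<in> borel_measurable M"
    and k: "\<And>x. k x \<ge> 0" and u: "integrable M (\<lambda>x. k x * \<bar>u x\<bar> powr r)"
    and bound: "\<And>n. (\<integral>\<^sup>+x. ennreal (k x * \<bar>w' n x\<bar> powr r) \<partial>M) \<le> B" and B: "B < \<infinity>"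
    and lim: "AE x in M. k x \<noteq> 0 \<longrightarrow> (\<lambda>n. w' n x) \<longlonglongrightarrow> w x"
  shows "integrable M (\<lambda>x. k x * sgn_powr r (u x) * w x)"
    and "(\<lambda>n. LINT x|M. k x * sgn_powr r (u x) * w' n x) \<longlonglongrightarrow> (LINT x|M. k x * sgn_powr r (u x) * w x)"
proof -
  have limk: "AE x in M. (\<lambda>n. k x * \<bar>w' n x\<bar> powr r) \<longlonglongrightarrow> k x * \<bar>w x\<bar> powr r"
    using lim
  proof eventually_elim
    case (elim x)
    show ?case
    proof (cases "k x = 0")
      case False
      then show ?thesis using elim r by (intro tendsto_mult tendsto_const tendsto_powr' tendsto_rabs) auto
    qed simp
  qed
  \<comment> \<open>Fatou: the limit satisfies the same bound.\<close>
  have bw: "(\<integral>\<^sup>+x. ennreal (k x * \<bar>w x\<bar> powr r) \<partial>M) \<le> B"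
  proof -
    have "(\<integral>\<^sup>+x. ennreal (k x * \<bar>w x\<bar> powr r) \<partial>M) =
      (\<integral>\<^sup>+x. liminf (\<lambda>n. ennreal (k x * \<bar>w' n x\<bar> powr r)) \<partial>M)"
    proof (rule nn_integral_cong_AE, use limk in eventually_elim)
      case (elim x)
      then have "(\<lambda>n. ennreal (k x * \<bar>w' n x\<bar> powr r)) \<longlonglongrightarrow> ennreal (k x * \<bar>w x\<bar> powr r)"
        by (rule tendsto_ennrealI)
      from lim_imp_Liminf[OF _ this] show ?case by simp
    qed
    also have "\<dots> \<le> liminf (\<lambda>n. \<integral>\<^sup>+x. ennreal (k x * \<bar>w' n x\<bar> powr r) \<partial>M)"
      by (rule nn_integral_liminf) measurable
    also have "\<dots> \<le> B"
      using bound by (intro Liminf_le always_eventually) auto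
    finally show ?thesis .
  qed
  have i: "integrable M (\<lambda>x. k x * sgn_powr r (u x) * w' n x)" for n
    using bound[of n] B by (intro weighted_sgn_powr_integrable r k u) auto
  show i0: "integrable M (\<lambda>x. k x * sgn_powr r (u x) * w x)"
    using bw B by (intro weighted_sgn_powr_integrable r k u) auto
  obtain B' where B': "B = ennreal B'" "B' \<ge> 0" using B by (cases B) auto
  show "(\<lambda>n. LINT x|M. k x * sgn_powr r (u x) * w' n x) \<longlonglongrightarrow> (LINT x|M. k x * sgn_powr r (u x) * w x)"
  proof (rule LIMSEQ_I)
    fix \<epsilon> :: real assume \<epsilon>: "\<epsilon> > 0"
    \<comment> \<open>Chosen such that the truncation error, \<open>L\<^sup>1\<^sup>-\<^sup>r\<close> times the bound, is at most \<open>\<epsilon> / 4\<close>.\<close>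
    define L where "L = (\<epsilon> / (4 * (B' + 1))) powr (1 / (1 - r))"
    have L: "L > 0" "L powr (1 - r) = \<epsilon> / (4 * (B' + 1))"
      using \<epsilon> B'(2) r by (auto simp: L_def powr_powr)
    define T where "T x b = max (- (L * \<bar>u x\<bar>)) (min (L * \<bar>u x\<bar>) b)" for x b
    have [measurable]: "(\<lambda>x. T x (v x)) \<in> borel_measurable M" if "v \<in> borel_measurable M" for v
      using that unfolding T_def by measurable
    have T_bound: "\<bar>k x * sgn_powr r (u x) * T x b\<bar> \<le> L * (k x * \<bar>u x\<bar> powr r)" for x b
    proof -
      have "L * \<bar>u x\<bar> \<ge> 0" using L by simp
      then have "\<bar>T x b\<bar> \<le> L * \<bar>u x\<bar>" unfolding T_def by linarith
      then have "\<bar>sgn_powr r (u x)\<bar> * \<bar>T x b\<bar> \<le> \<bar>sgn_powr r (u x)\<bar> * (L * \<bar>u x\<bar>)"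
        by (rule mult_left_mono) simp
      also have "\<dots> = L * \<bar>u x\<bar> powr r"
        using sgn_powr_mult_self[of r "u x"] by (metis abs_mult abs_of_nonneg mult.left_commute powr_ge_zero)
      finally show ?thesis using mult_left_mono[OF _ k[of x]] k[of x]
        by (fastforce simp: abs_mult mult.assoc mult.left_commute)
    qed
    have iT: "integrable M (\<lambda>x. k x * sgn_powr r (u x) * T x (v x))" if [measurable]: "v \<in> borel_measurable M" for v
      by (rule Bochner_Integration.integrable_bound[OF integrable_mult_right[OF u, of L]])
        (use T_bound in \<open>auto intro!: AE_I2 intro: order_trans[OF _ abs_ge_self]\<close>)
    have err: "\<bar>(LINT x|M. k x * sgn_powr r (u x) * v x) - (LINT x|M. k x * sgn_powr r (u x) * T x (v x))\<bar> \<le> \<epsilon> / 4"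
      if [measurable]: "v \<in> borel_measurable M" and v: "(\<integral>\<^sup>+x. ennreal (k x * \<bar>v x\<bar> powr r) \<partial>M) \<le> B" for v
    proof -
      have iv: "integrable M (\<lambda>x. k x * \<bar>v x\<bar> powr r)"
        using v B k by (intro integrableI_bounded) (auto intro: le_less_trans)
      have i1: "integrable M (\<lambda>x. k x * sgn_powr r (u x) * v x)"
        using v B by (intro weighted_sgn_powr_integrable r k u) auto
      have "\<bar>(LINT x|M. k x * sgn_powr r (u x) * v x) - (LINT x|M. k x * sgn_powr r (u x) * T x (v x))\<bar> =
        \<bar>LINT x|M. k x * sgn_powr r (u x) * v x - k x * sgn_powr r (u x) * T x (v x)\<bar>"
        by (subst Bochner_Integration.integral_diff[OF i1 iT]) auto
      also have "\<dots> \<le> (LINT x|M. \<bar>k x * sgn_powr r (u x) * v x - k x * sgn_powr r (u x) * T x (v x)\<bar>)"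
        by (rule integral_abs_bound)
      also have "\<dots> \<le> (LINT x|M. L powr (1 - r) * (k x * \<bar>v x\<bar> powr r))"
      proof (rule integral_mono)
        fix x
        have "\<bar>k x * sgn_powr r (u x) * v x - k x * sgn_powr r (u x) * T x (v x)\<bar> =
            k x * \<bar>sgn_powr r (u x) * (v x - T x (v x))\<bar>"
          using k[of x] by (simp add: right_diff_distrib[symmetric] abs_mult mult.assoc)
        also have "\<dots> \<le> k x * (L powr (1 - r) * \<bar>v x\<bar> powr r)"
          unfolding T_def by (rule mult_left_mono[OF clamp_error[OF r L(1)] k])
        finally show "\<bar>k x * sgn_powr r (u x) * v x - k x * sgn_powr r (u x) * T x (v x)\<bar> \<le> L powr (1 - r) * (k x * \<bar>v x\<bar> powr r)"
          by (simp add: mult.left_commute)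
      qed (intro integrable_abs Bochner_Integration.integrable_diff i1 iT integrable_mult_right iv; measurable)+
      also have "\<dots> = L powr (1 - r) * (LINT x|M. k x * \<bar>v x\<bar> powr r)" by simp
      also have "\<dots> \<le> L powr (1 - r) * B'"
      proof (rule mult_left_mono)
        show "(LINT x|M. k x * \<bar>v x\<bar> powr r) \<le> B'"
          using v iv k B' by (subst (asm) nn_integral_eq_integral) (auto intro!: AE_I2)
      qed simp
      also have "\<dots> \<le> \<epsilon> / 4" unfolding L(2) using B'(2) \<epsilon> by (simp add: field_simps)
      finally show ?thesis .
    qed
    have "(\<lambda>n. LINT x|M. k x * sgn_powr r (u x) * T x (w' n x)) \<longlonglongrightarrow> (LINT x|M. k x * sgn_powr r (u x) * T x (w x))"
    proof (rule integral_dominated_convergence[where w = "\<lambda>x. L * (k x * \<bar>u x\<bar> powr r)"])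
      show "AE x in M. (\<lambda>n. k x * sgn_powr r (u x) * T x (w' n x)) \<longlonglongrightarrow> k x * sgn_powr r (u x) * T x (w x)"
        using lim
      proof eventually_elim
        case (elim x)
        then show ?case
          unfolding T_def by (cases "k x = 0") (auto intro!: tendsto_intros)
      qed
    qed (use u T_bound in \<open>auto intro!: AE_I2 integrable_mult_right\<close>)
    from LIMSEQ_D[OF this, of "\<epsilon> / 4"] \<epsilon> obtain N where N: "\<And>n. n \<ge> N \<Longrightarrow>
      \<bar>(LINT x|M. k x * sgn_powr r (u x) * T x (w' n x)) - (LINT x|M. k x * sgn_powr r (u x) * T x (w x))\<bar> < \<epsilon> / 4"
      by auto
    have "\<bar>(LINT x|M. k x * sgn_powr r (u x) * w' n x) - (LINT x|M. k x * sgn_powr r (u x) * w x)\<bar> < \<epsilon>" if "n \<ge> N" for n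
      using N[OF that] err[OF m(3)[of n] bound[of n]] err[OF m(4) bw] \<epsilon> by linarith
    then show "\<exists>N. \<forall>n\<ge>N. norm ((LINT x|M. k x * sgn_powr r (u x) * w' n x) - (LINT x|M. k x * sgn_powr r (u x) * w x)) < \<epsilon>"
      by auto
  qed
qed

section \<open>Mollifiers and the fundamental lemma of the calculus of variations\<close>

definition mollifier :: "real \<Rightarrow> ('a::euclidean_space \<Rightarrow> real) \<Rightarrow> bool" where
  "mollifier \<delta> \<rho> \<longleftrightarrow> \<rho> \<in> test_functions \<and> (\<forall>x. 0 \<le> \<rho> x) \<and> (\<forall>x. \<rho> x \<noteq> 0 \<longrightarrow> norm x < \<delta>) \<and>
     (LINT x|lborel. \<rho> x) = 1"

lemma mollifier_exists:
  assumes "\<delta> > 0" shows "\<exists>\<rho>::'a::euclidean_space \<Rightarrow> real. mollifier \<delta> \<rho>"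
proof -
  obtain b :: "'a \<Rightarrow> real" where b: "b \<in> test_functions" "\<And>x. 0 \<le> b x" "\<And>x. b x \<noteq> 0 \<longleftrightarrow> norm x < \<delta>"
    using bump_exists[OF assms] by blast
  define c where "c = (LINT x|lborel. b x)"
  have "c \<noteq> 0"
  proof
    assume "c = 0"
    then have "AE x in lborel. b x = 0"
      using integral_nonneg_eq_0_iff_AE[OF integrable_test[OF b(1)]] b(2) by (simp add: c_def)
    then have "AE x in lborel. x \<notin> ball (0::'a) \<delta>"
      by eventually_elim (use b(3) in auto)
    then have "emeasure lborel (ball (0::'a) \<delta>) = 0"
      by (subst (asm) AE_iff_measurable[of "ball (0::'a) \<delta>"]) (auto simp: ball_def)
    then have "measure lborel (ball (0::'a) \<delta>) = 0" by (simp only: measure_def enn2real_0)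
    then show False using content_ball_gt_0_iff[of "0::'a" \<delta>] assms by linarith
  qed
  moreover have "c \<ge> 0" unfolding c_def by (intro Bochner_Integration.integral_nonneg b)
  ultimately have c: "c > 0" by simp
  have "(\<lambda>x. (1 / c) * b x) \<in> test_functions"
    using b(1) Ck_const by (intro test_functions_bilinear[OF bounded_bilinear_mult]) (auto simp: test_functions_iff)
  moreover have "0 \<le> (1 / c) * b x" "(1 / c) * b x \<noteq> 0 \<longrightarrow> norm x < \<delta>" for x
    using c b(2,3)[of x] by auto
  moreover have "(LINT x|lborel. (1 / c) * b x) = 1"
    unfolding Bochner_Integration.integral_mult_right_zero c_def[symmetric] using c by simp
  ultimately have "mollifier \<delta> (\<lambda>x. (1 / c) * b x)"
    unfolding mollifier_def by blast
  then show ?thesis by blast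
qed

text \<open>
  The shift is \<open>- y\<close> with \<open>y\<close> distributed with density \<open>\<rho>\<close>, since the convolution of \<open>\<rho>\<close> and \<open>g\<close> at \<open>x\<close> is the
  mean of \<open>g (x - y)\<close>.
\<close>

lemma mollifier_random_shift:
  assumes "mollifier \<delta> \<rho>"
  shows "random_shift (density lborel (\<lambda>x. ennreal (\<rho> x))) uminus"
    and "AE x in density lborel (\<lambda>x. ennreal (\<rho> x)). norm (- x) \<le> \<delta>"
proof -
  have \<rho>: "\<rho> \<in> test_functions" "\<And>x. 0 \<le> \<rho> x" "\<And>x. \<rho> x \<noteq> 0 \<Longrightarrow> norm x < \<delta>" "(LINT x|lborel. \<rho> x) = 1"
    using assms by (auto simp: mollifier_def)
  have [measurable]: "\<rho> \<in> borel_measurable borel" using \<rho>(1) by (rule test_functions_measurable)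
  have "(\<integral>\<^sup>+x. ennreal (\<rho> x) \<partial>lborel) = ennreal (LINT x|lborel. \<rho> x)"
    by (rule nn_integral_eq_integral[OF integrable_test[OF \<rho>(1)]]) (simp add: \<rho>(2))
  then have one: "(\<integral>\<^sup>+x. ennreal (\<rho> x) \<partial>lborel) = 1" by (simp add: \<rho>(4))
  show "random_shift (density lborel (\<lambda>x. ennreal (\<rho> x))) uminus"
  proof (intro random_shift.intro prob_spaceI random_shift_axioms.intro)
    show "emeasure (density lborel (\<lambda>x. ennreal (\<rho> x))) (space (density lborel (\<lambda>x. ennreal (\<rho> x)))) = 1"
      using one by (simp add: emeasure_density)
  qed simp
  show "AE x in density lborel (\<lambda>x. ennreal (\<rho> x)). norm (- x) \<le> \<delta>"
  proof (subst AE_density)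
    have "0 < ennreal (\<rho> x) \<longrightarrow> norm (- x) \<le> \<delta>" for x
      using \<rho>(3)[of x] by (cases "\<rho> x = 0") simp_all
    then show "AE x in lborel. 0 < ennreal (\<rho> x) \<longrightarrow> norm (- x) \<le> \<delta>" by simp
  qed simp
qed

lemma moll_eq_avg:
  assumes "mollifier \<delta> \<rho>" and [measurable]: "g \<in> borel_measurable borel"
  shows "moll \<rho> g = avg (density lborel (\<lambda>x. ennreal (\<rho> x))) uminus g"
proof
  fix x
  have \<rho>: "\<rho> \<in> test_functions" "\<And>x. 0 \<le> \<rho> x" using assms by (auto simp: mollifier_def)
  have [measurable]: "\<rho> \<in> borel_measurable borel" using \<rho>(1) by (rule test_functions_measurable)
  have "avg (density lborel (\<lambda>x. ennreal (\<rho> x))) uminus g x = (LINT y|lborel. \<rho> y * g (x - y))"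
    unfolding avg_def by (subst integral_density) (simp_all add: \<rho>(2))
  also have "\<dots> = (LINT y|lborel. \<rho> (x - y) * g (x - (x - y)))"
    by (rule integral_lborel_reflect(1)[of "\<lambda>y. \<rho> y * g (x - y)" x, symmetric]) measurable
  finally show "moll \<rho> g x = avg (density lborel (\<lambda>x. ennreal (\<rho> x))) uminus g x"
    by (simp add: moll_def)
qed

definition std_mollifier :: "nat \<Rightarrow> 'a::euclidean_space \<Rightarrow> real" where
  "std_mollifier n = (SOME \<rho>. mollifier (inverse (real (Suc n))) \<rho>)"

lemma mollifier_std: "mollifier (inverse (real (Suc n))) (std_mollifier n)"
  unfolding std_mollifier_def by (rule someI_ex[OF mollifier_exists]) simp

lemma std_mollifier_test: "std_mollifier n \<in> test_functions"
  using mollifier_std[of n] unfolding mollifier_def by blast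

lemma moll_tendsto_L1:
  assumes g: "integrable lborel g"
  shows "(\<lambda>n. \<integral>\<^sup>+x. ennreal \<bar>moll (std_mollifier n) g x - g x\<bar> \<partial>lborel) \<longlonglongrightarrow> 0"
proof -
  have "moll (std_mollifier n) g = avg (density lborel (\<lambda>x. ennreal (std_mollifier n x))) uminus g" for n
    using g by (intro moll_eq_avg[OF mollifier_std]) auto
  then show ?thesis
    using avg_tendsto_L1[OF mollifier_random_shift[OF mollifier_std] LIMSEQ_inverse_real_of_nat g] by simp
qed

text \<open>
  The mollifications of \<open>g\<close> are pairings with test functions, hence vanish, and they converge to \<open>g\<close>.
\<close>

lemma fundamental_lemma_integrable:
  fixes g :: "'a::euclidean_space \<Rightarrow> real"
  assumes g: "integrable lborel g"
    and zero: "\<And>\<phi>. \<phi> \<in> test_functions \<Longrightarrow> (LINT x|lborel. \<phi> x * g x) = 0"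
  shows "AE x in lborel. g x = 0"
proof -
  have "moll (std_mollifier n) g x = 0" for n x
  proof -
    have "(\<lambda>y. std_mollifier n (x + (- 1) *\<^sub>R y)) \<in> test_functions"
      by (rule test_functions_affine[OF std_mollifier_test]) simp
    from zero[OF this] show ?thesis by (simp add: moll_def)
  qed
  then have "(\<integral>\<^sup>+x. ennreal \<bar>g x\<bar> \<partial>lborel) = 0"
    using moll_tendsto_L1[OF g] by (simp add: LIMSEQ_const_iff)
  then show ?thesis using g by (subst (asm) nn_integral_0_iff_AE) auto
qed

lemma AE_if_AE_cballs:
  fixes P :: "'a::euclidean_space \<Rightarrow> bool"
  assumes "\<And>n::nat. AE x in lborel. norm x < real n \<longrightarrow> P x"
  shows "AE x in lborel. P x"
proof -
  have "AE x in lborel. \<forall>n::nat. norm x < real n \<longrightarrow> P x" unfolding AE_all_countable using assms by blast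
  then show ?thesis by eventually_elim (metis reals_Archimedean2)
qed

text \<open>
  Multiply \<open>g\<close> by bump functions to reduce to the integrable case.
\<close>

lemma fundamental_lemma:
  fixes g :: "'a::euclidean_space \<Rightarrow> real"
  assumes g: "loc_int g"
    and zero: "\<And>\<phi>. \<phi> \<in> test_functions \<Longrightarrow> (LINT x|lborel. \<phi> x * g x) = 0"
  shows "AE x in lborel. g x = 0"
proof (rule AE_if_AE_cballs)
  fix n :: nat
  obtain b :: "'a \<Rightarrow> real" where b: "b \<in> test_functions" "\<And>x. b x \<noteq> 0 \<longleftrightarrow> norm x < real n + 1"
    using bump_exists[of "real n + 1"] by force
  have "AE x in lborel. b x * g x = 0"
  proof (rule fundamental_lemma_integrable)
    show "integrable lborel (\<lambda>x. b x * g x)" by (rule loc_int_test_integrable[OF g b(1)])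
    fix \<phi> :: "'a \<Rightarrow> real" assume "\<phi> \<in> test_functions"
    then have "(\<lambda>x. \<phi> x * b x) \<in> test_functions"
      using b(1) by (intro test_functions_bilinear[OF bounded_bilinear_mult]) (auto simp: test_functions_iff)
    from zero[OF this] show "(LINT x|lborel. \<phi> x * (b x * g x)) = 0" by (simp add: mult.assoc)
  qed
  then show "AE x in lborel. norm x < real n \<longrightarrow> g x = 0"
    by eventually_elim (use b(2) in force)
qed

text \<open>
  Mollify the indicator of the ball of radius \<open>R + 1\<close> at unit scale.
\<close>

lemma cutoff_exists:
  fixes R :: real
  shows "\<exists>\<zeta>\<in>test_functions. (\<forall>x::'a::euclidean_space. 0 \<le> \<zeta> x \<and> \<zeta> x \<le> (1::real)) \<and> (\<forall>x. norm x \<le> R \<longrightarrow> \<zeta> x = 1)"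
proof -
  obtain \<rho> :: "'a \<Rightarrow> real" where \<rho>: "mollifier 1 \<rho>" using mollifier_exists[of 1] by auto
  then have \<rho>': "\<rho> \<in> test_functions" "\<And>x. 0 \<le> \<rho> x" "\<And>x. \<rho> x \<noteq> 0 \<Longrightarrow> norm x < 1" "(LINT x|lborel. \<rho> x) = 1"
    by (auto simp: mollifier_def)
  have [measurable]: "\<rho> \<in> borel_measurable borel" using \<rho>'(1) by (rule test_functions_measurable)
  define g :: "'a \<Rightarrow> real" where "g = indicator (cball 0 (R + 1))"
  have "g x = 0" if "norm x > R + 1" for x using that by (simp add: g_def)
  then have "bounded_support g" unfolding bounded_support_def by blast
  then have t: "moll \<rho> g \<in> test_functions"
    by (intro moll_test_functions \<rho>') (simp add: g_def)
  have int: "integrable lborel (\<lambda>y. \<rho> (x - y))" for x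
    using integral_lborel_reflect(2)[of \<rho> x] integrable_test[OF \<rho>'(1)] by simp
  have one: "(LINT y|lborel. \<rho> (x - y)) = 1" for x
    using integral_lborel_reflect(1)[of \<rho> x] \<rho>'(4) by simp
  have "0 \<le> moll \<rho> g x" for x
    unfolding moll_def by (intro Bochner_Integration.integral_nonneg) (auto simp: g_def \<rho>')
  moreover have "moll \<rho> g x \<le> 1" for x
  proof -
    have "moll \<rho> g x \<le> (LINT y|lborel. \<rho> (x - y))"
      unfolding moll_def
    proof (intro integral_mono int moll_integrable[of 0])
      show "loc_int g" by (intro integrable_imp_loc_int) (simp add: g_def)
      show "Ck 0 \<rho>" "bounded_support \<rho>" using \<rho>'(1) by (auto simp: test_functions_iff simp del: Ck.simps)
      show "\<rho> (x - y) * g y \<le> \<rho> (x - y)" for y using \<rho>'(2)[of "x - y"] by (simp add: g_def indicator_def)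
    qed
    then show ?thesis using one by simp
  qed
  moreover have "moll \<rho> g x = 1" if "norm x \<le> R" for x
  proof -
    have "\<rho> (x - y) * g y = \<rho> (x - y)" for y
    proof (cases "\<rho> (x - y) = 0")
      case False
      then have "norm (y - x) < 1" using \<rho>'(3)[of "x - y"] by (simp add: norm_minus_commute)
      then have "norm y \<le> R + 1" using that norm_triangle_ineq2[of y x] by linarith
      then show ?thesis by (simp add: g_def)
    qed simp
    then show ?thesis using one unfolding moll_def by (simp only:)
  qed
  ultimately show ?thesis using t by blast
qed

section \<open>Weak directional derivatives\<close>

definition wderiv :: "'a::euclidean_space \<Rightarrow> ('a \<Rightarrow> real) \<Rightarrow> ('a \<Rightarrow> real) \<Rightarrow> bool" where
  "wderiv e u v \<longleftrightarrow> loc_int u \<and> loc_int v \<and>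
     (\<forall>\<phi>\<in>test_functions. (LINT x|lborel. dir_deriv e \<phi> x * u x) = - (LINT x|lborel. \<phi> x * v x))"

lemma wderivD:
  assumes "wderiv e u v"
  shows "loc_int u" "loc_int v"
    "\<phi> \<in> test_functions \<Longrightarrow> (LINT x|lborel. dir_deriv e \<phi> x * u x) = - (LINT x|lborel. \<phi> x * v x)"
  using assms by (auto simp: wderiv_def)

lemma wderiv_minus:
  assumes "wderiv e u v" shows "wderiv (- e) u (\<lambda>x. - v x)"
proof -
  have "dir_deriv (- e) \<phi> x = - dir_deriv e \<phi> x" if "\<phi> \<in> test_functions" for \<phi> :: "'a \<Rightarrow> real" and x
    using linear_neg[OF linear_dir_deriv[OF Ck_differentiable[OF test_functions_Ck[OF that]]]] .
  then show ?thesis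
    using assms loc_int_cmult[of v "- 1"] by (simp add: wderiv_def)
qed

lemma wderiv_add:
  assumes "wderiv e u v" "wderiv e u' v'"
  shows "wderiv e (\<lambda>x. u x + u' x) (\<lambda>x. v x + v' x)"
proof -
  note d = wderivD[OF assms(1)] wderivD[OF assms(2)]
  have "(LINT x|lborel. dir_deriv e \<phi> x * (u x + u' x)) = - (LINT x|lborel. \<phi> x * (v x + v' x))"
    if \<phi>: "\<phi> \<in> test_functions" for \<phi>
  proof -
    note t = loc_int_test_integrable[OF _ \<phi>] loc_int_test_integrable[OF _ test_functions_dir_deriv[OF \<phi>]]
    show ?thesis
      unfolding distrib_left Bochner_Integration.integral_add[OF t(2)[OF d(1)] t(2)[OF d(4)]]
        Bochner_Integration.integral_add[OF t(1)[OF d(2)] t(1)[OF d(5)]] d(3)[OF \<phi>] d(6)[OF \<phi>] by simp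
  qed
  then show ?thesis using d by (auto simp: wderiv_def intro: loc_int_add)
qed

lemma wderiv_zero: "wderiv e (\<lambda>_. 0) (\<lambda>_. 0)"
  by (simp add: wderiv_def loc_int_def)

lemma wderiv_sum:
  assumes "\<And>i. i \<in> I \<Longrightarrow> wderiv e (u i) (v i)"
  shows "wderiv e (\<lambda>x. \<Sum>i\<in>I. u i x) (\<lambda>x. \<Sum>i\<in>I. v i x)"
  using assms
proof (induction I rule: infinite_finite_induct)
  case (insert i I)
  then show ?case using wderiv_add[of e "u i" "v i"] by simp
qed (auto intro: wderiv_zero)

lemma wderiv_cmult:
  assumes "wderiv e u v" shows "wderiv e (\<lambda>x. c * u x) (\<lambda>x. c * v x)"
proof -
  have "(LINT x|lborel. \<phi> x * (c * w x)) = c * (LINT x|lborel. \<phi> x * w x)" for \<phi> w :: "'a \<Rightarrow> real"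
    unfolding Bochner_Integration.integral_mult_right_zero[symmetric]
    by (intro Bochner_Integration.integral_cong refl) (rule mult.left_commute)
  then show ?thesis
    using wderivD[OF assms] by (auto simp: wderiv_def intro: loc_int_cmult)
qed

lemma wderiv_translate:
  assumes "wderiv e u v"
  shows "wderiv e (\<lambda>x. u (x + a)) (\<lambda>x. v (x + a))"
proof -
  note d = wderivD[OF assms]
  have [measurable]: "u \<in> borel_measurable borel" "v \<in> borel_measurable borel"
    using d(1,2) loc_int_measurable by auto
  have "(LINT x|lborel. dir_deriv e \<phi> x * u (x + a)) = - (LINT x|lborel. \<phi> x * v (x + a))"
    if \<phi>: "\<phi> \<in> test_functions" for \<phi>
  proof -
    have [measurable]: "\<phi> \<in> borel_measurable borel" "dir_deriv e \<phi> \<in> borel_measurable borel"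
      using \<phi> test_functions_dir_deriv[OF \<phi>] test_functions_measurable by auto
    define \<psi> where "\<psi> = (\<lambda>x. \<phi> ((- a) + 1 *\<^sub>R x))"
    have \<psi>: "\<psi> \<in> test_functions" unfolding \<psi>_def by (rule test_functions_affine[OF \<phi>]) simp
    have "dir_deriv e \<psi> x = dir_deriv e \<phi> (x - a)" for x
      unfolding \<psi>_def by (subst dir_deriv_affine[OF test_functions_Ck[OF \<phi>]]) simp
    then have "(LINT x|lborel. dir_deriv e \<phi> (x - a) * u x) = - (LINT x|lborel. \<phi> (x - a) * v x)"
      using d(3)[OF \<psi>] by (simp add: \<psi>_def)
    then show ?thesis
      using integral_lborel_translate(1)[of "\<lambda>x. dir_deriv e \<phi> (x - a) * u x" a]
        integral_lborel_translate(1)[of "\<lambda>x. \<phi> (x - a) * v x" a] by simp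
  qed
  then show ?thesis using d by (auto simp: wderiv_def intro: loc_int_translate)
qed

lemma test_functions_mult:
  fixes \<phi> \<psi> :: "'a::euclidean_space \<Rightarrow> real"
  shows "\<phi> \<in> test_functions \<Longrightarrow> \<psi> \<in> test_functions \<Longrightarrow> (\<lambda>x. \<phi> x * \<psi> x) \<in> test_functions"
  by (intro test_functions_bilinear[OF bounded_bilinear_mult]) (auto simp: test_functions_iff)

lemma loc_int_test_mult:
  assumes "loc_int u" "\<phi> \<in> test_functions"
  shows "loc_int (\<lambda>x. \<phi> x * u x)"
  by (intro integrable_imp_loc_int loc_int_test_integrable assms)

lemma wderiv_test_mult:
  assumes "wderiv e u v" and \<eta>: "\<eta> \<in> test_functions"
  shows "wderiv e (\<lambda>x. \<eta> x * u x) (\<lambda>x. \<eta> x * v x + dir_deriv e \<eta> x * u x)"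
proof -
  note d = wderivD[OF assms(1)]
  have "(LINT x|lborel. dir_deriv e \<phi> x * (\<eta> x * u x)) = - (LINT x|lborel. \<phi> x * (\<eta> x * v x + dir_deriv e \<eta> x * u x))"
    if \<phi>: "\<phi> \<in> test_functions" for \<phi>
  proof -
    note T = test_functions_mult test_functions_dir_deriv
    have D: "dir_deriv e (\<lambda>x. \<phi> x * \<eta> x) x = \<phi> x * dir_deriv e \<eta> x + dir_deriv e \<phi> x * \<eta> x" for x
      by (rule dir_deriv_bilinear[OF bounded_bilinear_mult test_functions_Ck[OF \<phi>] test_functions_Ck[OF \<eta>]])
    have i: "integrable lborel (\<lambda>x. (\<phi> x * dir_deriv e \<eta> x) * u x)" "integrable lborel (\<lambda>x. (dir_deriv e \<phi> x * \<eta> x) * u x)"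
        "integrable lborel (\<lambda>x. (\<phi> x * \<eta> x) * v x)"
      by (intro loc_int_test_integrable[OF d(1)] loc_int_test_integrable[OF d(2)] T \<phi> \<eta>)+
    have "(LINT x|lborel. (\<phi> x * dir_deriv e \<eta> x) * u x) + (LINT x|lborel. (dir_deriv e \<phi> x * \<eta> x) * u x) =
        - (LINT x|lborel. (\<phi> x * \<eta> x) * v x)"
      using d(3)[OF test_functions_mult[OF \<phi> \<eta>]] unfolding D distrib_right
      by (subst (asm) Bochner_Integration.integral_add[OF i(1,2)])
    moreover have "(LINT x|lborel. \<phi> x * (\<eta> x * v x + dir_deriv e \<eta> x * u x)) =
        (LINT x|lborel. (\<phi> x * \<eta> x) * v x) + (LINT x|lborel. (\<phi> x * dir_deriv e \<eta> x) * u x)"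
      unfolding distrib_left mult.assoc[symmetric] by (rule Bochner_Integration.integral_add[OF i(3,1)])
    ultimately show ?thesis by (simp add: mult.assoc)
  qed
  then show ?thesis
    using d \<eta> by (simp add: wderiv_def loc_int_add loc_int_test_mult test_functions_dir_deriv)
qed

text \<open>
  The difference of two derivatives pairs to zero with all test functions.
\<close>

lemma wderiv_unique:
  fixes u v v' :: "'a::euclidean_space \<Rightarrow> real"
  assumes "wderiv e u v" "wderiv e u v'"
  shows "AE x in lborel. v x = v' x"
proof -
  note d = wderivD[OF assms(1)] wderivD[OF assms(2)]
  have l: "loc_int (\<lambda>x. v x + (- 1) * v' x)" by (intro loc_int_add loc_int_cmult d)
  have "AE x in lborel. v x + (- 1) * v' x = 0"
  proof (rule fundamental_lemma[OF l])
    fix \<phi> :: "'a \<Rightarrow> real" assume \<phi>: "\<phi> \<in> test_functions"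
    have "(LINT x|lborel. \<phi> x * (v x + (- 1) * v' x)) = (LINT x|lborel. \<phi> x * v x - \<phi> x * v' x)"
      by (simp add: algebra_simps)
    also have "\<dots> = (LINT x|lborel. \<phi> x * v x) - (LINT x|lborel. \<phi> x * v' x)"
      by (intro Bochner_Integration.integral_diff loc_int_test_integrable d \<phi>)
    also have "\<dots> = 0" using d(3,6)[OF \<phi>] by simp
    finally show "(LINT x|lborel. \<phi> x * (v x + (- 1) * v' x)) = 0" .
  qed
  then show ?thesis by simp
qed

lemma loc_int_cong_AE:
  assumes u: "loc_int u" and [measurable]: "u' \<in> borel_measurable borel" and AE: "AE x in lborel. u x = u' x"
  shows "loc_int u'"
proof -
  have [measurable]: "u \<in> borel_measurable borel" using u by (rule loc_int_measurable)
  have "integrable lborel (\<lambda>x. indicator (cball 0 R) x * u' x)" for R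
  proof -
    have "integrable lborel (\<lambda>x. indicator (cball 0 R) x * u x)" using u by (simp add: loc_int_def)
    moreover have "AE x in lborel. indicator (cball 0 R) x * u x = indicator (cball 0 R) x * u' x"
      using AE by eventually_elim simp
    ultimately show ?thesis by (subst integrable_cong_AE[symmetric]) auto
  qed
  then show ?thesis by (simp add: loc_int_def)
qed

lemma wderiv_cong_AE:
  assumes d: "wderiv e u v" and [measurable]: "u' \<in> borel_measurable borel" "v' \<in> borel_measurable borel"
    and AE: "AE x in lborel. u x = u' x" "AE x in lborel. v x = v' x"
  shows "wderiv e u' v'"
proof -
  have [measurable]: "u \<in> borel_measurable borel" "v \<in> borel_measurable borel"
    using wderivD[OF d] loc_int_measurable by auto
  have "(LINT x|lborel. dir_deriv e \<phi> x * u' x) = - (LINT x|lborel. \<phi> x * v' x)" if \<phi>: "\<phi> \<in> test_functions" for \<phi>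
  proof -
    have [measurable]: "\<phi> \<in> borel_measurable borel" "dir_deriv e \<phi> \<in> borel_measurable borel"
      using \<phi> test_functions_dir_deriv[OF \<phi>] test_functions_measurable by auto
    have "(LINT x|lborel. dir_deriv e \<phi> x * u' x) = (LINT x|lborel. dir_deriv e \<phi> x * u x)"
    proof (rule integral_cong_AE)
      show "AE x in lborel. dir_deriv e \<phi> x * u' x = dir_deriv e \<phi> x * u x"
        using AE(1) by eventually_elim simp
    qed simp_all
    moreover have "(LINT x|lborel. \<phi> x * v' x) = (LINT x|lborel. \<phi> x * v x)"
    proof (rule integral_cong_AE)
      show "AE x in lborel. \<phi> x * v' x = \<phi> x * v x"
        using AE(2) by eventually_elim simp
    qed simp_all
    ultimately show ?thesis using wderivD(3)[OF d \<phi>] by simp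
  qed
  moreover have "loc_int u'" "loc_int v'"
    using loc_int_cong_AE[OF wderivD(1)[OF d] _ AE(1)] loc_int_cong_AE[OF wderivD(2)[OF d] _ AE(2)] by simp_all
  ultimately show ?thesis by (simp add: wderiv_def)
qed

lemma moll_dir_deriv_wderiv:
  assumes "wderiv e u v" and \<rho>: "\<rho> \<in> test_functions"
  shows "moll (dir_deriv e \<rho>) u x = moll \<rho> v x"
proof -
  define \<phi> where "\<phi> = (\<lambda>y. \<rho> (x + (- 1) *\<^sub>R y))"
  have \<phi>: "\<phi> \<in> test_functions" unfolding \<phi>_def by (rule test_functions_affine[OF \<rho>]) simp
  have "dir_deriv e \<phi> y = - dir_deriv e \<rho> (x - y)" for y
    unfolding \<phi>_def by (subst dir_deriv_affine[OF test_functions_Ck[OF \<rho>]]) simp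
  with wderivD(3)[OF assms(1) \<phi>] show ?thesis
    by (simp add: moll_def \<phi>_def)
qed

text \<open>
  Near \<open>x\<close> only the values of \<open>g\<close> on a fixed ball matter, so \<open>g\<close> may be cut off there.
\<close>

lemma moll_has_derivative_loc:
  fixes \<phi> g :: "'a::euclidean_space \<Rightarrow> real"
  assumes \<phi>: "Ck (Suc 0) \<phi>" "bounded_support \<phi>" and g: "loc_int g"
  shows "(moll \<phi> g has_derivative (\<lambda>v. moll (dir_deriv v \<phi>) g x)) (at x)"
proof -
  obtain R where R: "\<And>x. norm x > R \<Longrightarrow> \<phi> x = 0"
    using \<phi> by (auto simp: bounded_support_def)
  define g' where "g' y = indicator (cball 0 (R + norm x + 1)) y * g y" for y
  have g': "integrable lborel g'" using g by (simp add: g'_def[abs_def] loc_int_def)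
  have eq: "moll \<psi> g' z = moll \<psi> g z" if z: "norm (z - x) < 1" and \<psi>: "\<And>x. norm x > R \<Longrightarrow> \<psi> x = 0" for \<psi> z
    unfolding moll_def
  proof (intro Bochner_Integration.integral_cong refl)
    fix y
    show "\<psi> (z - y) * g' y = \<psi> (z - y) * g y"
    proof (cases "norm y \<le> R + norm x + 1")
      case False
      have "norm y \<le> norm (z - y) + norm (z - x) + norm x"
        using norm_triangle_ineq4[of z "z - y"] norm_triangle_ineq[of "z - x" x] by simp
      then have "\<psi> (z - y) = 0" using z False by (intro \<psi>) linarith
      then show ?thesis by simp
    qed (simp add: g'_def)
  qed
  have "(moll \<phi> g' has_derivative (\<lambda>v. moll (dir_deriv v \<phi>) g' x)) (at x)"
    by (rule moll_has_derivative[OF \<phi> g'])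
  then have "(moll \<phi> g has_derivative (\<lambda>v. moll (dir_deriv v \<phi>) g' x)) (at x)"
  proof (rule has_derivative_transform_within_open[of _ _ _ _ "ball x 1"])
    fix z assume "z \<in> ball x 1"
    then show "moll \<phi> g' z = moll \<phi> g z"
      by (intro eq R) (auto simp: dist_norm norm_minus_commute)
  qed auto
  moreover have "moll (dir_deriv v \<phi>) g' x = moll (dir_deriv v \<phi>) g x" for v
    by (intro eq dir_deriv_eq_0_outside[OF R]) auto
  ultimately show ?thesis by simp
qed

lemma (in random_shift) avg_pairing:
  fixes v \<eta> :: "'a \<Rightarrow> real"
  assumes v: "loc_int v" and d: "AE \<omega> in M. norm (Y \<omega>) \<le> d"
    and [measurable]: "\<eta> \<in> borel_measurable borel" and C: "\<And>x. \<bar>\<eta> x\<bar> \<le> C" and \<eta>: "bounded_support \<eta>"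
  shows "integrable lborel (\<lambda>x. \<eta> x * avg M Y v x)"
    and "(LINT x|lborel. \<eta> x * avg M Y v x) = (LINT \<omega>|M. LINT x|lborel. \<eta> x * v (x + Y \<omega>))"
proof -
  have [measurable]: "v \<in> borel_measurable borel" using v by (rule loc_int_measurable)
  have "C \<ge> 0" using C[of 0] by linarith
  obtain R where R: "\<And>x. norm x > R \<Longrightarrow> \<eta> x = 0"
    using \<eta> by (auto simp: bounded_support_def)
  define v' where "v' x = indicator (cball 0 (R + d)) x * v x" for x
  have v': "integrable lborel v'" using v by (simp add: v'_def[abs_def] loc_int_def)
  have [measurable]: "v' \<in> borel_measurable borel" using v' by auto
  interpret P: pair_sigma_finite M "lborel :: 'a measure" ..
  have "(\<integral>\<^sup>+z. ennreal (norm ((\<lambda>(\<omega>, x). \<eta> x * v (x + Y \<omega>)) z)) \<partial>(M \<Otimes>\<^sub>M lborel)) =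
      (\<integral>\<^sup>+\<omega>. \<integral>\<^sup>+x. ennreal (norm (\<eta> x * v (x + Y \<omega>))) \<partial>lborel \<partial>M)"
    by (subst lborel.nn_integral_fst[symmetric]) (auto simp: split_beta')
  also have "\<dots> \<le> (\<integral>\<^sup>+\<omega>. \<integral>\<^sup>+x. ennreal (C * \<bar>v' (x + Y \<omega>)\<bar>) \<partial>lborel \<partial>M)"
  proof (rule nn_integral_mono_AE, use d in eventually_elim)
    fix \<omega> assume \<omega>: "norm (Y \<omega>) \<le> d"
    show "(\<integral>\<^sup>+x. ennreal (norm (\<eta> x * v (x + Y \<omega>))) \<partial>lborel) \<le> (\<integral>\<^sup>+x. ennreal (C * \<bar>v' (x + Y \<omega>)\<bar>) \<partial>lborel)"
    proof (intro nn_integral_mono ennreal_leI)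
      fix x
      show "norm (\<eta> x * v (x + Y \<omega>)) \<le> C * \<bar>v' (x + Y \<omega>)\<bar>"
      proof (cases "norm x > R")
        case False
        then have "norm (x + Y \<omega>) \<le> R + d" using \<omega> norm_triangle_ineq[of x "Y \<omega>"] by linarith
        then show ?thesis using C[of x] by (simp add: v'_def abs_mult mult_right_mono)
      qed (use R \<open>C \<ge> 0\<close> in simp)
    qed
  qed
  also have "\<dots> = (\<integral>\<^sup>+\<omega>. \<integral>\<^sup>+x. ennreal (C * \<bar>v' x\<bar>) \<partial>lborel \<partial>M)"
    by (subst nn_integral_lborel_translate[of "\<lambda>x. ennreal (C * \<bar>v' x\<bar>)"]) auto
  also have "\<dots> = (\<integral>\<^sup>+x. ennreal (C * \<bar>v' x\<bar>) \<partial>lborel)"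
    by (simp add: emeasure_space_1)
  also have "\<dots> = ennreal (LINT x|lborel. C * \<bar>v' x\<bar>)"
    using v' \<open>C \<ge> 0\<close> by (intro nn_integral_eq_integral) auto
  also have "\<dots> < \<infinity>" by simp
  finally have int: "integrable (M \<Otimes>\<^sub>M lborel) (\<lambda>(\<omega>, x). \<eta> x * v (x + Y \<omega>))"
    by (intro integrableI_bounded) auto
  have avg: "(LINT \<omega>|M. \<eta> x * v (x + Y \<omega>)) = \<eta> x * avg M Y v x" for x
    by (simp add: avg_def)
  show "integrable lborel (\<lambda>x. \<eta> x * avg M Y v x)"
    using P.integrable_snd[OF int] unfolding avg .
  show "(LINT x|lborel. \<eta> x * avg M Y v x) = (LINT \<omega>|M. LINT x|lborel. \<eta> x * v (x + Y \<omega>))"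
    using P.Fubini_integral[OF int] unfolding avg .
qed

lemma (in random_shift) loc_int_avg:
  assumes "loc_int v" "AE \<omega> in M. norm (Y \<omega>) \<le> d"
  shows "loc_int (avg M Y v)"
proof -
  have "bounded_support (indicator (cball 0 R) :: 'a \<Rightarrow> real)" for R
    unfolding bounded_support_def by (intro exI[of _ R]) auto
  then have "integrable lborel (\<lambda>x. indicator (cball 0 R) x * avg M Y v x)" for R
    by (intro avg_pairing(1)[OF assms, where C = 1]) (simp_all add: indicator_le_1)
  moreover have "avg M Y v \<in> borel_measurable borel"
    using loc_int_measurable[OF assms(1)] by measurable
  ultimately show ?thesis by (simp add: loc_int_def)
qed

section \<open>Difference quotients\<close>

text \<open>
  The uniform distribution, which turns the average along a segment into an average over random translates.
\<close>

definition unit_interval_measure :: "real measure" where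
  "unit_interval_measure = restrict_space lborel {0..1}"

lemma line_random_shift:
  "random_shift unit_interval_measure (\<lambda>s. (s * t) *\<^sub>R (e::'a::euclidean_space))"
proof (intro random_shift.intro prob_spaceI random_shift_axioms.intro)
  show "emeasure unit_interval_measure (space unit_interval_measure) = 1"
    by (simp add: unit_interval_measure_def emeasure_restrict_space space_restrict_space)
  show "(\<lambda>s. (s * t) *\<^sub>R e) \<in> borel_measurable unit_interval_measure"
    unfolding unit_interval_measure_def by (intro measurable_restrict_space1) measurable
qed

lemma AE_line_shift:
  "AE s in unit_interval_measure. norm ((s * t) *\<^sub>R e) \<le> \<bar>t\<bar> * norm e"
proof -
  have "norm ((s * t) *\<^sub>R e) \<le> \<bar>t\<bar> * norm e" if "s \<in> {0..1}" for s :: real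
    using that by (simp add: abs_mult mult_right_mono mult_left_le_one_le)
  then show ?thesis
    unfolding unit_interval_measure_def by (subst AE_restrict_space_iff) auto
qed

lemma integral_unit_interval_measure:
  fixes f :: "real \<Rightarrow> real"
  shows "(LINT s|unit_interval_measure. f s) = (LINT s|lborel. indicator {0..1} s *\<^sub>R f s)"
  unfolding unit_interval_measure_def by (subst integral_restrict_space) auto

definition line_avg :: "real \<Rightarrow> 'a::euclidean_space \<Rightarrow> ('a \<Rightarrow> real) \<Rightarrow> 'a \<Rightarrow> real" where
  "line_avg t e = avg unit_interval_measure (\<lambda>s. (s * t) *\<^sub>R e)"

text \<open>
  The fundamental theorem of calculus for weak derivatives. Paired with a test function, the function
  \<open>s \<mapsto> u(\<cdot> + s t e)\<close> is a mollification of \<open>u\<close> evaluated along a line. It is continuously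
  differentiable in \<open>s\<close> with derivative given by \<open>v\<close>, so that the classical theorem applies; the fundamental
  lemma removes the test function.
\<close>

lemma wderiv_difference:
  assumes uv: "wderiv e u v"
  shows "AE x in lborel. u (x + t *\<^sub>R e) - u x = t * line_avg t e v x"
proof -
  note d = wderivD[OF uv]
  interpret random_shift unit_interval_measure "\<lambda>s. (s * t) *\<^sub>R e" by (rule line_random_shift)
  have [measurable]: "u \<in> borel_measurable borel" "v \<in> borel_measurable borel"
    using d(1,2) loc_int_measurable by auto
  have la: "loc_int (line_avg t e v)"
    unfolding line_avg_def by (rule loc_int_avg[OF d(2) AE_line_shift])
  have l: "loc_int (\<lambda>x. (u (x + t *\<^sub>R e) + (- 1) * u x) + (- t) * line_avg t e v x)"
    by (rule loc_int_add[OF loc_int_add[OF loc_int_translate[OF d(1)] loc_int_cmult[OF d(1)]] loc_int_cmult[OF la]])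
  have "AE x in lborel. (u (x + t *\<^sub>R e) + (- 1) * u x) + (- t) * line_avg t e v x = 0"
  proof (rule fundamental_lemma[OF l])
    fix \<phi> :: "'a \<Rightarrow> real" assume \<phi>: "\<phi> \<in> test_functions"
    have [measurable]: "\<phi> \<in> borel_measurable borel" using \<phi> by (rule test_functions_measurable)
    define \<psi> where "\<psi> = (\<lambda>z. \<phi> (0 + (- 1) *\<^sub>R z))"
    have \<psi>: "\<psi> \<in> test_functions" unfolding \<psi>_def by (rule test_functions_affine[OF \<phi>]) simp
    have \<psi>': "Ck (Suc 0) \<psi>" "bounded_support \<psi>" using \<psi> by (auto simp: test_functions_iff simp del: Ck.simps)
    have pair: "(LINT x|lborel. \<phi> x * g (x + a)) = moll \<psi> g a" if [measurable]: "g \<in> borel_measurable borel" for g a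
      using integral_lborel_translate(1)[of "\<lambda>x. \<phi> (x - a) * g x" a] by (simp add: moll_def \<psi>_def)
    define F where "F s = moll \<psi> u ((s * t) *\<^sub>R e)" for s
    have F: "(F has_vector_derivative t * moll \<psi> v ((s * t) *\<^sub>R e)) (at s within {0..1})" for s
    proof -
      have "((\<lambda>s. (s * t) *\<^sub>R e) has_derivative (\<lambda>h. (h * t) *\<^sub>R e)) (at s)"
        using bounded_linear_imp_has_derivative[OF bounded_linear_scaleR_left[of "t *\<^sub>R e"]] unfolding scaleR_scaleR .
      from diff_chain_at[OF this moll_has_derivative_loc[OF \<psi>' d(1)]]
      have "(F has_derivative (\<lambda>h. moll (dir_deriv ((h * t) *\<^sub>R e) \<psi>) u ((s * t) *\<^sub>R e))) (at s)"
        unfolding o_def F_def[abs_def] .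
      moreover have "moll (dir_deriv ((h * t) *\<^sub>R e) \<psi>) u z = h *\<^sub>R (t * moll \<psi> v z)" for h z
      proof -
        have "dir_deriv ((h * t) *\<^sub>R e) \<psi> x = (h * t) * dir_deriv e \<psi> x" for x
          unfolding real_scaleR_def[symmetric] by (rule linear_scale[OF linear_dir_deriv[OF Ck_differentiable[OF \<psi>'(1)]]])
        then have "moll (dir_deriv ((h * t) *\<^sub>R e) \<psi>) u z = (h * t) * moll (dir_deriv e \<psi>) u z"
          unfolding moll_def by (simp only: mult.assoc[of "h * t" "dir_deriv e \<psi> _"] Bochner_Integration.integral_mult_right_zero)
        then show ?thesis unfolding moll_dir_deriv_wderiv[OF uv \<psi>] by simp
      qed
      ultimately have "(F has_derivative (\<lambda>h. h *\<^sub>R (t * moll \<psi> v ((s * t) *\<^sub>R e)))) (at s)"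
        by (simp only:)
      then show ?thesis
        unfolding has_vector_derivative_def by (rule has_derivative_at_withinI)
    qed
    have "isCont (moll \<psi> v) x" for x
      by (rule has_derivative_continuous[OF moll_has_derivative_loc[OF \<psi>' d(2)]])
    then have "continuous_on UNIV (moll \<psi> v)"
      by (simp add: continuous_at_imp_continuous_on)
    then have "continuous_on {0..1} (\<lambda>s. moll \<psi> v ((s * t) *\<^sub>R e))"
      by (rule continuous_on_compose2) (auto intro!: continuous_intros)
    then have cont: "continuous_on {0..1} (\<lambda>s. t * moll \<psi> v ((s * t) *\<^sub>R e))"
      by (rule continuous_on_mult_left)
    have "(LINT s|lborel. indicator {0..1} s *\<^sub>R (t * moll \<psi> v ((s * t) *\<^sub>R e))) = F 1 - F 0"
      by (rule integral_FTC_Icc[OF _ F cont]) auto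
    then have FTC: "t * (LINT s|unit_interval_measure. moll \<psi> v ((s * t) *\<^sub>R e)) = F 1 - F 0"
      unfolding integral_unit_interval_measure[symmetric] by simp
    obtain C where C: "\<And>x. \<bar>\<phi> x\<bar> \<le> C" using test_functions_bounded[OF \<phi>] by auto
    have "bounded_support \<phi>" using \<phi> by (simp add: test_functions_iff)
    from avg_pairing(2)[OF d(2) AE_line_shift _ C this]
    have "(LINT x|lborel. \<phi> x * line_avg t e v x) = (LINT s|unit_interval_measure. moll \<psi> v ((s * t) *\<^sub>R e))"
      unfolding line_avg_def by (simp only: pair[of v] \<open>v \<in> borel_measurable borel\<close> \<open>\<phi> \<in> borel_measurable borel\<close>)
    moreover have "(LINT x|lborel. \<phi> x * u (x + t *\<^sub>R e)) = F 1" "(LINT x|lborel. \<phi> x * u x) = F 0"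
      using pair[of u "t *\<^sub>R e"] pair[of u 0] by (simp_all add: F_def)
    moreover have "(LINT x|lborel. \<phi> x * ((u (x + t *\<^sub>R e) + (- 1) * u x) + (- t) * line_avg t e v x)) =
      (LINT x|lborel. \<phi> x * u (x + t *\<^sub>R e)) - (LINT x|lborel. \<phi> x * u x) - t * (LINT x|lborel. \<phi> x * line_avg t e v x)"
    proof -
      have i: "integrable lborel (\<lambda>x. \<phi> x * u (x + t *\<^sub>R e))" "integrable lborel (\<lambda>x. \<phi> x * u x)"
        "integrable lborel (\<lambda>x. t * (\<phi> x * line_avg t e v x))"
        by (rule loc_int_test_integrable[OF loc_int_translate[OF d(1)] \<phi>] loc_int_test_integrable[OF d(1) \<phi>]
            integrable_mult_right[OF loc_int_test_integrable[OF la \<phi>]])+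
      have "(LINT x|lborel. \<phi> x * ((u (x + t *\<^sub>R e) + (- 1) * u x) + (- t) * line_avg t e v x)) =
        (LINT x|lborel. \<phi> x * u (x + t *\<^sub>R e) - \<phi> x * u x - t * (\<phi> x * line_avg t e v x))"
        by (intro Bochner_Integration.integral_cong refl) (simp add: algebra_simps)
      then show ?thesis
        by (simp only: Bochner_Integration.integral_diff[OF Bochner_Integration.integrable_diff[OF i(1,2)] i(3)]
            Bochner_Integration.integral_diff[OF i(1,2)] Bochner_Integration.integral_mult_right_zero)
    qed
    ultimately show "(LINT x|lborel. \<phi> x * ((u (x + t *\<^sub>R e) + (- 1) * u x) + (- t) * line_avg t e v x)) = 0"
      using FTC by simp
  qed
  then show ?thesis by eventually_elim linarith
qed

lemma line_avg_measurable [measurable]: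
  "g \<in> borel_measurable borel \<Longrightarrow> line_avg t e g \<in> borel_measurable borel"
  unfolding line_avg_def by (rule random_shift.avg_measurable[OF line_random_shift])

text \<open>
  Hence difference quotients of \<open>u\<close> are bounded in \<open>L\<^sup>r\<close> by the weak derivative.
\<close>

lemma nn_integral_line_avg_powr:
  fixes v :: "'a::euclidean_space \<Rightarrow> real"
  assumes [measurable]: "v \<in> borel_measurable borel" and r: "r > 1"
  shows "(\<integral>\<^sup>+x. ennreal (\<bar>line_avg t e v x\<bar> powr r) \<partial>lborel) \<le> (\<integral>\<^sup>+x. ennreal (\<bar>v x\<bar> powr r) \<partial>lborel)"
proof -
  interpret random_shift unit_interval_measure "\<lambda>s. (s * t) *\<^sub>R e" by (rule line_random_shift)
  have "(\<integral>\<^sup>+x. ennreal (\<bar>line_avg t e v x\<bar> powr r) \<partial>lborel) \<le>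
      (\<integral>\<^sup>+x. (\<integral>\<^sup>+s. ennreal (\<bar>v (x + (s * t) *\<^sub>R e)\<bar> powr r) \<partial>unit_interval_measure) \<partial>lborel)"
    unfolding line_avg_def by (intro nn_integral_mono jensen_avg r) measurable
  also have "\<dots> = (\<integral>\<^sup>+x. ennreal (\<bar>v x\<bar> powr r) \<partial>lborel)"
    by (rule nn_integral_avg[of "\<lambda>x. ennreal (\<bar>v x\<bar> powr r)"]) measurable
  finally show ?thesis .
qed

lemma line_avg_AE_subseq:
  assumes g: "integrable lborel g"
  shows "\<exists>s::nat \<Rightarrow> nat. strict_mono s \<and>
    (AE x in lborel. (\<lambda>n. line_avg (inverse (real (Suc (s n)))) e g x) \<longlonglongrightarrow> g x)"
proof -
  have [measurable]: "g \<in> borel_measurable borel" using g by auto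
  have d: "(\<lambda>n. \<bar>inverse (real (Suc n))\<bar> * norm e) \<longlonglongrightarrow> 0"
    using tendsto_mult_left_zero[OF LIMSEQ_inverse_real_of_nat, of "norm e"] by simp
  have "(\<lambda>n. \<integral>\<^sup>+x. ennreal \<bar>line_avg (inverse (real (Suc n))) e g x - g x\<bar> \<partial>lborel) \<longlonglongrightarrow> 0"
    unfolding line_avg_def by (rule avg_tendsto_L1[OF line_random_shift AE_line_shift d g])
  from L1_imp_AE_subseq[OF _ this] obtain s where "strict_mono s"
    "AE x in lborel. (\<lambda>n. line_avg (inverse (real (Suc (s n)))) e g x - g x) \<longlonglongrightarrow> 0"
    by auto
  from this(2) have "AE x in lborel. (\<lambda>n. line_avg (inverse (real (Suc (s n)))) e g x) \<longlonglongrightarrow> g x"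
    by eventually_elim (rule LIM_zero_cancel)
  with \<open>strict_mono s\<close> show ?thesis by blast
qed

section \<open>The chain rule for powers\<close>

text \<open>
  One half of the chain rule for \<open>|u|\<^sup>r\<close>, for nonnegative weights. Convexity gives
  \<open>r |u|\<^sup>r\<^sup>-\<^sup>2 u (u(x + t e) - u(x)) \<le> |u(x + t e)|\<^sup>r - |u(x)|\<^sup>r\<close>. After division by \<open>t\<close>, the left-hand
  side contains an average of \<open>v\<close> along a segment, which is bounded in \<open>L\<^sup>r\<close> locally and converges along a
  subsequence, and the difference quotient on the right-hand side is moved to the weight.
\<close>

lemma weak_chain_rule_le:
  fixes u v \<eta> :: "'a::euclidean_space \<Rightarrow> real"
  assumes r: "r > 1" and uv: "wderiv e u v"
    and u: "loc_int (\<lambda>x. \<bar>u x\<bar> powr r)" and v: "loc_int (\<lambda>x. \<bar>v x\<bar> powr r)"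
    and \<eta>: "Ck (Suc 0) \<eta>" "bounded_support \<eta>" "\<And>x. \<eta> x \<ge> 0"
  shows "integrable lborel (\<lambda>x. \<eta> x * sgn_powr r (u x) * v x)"
    and "r * (LINT x|lborel. \<eta> x * sgn_powr r (u x) * v x) \<le> - (LINT x|lborel. dir_deriv e \<eta> x * \<bar>u x\<bar> powr r)"
proof -
  note d = wderivD[OF uv]
  have [measurable]: "u \<in> borel_measurable borel" "v \<in> borel_measurable borel" "\<eta> \<in> borel_measurable borel"
    using d(1,2) loc_int_measurable Ck_measurable[OF \<eta>(1)] by auto
  obtain R where R: "\<And>x. norm x > R \<Longrightarrow> \<eta> x = 0"
    using \<eta> by (auto simp: bounded_support_def)
  obtain C where C: "C \<ge> 0" "\<And>x. \<bar>\<eta> x\<bar> \<le> C"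
    using continuous_bounded_support_bounded[OF Ck_imp_continuous[OF \<eta>(1)] \<eta>(2)] by auto
  obtain K where K: "K \<ge> 0" "\<And>x h. \<bar>\<eta> (x + h) - \<eta> x\<bar> \<le> K * norm h"
    using Ck1_bounded_derivative[OF \<eta>(1,2)] by blast
  define t where "t n = inverse (real (Suc n))" for n
  have t: "0 < t n" "t n \<le> 1" for n
    by (auto simp: t_def inverse_le_1_iff)
  have t0: "t \<longlonglongrightarrow> 0" unfolding t_def by (rule LIMSEQ_inverse_real_of_nat)
  \<comment> \<open>The weight sees \<open>v\<close> only on segments of length at most \<open>norm e\<close> that start in its support.\<close>
  define v' where "v' x = indicator (cball 0 (R + norm e)) x * v x" for x
  have v': "integrable lborel v'" using d(2) by (simp add: v'_def[abs_def] loc_int_def)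
  have [measurable]: "v' \<in> borel_measurable borel" using v' by auto
  have line: "\<eta> x * line_avg (t n) e v x = \<eta> x * line_avg (t n) e v' x" for x n
  proof (cases "norm x > R")
    case False
    have "v (x + (s * t n) *\<^sub>R e) = v' (x + (s * t n) *\<^sub>R e)" if s: "s \<in> {0..1}" for s
    proof -
      have "norm ((s * t n) *\<^sub>R e) \<le> norm e"
        using s t[of n] by (simp add: abs_mult mult_le_one mult_left_le_one_le)
      then have "norm (x + (s * t n) *\<^sub>R e) \<le> R + norm e"
        using False norm_triangle_ineq[of x "(s * t n) *\<^sub>R e"] by linarith
      then show ?thesis by (simp add: v'_def)
    qed
    then have "line_avg (t n) e v x = line_avg (t n) e v' x"
      unfolding line_avg_def avg_def integral_unit_interval_measure
      by (intro Bochner_Integration.integral_cong refl) (auto simp: indicator_def)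
    then show ?thesis by simp
  qed (use R in simp)
  have bound: "(\<integral>\<^sup>+x. ennreal (\<eta> x * \<bar>line_avg (t n) e v' x\<bar> powr r) \<partial>lborel) \<le>
      ennreal C * (\<integral>\<^sup>+x. ennreal (\<bar>v' x\<bar> powr r) \<partial>lborel)" for n
  proof -
    have "(\<integral>\<^sup>+x. ennreal (\<eta> x * \<bar>line_avg (t n) e v' x\<bar> powr r) \<partial>lborel) \<le>
      (\<integral>\<^sup>+x. ennreal C * ennreal (\<bar>line_avg (t n) e v' x\<bar> powr r) \<partial>lborel)"
    proof (rule nn_integral_mono)
      fix x
      have "\<eta> x \<le> C" using C(2)[of x] by linarith
      then show "ennreal (\<eta> x * \<bar>line_avg (t n) e v' x\<bar> powr r) \<le> ennreal C * ennreal (\<bar>line_avg (t n) e v' x\<bar> powr r)"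
        unfolding ennreal_mult[OF C(1) powr_ge_zero, symmetric] by (intro ennreal_leI mult_right_mono) auto
    qed
    also have "\<dots> = ennreal C * (\<integral>\<^sup>+x. ennreal (\<bar>line_avg (t n) e v' x\<bar> powr r) \<partial>lborel)"
      by (rule nn_integral_cmult) measurable
    also have "\<dots> \<le> ennreal C * (\<integral>\<^sup>+x. ennreal (\<bar>v' x\<bar> powr r) \<partial>lborel)"
      by (intro mult_left_mono nn_integral_line_avg_powr r) auto
    finally show ?thesis .
  qed
  have fin: "ennreal C * (\<integral>\<^sup>+x. ennreal (\<bar>v' x\<bar> powr r) \<partial>lborel) < \<infinity>"
  proof -
    have "\<bar>v' x\<bar> powr r = indicator (cball 0 (R + norm e)) x * \<bar>v x\<bar> powr r" for x
      using r by (simp add: v'_def indicator_def)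
    then have "integrable lborel (\<lambda>x. \<bar>v' x\<bar> powr r)"
      using v by (simp add: loc_int_def)
    then show ?thesis by (simp add: nn_integral_eq_integral ennreal_mult_less_top)
  qed
  have u\<eta>: "integrable lborel (\<lambda>x. \<eta> x * \<bar>u x\<bar> powr r)"
    using loc_int_mult_integrable[OF u _ C(2) \<eta>(2)] by simp
  obtain s where s: "strict_mono s" "AE x in lborel. (\<lambda>n. line_avg (t (s n)) e v' x) \<longlonglongrightarrow> v' x"
    using line_avg_AE_subseq[OF v', of e] by (auto simp: t_def)
  have \<eta>v': "\<eta> x * sgn_powr r (u x) * v' x = \<eta> x * sgn_powr r (u x) * v x" for x
  proof (cases "norm x > R")
    case False
    then have "norm x \<le> R + norm e" using norm_ge_zero[of e] by linarith
    then show ?thesis by (simp add: v'_def)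
  qed (simp add: R)
  have AE: "AE x in lborel. \<eta> x \<noteq> 0 \<longrightarrow> (\<lambda>n. line_avg (t (s n)) e v' x) \<longlonglongrightarrow> v' x"
    using s(2) by eventually_elim simp
  have m: "line_avg (t (s n)) e v' \<in> borel_measurable lborel" "\<eta> \<in> borel_measurable lborel"
    "u \<in> borel_measurable lborel" "v' \<in> borel_measurable lborel" for n
    by measurable
  note lim1 = sgn_powr_weak_limit[OF r m(2,3,1,4) \<eta>(3) u\<eta> bound fin AE]
  from lim1(1) show "integrable lborel (\<lambda>x. \<eta> x * sgn_powr r (u x) * v x)" unfolding \<eta>v' .
  define q where "q n x = (\<eta> (x - t n *\<^sub>R e) - \<eta> x) / t n * \<bar>u x\<bar> powr r" for n x
  \<comment> \<open>Convexity of \<open>|\<cdot>|\<^sup>r\<close> bounds the difference quotient of \<open>u\<close> by that of \<open>|u|\<^sup>r\<close>, and the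
    latter can be moved to \<open>\<eta>\<close> by a translation.\<close>
  have le: "r * (LINT x|lborel. \<eta> x * sgn_powr r (u x) * line_avg (t n) e v' x) \<le> (LINT x|lborel. q n x)" for n
  proof -
    have ut: "integrable lborel (\<lambda>x. \<eta> x * \<bar>u (x + t n *\<^sub>R e)\<bar> powr r)"
      using loc_int_mult_integrable[OF loc_int_translate[OF u] _ C(2) \<eta>(2)] by simp
    have i: "integrable lborel (\<lambda>x. \<eta> x * sgn_powr r (u x) * line_avg (t n) e v' x)"
      by (intro weighted_sgn_powr_integrable[OF r _ _ _ \<eta>(3) u\<eta>] le_less_trans[OF bound fin]) auto
    have "r * (LINT x|lborel. \<eta> x * sgn_powr r (u x) * line_avg (t n) e v' x) =
        (LINT x|lborel. r * (\<eta> x * sgn_powr r (u x) * line_avg (t n) e v' x))" by simp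
    also have "\<dots> \<le> (LINT x|lborel. (\<eta> x * \<bar>u (x + t n *\<^sub>R e)\<bar> powr r - \<eta> x * \<bar>u x\<bar> powr r) / t n)"
    proof (rule integral_mono_AE)
      show "AE x in lborel. r * (\<eta> x * sgn_powr r (u x) * line_avg (t n) e v' x) \<le>
          (\<eta> x * \<bar>u (x + t n *\<^sub>R e)\<bar> powr r - \<eta> x * \<bar>u x\<bar> powr r) / t n"
        using wderiv_difference[OF uv, of "t n"]
      proof eventually_elim
        case (elim x)
        have "r * sgn_powr r (u x) * (t n * line_avg (t n) e v x) \<le> \<bar>u (x + t n *\<^sub>R e)\<bar> powr r - \<bar>u x\<bar> powr r"
          using abs_powr_convex[OF r, of "u x" "u (x + t n *\<^sub>R e)"] elim by simp
        then have "\<eta> x * (r * sgn_powr r (u x) * (t n * line_avg (t n) e v x)) \<le>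
            \<eta> x * (\<bar>u (x + t n *\<^sub>R e)\<bar> powr r - \<bar>u x\<bar> powr r)"
          by (rule mult_left_mono) (rule \<eta>(3))
        moreover have "\<eta> x * (r * sgn_powr r (u x) * (t n * line_avg (t n) e v x)) =
            (r * (\<eta> x * sgn_powr r (u x) * line_avg (t n) e v' x)) * t n"
        proof -
          have "\<eta> x * (r * sgn_powr r (u x) * (t n * line_avg (t n) e v x)) =
              r * sgn_powr r (u x) * t n * (\<eta> x * line_avg (t n) e v x)" by (simp only: mult_ac)
          then show ?thesis unfolding line by (simp only: mult_ac)
        qed
        ultimately show ?case using t(1)[of n] by (simp only: pos_le_divide_eq right_diff_distrib)
      qed
    qed (rule integrable_mult_right[OF i] Bochner_Integration.integrable_divide[OF Bochner_Integration.integrable_diff[OF ut u\<eta>]])+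
    also have "\<dots> = ((LINT x|lborel. \<eta> x * \<bar>u (x + t n *\<^sub>R e)\<bar> powr r) - (LINT x|lborel. \<eta> x * \<bar>u x\<bar> powr r)) / t n"
      unfolding Bochner_Integration.integral_divide_zero Bochner_Integration.integral_diff[OF ut u\<eta>] ..
    also have "(LINT x|lborel. \<eta> x * \<bar>u (x + t n *\<^sub>R e)\<bar> powr r) = (LINT x|lborel. \<eta> (x - t n *\<^sub>R e) * \<bar>u x\<bar> powr r)"
      using integral_lborel_translate(1)[of "\<lambda>x. \<eta> (x - t n *\<^sub>R e) * \<bar>u x\<bar> powr r" "t n *\<^sub>R e"] by simp
    also have "((LINT x|lborel. \<eta> (x - t n *\<^sub>R e) * \<bar>u x\<bar> powr r) - (LINT x|lborel. \<eta> x * \<bar>u x\<bar> powr r)) / t n = (LINT x|lborel. q n x)"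
    proof -
      have "integrable lborel (\<lambda>x. \<eta> (x - t n *\<^sub>R e) * \<bar>u x\<bar> powr r)"
        using ut integral_lborel_translate(2)[of "\<lambda>x. \<eta> (x - t n *\<^sub>R e) * \<bar>u x\<bar> powr r" "t n *\<^sub>R e"] by simp
      from Bochner_Integration.integral_diff[OF this u\<eta>] show ?thesis
        unfolding q_def by (simp only: left_diff_distrib[symmetric] times_divide_eq_left Bochner_Integration.integral_divide_zero)
    qed
    finally show ?thesis .
  qed
  have lim2: "(\<lambda>n. LINT x|lborel. q n x) \<longlonglongrightarrow> (LINT x|lborel. - dir_deriv e \<eta> x * \<bar>u x\<bar> powr r)"
  proof (rule integral_dominated_convergence[where w = "\<lambda>x. K * norm e * (indicator (cball 0 (R + norm e)) x * \<bar>u x\<bar> powr r)"])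
    show "integrable lborel (\<lambda>x. K * norm e * (indicator (cball 0 (R + norm e)) x * \<bar>u x\<bar> powr r))"
      using u by (intro integrable_mult_right) (simp add: loc_int_def)
    have [measurable]: "dir_deriv e \<eta> \<in> borel_measurable borel"
      by (rule Ck_measurable[OF Ck_dir_deriv[OF \<eta>(1)]])
    show "(\<lambda>x. - dir_deriv e \<eta> x * \<bar>u x\<bar> powr r) \<in> borel_measurable lborel" by measurable
    show "q n \<in> borel_measurable lborel" for n unfolding q_def by measurable
    show "AE x in lborel. (\<lambda>n. q n x) \<longlonglongrightarrow> - dir_deriv e \<eta> x * \<bar>u x\<bar> powr r"
    proof (rule AE_I2)
      fix x
      have "((\<lambda>h. x - h *\<^sub>R e) has_derivative (\<lambda>h. - (h *\<^sub>R e))) (at 0)"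
        using has_derivative_diff[OF has_derivative_const[of x] bounded_linear_imp_has_derivative[OF bounded_linear_scaleR_left[of e]]]
        by simp
      from diff_chain_at[OF this Ck_Suc_has_derivative[OF \<eta>(1)]]
      have "((\<lambda>h. \<eta> (x - h *\<^sub>R e)) has_derivative (\<lambda>h. dir_deriv (- (h *\<^sub>R e)) \<eta> x)) (at 0)"
        by (simp add: o_def)
      moreover have "(\<lambda>h. dir_deriv (- (h *\<^sub>R e)) \<eta> x) = (*) (- dir_deriv e \<eta> x)"
      proof
        fix h
        have lin: "linear (\<lambda>v. dir_deriv v \<eta> x)" by (rule linear_dir_deriv[OF Ck_differentiable[OF \<eta>(1)]])
        show "dir_deriv (- (h *\<^sub>R e)) \<eta> x = - dir_deriv e \<eta> x * h"
          unfolding linear_neg[OF lin] linear_scale[OF lin] by simp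
      qed
      ultimately have "((\<lambda>h. \<eta> (x - h *\<^sub>R e)) has_real_derivative - dir_deriv e \<eta> x) (at 0)"
        unfolding has_field_derivative_def by (simp only:)
      then have "((\<lambda>h. (\<eta> (x - h *\<^sub>R e) - \<eta> x) / h) \<longlongrightarrow> - dir_deriv e \<eta> x) (at 0)"
        unfolding DERIV_def by simp
      then have "(\<lambda>n. (\<eta> (x - t n *\<^sub>R e) - \<eta> x) / t n) \<longlonglongrightarrow> - dir_deriv e \<eta> x"
      proof (rule tendsto_at_iff_sequentially[THEN iffD1, rule_format, unfolded o_def, OF _ _ t0])
        show "t n \<in> UNIV - {0}" for n using t(1)[of n] by simp
      qed
      then show "(\<lambda>n. q n x) \<longlonglongrightarrow> - dir_deriv e \<eta> x * \<bar>u x\<bar> powr r"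
        unfolding q_def by (rule tendsto_mult_right)
    qed
    show "AE x in lborel. norm (q n x) \<le> K * norm e * (indicator (cball 0 (R + norm e)) x * \<bar>u x\<bar> powr r)" for n
    proof (rule AE_I2)
      fix x
      have "norm (t n *\<^sub>R e) \<le> norm e" using t[of n] by (simp add: mult_left_le_one_le)
      show "norm (q n x) \<le> K * norm e * (indicator (cball 0 (R + norm e)) x * \<bar>u x\<bar> powr r)"
      proof (cases "norm x \<le> R + norm e")
        case True
        have "\<bar>\<eta> (x - t n *\<^sub>R e) - \<eta> x\<bar> \<le> K * (t n * norm e)"
          using K(2)[of x "- (t n *\<^sub>R e)"] t(1)[of n] by simp
        then have "\<bar>\<eta> (x - t n *\<^sub>R e) - \<eta> x\<bar> / t n \<le> K * norm e"
          using t(1)[of n] by (simp add: pos_divide_le_eq mult_ac)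
        from mult_right_mono[OF this, of "\<bar>u x\<bar> powr r"] show ?thesis
          using True t(1)[of n] by (simp add: q_def abs_mult)
      next
        case False
        have "norm x \<le> norm (x - t n *\<^sub>R e) + norm (t n *\<^sub>R e)"
          using norm_triangle_ineq[of "x - t n *\<^sub>R e" "t n *\<^sub>R e"] by simp
        then have "norm (x - t n *\<^sub>R e) > R" using False \<open>norm (t n *\<^sub>R e) \<le> norm e\<close> by linarith
        moreover have "norm x > R" using False norm_ge_zero[of e] by linarith
        ultimately show ?thesis using R by (simp add: q_def K(1))
      qed
    qed
  qed
  have "r * (LINT x|lborel. \<eta> x * sgn_powr r (u x) * v' x) \<le> (LINT x|lborel. - dir_deriv e \<eta> x * \<bar>u x\<bar> powr r)"
  proof (rule LIMSEQ_le)
    show "(\<lambda>n. r * (LINT x|lborel. \<eta> x * sgn_powr r (u x) * line_avg (t (s n)) e v' x)) \<longlonglongrightarrow>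
        r * (LINT x|lborel. \<eta> x * sgn_powr r (u x) * v' x)"
      by (rule tendsto_mult_left[OF lim1(2)])
    show "(\<lambda>n. LINT x|lborel. q (s n) x) \<longlonglongrightarrow> (LINT x|lborel. - dir_deriv e \<eta> x * \<bar>u x\<bar> powr r)"
      using LIMSEQ_subseq_LIMSEQ[OF lim2 s(1)] unfolding o_def .
    show "\<exists>N. \<forall>n\<ge>N. r * (LINT x|lborel. \<eta> x * sgn_powr r (u x) * line_avg (t (s n)) e v' x) \<le> (LINT x|lborel. q (s n) x)"
      using le by blast
  qed
  then show "r * (LINT x|lborel. \<eta> x * sgn_powr r (u x) * v x) \<le> - (LINT x|lborel. dir_deriv e \<eta> x * \<bar>u x\<bar> powr r)"
    unfolding \<eta>v' by (simp only: mult_minus_left Bochner_Integration.integral_minus)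
qed

text \<open>
  The inequality for the direction \<open>- e\<close> is the reverse one, so equality holds for nonnegative weights.
  A general weight is the difference of two nonnegative ones, since adding a multiple of a cut-off function
  that equals \<open>1\<close> on its support makes it nonnegative.
\<close>

lemma weak_chain_rule:
  fixes u v \<eta> :: "'a::euclidean_space \<Rightarrow> real"
  assumes r: "r > 1" and uv: "wderiv e u v"
    and u: "loc_int (\<lambda>x. \<bar>u x\<bar> powr r)" and v: "loc_int (\<lambda>x. \<bar>v x\<bar> powr r)"
    and \<eta>: "Ck (Suc 0) \<eta>" "bounded_support \<eta>"
  shows "integrable lborel (\<lambda>x. \<eta> x * sgn_powr r (u x) * v x)"
    and "r * (LINT x|lborel. \<eta> x * sgn_powr r (u x) * v x) = - (LINT x|lborel. dir_deriv e \<eta> x * \<bar>u x\<bar> powr r)"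
proof -
  have pos: "integrable lborel (\<lambda>x. \<eta> x * sgn_powr r (u x) * v x) \<and>
     r * (LINT x|lborel. \<eta> x * sgn_powr r (u x) * v x) = - (LINT x|lborel. dir_deriv e \<eta> x * \<bar>u x\<bar> powr r)"
    if \<eta>: "Ck (Suc 0) \<eta>" "bounded_support \<eta>" "\<And>x. \<eta> x \<ge> 0" for \<eta>
  proof -
    have v2: "loc_int (\<lambda>x. \<bar>- v x\<bar> powr r)" using v by simp
    have neg: "dir_deriv (- e) \<eta> x = - dir_deriv e \<eta> x" for x
      by (rule linear_neg[OF linear_dir_deriv[OF Ck_differentiable[OF \<eta>(1)]]])
    show ?thesis
      using weak_chain_rule_le[OF r uv u v \<eta>] weak_chain_rule_le(2)[OF r wderiv_minus[OF uv] u v2 \<eta>]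
      unfolding neg by simp
  qed
  obtain C where C: "C \<ge> 0" "\<And>x. \<bar>\<eta> x\<bar> \<le> C"
    using continuous_bounded_support_bounded[OF Ck_imp_continuous[OF \<eta>(1)] \<eta>(2)] by auto
  obtain R where R: "\<And>x. norm x > R \<Longrightarrow> \<eta> x = 0"
    using \<eta> by (auto simp: bounded_support_def)
  obtain \<zeta> :: "'a \<Rightarrow> real" where \<zeta>: "\<zeta> \<in> test_functions" "\<And>x. 0 \<le> \<zeta> x" "\<And>x. norm x \<le> R \<Longrightarrow> \<zeta> x = 1"
    using cutoff_exists[of R] by blast
  have \<zeta>': "Ck (Suc 0) \<zeta>" "bounded_support \<zeta>" using \<zeta>(1) by (auto simp: test_functions_iff simp del: Ck.simps)
  define \<xi> where "\<xi> x = C * \<zeta> x" for x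
  have \<xi>: "Ck (Suc 0) \<xi>" unfolding \<xi>_def by (rule Ck_mult[OF Ck_const \<zeta>'(1)])
  have \<xi>b: "bounded_support \<xi>" using \<zeta>'(2) by (auto simp: \<xi>_def bounded_support_def)
  have s: "Ck (Suc 0) (\<lambda>x. \<eta> x + \<xi> x)" by (rule Ck_add[OF \<eta>(1) \<xi>])
  obtain R' where "\<And>x. norm x > R' \<Longrightarrow> \<xi> x = 0" using \<xi>b by (auto simp: bounded_support_def)
  with R have "norm x > max R R' \<Longrightarrow> \<eta> x + \<xi> x = 0" for x by simp
  then have sb: "bounded_support (\<lambda>x. \<eta> x + \<xi> x)" unfolding bounded_support_def by blast
  have "\<eta> x + \<xi> x \<ge> 0" for x
  proof (cases "norm x \<le> R")
    case True
    then show ?thesis using C(2)[of x] \<zeta>(3)[of x] by (simp add: \<xi>_def)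
  next
    case False
    then show ?thesis using R[of x] C(1) \<zeta>(2)[of x] by (simp add: \<xi>_def)
  qed
  from pos[OF s sb this] have 1: "integrable lborel (\<lambda>x. (\<eta> x + \<xi> x) * sgn_powr r (u x) * v x)"
    "r * (LINT x|lborel. (\<eta> x + \<xi> x) * sgn_powr r (u x) * v x) = - (LINT x|lborel. dir_deriv e (\<lambda>x. \<eta> x + \<xi> x) x * \<bar>u x\<bar> powr r)"
    by auto
  have "\<xi> x \<ge> 0" for x using C(1) \<zeta>(2)[of x] by (simp add: \<xi>_def)
  from pos[OF \<xi> \<xi>b this] have 2: "integrable lborel (\<lambda>x. \<xi> x * sgn_powr r (u x) * v x)"
    "r * (LINT x|lborel. \<xi> x * sgn_powr r (u x) * v x) = - (LINT x|lborel. dir_deriv e \<xi> x * \<bar>u x\<bar> powr r)"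
    by auto
  have D: "dir_deriv e (\<lambda>x. \<eta> x + \<xi> x) x = dir_deriv e \<eta> x + dir_deriv e \<xi> x" for x
    by (rule dir_derivI[OF has_derivative_add[OF Ck_Suc_has_derivative[OF \<eta>(1)] Ck_Suc_has_derivative[OF \<xi>]]])
  have i: "integrable lborel (\<lambda>x. dir_deriv e f x * \<bar>u x\<bar> powr r)" if f: "Ck (Suc 0) f" "bounded_support f" for f
  proof -
    obtain K where "\<And>x v. \<bar>dir_deriv v f x\<bar> \<le> K * norm v" using Ck1_bounded_derivative[OF f] by blast
    then show ?thesis
      by (intro loc_int_mult_integrable[OF u Ck_measurable[OF Ck_dir_deriv[OF f(1)]]] bounded_support_dir_deriv f)
  qed
  have eq: "\<eta> x * sgn_powr r (u x) * v x = (\<eta> x + \<xi> x) * sgn_powr r (u x) * v x - \<xi> x * sgn_powr r (u x) * v x" for x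
    by (simp add: algebra_simps)
  show "integrable lborel (\<lambda>x. \<eta> x * sgn_powr r (u x) * v x)"
    unfolding eq by (rule Bochner_Integration.integrable_diff[OF 1(1) 2(1)])
  have "(LINT x|lborel. \<eta> x * sgn_powr r (u x) * v x) =
      (LINT x|lborel. (\<eta> x + \<xi> x) * sgn_powr r (u x) * v x) - (LINT x|lborel. \<xi> x * sgn_powr r (u x) * v x)"
    unfolding eq by (rule Bochner_Integration.integral_diff[OF 1(1) 2(1)])
  moreover have "(LINT x|lborel. dir_deriv e (\<lambda>x. \<eta> x + \<xi> x) x * \<bar>u x\<bar> powr r) =
      (LINT x|lborel. dir_deriv e \<eta> x * \<bar>u x\<bar> powr r) + (LINT x|lborel. dir_deriv e \<xi> x * \<bar>u x\<bar> powr r)"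
    unfolding D distrib_right by (rule Bochner_Integration.integral_add[OF i[OF \<eta>] i[OF \<xi> \<xi>b]])
  ultimately show "r * (LINT x|lborel. \<eta> x * sgn_powr r (u x) * v x) = - (LINT x|lborel. dir_deriv e \<eta> x * \<bar>u x\<bar> powr r)"
    using 1(2) 2(2) by (simp add: right_diff_distrib)
qed

section \<open>Riesz potentials and the Coulomb energy\<close>

lemma riesz_potential_lborel:
  "riesz_potential \<alpha> f x = (\<integral>\<^sup>+y. ennreal (riesz_kernel \<alpha> (x - y) * f y) \<partial>lborel)"
  unfolding riesz_potential_def by (rule nn_integral_completion)

lemma riesz_kernel_measurable [measurable]: "riesz_kernel \<alpha> \<in> borel_measurable borel"
  unfolding riesz_kernel_def[abs_def] by measurable

lemma riesz_kernel_commute: "riesz_kernel \<alpha> (x - y) = riesz_kernel \<alpha> (y - x)"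
  by (simp add: riesz_kernel_def norm_minus_commute)

lemma riesz_const_pos: "0 < \<alpha> \<Longrightarrow> \<alpha> < real N \<Longrightarrow> riesz_const N \<alpha> > 0"
  unfolding riesz_const_def by (intro divide_pos_pos mult_pos_pos Gamma_real_pos) auto

lemma riesz_kernel_nonneg:
  "0 < \<alpha> \<Longrightarrow> \<alpha> < real DIM('a::euclidean_space) \<Longrightarrow> riesz_kernel \<alpha> (x::'a) \<ge> 0"
  using riesz_const_pos[of \<alpha> "DIM('a)"] by (simp add: riesz_kernel_def)

lemma riesz_kernel_pos:
  "0 < \<alpha> \<Longrightarrow> \<alpha> < real DIM('a::euclidean_space) \<Longrightarrow> x \<noteq> 0 \<Longrightarrow> riesz_kernel \<alpha> (x::'a) > 0"
  using riesz_const_pos[of \<alpha> "DIM('a)"] by (simp add: riesz_kernel_def)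

lemma riesz_potential_measurable [measurable]:
  assumes [measurable]: "f \<in> borel_measurable borel"
  shows "riesz_potential \<alpha> f \<in> borel_measurable borel"
  unfolding riesz_potential_lborel[abs_def] by measurable

text \<open>
  The ball around \<open>x\<close> of radius \<open>|x - y|\<close> already contributes a fixed multiple of \<open>|x - y|\<^sup>\<alpha>\<^sup>-\<^sup>N\<close> to the
  convolution: on it the two factors are bounded below by their values at distance \<open>|x - y|\<close> and \<open>2 |x - y|\<close>.
\<close>

lemma riesz_kernel_le_convolution:
  assumes \<alpha>: "0 < \<alpha>" "\<alpha> < real DIM('a::euclidean_space)"
  shows "\<exists>C\<ge>0. \<forall>x y::'a. ennreal (riesz_kernel \<alpha> (x - y)) \<le>
    ennreal C * (\<integral>\<^sup>+z. ennreal (riesz_kernel (\<alpha> / 2) (x - z)) * ennreal (riesz_kernel (\<alpha> / 2) (z - y)) \<partial>lborel)"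
proof -
  define N where "N = real DIM('a)"
  define m where "m = N - \<alpha> / 2"
  define c where "c = riesz_const DIM('a) (\<alpha> / 2)"
  define c' where "c' = riesz_const DIM('a) \<alpha>"
  define V where "V = unit_ball_vol N"
  have c: "c > 0" and c': "c' > 0" and m: "m > 0" and V: "V > 0"
    using \<alpha> riesz_const_pos[of "\<alpha> / 2" "DIM('a)"] riesz_const_pos[of \<alpha> "DIM('a)"]
    by (auto simp: c_def c'_def m_def N_def V_def)
  have K: "riesz_kernel (\<alpha> / 2) (z::'a) = c / norm z powr m" for z
    by (simp add: riesz_kernel_def c_def m_def N_def)
  define C where "C = c' * 2 powr m / (c\<^sup>2 * V)"
  have "ennreal (riesz_kernel \<alpha> (x - y)) \<le>
      ennreal C * (\<integral>\<^sup>+z. ennreal (riesz_kernel (\<alpha> / 2) (x - z)) * ennreal (riesz_kernel (\<alpha> / 2) (z - y)) \<partial>lborel)"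
    for x y :: 'a
  proof (cases "x = y")
    case False
    define r where "r = norm (x - y)"
    have r: "r > 0" using False by (simp add: r_def)
    define k where "k = (c / r powr m) * (c / (2 * r) powr m)"
    have k: "k \<ge> 0" using c by (simp add: k_def)
    have "ennreal k * emeasure lborel (ball x r - {x}) = (\<integral>\<^sup>+z. ennreal k * indicator (ball x r - {x}) z \<partial>lborel)"
      by (rule nn_integral_cmult_indicator[symmetric]) auto
    also have "\<dots> \<le> (\<integral>\<^sup>+z. ennreal (riesz_kernel (\<alpha> / 2) (x - z)) * ennreal (riesz_kernel (\<alpha> / 2) (z - y)) \<partial>lborel)"
    proof (rule nn_integral_mono)
      fix z
      show "ennreal k * indicator (ball x r - {x}) z \<le>
        ennreal (riesz_kernel (\<alpha> / 2) (x - z)) * ennreal (riesz_kernel (\<alpha> / 2) (z - y))"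
      proof (cases "z \<in> ball x r - {x}")
        case True
        then have z: "0 < norm (x - z)" "norm (x - z) < r" by (auto simp: dist_norm)
        have "norm (z - y) \<le> norm (x - z) + r"
          using norm_triangle_ineq4[of "x - y" "x - z"] by (simp add: r_def)
        then have zy: "norm (z - y) \<le> 2 * r" using z by linarith
        have "r \<le> norm (x - z) + norm (z - y)"
          using norm_triangle_ineq[of "x - z" "z - y"] by (simp add: r_def)
        then have zy': "0 < norm (z - y)" using z by linarith
        have "c / r powr m \<le> c / norm (x - z) powr m"
          using z c m by (intro divide_left_mono powr_mono2 mult_pos_pos) auto
        moreover have "c / (2 * r) powr m \<le> c / norm (z - y) powr m"
          using zy zy' r c m by (intro divide_left_mono powr_mono2 mult_pos_pos) auto
        ultimately have "k \<le> riesz_kernel (\<alpha> / 2) (x - z) * riesz_kernel (\<alpha> / 2) (z - y)"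
          unfolding k_def K using c by (intro mult_mono) auto
        moreover have "0 \<le> riesz_kernel (\<alpha> / 2) (x - z)" "0 \<le> riesz_kernel (\<alpha> / 2) (z - y)"
          unfolding K using c by auto
        ultimately show ?thesis using True by (simp add: ennreal_mult[symmetric] ennreal_leI)
      qed simp
    qed
    finally have lower: "ennreal k * emeasure lborel (ball x r - {x}) \<le>
      (\<integral>\<^sup>+z. ennreal (riesz_kernel (\<alpha> / 2) (x - z)) * ennreal (riesz_kernel (\<alpha> / 2) (z - y)) \<partial>lborel)" .
    have "emeasure lborel (ball x r - {x}) = emeasure lborel (ball x r)"
      by (rule emeasure_Diff_null_set) (auto intro: countable_imp_null_set_lborel)
    also have "\<dots> = ennreal (V * r powr N)"
      using r by (simp add: emeasure_ball V_def N_def powr_realpow)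
    finally have "ennreal C * ennreal (k * (V * r powr N)) \<le> ennreal C * (\<integral>\<^sup>+z. ennreal (riesz_kernel (\<alpha> / 2) (x - z)) *
        ennreal (riesz_kernel (\<alpha> / 2) (z - y)) \<partial>lborel)"
      using lower k V by (intro mult_left_mono) (auto simp: ennreal_mult)
    moreover have "C * (k * (V * r powr N)) = riesz_kernel \<alpha> (x - y)"
    proof -
      have "(2 * r) powr m = 2 powr m * r powr m" using r by (simp add: powr_mult)
      then have "C * (k * (V * r powr N)) = c' * (r powr N / (r powr m * r powr m))"
        using c V r by (simp add: C_def k_def power2_eq_square)
      also have "r powr N / (r powr m * r powr m) = r powr (N - (m + m))"
        by (simp only: powr_add powr_diff)
      also have "N - (m + m) = - (N - \<alpha>)" by (simp add: m_def)
      finally show ?thesis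
        unfolding riesz_kernel_def c'_def N_def r_def powr_minus divide_inverse .
    qed
    moreover have "C \<ge> 0" using c c' V by (simp add: C_def)
    ultimately show ?thesis using k V by (simp add: ennreal_mult[symmetric])
  qed (simp add: riesz_kernel_def)
  moreover have "C \<ge> 0" using c c' V by (simp add: C_def)
  ultimately show ?thesis by blast
qed

text \<open>
  The square of the norm of \<open>|w|\<^sup>p\<close> in the dual of the homogeneous Sobolev space of order \<open>\<alpha>/2\<close>, because
  \<open>I\<^bsub>\<alpha>/2\<^esub> *\<close> is the operator \<open>(-\<Delta>)\<^sup>-\<^sup>\<alpha>\<^sup>/\<^sup>4\<close>.
\<close>

definition coulomb_energy :: "real \<Rightarrow> real \<Rightarrow> ('a::euclidean_space \<Rightarrow> real) \<Rightarrow> ennreal" where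
  "coulomb_energy \<alpha> p w = (\<integral>\<^sup>+x. (riesz_potential (\<alpha> / 2) (\<lambda>y. \<bar>w y\<bar> powr p) x)\<^sup>2 \<partial>lborel)"

lemma ennreal_mult_le_squares: "a * b \<le> a\<^sup>2 + (b\<^sup>2 :: ennreal)"
proof (cases "a \<le> b")
  case True
  then have "a * b \<le> b * b" by (rule mult_right_mono) simp
  then show ?thesis by (simp add: power2_eq_square add_increasing)
next
  case False
  then have "a * b \<le> a * a" by (intro mult_left_mono) auto
  then show ?thesis by (simp add: power2_eq_square add_increasing2)
qed

text \<open>
  Insert the bound of \<open>I\<^sub>\<alpha>\<close> by \<open>I\<^bsub>\<alpha>/2\<^esub> * I\<^bsub>\<alpha>/2\<^esub>\<close> and exchange the integrals: the pairing becomes the integral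
  of the product of the two potentials of order \<open>\<alpha>/2\<close>.
\<close>

lemma riesz_potential_pairing_le:
  assumes \<alpha>: "0 < \<alpha>" "\<alpha> < real DIM('a::euclidean_space)"
  shows "\<exists>C\<ge>0. \<forall>f h :: 'a \<Rightarrow> real. f \<in> borel_measurable borel \<longrightarrow> h \<in> borel_measurable borel \<longrightarrow>
    (\<forall>x. f x \<ge> 0) \<longrightarrow> (\<forall>x. h x \<ge> 0) \<longrightarrow>
    (\<integral>\<^sup>+x. riesz_potential \<alpha> f x * ennreal (h x) \<partial>lborel) \<le>
    ennreal C * ((\<integral>\<^sup>+x. (riesz_potential (\<alpha> / 2) f x)\<^sup>2 \<partial>lborel) + (\<integral>\<^sup>+x. (riesz_potential (\<alpha> / 2) h x)\<^sup>2 \<partial>lborel))"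
proof -
  define K where "K z = ennreal (riesz_kernel (\<alpha> / 2) z)" for z :: 'a
  have [measurable]: "K \<in> borel_measurable borel" unfolding K_def[abs_def] by measurable
  obtain C where C: "C \<ge> 0" "\<And>x y::'a. ennreal (riesz_kernel \<alpha> (x - y)) \<le>
    ennreal C * (\<integral>\<^sup>+z. K (x - z) * K (z - y) \<partial>lborel)"
    using riesz_kernel_le_convolution[OF \<alpha>] unfolding K_def by blast
  have "(\<integral>\<^sup>+x. riesz_potential \<alpha> f x * ennreal (h x) \<partial>lborel) \<le>
    ennreal C * ((\<integral>\<^sup>+x. (riesz_potential (\<alpha> / 2) f x)\<^sup>2 \<partial>lborel) + (\<integral>\<^sup>+x. (riesz_potential (\<alpha> / 2) h x)\<^sup>2 \<partial>lborel))"
    if [measurable]: "f \<in> borel_measurable borel" "h \<in> borel_measurable borel"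
      and f: "\<And>x. f x \<ge> 0" and h: "\<And>x. h x \<ge> 0" for f h :: "'a \<Rightarrow> real"
  proof -
    define F where "F x = ennreal (f x)" for x
    define H where "H x = ennreal (h x)" for x
    have [measurable]: "F \<in> borel_measurable borel" "H \<in> borel_measurable borel"
      unfolding F_def[abs_def] H_def[abs_def] by measurable
    have ker: "0 \<le> riesz_kernel \<alpha> z" "0 \<le> riesz_kernel (\<alpha> / 2) z" for z :: 'a
      using \<alpha> by (auto intro!: riesz_kernel_nonneg)
    have R: "riesz_potential (\<alpha> / 2) f z = (\<integral>\<^sup>+y. K (z - y) * F y \<partial>lborel)" for z
      unfolding riesz_potential_lborel K_def F_def by (intro nn_integral_cong ennreal_mult ker f)
    have R': "riesz_potential (\<alpha> / 2) h z = (\<integral>\<^sup>+x. K (x - z) * H x \<partial>lborel)" for z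
      unfolding riesz_potential_lborel K_def H_def
      by (subst riesz_kernel_commute) (intro nn_integral_cong ennreal_mult ker h)
    have "(\<integral>\<^sup>+x. riesz_potential \<alpha> f x * ennreal (h x) \<partial>lborel) =
        (\<integral>\<^sup>+x. (\<integral>\<^sup>+y. ennreal (riesz_kernel \<alpha> (x - y)) * F y \<partial>lborel) * H x \<partial>lborel)"
      unfolding riesz_potential_lborel F_def H_def by (simp add: ennreal_mult ker f)
    also have "\<dots> \<le> (\<integral>\<^sup>+x. (\<integral>\<^sup>+y. (ennreal C * (\<integral>\<^sup>+z. K (x - z) * K (z - y) \<partial>lborel)) * F y \<partial>lborel) * H x \<partial>lborel)"
      by (intro nn_integral_mono mult_right_mono C(2)) auto
    also have "\<dots> = ennreal C * (\<integral>\<^sup>+x. (\<integral>\<^sup>+y. (\<integral>\<^sup>+z. K (x - z) * K (z - y) \<partial>lborel) * F y \<partial>lborel) * H x \<partial>lborel)"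
      by (simp add: nn_integral_cmult mult.assoc)
    also have "(\<integral>\<^sup>+x. (\<integral>\<^sup>+y. (\<integral>\<^sup>+z. K (x - z) * K (z - y) \<partial>lborel) * F y \<partial>lborel) * H x \<partial>lborel) =
        (\<integral>\<^sup>+x. (\<integral>\<^sup>+y. (\<integral>\<^sup>+z. K (x - z) * H x * (K (z - y) * F y) \<partial>lborel) \<partial>lborel) \<partial>lborel)"
    proof (intro nn_integral_cong)
      fix x
      have "(\<integral>\<^sup>+y. (\<integral>\<^sup>+z. K (x - z) * K (z - y) \<partial>lborel) * F y \<partial>lborel) * H x =
          (\<integral>\<^sup>+y. (\<integral>\<^sup>+z. K (x - z) * K (z - y) \<partial>lborel) * F y * H x \<partial>lborel)"
        by (rule nn_integral_multc[symmetric]) measurable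
      also have "\<dots> = (\<integral>\<^sup>+y. (\<integral>\<^sup>+z. K (x - z) * H x * (K (z - y) * F y) \<partial>lborel) \<partial>lborel)"
      proof (intro nn_integral_cong)
        fix y
        have "(\<integral>\<^sup>+z. K (x - z) * K (z - y) \<partial>lborel) * F y * H x = (\<integral>\<^sup>+z. K (x - z) * K (z - y) * (F y * H x) \<partial>lborel)"
          unfolding mult.assoc[of _ "F y" "H x"] by (rule nn_integral_multc[symmetric]) measurable
        also have "\<dots> = (\<integral>\<^sup>+z. K (x - z) * H x * (K (z - y) * F y) \<partial>lborel)"
          by (intro nn_integral_cong) (simp only: mult_ac)
        finally show "(\<integral>\<^sup>+z. K (x - z) * K (z - y) \<partial>lborel) * F y * H x =
            (\<integral>\<^sup>+z. K (x - z) * H x * (K (z - y) * F y) \<partial>lborel)" .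
      qed
      finally show "(\<integral>\<^sup>+y. (\<integral>\<^sup>+z. K (x - z) * K (z - y) \<partial>lborel) * F y \<partial>lborel) * H x =
          (\<integral>\<^sup>+y. (\<integral>\<^sup>+z. K (x - z) * H x * (K (z - y) * F y) \<partial>lborel) \<partial>lborel)" .
    qed
    also have "\<dots> = (\<integral>\<^sup>+x. (\<integral>\<^sup>+z. (\<integral>\<^sup>+y. K (x - z) * H x * (K (z - y) * F y) \<partial>lborel) \<partial>lborel) \<partial>lborel)"
      by (intro nn_integral_cong lborel_pair.Fubini') measurable
    also have "\<dots> = (\<integral>\<^sup>+x. (\<integral>\<^sup>+z. K (x - z) * H x * riesz_potential (\<alpha> / 2) f z \<partial>lborel) \<partial>lborel)"
      unfolding R by (simp add: nn_integral_cmult)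
    also have "\<dots> = (\<integral>\<^sup>+z. (\<integral>\<^sup>+x. K (x - z) * H x * riesz_potential (\<alpha> / 2) f z \<partial>lborel) \<partial>lborel)"
      by (rule lborel_pair.Fubini') measurable
    also have "\<dots> = (\<integral>\<^sup>+z. riesz_potential (\<alpha> / 2) h z * riesz_potential (\<alpha> / 2) f z \<partial>lborel)"
      unfolding R' by (simp add: nn_integral_multc)
    also have "\<dots> \<le> (\<integral>\<^sup>+z. (riesz_potential (\<alpha> / 2) h z)\<^sup>2 + (riesz_potential (\<alpha> / 2) f z)\<^sup>2 \<partial>lborel)"
      by (intro nn_integral_mono ennreal_mult_le_squares)
    also have "\<dots> = (\<integral>\<^sup>+x. (riesz_potential (\<alpha> / 2) f x)\<^sup>2 \<partial>lborel) + (\<integral>\<^sup>+x. (riesz_potential (\<alpha> / 2) h x)\<^sup>2 \<partial>lborel)"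
      by (subst nn_integral_add) (auto simp: add.commute)
    finally show ?thesis by (simp add: mult_left_mono)
  qed
  with C(1) show ?thesis by blast
qed

lemma riesz_potential_mono:
  assumes "0 < \<alpha>" "\<alpha> < real DIM('a::euclidean_space)" "\<And>y::'a. f y \<le> h y"
  shows "riesz_potential \<alpha> f x \<le> riesz_potential \<alpha> h x"
  unfolding riesz_potential_lborel
  by (intro nn_integral_mono ennreal_leI mult_left_mono assms riesz_kernel_nonneg)

lemma coulomb_energy_mono:
  assumes \<alpha>: "0 < \<alpha>" "\<alpha> < real DIM('a::euclidean_space)" and p: "p \<ge> 0" and le: "\<And>y::'a. \<bar>w y\<bar> \<le> \<bar>v y\<bar>"
  shows "coulomb_energy \<alpha> p w \<le> coulomb_energy \<alpha> p v"
  unfolding coulomb_energy_def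
  using \<alpha> p le by (intro nn_integral_mono power_mono riesz_potential_mono powr_mono2) auto

lemma coulomb_energy_cmult:
  assumes \<alpha>: "0 < \<alpha>" "\<alpha> < real DIM('a::euclidean_space)" and [measurable]: "w \<in> borel_measurable borel"
  shows "coulomb_energy \<alpha> p (\<lambda>x::'a. c * w x) = ennreal ((\<bar>c\<bar> powr p)\<^sup>2) * coulomb_energy \<alpha> p w"
proof -
  have "riesz_potential (\<alpha> / 2) (\<lambda>y. \<bar>c * w y\<bar> powr p) x = ennreal (\<bar>c\<bar> powr p) * riesz_potential (\<alpha> / 2) (\<lambda>y. \<bar>w y\<bar> powr p) x" for x
  proof -
    have "ennreal (riesz_kernel (\<alpha> / 2) (x - y) * \<bar>c * w y\<bar> powr p) =
        ennreal (\<bar>c\<bar> powr p) * ennreal (riesz_kernel (\<alpha> / 2) (x - y) * \<bar>w y\<bar> powr p)" for y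
      using riesz_kernel_nonneg[of "\<alpha> / 2" "x - y"] \<alpha>
      by (simp add: abs_mult powr_mult ennreal_mult[symmetric] mult_ac)
    then show ?thesis unfolding riesz_potential_lborel by (simp add: nn_integral_cmult)
  qed
  then show ?thesis
    unfolding coulomb_energy_def by (simp add: power_mult_distrib nn_integral_cmult ennreal_power)
qed

lemma coulomb_energy_add_le:
  assumes \<alpha>: "0 < \<alpha>" "\<alpha> < real DIM('a::euclidean_space)" and p: "p \<ge> 0"
    and [measurable]: "w \<in> borel_measurable borel" "v \<in> borel_measurable borel"
  shows "coulomb_energy \<alpha> p (\<lambda>x::'a. w x + v x) \<le>
    3 * (ennreal ((2 powr p)\<^sup>2) * coulomb_energy \<alpha> p w + ennreal ((2 powr p)\<^sup>2) * coulomb_energy \<alpha> p v)"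
proof -
  define f where "f = (\<lambda>y. \<bar>2 * w y\<bar> powr p)"
  define h where "h = (\<lambda>y. \<bar>2 * v y\<bar> powr p)"
  have [measurable]: "f \<in> borel_measurable borel" "h \<in> borel_measurable borel" by (auto simp: f_def h_def)
  have le: "\<bar>w y + v y\<bar> powr p \<le> f y + h y" for y
  proof (cases "\<bar>w y\<bar> \<le> \<bar>v y\<bar>")
    case True
    then have "\<bar>w y + v y\<bar> powr p \<le> \<bar>2 * v y\<bar> powr p" by (intro powr_mono2 p) auto
    then show ?thesis unfolding f_def h_def by (rule add_increasing[OF powr_ge_zero])
  next
    case False
    then have "\<bar>w y + v y\<bar> powr p \<le> \<bar>2 * w y\<bar> powr p" by (intro powr_mono2 p) auto
    then show ?thesis unfolding f_def h_def by (rule add_increasing2[OF powr_ge_zero])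
  qed
  have R: "riesz_potential (\<alpha> / 2) (\<lambda>y. \<bar>w y + v y\<bar> powr p) x \<le> riesz_potential (\<alpha> / 2) f x + riesz_potential (\<alpha> / 2) h x" for x
  proof -
    have "riesz_potential (\<alpha> / 2) (\<lambda>y. \<bar>w y + v y\<bar> powr p) x \<le> riesz_potential (\<alpha> / 2) (\<lambda>y. f y + h y) x"
      using \<alpha> by (intro riesz_potential_mono le) auto
    also have "\<dots> = riesz_potential (\<alpha> / 2) f x + riesz_potential (\<alpha> / 2) h x"
    proof -
      have "ennreal (riesz_kernel (\<alpha> / 2) (x - y) * (f y + h y)) =
        ennreal (riesz_kernel (\<alpha> / 2) (x - y) * f y) + ennreal (riesz_kernel (\<alpha> / 2) (x - y) * h y)" for y
        using riesz_kernel_nonneg[of "\<alpha> / 2" "x - y"] \<alpha>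
        by (simp add: distrib_left f_def h_def flip: ennreal_plus)
      then show ?thesis unfolding riesz_potential_lborel by (simp add: nn_integral_add)
    qed
    finally show ?thesis .
  qed
  have sq: "(a + b)\<^sup>2 \<le> 3 * (a\<^sup>2 + b\<^sup>2)" for a b :: ennreal
  proof -
    have "(a + b)\<^sup>2 = a\<^sup>2 + b\<^sup>2 + (a * b + a * b)" by (simp add: power2_eq_square algebra_simps)
    also have "\<dots> \<le> a\<^sup>2 + b\<^sup>2 + ((a\<^sup>2 + b\<^sup>2) + (a\<^sup>2 + b\<^sup>2))"
      by (intro add_mono order_refl ennreal_mult_le_squares)
    also have "\<dots> = 3 * (a\<^sup>2 + b\<^sup>2)"
      by (simp only: numeral_Bit1 numeral_One one_add_one[symmetric] distrib_right mult_1_left add.assoc)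
    finally show ?thesis .
  qed
  have "coulomb_energy \<alpha> p (\<lambda>x. w x + v x) \<le>
      (\<integral>\<^sup>+x. 3 * ((riesz_potential (\<alpha> / 2) f x)\<^sup>2 + (riesz_potential (\<alpha> / 2) h x)\<^sup>2) \<partial>lborel)"
    unfolding coulomb_energy_def
    by (intro nn_integral_mono order_trans[OF power_mono[OF R] sq]) auto
  also have "\<dots> = 3 * (coulomb_energy \<alpha> p (\<lambda>x. 2 * w x) + coulomb_energy \<alpha> p (\<lambda>x. 2 * v x))"
    unfolding coulomb_energy_def f_def[symmetric] h_def[symmetric]
    by (simp add: nn_integral_cmult nn_integral_add)
  finally show ?thesis
    unfolding coulomb_energy_cmult[OF \<alpha> \<open>w \<in> borel_measurable borel\<close>] coulomb_energy_cmult[OF \<alpha> \<open>v \<in> borel_measurable borel\<close>]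
    by simp
qed

lemma coulomb_energy_translate:
  assumes [measurable]: "w \<in> borel_measurable borel"
  shows "coulomb_energy \<alpha> p (\<lambda>x::'a::euclidean_space. w (x + a)) = coulomb_energy \<alpha> p w"
proof -
  have "riesz_potential (\<alpha> / 2) (\<lambda>y. \<bar>w (y + a)\<bar> powr p) x = riesz_potential (\<alpha> / 2) (\<lambda>y. \<bar>w y\<bar> powr p) (x + a)" for x
    unfolding riesz_potential_lborel
    using nn_integral_lborel_translate[of "\<lambda>y. ennreal (riesz_kernel (\<alpha> / 2) (x + a - y) * \<bar>w y\<bar> powr p)" a]
    by simp
  then show ?thesis
    unfolding coulomb_energy_def
    by (simp add: nn_integral_lborel_translate[of "\<lambda>x. (riesz_potential (\<alpha> / 2) (\<lambda>y. \<bar>w y\<bar> powr p) x)\<^sup>2"])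
qed

text \<open>
  Jensen's inequality for \<open>|\<cdot>|\<^sup>p\<close> bounds the potential of the average by the average of the translated
  potentials, and the Cauchy-Schwarz inequality on the probability space does the same for the square.
\<close>

lemma (in random_shift) coulomb_energy_avg_le:
  assumes \<alpha>: "0 < \<alpha>" "\<alpha> < real DIM('a)" and p: "p > 1" and [measurable]: "w \<in> borel_measurable borel"
  shows "coulomb_energy \<alpha> p (avg M Y w) \<le> coulomb_energy \<alpha> p w"
proof -
  define f where "f y = ennreal (\<bar>w y\<bar> powr p)" for y
  define R where "R x = riesz_potential (\<alpha> / 2) (\<lambda>y. \<bar>w y\<bar> powr p) x" for x
  define K where "K z = ennreal (riesz_kernel (\<alpha> / 2) z)" for z :: 'a
  have [measurable]: "K \<in> borel_measurable borel" "f \<in> borel_measurable borel" "R \<in> borel_measurable borel"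
    unfolding K_def[abs_def] f_def[abs_def] R_def[abs_def] by measurable
  have ker: "0 \<le> riesz_kernel (\<alpha> / 2) z" for z :: 'a using \<alpha> by (auto intro!: riesz_kernel_nonneg)
  have R: "R x = (\<integral>\<^sup>+y. K (x - y) * f y \<partial>lborel)" for x
    unfolding R_def riesz_potential_lborel K_def f_def by (intro nn_integral_cong ennreal_mult ker) auto
  have le: "riesz_potential (\<alpha> / 2) (\<lambda>y. \<bar>avg M Y w y\<bar> powr p) x \<le> (\<integral>\<^sup>+\<omega>. R (x + Y \<omega>) \<partial>M)" for x
  proof -
    have "riesz_potential (\<alpha> / 2) (\<lambda>y. \<bar>avg M Y w y\<bar> powr p) x =
        (\<integral>\<^sup>+y. K (x - y) * ennreal (\<bar>avg M Y w y\<bar> powr p) \<partial>lborel)"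
      unfolding riesz_potential_lborel K_def by (intro nn_integral_cong ennreal_mult ker) auto
    also have "\<dots> \<le> (\<integral>\<^sup>+y. K (x - y) * (\<integral>\<^sup>+\<omega>. f (y + Y \<omega>) \<partial>M) \<partial>lborel)"
      unfolding f_def using p by (intro nn_integral_mono mult_left_mono jensen_avg) auto
    also have "\<dots> = (\<integral>\<^sup>+\<omega>. (\<integral>\<^sup>+y. K (x - y) * f (y + Y \<omega>) \<partial>lborel) \<partial>M)"
      by (rule nn_integral_avg_weighted) measurable
    also have "\<dots> = (\<integral>\<^sup>+\<omega>. R (x + Y \<omega>) \<partial>M)"
    proof (rule nn_integral_cong)
      fix \<omega>
      show "(\<integral>\<^sup>+y. K (x - y) * f (y + Y \<omega>) \<partial>lborel) = R (x + Y \<omega>)"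
        using nn_integral_lborel_translate[of "\<lambda>y. K (x + Y \<omega> - y) * f y" "Y \<omega>"] by (simp add: R)
    qed
    finally show ?thesis .
  qed
  have "coulomb_energy \<alpha> p (avg M Y w) \<le> (\<integral>\<^sup>+x. (\<integral>\<^sup>+\<omega>. (R (x + Y \<omega>))\<^sup>2 \<partial>M) \<partial>lborel)"
    unfolding coulomb_energy_def
  proof (rule nn_integral_mono)
    fix x
    have "(riesz_potential (\<alpha> / 2) (\<lambda>y. \<bar>avg M Y w y\<bar> powr p) x)\<^sup>2 \<le> (\<integral>\<^sup>+\<omega>. R (x + Y \<omega>) * 1 \<partial>M)\<^sup>2"
      using le[of x] by (intro power_mono) auto
    also have "\<dots> \<le> (\<integral>\<^sup>+\<omega>. (R (x + Y \<omega>))\<^sup>2 \<partial>M) * (\<integral>\<^sup>+\<omega>. 1\<^sup>2 \<partial>M)"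
      by (rule Cauchy_Schwarz_nn_integral) measurable
    finally show "(riesz_potential (\<alpha> / 2) (\<lambda>y. \<bar>avg M Y w y\<bar> powr p) x)\<^sup>2 \<le> (\<integral>\<^sup>+\<omega>. (R (x + Y \<omega>))\<^sup>2 \<partial>M)"
      by (simp add: emeasure_space_1)
  qed
  also have "\<dots> = coulomb_energy \<alpha> p w"
    unfolding coulomb_energy_def R_def[symmetric] by (rule nn_integral_avg) measurable
  finally show ?thesis .
qed

text \<open>
  The potential is finite at some point \<open>x\<close>, and the kernel \<open>y \<mapsto> I\<^bsub>\<alpha>/2\<^esub>(x - y)\<close> is bounded below by a positive
  constant on every ball.
\<close>

lemma finite_coulomb_energy_imp_loc_int:
  assumes \<alpha>: "0 < \<alpha>" "\<alpha> < real DIM('a::euclidean_space)" and [measurable]: "w \<in> borel_measurable borel"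
    and fin: "coulomb_energy \<alpha> p w < \<infinity>"
  shows "loc_int (\<lambda>x::'a. \<bar>w x\<bar> powr p)"
proof -
  define f where "f = (\<lambda>y. \<bar>w y\<bar> powr p)"
  have [measurable]: "f \<in> borel_measurable borel" by (simp add: f_def)
  have "AE x in lborel. (riesz_potential (\<alpha> / 2) f x)\<^sup>2 \<noteq> \<infinity>"
    using fin unfolding coulomb_energy_def f_def[symmetric]
    by (intro nn_integral_PInf_AE) auto
  moreover have "\<not> (AE x::'a in lborel. False)"
    by (simp add: AE_iff_null null_sets_def emeasure_lborel_UNIV)
  ultimately obtain x :: 'a where x: "(riesz_potential (\<alpha> / 2) f x)\<^sup>2 \<noteq> \<infinity>"
    by (meson AE_mp always_eventually eventually_mono)
  then have x: "riesz_potential (\<alpha> / 2) f x < \<infinity>"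
    by (auto simp: power2_eq_square less_top ennreal_mult_eq_top_iff)
  define m where "m = real DIM('a) - \<alpha> / 2"
  define c where "c = riesz_const DIM('a) (\<alpha> / 2)"
  have m: "m > 0" and c: "c > 0" using \<alpha> riesz_const_pos[of "\<alpha> / 2" "DIM('a)"] by (auto simp: m_def c_def)
  have "integrable lborel (\<lambda>y. indicator (cball 0 R) y * f y)" for R
  proof (rule integrableI_bounded)
    define r where "r = max 1 (norm x + R)"
    define k where "k = c / r powr m"
    have r: "r > 0" by (simp add: r_def)
    have k: "k > 0" using c r by (simp add: k_def)
    have "AE y in lborel. y \<noteq> x"
      by (rule AE_lborel_singleton)
    then have "AE y in lborel. ennreal (norm (indicator (cball 0 R) y * f y)) \<le>
        ennreal (1 / k) * ennreal (riesz_kernel (\<alpha> / 2) (x - y) * f y)"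
    proof eventually_elim
      case (elim y)
      have f0: "f y \<ge> 0" by (simp add: f_def)
      show ?case
      proof (cases "y \<in> cball 0 R")
        case True
        then have "norm (x - y) \<le> r" using norm_triangle_ineq4[of x y] by (simp add: r_def)
        then have "k \<le> riesz_kernel (\<alpha> / 2) (x - y)"
          unfolding k_def riesz_kernel_def m_def[symmetric] c_def[symmetric]
          using elim c m r by (intro divide_left_mono powr_mono2 mult_pos_pos) auto
        then have "1 \<le> 1 / k * riesz_kernel (\<alpha> / 2) (x - y)" using k by (simp add: field_simps)
        from mult_right_mono[OF this f0] have "f y \<le> 1 / k * (riesz_kernel (\<alpha> / 2) (x - y) * f y)"
          by (simp add: mult.assoc)
        then show ?thesis using True f0 k \<open>k \<le> _\<close> by (simp add: ennreal_mult[symmetric] ennreal_leI)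
      qed simp
    qed
    then have "(\<integral>\<^sup>+y. ennreal (norm (indicator (cball 0 R) y * f y)) \<partial>lborel) \<le>
        (\<integral>\<^sup>+y. ennreal (1 / k) * ennreal (riesz_kernel (\<alpha> / 2) (x - y) * f y) \<partial>lborel)"
      by (rule nn_integral_mono_AE)
    also have "\<dots> = ennreal (1 / k) * riesz_potential (\<alpha> / 2) f x"
      unfolding riesz_potential_lborel by (rule nn_integral_cmult) measurable
    also have "\<dots> < \<infinity>" using x by (simp add: ennreal_mult_less_top)
    finally show "(\<integral>\<^sup>+y. ennreal (norm (indicator (cball 0 R) y * f y)) \<partial>lborel) < \<infinity>" .
  qed measurable
  then show ?thesis by (simp add: loc_int_def f_def)
qed

section \<open>Enlarging the class of test functions\<close>

definition partials :: "('a::euclidean_space \<Rightarrow> real) \<Rightarrow> ('a \<Rightarrow> 'a \<Rightarrow> real) \<Rightarrow> bool" where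
  "partials w G \<longleftrightarrow> (\<forall>b\<in>Basis. wderiv b w (G b))"

text \<open>
  A weak solution, given by Borel representatives \<open>u\<close> of the function and \<open>g b\<close> of its weak partial derivatives.
\<close>

locale choquard_solution =
  fixes \<alpha> p q :: real and u :: "'a::euclidean_space \<Rightarrow> real" and g :: "'a \<Rightarrow> 'a \<Rightarrow> real"
  assumes \<alpha>: "0 < \<alpha>" "\<alpha> < real DIM('a)" and p: "p > 1" and q: "q > 1"
    and u_partials: "partials u g"
    and g_sq: "\<And>b. b \<in> Basis \<Longrightarrow> integrable lborel (\<lambda>x. \<bar>g b x\<bar> powr 2)"
    and u_q: "integrable lborel (\<lambda>x. \<bar>u x\<bar> powr q)"
    and u_coulomb: "coulomb_energy \<alpha> p u < \<infinity>"
    and weak_eq: "\<And>\<phi>. \<phi> \<in> test_functions \<Longrightarrow>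
      (\<Sum>b\<in>Basis. LINT x|lborel. g b x * dir_deriv b \<phi> x) +
      (LINT x|lborel. enn2real (riesz_potential \<alpha> (\<lambda>y. \<bar>u y\<bar> powr p) x) * sgn_powr p (u x) * \<phi> x) =
      (LINT x|lborel. sgn_powr q (u x) * \<phi> x)"
begin

text \<open>
  The potential \<open>I\<^sub>\<alpha> * |u|\<^sup>p\<close> as a real-valued function. Nothing is lost where it matters: by
  \<open>potential_energy_bound\<close>, the potential is finite almost everywhere on the set where \<open>u\<close> does not vanish.
\<close>

definition k :: "'a \<Rightarrow> real" where
  "k x = enn2real (riesz_potential \<alpha> (\<lambda>y. \<bar>u y\<bar> powr p) x)"

text \<open>
  The equation tested with \<open>w\<close>, where \<open>G b\<close> plays the role of the partial derivatives of \<open>w\<close>. These are carried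
  along explicitly so that limits of the pair can be taken.
\<close>

definition testable :: "('a \<Rightarrow> real) \<Rightarrow> ('a \<Rightarrow> 'a \<Rightarrow> real) \<Rightarrow> bool" where
  "testable w G \<longleftrightarrow>
     (\<Sum>b\<in>Basis. LINT x|lborel. g b x * G b x) + (LINT x|lborel. k x * sgn_powr p (u x) * w x) =
     (LINT x|lborel. sgn_powr q (u x) * w x)"

text \<open>
  Membership in the energy space, the natural class of test functions.
\<close>

definition admissible :: "('a \<Rightarrow> real) \<Rightarrow> ('a \<Rightarrow> 'a \<Rightarrow> real) \<Rightarrow> bool" where
  "admissible w G \<longleftrightarrow> partials w G \<and> (\<forall>b\<in>Basis. integrable lborel (\<lambda>x. \<bar>G b x\<bar> powr 2)) \<and>
     integrable lborel (\<lambda>x. \<bar>w x\<bar> powr q) \<and> coulomb_energy \<alpha> p w < \<infinity>"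

lemma u_measurable [measurable]: "u \<in> borel_measurable borel"
proof -
  obtain b :: 'a where "b \<in> Basis" using nonempty_Basis by blast
  then show ?thesis using u_partials wderivD(1) loc_int_measurable unfolding partials_def by blast
qed

lemma g_measurable: "b \<in> Basis \<Longrightarrow> g b \<in> borel_measurable borel"
  using u_partials wderivD(2) loc_int_measurable unfolding partials_def by blast

lemma k_measurable [measurable]: "k \<in> borel_measurable borel"
  unfolding k_def[abs_def] by measurable

lemma k_nonneg: "k x \<ge> 0"
  by (simp add: k_def)

lemma admissible_measurable:
  assumes "admissible w G"
  shows "w \<in> borel_measurable borel" "b \<in> Basis \<Longrightarrow> G b \<in> borel_measurable borel"
proof -
  obtain b :: 'a where "b \<in> Basis" using nonempty_Basis by blast
  then show "w \<in> borel_measurable borel"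
    using assms wderivD(1) loc_int_measurable unfolding admissible_def partials_def by blast
  show "b \<in> Basis \<Longrightarrow> G b \<in> borel_measurable borel" for b
    using assms wderivD(2) loc_int_measurable unfolding admissible_def partials_def by blast
qed

lemma potential_energy_bound:
  "\<exists>C<\<infinity>. \<forall>w \<in> borel_measurable borel. (\<integral>\<^sup>+x. riesz_potential \<alpha> (\<lambda>y. \<bar>u y\<bar> powr p) x * ennreal (\<bar>w x\<bar> powr p) \<partial>lborel) \<le>
     C * (coulomb_energy \<alpha> p u + coulomb_energy \<alpha> p w)"
proof -
  obtain C where C: "C \<ge> 0" "\<And>f h :: 'a \<Rightarrow> real. f \<in> borel_measurable borel \<Longrightarrow> h \<in> borel_measurable borel \<Longrightarrow>
    (\<And>x. f x \<ge> 0) \<Longrightarrow> (\<And>x. h x \<ge> 0) \<Longrightarrow>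
    (\<integral>\<^sup>+x. riesz_potential \<alpha> f x * ennreal (h x) \<partial>lborel) \<le>
    ennreal C * ((\<integral>\<^sup>+x. (riesz_potential (\<alpha> / 2) f x)\<^sup>2 \<partial>lborel) + (\<integral>\<^sup>+x. (riesz_potential (\<alpha> / 2) h x)\<^sup>2 \<partial>lborel))"
    using riesz_potential_pairing_le[OF \<alpha>] by blast
  have "(\<integral>\<^sup>+x. riesz_potential \<alpha> (\<lambda>y. \<bar>u y\<bar> powr p) x * ennreal (\<bar>w x\<bar> powr p) \<partial>lborel) \<le>
     ennreal C * (coulomb_energy \<alpha> p u + coulomb_energy \<alpha> p w)"
    if [measurable]: "w \<in> borel_measurable borel" for w
    unfolding coulomb_energy_def by (rule C(2)) auto
  then show ?thesis by (intro exI[of _ "ennreal C"]) auto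
qed

lemma k_bound:
  "\<exists>C<\<infinity>. \<forall>w \<in> borel_measurable borel.
     (\<integral>\<^sup>+x. ennreal (k x * \<bar>w x\<bar> powr p) \<partial>lborel) \<le> C * (coulomb_energy \<alpha> p u + coulomb_energy \<alpha> p w)"
proof -
  obtain C where C: "C < \<infinity>" "\<And>w. w \<in> borel_measurable borel \<Longrightarrow>
    (\<integral>\<^sup>+x. riesz_potential \<alpha> (\<lambda>y. \<bar>u y\<bar> powr p) x * ennreal (\<bar>w x\<bar> powr p) \<partial>lborel) \<le>
     C * (coulomb_energy \<alpha> p u + coulomb_energy \<alpha> p w)"
    using potential_energy_bound by blast
  have "(\<integral>\<^sup>+x. ennreal (k x * \<bar>w x\<bar> powr p) \<partial>lborel) \<le>
      (\<integral>\<^sup>+x. riesz_potential \<alpha> (\<lambda>y. \<bar>u y\<bar> powr p) x * ennreal (\<bar>w x\<bar> powr p) \<partial>lborel)" for w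
  proof (rule nn_integral_mono)
    fix x
    have "ennreal (k x) \<le> riesz_potential \<alpha> (\<lambda>y. \<bar>u y\<bar> powr p) x"
      unfolding k_def by (cases "riesz_potential \<alpha> (\<lambda>y. \<bar>u y\<bar> powr p) x") auto
    then show "ennreal (k x * \<bar>w x\<bar> powr p) \<le> riesz_potential \<alpha> (\<lambda>y. \<bar>u y\<bar> powr p) x * ennreal (\<bar>w x\<bar> powr p)"
      by (simp add: ennreal_mult k_nonneg mult_right_mono)
  qed
  with C show ?thesis by (meson order_trans)
qed

lemma k_u_integrable: "integrable lborel (\<lambda>x. k x * \<bar>u x\<bar> powr p)"
proof (rule integrableI_bounded)
  obtain C where C: "C < \<infinity>" "(\<integral>\<^sup>+x. ennreal (k x * \<bar>u x\<bar> powr p) \<partial>lborel) \<le> C * (coulomb_energy \<alpha> p u + coulomb_energy \<alpha> p u)"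
    using k_bound u_measurable by blast
  have "C * (coulomb_energy \<alpha> p u + coulomb_energy \<alpha> p u) < \<infinity>"
    using C(1) u_coulomb by (simp add: ennreal_mult_less_top)
  with C(2) show "(\<integral>\<^sup>+x. ennreal (norm (k x * \<bar>u x\<bar> powr p)) \<partial>lborel) < \<infinity>"
    by (simp add: abs_mult k_nonneg)
qed measurable

text \<open>
  Each of the three terms of the equation is an instance of the weak limit lemma: weight \<open>1\<close> with the
  exponents \<open>2\<close> and \<open>q\<close>, and weight \<open>k\<close> with the exponent \<open>p\<close>. In the last case the bound comes from
  the Coulomb energy.
\<close>

lemma testable_limit:
  assumes [measurable]: "\<And>n. w' n \<in> borel_measurable borel" "w \<in> borel_measurable borel"
    and G: "\<And>b n. b \<in> Basis \<Longrightarrow> G' n b \<in> borel_measurable borel" "\<And>b. b \<in> Basis \<Longrightarrow> G b \<in> borel_measurable borel"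
    and t: "\<And>n. testable (w' n) (G' n)"
    and w: "AE x in lborel. (\<lambda>n. w' n x) \<longlonglongrightarrow> w x"
    and Glim: "\<And>b. b \<in> Basis \<Longrightarrow> AE x in lborel. (\<lambda>n. G' n b x) \<longlonglongrightarrow> G b x"
    and BG: "\<And>b n. b \<in> Basis \<Longrightarrow> (\<integral>\<^sup>+x. ennreal (\<bar>G' n b x\<bar> powr 2) \<partial>lborel) \<le> B b" "\<And>b. b \<in> Basis \<Longrightarrow> B b < \<infinity>"
    and Bq: "\<And>n. (\<integral>\<^sup>+x. ennreal (\<bar>w' n x\<bar> powr q) \<partial>lborel) \<le> Bq" "Bq < \<infinity>"
    and Bp: "\<And>n. coulomb_energy \<alpha> p (w' n) \<le> Bp" "Bp < \<infinity>"
  shows "testable w G"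
proof -
  have "(\<lambda>n. LINT x|lborel. 1 * sgn_powr 2 (g b x) * G' n b x) \<longlonglongrightarrow> (LINT x|lborel. 1 * sgn_powr 2 (g b x) * G b x)"
    if b: "b \<in> Basis" for b
  proof (rule sgn_powr_weak_limit(2)[where B = "B b"])
    show "AE x in lborel. (1::real) \<noteq> 0 \<longrightarrow> (\<lambda>n. G' n b x) \<longlonglongrightarrow> G b x" using Glim[OF b] by simp
  qed (use b G BG g_measurable[OF b] g_sq[OF b] in simp_all)
  then have 1: "(\<lambda>n. \<Sum>b\<in>Basis. LINT x|lborel. g b x * G' n b x) \<longlonglongrightarrow> (\<Sum>b\<in>Basis. LINT x|lborel. g b x * G b x)"
    by (intro tendsto_sum) simp
  have "(\<lambda>n. LINT x|lborel. 1 * sgn_powr q (u x) * w' n x) \<longlonglongrightarrow> (LINT x|lborel. 1 * sgn_powr q (u x) * w x)"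
  proof (rule sgn_powr_weak_limit(2)[OF q, where B = Bq])
    show "AE x in lborel. (1::real) \<noteq> 0 \<longrightarrow> (\<lambda>n. w' n x) \<longlonglongrightarrow> w x" using w by simp
  qed (use Bq u_q in simp_all)
  then have 3: "(\<lambda>n. LINT x|lborel. sgn_powr q (u x) * w' n x) \<longlonglongrightarrow> (LINT x|lborel. sgn_powr q (u x) * w x)"
    by simp
  obtain C where C: "C < \<infinity>" "\<And>v. v \<in> borel_measurable borel \<Longrightarrow>
     (\<integral>\<^sup>+x. ennreal (k x * \<bar>v x\<bar> powr p) \<partial>lborel) \<le> C * (coulomb_energy \<alpha> p u + coulomb_energy \<alpha> p v)"
    using k_bound by blast
  have 2: "(\<lambda>n. LINT x|lborel. k x * sgn_powr p (u x) * w' n x) \<longlonglongrightarrow> (LINT x|lborel. k x * sgn_powr p (u x) * w x)"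
  proof (rule sgn_powr_weak_limit(2)[OF p, where B = "C * (coulomb_energy \<alpha> p u + Bp)"])
    show "AE x in lborel. k x \<noteq> 0 \<longrightarrow> (\<lambda>n. w' n x) \<longlonglongrightarrow> w x" using w by eventually_elim simp
    show "(\<integral>\<^sup>+x. ennreal (k x * \<bar>w' n x\<bar> powr p) \<partial>lborel) \<le> C * (coulomb_energy \<alpha> p u + Bp)" for n
      by (rule order_trans[OF C(2)]) (auto intro!: mult_left_mono add_left_mono Bp)
    show "C * (coulomb_energy \<alpha> p u + Bp) < \<infinity>"
      using C(1) Bp(2) u_coulomb by (simp add: ennreal_mult_less_top)
  qed (use k_u_integrable k_nonneg in simp_all)
  have "(\<lambda>n. LINT x|lborel. sgn_powr q (u x) * w' n x) \<longlonglongrightarrow>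
      (\<Sum>b\<in>Basis. LINT x|lborel. g b x * G b x) + (LINT x|lborel. k x * sgn_powr p (u x) * w x)"
    using tendsto_add[OF 1 2] t by (simp add: testable_def)
  with 3 show ?thesis unfolding testable_def by (rule LIMSEQ_unique[symmetric])
qed

text \<open>
  Apply the result for one sequence to the sum of the absolute values.
\<close>

lemma finite_family_AE_subseq:
  fixes f :: "'i \<Rightarrow> nat \<Rightarrow> 'a \<Rightarrow> real"
  assumes I: "finite I" and [measurable]: "\<And>i n. i \<in> I \<Longrightarrow> f i n \<in> borel_measurable borel"
    and lim: "\<And>i. i \<in> I \<Longrightarrow> (\<lambda>n. \<integral>\<^sup>+x. ennreal \<bar>f i n x\<bar> \<partial>lborel) \<longlonglongrightarrow> 0"
  shows "\<exists>s::nat \<Rightarrow> nat. strict_mono s \<and> (\<forall>i\<in>I. AE x in lborel. (\<lambda>n. f i (s n) x) \<longlonglongrightarrow> 0)"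
proof -
  define F where "F n x = (\<Sum>i\<in>I. \<bar>f i n x\<bar>)" for n x
  have "(\<integral>\<^sup>+x. ennreal \<bar>F n x\<bar> \<partial>lborel) = (\<Sum>i\<in>I. \<integral>\<^sup>+x. ennreal \<bar>f i n x\<bar> \<partial>lborel)" for n
  proof -
    have "\<bar>F n x\<bar> = F n x" for x unfolding F_def by (intro abs_of_nonneg sum_nonneg) auto
    then have "(\<integral>\<^sup>+x. ennreal \<bar>F n x\<bar> \<partial>lborel) = (\<integral>\<^sup>+x. (\<Sum>i\<in>I. ennreal \<bar>f i n x\<bar>) \<partial>lborel)"
      by (simp add: F_def sum_ennreal)
    also have "\<dots> = (\<Sum>i\<in>I. \<integral>\<^sup>+x. ennreal \<bar>f i n x\<bar> \<partial>lborel)"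
      by (rule nn_integral_sum) auto
    finally show ?thesis .
  qed
  moreover have "(\<lambda>n. \<Sum>i\<in>I. \<integral>\<^sup>+x. ennreal \<bar>f i n x\<bar> \<partial>lborel) \<longlonglongrightarrow> (\<Sum>i\<in>I. 0)"
    by (intro tendsto_sum lim)
  ultimately have "(\<lambda>n. \<integral>\<^sup>+x. ennreal \<bar>F n x\<bar> \<partial>lborel) \<longlonglongrightarrow> 0" by simp
  moreover have "F n \<in> borel_measurable lborel" for n
    unfolding F_def by (intro borel_measurable_sum) auto
  ultimately obtain s where s: "strict_mono s" "AE x in lborel. (\<lambda>n. F (s n) x) \<longlonglongrightarrow> 0"
    using L1_imp_AE_subseq[of F] by blast
  have "AE x in lborel. (\<lambda>n. f i (s n) x) \<longlonglongrightarrow> 0" if i: "i \<in> I" for i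
    using s(2)
  proof eventually_elim
    case (elim x)
    have "norm (f i (s n) x) \<le> F (s n) x" for n
      unfolding F_def using I i by (auto intro: member_le_sum)
    then show ?case by (intro Lim_null_comparison[OF _ elim]) auto
  qed
  with s(1) show ?thesis by blast
qed

lemma loc_int_mollify:
  fixes h :: "'a \<Rightarrow> real"
  assumes h: "loc_int h"
  shows "moll (std_mollifier n) h \<in> borel_measurable borel"
    and "r > 1 \<Longrightarrow> (\<integral>\<^sup>+x. ennreal (\<bar>moll (std_mollifier n) h x\<bar> powr r) \<partial>lborel) \<le> (\<integral>\<^sup>+x. ennreal (\<bar>h x\<bar> powr r) \<partial>lborel)"
    and "coulomb_energy \<alpha> p (moll (std_mollifier n) h) \<le> coulomb_energy \<alpha> p h"
proof -
  have [measurable]: "h \<in> borel_measurable borel" using h by (rule loc_int_measurable)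
  interpret random_shift "density lborel (\<lambda>x::'a. ennreal (std_mollifier n x))" uminus
    by (rule mollifier_random_shift[OF mollifier_std])
  have eq: "moll (std_mollifier n) h = avg (density lborel (\<lambda>x. ennreal (std_mollifier n x))) uminus h"
    by (rule moll_eq_avg[OF mollifier_std]) simp
  show "moll (std_mollifier n) h \<in> borel_measurable borel" unfolding eq by measurable
  show "coulomb_energy \<alpha> p (moll (std_mollifier n) h) \<le> coulomb_energy \<alpha> p h"
    unfolding eq by (rule coulomb_energy_avg_le[OF \<alpha> p]) measurable
  assume r: "r > 1"
  have "(\<integral>\<^sup>+x. ennreal (\<bar>moll (std_mollifier n) h x\<bar> powr r) \<partial>lborel) \<le>
    (\<integral>\<^sup>+x. (\<integral>\<^sup>+\<omega>. ennreal (\<bar>h (x + (- \<omega>))\<bar> powr r) \<partial>density lborel (\<lambda>x. ennreal (std_mollifier n x))) \<partial>lborel)"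
    unfolding eq by (intro nn_integral_mono jensen_avg r) measurable
  also have "\<dots> = (\<integral>\<^sup>+x. ennreal (\<bar>h x\<bar> powr r) \<partial>lborel)"
    by (rule nn_integral_avg[of "\<lambda>x. ennreal (\<bar>h x\<bar> powr r)"]) measurable
  finally show "(\<integral>\<^sup>+x. ennreal (\<bar>moll (std_mollifier n) h x\<bar> powr r) \<partial>lborel) \<le> (\<integral>\<^sup>+x. ennreal (\<bar>h x\<bar> powr r) \<partial>lborel)" .
qed

lemma integrable_nn_finite:
  fixes f :: "'a \<Rightarrow> real"
  assumes "integrable lborel f" "\<And>x. f x \<ge> 0" shows "(\<integral>\<^sup>+x. ennreal (f x) \<partial>lborel) < \<infinity>"
  using assms by (simp add: nn_integral_eq_integral)

lemma bounded_support_loc_int_integrable: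
  fixes h :: "'a \<Rightarrow> real"
  assumes "loc_int h" "bounded_support h"
  shows "integrable lborel h"
proof -
  obtain R where "\<And>x. norm x > R \<Longrightarrow> h x = 0" using assms by (auto simp: bounded_support_def)
  then have "(\<lambda>x. indicator (cball 0 R) x * h x) = h" by (auto simp: indicator_def fun_eq_iff not_le)
  moreover have "integrable lborel (\<lambda>x. indicator (cball 0 R) x * h x)" using assms by (simp add: loc_int_def)
  ultimately show ?thesis by simp
qed

lemma wderiv_bounded_support_integrable:
  fixes w v :: "'a \<Rightarrow> real"
  assumes w: "wderiv e w v" and supp: "bounded_support w"
  shows "integrable lborel v"
proof -
  obtain R where R: "\<And>x. norm x > R \<Longrightarrow> w x = 0" using supp by (auto simp: bounded_support_def)
  obtain \<zeta> :: "'a \<Rightarrow> real" where \<zeta>: "\<zeta> \<in> test_functions" "\<And>x. norm x \<le> R \<Longrightarrow> \<zeta> x = 1"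
    using cutoff_exists[of R] by blast
  have "\<zeta> x * w x = w x" for x using R[of x] \<zeta>(2)[of x] by (cases "norm x \<le> R") auto
  then have "wderiv e w (\<lambda>x. \<zeta> x * v x + dir_deriv e \<zeta> x * w x)"
    using wderiv_test_mult[OF w \<zeta>(1)] by (simp only:)
  from wderiv_unique[OF this w] have AE: "AE x in lborel. \<zeta> x * v x + dir_deriv e \<zeta> x * w x = v x" .
  have int: "integrable lborel (\<lambda>x. \<zeta> x * v x + dir_deriv e \<zeta> x * w x)"
    using wderivD(1,2)[OF w] \<zeta>(1)
    by (intro Bochner_Integration.integrable_add loc_int_test_integrable test_functions_dir_deriv)
  have "v \<in> borel_measurable lborel" using loc_int_measurable[OF wderivD(2)[OF w]] by simp
  then show ?thesis using integrable_cong_AE_imp[OF int] AE by blast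
qed

text \<open>
  Mollifications of \<open>w\<close> are smooth test functions, their derivatives are the mollified weak derivatives, and
  none of the norms increases.
\<close>

lemma testable_bounded_support:
  assumes adm: "admissible w G" and supp: "bounded_support w"
  shows "testable w G"
proof -
  have d: "wderiv b w (G b)" if "b \<in> Basis" for b using adm that by (simp add: admissible_def partials_def)
  note m = admissible_measurable[OF adm]
  obtain b0 :: 'a where b0: "b0 \<in> Basis" using nonempty_Basis by blast
  have lw: "loc_int w" using wderivD(1)[OF d[OF b0]] .
  have iw: "integrable lborel w" by (rule bounded_support_loc_int_integrable[OF lw supp])
  have iG: "integrable lborel (G b)" if "b \<in> Basis" for b
    by (rule wderiv_bounded_support_integrable[OF d[OF that] supp])
  define I where "I = insert w (G ` Basis)"
  have I: "integrable lborel h" if "h \<in> I" for h using that iw iG by (auto simp: I_def)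
  have "\<exists>s::nat \<Rightarrow> nat. strict_mono s \<and> (\<forall>h\<in>I. AE x in lborel. (\<lambda>n. moll (std_mollifier (s n)) h x - h x) \<longlonglongrightarrow> 0)"
  proof (rule finite_family_AE_subseq)
    show "finite I" by (simp add: I_def)
    show "(\<lambda>n. \<integral>\<^sup>+x. ennreal \<bar>moll (std_mollifier n) h x - h x\<bar> \<partial>lborel) \<longlonglongrightarrow> 0" if "h \<in> I" for h
      by (rule moll_tendsto_L1[OF I[OF that]])
    show "(\<lambda>x. moll (std_mollifier n) h x - h x) \<in> borel_measurable borel" if "h \<in> I" for h n
    proof -
      have "moll (std_mollifier n) h \<in> borel_measurable borel"
        by (rule loc_int_mollify(1)[OF integrable_imp_loc_int[OF I[OF that]]])
      moreover have "h \<in> borel_measurable borel" using I[OF that] by auto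
      ultimately show ?thesis by measurable
    qed
  qed
  then obtain s :: "nat \<Rightarrow> nat" where s': "\<forall>h\<in>I. AE x in lborel. (\<lambda>n. moll (std_mollifier (s n)) h x - h x) \<longlonglongrightarrow> 0"
    by blast
  have s: "AE x in lborel. (\<lambda>n. moll (std_mollifier (s n)) h x) \<longlonglongrightarrow> h x" if "h \<in> I" for h
    using bspec[OF s' that] by eventually_elim (rule LIM_zero_cancel)
  note LM = loc_int_mollify[OF integrable_imp_loc_int]
  show ?thesis
  proof (rule testable_limit[where w' = "\<lambda>n. moll (std_mollifier (s n)) w" and G' = "\<lambda>n b. moll (std_mollifier (s n)) (G b)"
        and B = "\<lambda>b. \<integral>\<^sup>+x. ennreal (\<bar>G b x\<bar> powr 2) \<partial>lborel" and Bq = "\<integral>\<^sup>+x. ennreal (\<bar>w x\<bar> powr q) \<partial>lborel"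
        and Bp = "coulomb_energy \<alpha> p w"])
    show "testable (moll (std_mollifier (s n)) w) (\<lambda>b. moll (std_mollifier (s n)) (G b))" for n
    proof -
      have t: "moll (std_mollifier (s n)) w \<in> test_functions"
        by (rule moll_test_functions[OF std_mollifier_test iw supp])
      have "dir_deriv b (moll (std_mollifier (s n)) w) x = moll (std_mollifier (s n)) (G b) x" if "b \<in> Basis" for b x
        unfolding dir_deriv_moll[OF std_mollifier_test iw]
        by (rule moll_dir_deriv_wderiv[OF d[OF that] std_mollifier_test])
      with weak_eq[OF t] show ?thesis by (simp add: testable_def k_def)
    qed
    show "AE x in lborel. (\<lambda>n. moll (std_mollifier (s n)) w x) \<longlonglongrightarrow> w x" by (rule s) (simp add: I_def)
    show "AE x in lborel. (\<lambda>n. moll (std_mollifier (s n)) (G b) x) \<longlonglongrightarrow> G b x" if "b \<in> Basis" for b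
      using that by (intro s) (simp add: I_def)
    show "coulomb_energy \<alpha> p (moll (std_mollifier (s n)) w) \<le> coulomb_energy \<alpha> p w" for n by (rule LM(3)[OF iw])
    show "(\<integral>\<^sup>+x. ennreal (\<bar>moll (std_mollifier (s n)) w x\<bar> powr q) \<partial>lborel) \<le> (\<integral>\<^sup>+x. ennreal (\<bar>w x\<bar> powr q) \<partial>lborel)" for n
      by (rule LM(2)[OF iw q])
    show "(\<integral>\<^sup>+x. ennreal (\<bar>moll (std_mollifier (s n)) (G b) x\<bar> powr 2) \<partial>lborel) \<le> (\<integral>\<^sup>+x. ennreal (\<bar>G b x\<bar> powr 2) \<partial>lborel)"
      if "b \<in> Basis" for b n
      by (rule LM(2)[OF iG[OF that]]) simp
    show "moll (std_mollifier (s n)) w \<in> borel_measurable borel" for n by (rule LM(1)[OF iw])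
    show "moll (std_mollifier (s n)) (G b) \<in> borel_measurable borel" if "b \<in> Basis" for n b by (rule LM(1)[OF iG[OF that]])
    show "(\<integral>\<^sup>+x. ennreal (\<bar>G b x\<bar> powr 2) \<partial>lborel) < \<infinity>" if "b \<in> Basis" for b
      using adm that by (intro integrable_nn_finite) (auto simp: admissible_def)
    show "(\<integral>\<^sup>+x. ennreal (\<bar>w x\<bar> powr q) \<partial>lborel) < \<infinity>"
      using adm by (intro integrable_nn_finite) (auto simp: admissible_def)
    show "coulomb_energy \<alpha> p w < \<infinity>" using adm by (simp add: admissible_def)
    show "w \<in> borel_measurable borel" by (rule m(1))
    show "G b \<in> borel_measurable borel" if "b \<in> Basis" for b by (rule m(2)[OF that])
  qed
qed

text \<open>
  By \<open>wderiv_difference\<close> the difference is \<open>t\<close> times an average of a square integrable derivative.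
\<close>

lemma solution_difference_square_integrable:
  assumes b: "b \<in> Basis"
  shows "integrable lborel (\<lambda>x. \<bar>u (x + t *\<^sub>R b) - u x\<bar> powr 2)"
proof (rule integrableI_bounded)
  have d: "wderiv b u (g b)" using u_partials b by (simp add: partials_def)
  have [measurable]: "g b \<in> borel_measurable borel" by (rule g_measurable[OF b])
  have "AE x in lborel. ennreal (norm (\<bar>u (x + t *\<^sub>R b) - u x\<bar> powr 2)) = ennreal (t\<^sup>2) * ennreal (\<bar>line_avg t b (g b) x\<bar> powr 2)"
    using wderiv_difference[OF d, of t]
    by eventually_elim (simp add: abs_mult power_mult_distrib ennreal_mult)
  then have "(\<integral>\<^sup>+x. ennreal (norm (\<bar>u (x + t *\<^sub>R b) - u x\<bar> powr 2)) \<partial>lborel) =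
      (\<integral>\<^sup>+x. ennreal (t\<^sup>2) * ennreal (\<bar>line_avg t b (g b) x\<bar> powr 2) \<partial>lborel)"
    by (rule nn_integral_cong_AE)
  also have "\<dots> = ennreal (t\<^sup>2) * (\<integral>\<^sup>+x. ennreal (\<bar>line_avg t b (g b) x\<bar> powr 2) \<partial>lborel)"
    by (rule nn_integral_cmult) measurable
  also have "\<dots> \<le> ennreal (t\<^sup>2) * (\<integral>\<^sup>+x. ennreal (\<bar>g b x\<bar> powr 2) \<partial>lborel)"
    by (intro mult_left_mono nn_integral_line_avg_powr) auto
  also have "\<dots> < \<infinity>"
    using integrable_nn_finite[OF g_sq[OF b]] by (simp add: ennreal_mult_less_top)
  finally show "(\<integral>\<^sup>+x. ennreal (norm (\<bar>u (x + t *\<^sub>R b) - u x\<bar> powr 2)) \<partial>lborel) < \<infinity>" .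
qed measurable

lemma powr_add_le:
  fixes a c r :: real
  assumes "r \<ge> 0" shows "\<bar>a + c\<bar> powr r \<le> 2 powr r * \<bar>a\<bar> powr r + 2 powr r * \<bar>c\<bar> powr r"
proof (cases "\<bar>a\<bar> \<le> \<bar>c\<bar>")
  case True
  then have "\<bar>a + c\<bar> powr r \<le> (2 * \<bar>c\<bar>) powr r" by (intro powr_mono2 assms) auto
  then show ?thesis by (simp add: powr_mult add_increasing)
next
  case False
  then have "\<bar>a + c\<bar> powr r \<le> (2 * \<bar>a\<bar>) powr r" by (intro powr_mono2 assms) auto
  then show ?thesis by (simp add: powr_mult add_increasing2)
qed

lemma powr_integrable_add:
  fixes v w :: "'a \<Rightarrow> real"
  assumes r: "r \<ge> 0" and [measurable]: "v \<in> borel_measurable borel" "w \<in> borel_measurable borel"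
    and int: "integrable lborel (\<lambda>x. \<bar>v x\<bar> powr r)" "integrable lborel (\<lambda>x. \<bar>w x\<bar> powr r)"
  shows "integrable lborel (\<lambda>x. \<bar>v x + w x\<bar> powr r)"
proof (rule Bochner_Integration.integrable_bound)
  show "integrable lborel (\<lambda>x. 2 powr r * \<bar>v x\<bar> powr r + 2 powr r * \<bar>w x\<bar> powr r)"
    by (intro Bochner_Integration.integrable_add integrable_mult_right int)
  show "AE x in lborel. norm (\<bar>v x + w x\<bar> powr r) \<le> norm (2 powr r * \<bar>v x\<bar> powr r + 2 powr r * \<bar>w x\<bar> powr r)"
    using powr_add_le[OF r] by (intro AE_I2) simp
qed measurable

text \<open>
  Cut off with \<open>\<zeta>(c x)\<close> and let \<open>c \<rightarrow> 0\<close>. The derivative of the product contains \<open>c w\<close> times a bounded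
  function, which is controlled because \<open>w\<close> is square integrable; the other norms do not increase.
\<close>

lemma testable_square_integrable:
  assumes adm: "admissible w G" and sq: "integrable lborel (\<lambda>x. \<bar>w x\<bar> powr 2)"
  shows "testable w G"
proof -
  have d: "wderiv b w (G b)" if "b \<in> Basis" for b using adm that by (simp add: admissible_def partials_def)
  have wq: "integrable lborel (\<lambda>x. \<bar>w x\<bar> powr q)" and wc: "coulomb_energy \<alpha> p w < \<infinity>"
    and Gsq: "\<And>b. b \<in> Basis \<Longrightarrow> integrable lborel (\<lambda>x. \<bar>G b x\<bar> powr 2)" using adm by (auto simp: admissible_def)
  note m = admissible_measurable[OF adm]
  have [measurable]: "w \<in> borel_measurable borel" by (rule m(1))
  obtain \<zeta> :: "'a \<Rightarrow> real" where \<zeta>: "\<zeta> \<in> test_functions" "\<And>x. 0 \<le> \<zeta> x" "\<And>x. \<zeta> x \<le> 1" "\<And>x. norm x \<le> 1 \<Longrightarrow> \<zeta> x = 1"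
    using cutoff_exists[of 1] by blast
  have "Ck (Suc 0) \<zeta>" "bounded_support \<zeta>" using \<zeta>(1) by (auto simp: test_functions_iff simp del: Ck.simps)
  then obtain K where K: "K \<ge> 0" "\<And>x v. \<bar>dir_deriv v \<zeta> x\<bar> \<le> K * norm v"
    using Ck1_bounded_derivative by blast
  define c where "c n = inverse (real (Suc n))" for n
  have c: "0 < c n" "c n \<le> 1" for n by (auto simp: c_def inverse_le_1_iff)
  have c0: "c \<longlonglongrightarrow> 0" unfolding c_def by (rule LIMSEQ_inverse_real_of_nat)
  define \<zeta>' where "\<zeta>' n = (\<lambda>x. \<zeta> (0 + c n *\<^sub>R x))" for n
  have \<zeta>': "\<zeta>' n \<in> test_functions" for n
    unfolding \<zeta>'_def using c(1)[of n] by (intro test_functions_affine \<zeta>(1)) auto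
  have [measurable]: "\<zeta>' n \<in> borel_measurable borel" "dir_deriv b (\<zeta>' n) \<in> borel_measurable borel" for n b
    using test_functions_measurable[OF \<zeta>'] test_functions_measurable[OF test_functions_dir_deriv[OF \<zeta>']] by auto
  have D: "\<bar>dir_deriv b (\<zeta>' n) x\<bar> \<le> K * c n" if "b \<in> Basis" for b n x
  proof -
    have "dir_deriv b (\<zeta>' n) x = c n * dir_deriv b \<zeta> (0 + c n *\<^sub>R x)"
      unfolding \<zeta>'_def by (subst dir_deriv_affine[OF test_functions_Ck[OF \<zeta>(1)]]) simp
    moreover have "c n * \<bar>dir_deriv b \<zeta> (0 + c n *\<^sub>R x)\<bar> \<le> c n * K"
      using K(2)[of b] that c(1)[of n] by (intro mult_left_mono) auto
    ultimately show ?thesis using c(1)[of n] by (simp add: abs_mult mult.commute)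
  qed
  have \<zeta>'1: "0 \<le> \<zeta>' n x" "\<zeta>' n x \<le> 1" for n x using \<zeta> by (auto simp: \<zeta>'_def)
  have ev: "\<forall>\<^sub>F n in sequentially. \<zeta>' n x = 1" for x
  proof -
    have "(\<lambda>n. c n * norm x) \<longlonglongrightarrow> 0" using tendsto_mult_left_zero[OF c0] .
    then have "\<forall>\<^sub>F n in sequentially. c n * norm x < 1" by (rule order_tendstoD) simp
    then show ?thesis
      by eventually_elim (use c in \<open>auto simp: \<zeta>'_def less_imp_le intro!: \<zeta>(4)\<close>)
  qed
  define w' where "w' n x = \<zeta>' n x * w x" for n x
  define G' where "G' n b x = \<zeta>' n x * G b x + dir_deriv b (\<zeta>' n) x * w x" for n b x
  have w'le: "\<bar>w' n x\<bar> \<le> \<bar>w x\<bar>" for n x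
    using \<zeta>'1[of n x] by (simp add: w'_def abs_mult mult_left_le_one_le)
  have G'le: "\<bar>G' n b x\<bar> powr 2 \<le> 4 * \<bar>G b x\<bar> powr 2 + 4 * K\<^sup>2 * \<bar>w x\<bar> powr 2" if b: "b \<in> Basis" for n b x
  proof -
    have "\<bar>\<zeta>' n x * G b x\<bar> powr 2 \<le> \<bar>G b x\<bar> powr 2"
      using \<zeta>'1[of n x] by (intro powr_mono2) (auto simp: abs_mult mult_left_le_one_le)
    moreover have "\<bar>dir_deriv b (\<zeta>' n) x * w x\<bar> powr 2 \<le> (K * \<bar>w x\<bar>) powr 2"
    proof -
      have "K * c n \<le> K" using K(1) c(2)[of n] by (simp add: mult_left_le)
      then have "\<bar>dir_deriv b (\<zeta>' n) x\<bar> \<le> K" using D[OF b, of n x] by linarith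
      then show ?thesis by (intro powr_mono2) (auto simp: abs_mult mult_right_mono)
    qed
    moreover have "(K * \<bar>w x\<bar>) powr 2 = K\<^sup>2 * \<bar>w x\<bar> powr 2" using K(1) by (simp add: power_mult_distrib)
    ultimately show ?thesis
      using powr_add_le[of 2 "\<zeta>' n x * G b x" "dir_deriv b (\<zeta>' n) x * w x"] unfolding G'_def by simp
  qed
  have mG: "G' n b \<in> borel_measurable borel" if "b \<in> Basis" for n b
    using m(2)[OF that] unfolding G'_def[abs_def] by measurable
  have mw: "w' n \<in> borel_measurable borel" for n unfolding w'_def[abs_def] by measurable
  have ce: "coulomb_energy \<alpha> p (w' n) \<le> coulomb_energy \<alpha> p w" for n
    using p by (intro coulomb_energy_mono \<alpha> w'le) auto
  have iq: "integrable lborel (\<lambda>x. \<bar>w' n x\<bar> powr q)" for n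
  proof (rule Bochner_Integration.integrable_bound[OF wq])
    show "AE x in lborel. norm (\<bar>w' n x\<bar> powr q) \<le> norm (\<bar>w x\<bar> powr q)"
      using w'le q by (intro AE_I2) (simp add: powr_mono2)
  qed (use mw in measurable)
  have i4: "integrable lborel (\<lambda>x. 4 * \<bar>G b x\<bar> powr 2 + 4 * K\<^sup>2 * \<bar>w x\<bar> powr 2)" if b: "b \<in> Basis" for b
    by (intro Bochner_Integration.integrable_add integrable_mult_right Gsq[OF b] sq)
  have iG: "integrable lborel (\<lambda>x. \<bar>G' n b x\<bar> powr 2)" if b: "b \<in> Basis" for n b
  proof (rule Bochner_Integration.integrable_bound[OF i4[OF b]])
    show "AE x in lborel. norm (\<bar>G' n b x\<bar> powr 2) \<le> norm (4 * \<bar>G b x\<bar> powr 2 + 4 * K\<^sup>2 * \<bar>w x\<bar> powr 2)"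
      using G'le[OF b] by (intro AE_I2) simp
  qed (use mG[OF b] in measurable)
  show ?thesis
  proof (rule testable_limit[where w' = w' and G' = G' and B = "\<lambda>b. \<integral>\<^sup>+x. ennreal (4 * \<bar>G b x\<bar> powr 2 + 4 * K\<^sup>2 * \<bar>w x\<bar> powr 2) \<partial>lborel"
        and Bq = "\<integral>\<^sup>+x. ennreal (\<bar>w x\<bar> powr q) \<partial>lborel" and Bp = "coulomb_energy \<alpha> p w"])
    show "testable (w' n) (G' n)" for n
    proof (rule testable_bounded_support)
      have "partials (w' n) (G' n)"
        unfolding partials_def w'_def[abs_def] G'_def[abs_def] using wderiv_test_mult[OF d \<zeta>'] by blast
      moreover have "coulomb_energy \<alpha> p (w' n) < \<infinity>" using ce[of n] wc by (rule le_less_trans)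
      ultimately show "admissible (w' n) (G' n)" unfolding admissible_def using iG iq by blast
      obtain R where "\<And>x. norm x > R \<Longrightarrow> \<zeta>' n x = 0" using \<zeta>'[of n] by (auto simp: test_functions_iff bounded_support_def)
      then show "bounded_support (w' n)" unfolding bounded_support_def w'_def by auto
    qed
    show "AE x in lborel. (\<lambda>n. w' n x) \<longlonglongrightarrow> w x"
    proof (rule AE_I2)
      fix x
      have "\<forall>\<^sub>F n in sequentially. w x = w' n x" using ev[of x] by eventually_elim (simp add: w'_def)
      then show "(\<lambda>n. w' n x) \<longlonglongrightarrow> w x" by (rule Lim_transform_eventually[OF tendsto_const])
    qed
    show "AE x in lborel. (\<lambda>n. G' n b x) \<longlonglongrightarrow> G b x" if b: "b \<in> Basis" for b
    proof (rule AE_I2)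
      fix x
      have "(\<lambda>n. K * c n) \<longlonglongrightarrow> 0" using tendsto_mult_right_zero[OF c0] .
      then have "(\<lambda>n. dir_deriv b (\<zeta>' n) x) \<longlonglongrightarrow> 0"
        by (rule Lim_null_comparison[rotated]) (use D[OF b] in simp)
      then have "(\<lambda>n. dir_deriv b (\<zeta>' n) x * w x) \<longlonglongrightarrow> 0" by (rule tendsto_mult_left_zero)
      then have 1: "(\<lambda>n. G b x + dir_deriv b (\<zeta>' n) x * w x) \<longlonglongrightarrow> G b x + 0"
        by (intro tendsto_add tendsto_const)
      have "\<forall>\<^sub>F n in sequentially. G b x + dir_deriv b (\<zeta>' n) x * w x = G' n b x"
        using ev[of x] by eventually_elim (simp add: G'_def)
      from Lim_transform_eventually[OF 1 this] show "(\<lambda>n. G' n b x) \<longlonglongrightarrow> G b x" by simp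
    qed
    show "(\<integral>\<^sup>+x. ennreal (\<bar>G' n b x\<bar> powr 2) \<partial>lborel) \<le> (\<integral>\<^sup>+x. ennreal (4 * \<bar>G b x\<bar> powr 2 + 4 * K\<^sup>2 * \<bar>w x\<bar> powr 2) \<partial>lborel)"
      if "b \<in> Basis" for b n
      by (intro nn_integral_mono ennreal_leI G'le[OF that])
    show "(\<integral>\<^sup>+x. ennreal (4 * \<bar>G b x\<bar> powr 2 + 4 * K\<^sup>2 * \<bar>w x\<bar> powr 2) \<partial>lborel) < \<infinity>" if "b \<in> Basis" for b
      by (rule integrable_nn_finite[OF i4[OF that]]) simp
    show "(\<integral>\<^sup>+x. ennreal (\<bar>w' n x\<bar> powr q) \<partial>lborel) \<le> (\<integral>\<^sup>+x. ennreal (\<bar>w x\<bar> powr q) \<partial>lborel)" for n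
      using w'le q by (intro nn_integral_mono ennreal_leI powr_mono2) auto
    show "(\<integral>\<^sup>+x. ennreal (\<bar>w x\<bar> powr q) \<partial>lborel) < \<infinity>" by (rule integrable_nn_finite[OF wq]) simp
    show "coulomb_energy \<alpha> p (w' n) \<le> coulomb_energy \<alpha> p w" for n by (rule ce)
    show "coulomb_energy \<alpha> p w < \<infinity>" by (rule wc)
    show "w' n \<in> borel_measurable borel" for n by (rule mw)
    show "w \<in> borel_measurable borel" by (rule m(1))
    show "G' n b \<in> borel_measurable borel" if "b \<in> Basis" for n b by (rule mG[OF that])
    show "G b \<in> borel_measurable borel" if "b \<in> Basis" for b by (rule m(2)[OF that])
  qed
qed

text \<open>
  On the ball of radius \<open>n/2\<close> the translate by \<open>n b\<close> takes values of \<open>h\<close> at distance at least \<open>n/2\<close> from the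
  origin, so its integral over this growing ball is at most a tail of the integral of \<open>|h|\<close>. A subsequence
  converges almost everywhere, and every point lies in all balls from some index on.
\<close>

lemma integrable_translates_tendsto_zero:
  fixes h :: "'a \<Rightarrow> real"
  assumes h: "integrable lborel h" and b: "b \<in> Basis"
  shows "\<exists>s::nat \<Rightarrow> nat. strict_mono s \<and> (AE x in lborel. (\<lambda>n. h (x + real (s n) *\<^sub>R b)) \<longlonglongrightarrow> 0)"
proof -
  have [measurable]: "h \<in> borel_measurable borel" using h by auto
  define f where "f n x = indicator (cball 0 (real n / 2)) x * h (x + real n *\<^sub>R b)" for n x
  define e where "e n x = indicator (- ball 0 (real n / 2)) x * \<bar>h x\<bar>" for n and x :: 'a
  have e: "(\<lambda>n. LINT x|lborel. e n x) \<longlonglongrightarrow> 0"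
  proof (rule integral_dominated_convergence_zero[where w = "\<lambda>x. \<bar>h x\<bar>"])
    show "e n \<in> borel_measurable lborel" for n unfolding e_def by measurable
    show "AE x in lborel. (\<lambda>n. e n x) \<longlonglongrightarrow> 0"
    proof (rule AE_I2)
      fix x :: 'a
      have "\<forall>\<^sub>F n in sequentially. 0 = e n x"
      proof (rule eventually_sequentiallyI[of "nat \<lceil>2 * norm x\<rceil> + 1"])
        fix n assume "n \<ge> nat \<lceil>2 * norm x\<rceil> + 1"
        then have "2 * norm x < real n" by linarith
        then show "0 = e n x" by (simp add: e_def)
      qed
      then show "(\<lambda>n. e n x) \<longlonglongrightarrow> 0" by (rule Lim_transform_eventually[OF tendsto_const])
    qed
    show "AE x in lborel. norm (e n x) \<le> \<bar>h x\<bar>" for n by (intro AE_I2) (simp add: e_def abs_mult mult_left_le_one_le)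
  qed (use h in simp)
  have fe: "(\<integral>\<^sup>+x. ennreal \<bar>f n x\<bar> \<partial>lborel) \<le> ennreal (LINT x|lborel. e n x)" for n
  proof -
    have ie: "integrable lborel (e n)"
    proof (rule Bochner_Integration.integrable_bound[OF h])
      show "e n \<in> borel_measurable lborel" unfolding e_def by measurable
      show "AE x in lborel. norm (e n x) \<le> norm (h x)" by (intro AE_I2) (simp add: e_def abs_mult mult_left_le_one_le)
    qed
    have "(\<integral>\<^sup>+x. ennreal \<bar>f n x\<bar> \<partial>lborel) \<le> (\<integral>\<^sup>+x. ennreal (e n (x + real n *\<^sub>R b)) \<partial>lborel)"
    proof (intro nn_integral_mono ennreal_leI)
      fix x
      show "\<bar>f n x\<bar> \<le> e n (x + real n *\<^sub>R b)"
      proof (cases "norm x \<le> real n / 2")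
        case True
        have "real n \<le> norm (x + real n *\<^sub>R b) + norm x"
          using norm_triangle_ineq4[of "x + real n *\<^sub>R b" x] b by simp
        then have "real n / 2 \<le> norm (x + real n *\<^sub>R b)" using True by linarith
        then show ?thesis using True by (simp add: f_def e_def)
      qed (simp add: f_def e_def)
    qed
    also have "\<dots> = (\<integral>\<^sup>+x. ennreal (e n x) \<partial>lborel)"
      by (rule nn_integral_lborel_translate[of "\<lambda>x. ennreal (e n x)"]) (unfold e_def, measurable)
    also have "\<dots> = ennreal (LINT x|lborel. e n x)"
      by (rule nn_integral_eq_integral[OF ie]) (simp add: e_def)
    finally show ?thesis .
  qed
  have "(\<lambda>n. ennreal (LINT x|lborel. e n x)) \<longlonglongrightarrow> ennreal 0"
    by (rule tendsto_ennrealI[OF e])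
  then have e': "(\<lambda>n. ennreal (LINT x|lborel. e n x)) \<longlonglongrightarrow> 0" by (simp only: ennreal_0)
  have lim: "(\<lambda>n. \<integral>\<^sup>+x. ennreal \<bar>f n x\<bar> \<partial>lborel) \<longlonglongrightarrow> 0"
  proof (rule tendsto_sandwich[OF _ _ tendsto_const e'])
    show "\<forall>\<^sub>F n in sequentially. 0 \<le> (\<integral>\<^sup>+x. ennreal \<bar>f n x\<bar> \<partial>lborel)" by simp
    show "\<forall>\<^sub>F n in sequentially. (\<integral>\<^sup>+x. ennreal \<bar>f n x\<bar> \<partial>lborel) \<le> ennreal (LINT x|lborel. e n x)"
      by (intro always_eventually allI fe)
  qed
  have "f n \<in> borel_measurable lborel" for n unfolding f_def[abs_def] by measurable
  from L1_imp_AE_subseq[OF this lim] obtain s where s: "strict_mono s" "AE x in lborel. (\<lambda>n. f (s n) x) \<longlonglongrightarrow> 0" by blast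
  have "AE x in lborel. (\<lambda>n. h (x + real (s n) *\<^sub>R b)) \<longlonglongrightarrow> 0"
    using s(2)
  proof eventually_elim
    case (elim x)
    have "\<forall>\<^sub>F n in sequentially. f (s n) x = h (x + real (s n) *\<^sub>R b)"
    proof (rule eventually_sequentiallyI[of "nat \<lceil>2 * norm x\<rceil>"])
      fix n assume "n \<ge> nat \<lceil>2 * norm x\<rceil>"
      then have "2 * norm x \<le> real n" by linarith
      also have "\<dots> \<le> real (s n)" using seq_suble[OF s(1), of n] by simp
      finally have "2 * norm x \<le> real (s n)" .
      then show "f (s n) x = h (x + real (s n) *\<^sub>R b)" by (simp add: f_def)
    qed
    from Lim_transform_eventually[OF elim this] show ?case .
  qed
  with s(1) show ?thesis by blast
qed

lemma powr_tendsto_zero_cancel: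
  fixes f :: "nat \<Rightarrow> real"
  assumes "(\<lambda>n. \<bar>f n\<bar> powr r) \<longlonglongrightarrow> 0" "r > 0"
  shows "f \<longlonglongrightarrow> 0"
proof -
  have "(\<lambda>n. (\<bar>f n\<bar> powr r) powr (1 / r)) \<longlonglongrightarrow> 0 powr (1 / r)"
    using assms by (intro tendsto_powr' tendsto_const) auto
  then have "(\<lambda>n. \<bar>f n\<bar>) \<longlonglongrightarrow> 0" using assms(2) by (simp add: powr_powr)
  then show ?thesis by (rule tendsto_rabs_zero_cancel)
qed

text \<open>
  A common sequence for \<open>u\<close> and all \<open>g b\<close>, from the integrable function \<open>|u|\<^sup>q\<close> plus the sum of the \<open>|g b|\<^sup>2\<close>.
\<close>

lemma translates_tendsto_zero:
  assumes b0: "b0 \<in> Basis"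
  shows "\<exists>s::nat \<Rightarrow> nat. strict_mono s \<and> (AE x in lborel. (\<lambda>n. u (x + real (s n) *\<^sub>R b0)) \<longlonglongrightarrow> 0) \<and>
    (\<forall>b\<in>Basis. AE x in lborel. (\<lambda>n. g b (x + real (s n) *\<^sub>R b0)) \<longlonglongrightarrow> 0)"
proof -
  define h where "h x = \<bar>u x\<bar> powr q + (\<Sum>b\<in>Basis. \<bar>g b x\<bar> powr 2)" for x
  have "integrable lborel h" unfolding h_def[abs_def]
    by (intro Bochner_Integration.integrable_add u_q Bochner_Integration.integrable_sum g_sq)
  from integrable_translates_tendsto_zero[OF this b0] obtain s where s: "strict_mono s"
    "AE x in lborel. (\<lambda>n. h (x + real (s n) *\<^sub>R b0)) \<longlonglongrightarrow> 0" by blast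
  have le: "\<bar>u x\<bar> powr q \<le> h x" "b \<in> Basis \<Longrightarrow> \<bar>g b x\<bar> powr 2 \<le> h x" for b x
  proof -
    show "\<bar>u x\<bar> powr q \<le> h x" unfolding h_def by (simp add: sum_nonneg)
    assume "b \<in> Basis"
    then have "\<bar>g b x\<bar> powr 2 \<le> (\<Sum>b\<in>Basis. \<bar>g b x\<bar> powr 2)"
      by (intro member_le_sum[of b Basis "\<lambda>b. \<bar>g b x\<bar> powr 2"]) auto
    then show "\<bar>g b x\<bar> powr 2 \<le> h x" unfolding h_def by (rule add_increasing[OF powr_ge_zero])
  qed
  have "AE x in lborel. (\<lambda>n. u (x + real (s n) *\<^sub>R b0)) \<longlonglongrightarrow> 0"
    using s(2)
  proof eventually_elim
    case (elim x)
    have "(\<lambda>n. \<bar>u (x + real (s n) *\<^sub>R b0)\<bar> powr q) \<longlonglongrightarrow> 0"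
      by (rule Lim_null_comparison[OF _ elim]) (use le(1) in simp)
    then show ?case by (rule powr_tendsto_zero_cancel) (use q in simp)
  qed
  moreover have "AE x in lborel. (\<lambda>n. g b (x + real (s n) *\<^sub>R b0)) \<longlonglongrightarrow> 0" if b: "b \<in> Basis" for b
    using s(2)
  proof eventually_elim
    case (elim x)
    have "(\<lambda>n. \<bar>g b (x + real (s n) *\<^sub>R b0)\<bar> powr 2) \<longlonglongrightarrow> 0"
      by (rule Lim_null_comparison[OF _ elim]) (use le(2)[OF b] in simp)
    then show ?case by (rule powr_tendsto_zero_cancel) simp
  qed
  ultimately show ?thesis using s(1) by blast
qed

text \<open>
  The solution need not be square integrable, so it cannot be cut off directly. The difference with a
  translate is square integrable, and the translate disappears in the limit.
\<close>

lemma testable_solution: "testable u g"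
proof -
  obtain b0 :: 'a where b0: "b0 \<in> Basis" using nonempty_Basis by blast
  obtain s :: "nat \<Rightarrow> nat" where s: "AE x in lborel. (\<lambda>n. u (x + real (s n) *\<^sub>R b0)) \<longlonglongrightarrow> 0"
    "\<And>b. b \<in> Basis \<Longrightarrow> AE x in lborel. (\<lambda>n. g b (x + real (s n) *\<^sub>R b0)) \<longlonglongrightarrow> 0"
    using translates_tendsto_zero[OF b0] by blast
  have d: "wderiv b u (g b)" if "b \<in> Basis" for b using u_partials that by (simp add: partials_def)
  define t where "t n = real (s n) *\<^sub>R b0" for n
  define w where "w n x = u x + (- 1) * u (x + t n)" for n x
  define G where "G n b x = g b x + (- 1) * g b (x + t n)" for n b x
  have mG: "G n b \<in> borel_measurable borel" if "b \<in> Basis" for n b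
    using g_measurable[OF that] unfolding G_def[abs_def] by measurable
  have ut: "integrable lborel (\<lambda>x. \<bar>u (x + a)\<bar> powr q)" for a
    using u_q integral_lborel_translate(2)[of "\<lambda>x. \<bar>u x\<bar> powr q" a] by simp
  have gt: "integrable lborel (\<lambda>x. \<bar>g b (x + a)\<bar> powr 2)" if b: "b \<in> Basis" for a b
  proof -
    have "(\<lambda>x. \<bar>g b x\<bar> powr 2) \<in> borel_measurable borel" using g_measurable[OF b] by measurable
    from integral_lborel_translate(2)[OF this, of a] show ?thesis using g_sq[OF b] by simp
  qed
  have pw: "\<bar>w n x\<bar> powr q \<le> 2 powr q * \<bar>u x\<bar> powr q + 2 powr q * \<bar>u (x + t n)\<bar> powr q" for n x
    using powr_add_le[of q "u x" "- u (x + t n)"] q by (simp add: w_def)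
  have pG: "\<bar>G n b x\<bar> powr 2 \<le> 2 powr 2 * \<bar>g b x\<bar> powr 2 + 2 powr 2 * \<bar>g b (x + t n)\<bar> powr 2" for n b x
    using powr_add_le[of 2 "g b x" "- g b (x + t n)"] by (simp add: G_def)
  have cu: "coulomb_energy \<alpha> p (\<lambda>x. (- 1) * u (x + t n)) = coulomb_energy \<alpha> p u" for n
  proof -
    have "coulomb_energy \<alpha> p (\<lambda>x. (- 1) * u (x + t n)) = coulomb_energy \<alpha> p (\<lambda>x. u (x + t n))"
      by (subst coulomb_energy_cmult[OF \<alpha>]) auto
    then show ?thesis by (simp add: coulomb_energy_translate)
  qed
  \<comment> \<open>A bound on the Coulomb energies that does not depend on \<open>n\<close>: \<open>|w n|\<close> is at most the sum
    of \<open>|u|\<close> and its translate.\<close>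
  have cw: "coulomb_energy \<alpha> p (w n) \<le>
      3 * (ennreal ((2 powr p)\<^sup>2) * coulomb_energy \<alpha> p u + ennreal ((2 powr p)\<^sup>2) * coulomb_energy \<alpha> p u)" for n
    using coulomb_energy_add_le[OF \<alpha>, of p u "\<lambda>x. (- 1) * u (x + t n)"] p
    unfolding cu w_def[abs_def] by simp
  have adm: "admissible (w n) (G n)" for n
  proof -
    have "partials (w n) (G n)"
      unfolding partials_def w_def[abs_def] G_def[abs_def]
      by (intro ballI wderiv_add wderiv_cmult wderiv_translate d)
    moreover have "integrable lborel (\<lambda>x. \<bar>G n b x\<bar> powr 2)" if b: "b \<in> Basis" for b
      unfolding G_def using g_measurable[OF b] gt[OF b] g_sq[OF b]
      by (intro powr_integrable_add) auto
    moreover have "integrable lborel (\<lambda>x. \<bar>w n x\<bar> powr q)"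
      unfolding w_def using u_q ut q by (intro powr_integrable_add) auto
    moreover have "coulomb_energy \<alpha> p (w n) < \<infinity>"
      by (rule le_less_trans[OF cw]) (use u_coulomb in \<open>simp add: ennreal_mult_less_top\<close>)
    ultimately show ?thesis by (simp add: admissible_def)
  qed
  have sq: "integrable lborel (\<lambda>x. \<bar>w n x\<bar> powr 2)" for n
    using solution_difference_square_integrable[OF b0, of "real (s n)"]
    by (simp add: w_def t_def abs_minus_commute)
  show ?thesis
  proof (rule testable_limit[where w' = w and G' = G and B = "\<lambda>b. \<integral>\<^sup>+x. ennreal (2 powr 2 * \<bar>g b x\<bar> powr 2) \<partial>lborel + \<integral>\<^sup>+x. ennreal (2 powr 2 * \<bar>g b x\<bar> powr 2) \<partial>lborel"
        and Bq = "\<integral>\<^sup>+x. ennreal (2 powr q * \<bar>u x\<bar> powr q) \<partial>lborel + \<integral>\<^sup>+x. ennreal (2 powr q * \<bar>u x\<bar> powr q) \<partial>lborel"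
        and Bp = "3 * (ennreal ((2 powr p)\<^sup>2) * coulomb_energy \<alpha> p u + ennreal ((2 powr p)\<^sup>2) * coulomb_energy \<alpha> p u)"])
    show "testable (w n) (G n)" for n by (rule testable_square_integrable[OF adm sq])
    show "AE x in lborel. (\<lambda>n. w n x) \<longlonglongrightarrow> u x"
      using s(1)
    proof eventually_elim
      case (elim x)
      from tendsto_add[OF tendsto_const[of "u x"] tendsto_mult_right_zero[OF elim, of "- 1"]]
      show ?case by (simp add: w_def t_def)
    qed
    show "AE x in lborel. (\<lambda>n. G n b x) \<longlonglongrightarrow> g b x" if b: "b \<in> Basis" for b
      using s(2)[OF b]
    proof eventually_elim
      case (elim x)
      from tendsto_add[OF tendsto_const[of "g b x"] tendsto_mult_right_zero[OF elim, of "- 1"]]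
      show ?case by (simp add: G_def t_def)
    qed
    have tr: "(\<integral>\<^sup>+x. ennreal (2 powr r * \<bar>v (x + t n)\<bar> powr r) \<partial>lborel) = (\<integral>\<^sup>+x. ennreal (2 powr r * \<bar>v x\<bar> powr r) \<partial>lborel)"
      if [measurable]: "v \<in> borel_measurable borel" for v n and r :: real
      by (rule nn_integral_lborel_translate[of "\<lambda>x. ennreal (2 powr r * \<bar>v x\<bar> powr r)"]) measurable
    have split: "(\<integral>\<^sup>+x. ennreal (\<bar>f x\<bar> powr r) \<partial>lborel) \<le> \<integral>\<^sup>+x. ennreal (2 powr r * \<bar>v x\<bar> powr r) \<partial>lborel + \<integral>\<^sup>+x. ennreal (2 powr r * \<bar>v x\<bar> powr r) \<partial>lborel"
      if [measurable]: "v \<in> borel_measurable borel" and le: "\<And>x. \<bar>f x\<bar> powr r \<le> 2 powr r * \<bar>v x\<bar> powr r + 2 powr r * \<bar>v (x + t n)\<bar> powr r" for v f n and r :: real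
    proof -
      have "(\<integral>\<^sup>+x. ennreal (\<bar>f x\<bar> powr r) \<partial>lborel) \<le> (\<integral>\<^sup>+x. ennreal (2 powr r * \<bar>v x\<bar> powr r) + ennreal (2 powr r * \<bar>v (x + t n)\<bar> powr r) \<partial>lborel)"
        by (intro nn_integral_mono) (simp add: le ennreal_leI flip: ennreal_plus)
      also have "\<dots> = (\<integral>\<^sup>+x. ennreal (2 powr r * \<bar>v x\<bar> powr r) \<partial>lborel) + (\<integral>\<^sup>+x. ennreal (2 powr r * \<bar>v (x + t n)\<bar> powr r) \<partial>lborel)"
        by (rule nn_integral_add) measurable
      finally show ?thesis unfolding tr[OF \<open>v \<in> borel_measurable borel\<close>] .
    qed
    show "(\<integral>\<^sup>+x. ennreal (\<bar>G n b x\<bar> powr 2) \<partial>lborel) \<le> \<integral>\<^sup>+x. ennreal (2 powr 2 * \<bar>g b x\<bar> powr 2) \<partial>lborel + \<integral>\<^sup>+x. ennreal (2 powr 2 * \<bar>g b x\<bar> powr 2) \<partial>lborel"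
      if "b \<in> Basis" for b n by (rule split[OF g_measurable[OF that] pG])
    show "(\<integral>\<^sup>+x. ennreal (\<bar>w n x\<bar> powr q) \<partial>lborel) \<le> \<integral>\<^sup>+x. ennreal (2 powr q * \<bar>u x\<bar> powr q) \<partial>lborel + \<integral>\<^sup>+x. ennreal (2 powr q * \<bar>u x\<bar> powr q) \<partial>lborel"
      for n by (rule split[OF u_measurable pw])
    show "(\<integral>\<^sup>+x. ennreal (2 powr 2 * \<bar>g b x\<bar> powr 2) \<partial>lborel) + (\<integral>\<^sup>+x. ennreal (2 powr 2 * \<bar>g b x\<bar> powr 2) \<partial>lborel) < \<infinity>" if "b \<in> Basis" for b
      using integrable_nn_finite[OF integrable_mult_right[OF g_sq[OF that], of "2 powr 2"]] by simp
    show "(\<integral>\<^sup>+x. ennreal (2 powr q * \<bar>u x\<bar> powr q) \<partial>lborel) + (\<integral>\<^sup>+x. ennreal (2 powr q * \<bar>u x\<bar> powr q) \<partial>lborel) < \<infinity>"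
      using integrable_nn_finite[OF integrable_mult_right[OF u_q, of "2 powr q"]] by simp
    show "coulomb_energy \<alpha> p (w n) \<le> 3 * (ennreal ((2 powr p)\<^sup>2) * coulomb_energy \<alpha> p u + ennreal ((2 powr p)\<^sup>2) * coulomb_energy \<alpha> p u)" for n by (rule cw)
    show "3 * (ennreal ((2 powr p)\<^sup>2) * coulomb_energy \<alpha> p u + ennreal ((2 powr p)\<^sup>2) * coulomb_energy \<alpha> p u) < \<infinity>" using u_coulomb by (simp add: ennreal_mult_less_top)
    show "w n \<in> borel_measurable borel" for n by (rule admissible_measurable(1)[OF adm])
    show "u \<in> borel_measurable borel" by (rule u_measurable)
    show "G n b \<in> borel_measurable borel" if "b \<in> Basis" for n b by (rule mG[OF that])
    show "g b \<in> borel_measurable borel" if "b \<in> Basis" for b by (rule g_measurable[OF that])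
  qed
qed

end

section \<open>Local regularity and the local terms of the Pohozaev identity\<close>

lemma coulomb_energy_cong_AE:
  assumes "AE x in lborel. w x = w' x"
  shows "coulomb_energy \<alpha> p w = coulomb_energy \<alpha> p (w' :: 'a::euclidean_space \<Rightarrow> real)"
proof -
  have "riesz_potential (\<alpha> / 2) (\<lambda>y. \<bar>w y\<bar> powr p) x = riesz_potential (\<alpha> / 2) (\<lambda>y. \<bar>w' y\<bar> powr p) x" for x
    unfolding riesz_potential_lborel
    by (rule nn_integral_cong_AE) (use assms in eventually_elim, simp)
  then show ?thesis by (simp add: coulomb_energy_def)
qed

lemma integrable_powr_cong_AE:
  fixes w w' :: "'a::euclidean_space \<Rightarrow> real"
  assumes "AE x in lborel. w x = w' x" and [measurable]: "w \<in> borel_measurable borel" "w' \<in> borel_measurable borel"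
  shows "integrable lborel (\<lambda>x. \<bar>w x\<bar> powr r) \<longleftrightarrow> integrable lborel (\<lambda>x. \<bar>w' x\<bar> powr r)"
proof (rule integrable_cong_AE)
  show "AE x in lborel. \<bar>w x\<bar> powr r = \<bar>w' x\<bar> powr r" using assms(1) by eventually_elim simp
qed simp_all

lemma test_functions_sum_Basis:
  fixes Y :: "'a::euclidean_space \<Rightarrow> 'a \<Rightarrow> real"
  assumes Y: "\<And>b. b \<in> Basis \<Longrightarrow> Y b \<in> test_functions"
  shows "(\<lambda>x. \<Sum>b\<in>Basis. Y b x *\<^sub>R b) \<in> test_functions"
proof -
  have "(\<lambda>x. \<Sum>b\<in>B. Y b x *\<^sub>R b) \<in> test_functions" if "finite B" "B \<subseteq> Basis" for B
    using that
  proof (induction B rule: finite_induct)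
    case empty
    show ?case by (simp add: test_functions_iff bounded_support_def)
  next
    case (insert b B)
    have b: "Y b \<in> test_functions" using insert Y by blast
    have 1: "(\<lambda>x. Y b x *\<^sub>R b) \<in> test_functions"
      by (rule test_functions_bilinear[OF bounded_bilinear_scaleR]) (use b in \<open>simp_all add: test_functions_iff\<close>)
    have 2: "(\<lambda>x. \<Sum>b\<in>B. Y b x *\<^sub>R b) \<in> test_functions" using insert by blast
    obtain R1 where R1: "\<And>x. norm x > R1 \<Longrightarrow> Y b x *\<^sub>R b = 0" using 1 by (auto simp: test_functions_iff bounded_support_def)
    obtain R2 where R2: "\<And>x. norm x > R2 \<Longrightarrow> (\<Sum>b\<in>B. Y b x *\<^sub>R b) = 0" using 2 by (auto simp: test_functions_iff bounded_support_def)
    have "bounded_support (\<lambda>x. Y b x *\<^sub>R b + (\<Sum>b\<in>B. Y b x *\<^sub>R b))"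
      unfolding bounded_support_def by (intro exI[of _ "max R1 R2"]) (simp add: R1 R2)
    moreover have "Ck k (\<lambda>x. Y b x *\<^sub>R b + (\<Sum>b\<in>B. Y b x *\<^sub>R b))" for k
      by (rule Ck_add[OF test_functions_Ck[OF 1] test_functions_Ck[OF 2]])
    ultimately show ?case using insert by (simp add: test_functions_iff)
  qed
  then show ?thesis by simp
qed

lemma loc_int_powr_local:
  fixes h :: "'a::euclidean_space \<Rightarrow> real"
  assumes [measurable]: "h \<in> borel_measurable borel"
    and loc: "\<And>\<kappa>. \<kappa> \<in> test_functions \<Longrightarrow> loc_int (\<lambda>x. \<bar>\<kappa> x * h x\<bar> powr r)"
  shows "loc_int (\<lambda>x. \<bar>h x\<bar> powr r)"
  unfolding loc_int_def
proof (intro conjI allI)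
  fix R :: real
  obtain \<kappa> :: "'a \<Rightarrow> real" where \<kappa>: "\<kappa> \<in> test_functions" "\<And>x. norm x \<le> R \<Longrightarrow> \<kappa> x = 1"
    using cutoff_exists[of R] by blast
  have eq: "(\<lambda>x. indicator (cball 0 R) x * \<bar>\<kappa> x * h x\<bar> powr r) = (\<lambda>x. indicator (cball 0 R) x * \<bar>h x\<bar> powr r)"
    using \<kappa>(2) by (auto simp: indicator_def fun_eq_iff)
  have "integrable lborel (\<lambda>x. indicator (cball 0 R) x * \<bar>\<kappa> x * h x\<bar> powr r)"
    using loc[OF \<kappa>(1)] unfolding loc_int_def by blast
  then show "integrable lborel (\<lambda>x. indicator (cball 0 R) x * \<bar>h x\<bar> powr r)"
    unfolding eq .
qed measurable

context choquard_solution
begin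

lemma admissible_cong_AE:
  assumes adm: "admissible w H" and AE: "AE x in lborel. w x = w' x" and w': "w' \<in> borel_measurable borel"
  shows "admissible w' H"
proof -
  note m = admissible_measurable[OF adm]
  have "partials w' H"
    unfolding partials_def
  proof
    fix b :: 'a assume b: "b \<in> Basis"
    have d: "wderiv b w (H b)" using adm b by (simp add: admissible_def partials_def)
    show "wderiv b w' (H b)" by (rule wderiv_cong_AE[OF d w' m(2)[OF b] AE]) simp
  qed
  then show ?thesis
    using adm integrable_powr_cong_AE[OF AE m(1) w'] coulomb_energy_cong_AE[OF AE] by (simp add: admissible_def)
qed

end

text \<open>
  The assumption expresses that \<open>\<psi> \<cdot> \<nabla>u\<close> belongs to the energy space for every test field \<open>\<psi>\<close>.
\<close>

locale choquard_regular = choquard_solution +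
  assumes regular: "\<And>\<psi>. \<psi> \<in> test_functions \<Longrightarrow>
    \<exists>w H. admissible w H \<and> (AE x in lborel. w x = (\<Sum>b\<in>Basis. (\<psi> x \<bullet> b) * g b x))"
begin

lemma field_admissible:
  assumes Y: "\<And>b. b \<in> Basis \<Longrightarrow> Y b \<in> test_functions"
  shows "\<exists>H. admissible (\<lambda>x. \<Sum>b\<in>Basis. Y b x * g b x) H"
proof -
  have inner: "(\<Sum>c\<in>Basis. Y c x *\<^sub>R c) \<bullet> b = Y b x" if "b \<in> Basis" for b x
    using that by simp
  obtain w H where w: "admissible w H" "AE x in lborel. w x = (\<Sum>b\<in>Basis. ((\<Sum>c\<in>Basis. Y c x *\<^sub>R c) \<bullet> b) * g b x)"
    using regular[OF test_functions_sum_Basis[of Y, OF Y]] by blast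
  have "(\<Sum>b\<in>Basis. ((\<Sum>c\<in>Basis. Y c x *\<^sub>R c) \<bullet> b) * g b x) = (\<Sum>b\<in>Basis. Y b x * g b x)" for x
    by (intro sum.cong refl) (simp only: inner)
  with w(2) have AE: "AE x in lborel. w x = (\<Sum>b\<in>Basis. Y b x * g b x)" by simp
  have "(\<lambda>x. \<Sum>b\<in>Basis. Y b x * g b x) \<in> borel_measurable borel"
    using test_functions_measurable[OF Y] g_measurable by (intro borel_measurable_sum borel_measurable_times) auto
  from admissible_cong_AE[OF w(1) AE this] show ?thesis by blast
qed

lemma cutoff_gradient_admissible:
  assumes \<kappa>: "\<kappa> \<in> test_functions" and b: "b \<in> Basis"
  shows "\<exists>H. admissible (\<lambda>x. \<kappa> x * g b x) H"
proof -
  have "(\<lambda>x. 0) \<in> (test_functions :: ('a \<Rightarrow> real) set)" by (simp add: test_functions_iff bounded_support_def)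
  then have "\<exists>H. admissible (\<lambda>x. \<Sum>c\<in>Basis. (if c = b then \<kappa> else (\<lambda>x. 0)) x * g c x) H"
    using \<kappa> by (intro field_admissible) simp
  moreover have "(\<Sum>c\<in>Basis. (if c = b then \<kappa> else (\<lambda>x. 0)) x * g c x) = \<kappa> x * g b x" for x
    using b by (subst sum.remove[OF finite_Basis b]) simp
  ultimately show ?thesis by simp
qed

text \<open>
  Multiply by a cut-off function. For the exponent \<open>p\<close> this uses that functions of finite Coulomb energy are
  locally \<open>p\<close>-integrable.
\<close>

lemma gradient_loc_int:
  assumes b: "b \<in> Basis"
  shows "loc_int (\<lambda>x. \<bar>g b x\<bar> powr q)" "loc_int (\<lambda>x. \<bar>g b x\<bar> powr p)"
proof -
  have q': "loc_int (\<lambda>x. \<bar>\<kappa> x * g b x\<bar> powr q)" and p': "loc_int (\<lambda>x. \<bar>\<kappa> x * g b x\<bar> powr p)"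
    if \<kappa>: "\<kappa> \<in> test_functions" for \<kappa>
  proof -
    obtain H where adm: "admissible (\<lambda>x. \<kappa> x * g b x) H" using cutoff_gradient_admissible[OF \<kappa> b] by blast
    show "loc_int (\<lambda>x. \<bar>\<kappa> x * g b x\<bar> powr q)"
      by (rule integrable_imp_loc_int) (use adm in \<open>simp add: admissible_def\<close>)
    show "loc_int (\<lambda>x. \<bar>\<kappa> x * g b x\<bar> powr p)"
      by (rule finite_coulomb_energy_imp_loc_int[OF \<alpha> admissible_measurable(1)[OF adm]])
        (use adm in \<open>simp add: admissible_def\<close>)
  qed
  show "loc_int (\<lambda>x. \<bar>g b x\<bar> powr q)" by (rule loc_int_powr_local[OF g_measurable[OF b] q'])
  show "loc_int (\<lambda>x. \<bar>g b x\<bar> powr p)" by (rule loc_int_powr_local[OF g_measurable[OF b] p'])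
qed

lemma u_loc_int: "loc_int (\<lambda>x. \<bar>u x\<bar> powr q)" "loc_int (\<lambda>x. \<bar>u x\<bar> powr p)"
  using integrable_imp_loc_int[OF u_q] finite_coulomb_energy_imp_loc_int[OF \<alpha> u_measurable u_coulomb] by auto

lemma u_wderiv: "b \<in> Basis \<Longrightarrow> wderiv b u (g b)"
  using u_partials by (simp add: partials_def)

lemma test_Ck1: "\<phi> \<in> test_functions \<Longrightarrow> Ck (Suc 0) \<phi>" "\<phi> \<in> test_functions \<Longrightarrow> bounded_support \<phi>"
  by (simp_all add: test_functions_iff)

text \<open>
  Multiplied by \<open>Y\<close>, the chain rule says that \<open>q |u|\<^sup>q\<^sup>-\<^sup>2 u Y \<cdot> \<nabla>u = Y \<cdot> \<nabla>|u|\<^sup>q\<close>; integrate by parts.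
\<close>

lemma power_term:
  assumes Y: "\<And>b. b \<in> Basis \<Longrightarrow> Y b \<in> test_functions"
  shows "q * (LINT x|lborel. sgn_powr q (u x) * (\<Sum>b\<in>Basis. Y b x * g b x)) =
    - (LINT x|lborel. (\<Sum>b\<in>Basis. dir_deriv b (Y b) x) * \<bar>u x\<bar> powr q)"
proof -
  have i: "integrable lborel (\<lambda>x. Y b x * sgn_powr q (u x) * g b x)"
    and e: "q * (LINT x|lborel. Y b x * sgn_powr q (u x) * g b x) = - (LINT x|lborel. dir_deriv b (Y b) x * \<bar>u x\<bar> powr q)"
    if b: "b \<in> Basis" for b
    using weak_chain_rule[OF q u_wderiv[OF b] u_loc_int(1) gradient_loc_int(1)[OF b] test_Ck1[OF Y[OF b]]] by auto
  have j: "integrable lborel (\<lambda>x. dir_deriv b (Y b) x * \<bar>u x\<bar> powr q)" if b: "b \<in> Basis" for b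
    by (rule loc_int_test_integrable[OF u_loc_int(1) test_functions_dir_deriv[OF Y[OF b]]])
  have "(LINT x|lborel. sgn_powr q (u x) * (\<Sum>b\<in>Basis. Y b x * g b x)) =
      (LINT x|lborel. (\<Sum>b\<in>Basis. Y b x * sgn_powr q (u x) * g b x))"
    by (intro Bochner_Integration.integral_cong refl) (simp add: sum_distrib_left mult_ac)
  also have "\<dots> = (\<Sum>b\<in>Basis. LINT x|lborel. Y b x * sgn_powr q (u x) * g b x)"
    by (rule Bochner_Integration.integral_sum) (rule i)
  finally have "q * (LINT x|lborel. sgn_powr q (u x) * (\<Sum>b\<in>Basis. Y b x * g b x)) =
      (\<Sum>b\<in>Basis. - (LINT x|lborel. dir_deriv b (Y b) x * \<bar>u x\<bar> powr q))"
    by (simp add: sum_distrib_left e)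
  also have "\<dots> = - (LINT x|lborel. (\<Sum>b\<in>Basis. dir_deriv b (Y b) x * \<bar>u x\<bar> powr q))"
    by (subst Bochner_Integration.integral_sum) (simp_all add: j sum_negf)
  finally show ?thesis by (simp add: sum_distrib_right)
qed

text \<open>
  The Hessian of \<open>u\<close> exists locally, as the weak derivatives of the cut-off functions \<open>\<kappa> g b\<close>. Where \<open>\<kappa> = 1\<close>
  it is symmetric, because two integrations by parts move both derivatives to the test function.
\<close>

lemma weak_hessian_symmetric:
  assumes a: "a \<in> Basis" and b: "b \<in> Basis"
    and Ga: "wderiv b (\<lambda>x. \<kappa> x * g a x) Gab" and Gb: "wderiv a (\<lambda>x. \<kappa> x * g b x) Gba"
    and \<kappa>: "\<And>x. norm x \<le> R \<Longrightarrow> \<kappa> x = 1"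
    and \<eta>: "\<eta> \<in> test_functions" "\<And>x. norm x > R \<Longrightarrow> \<eta> x = 0"
  shows "AE x in lborel. \<eta> x * Gab x = \<eta> x * Gba x"
proof -
  have key: "(LINT x|lborel. \<theta> x * G x) = (LINT x|lborel. dir_deriv a (dir_deriv b \<theta>) x * u x)"
    if \<theta>: "\<theta> \<in> test_functions" "\<And>x. norm x > R \<Longrightarrow> \<theta> x = 0"
      and G: "wderiv b (\<lambda>x. \<kappa> x * g a x) G" and a: "a \<in> Basis" for a b G \<theta>
  proof -
    have t: "dir_deriv b \<theta> \<in> test_functions" by (rule test_functions_dir_deriv[OF \<theta>(1)])
    have eq: "dir_deriv b \<theta> x * (\<kappa> x * g a x) = dir_deriv b \<theta> x * g a x" for x
      using \<kappa>[of x] dir_deriv_eq_0_outside[OF \<theta>(2), where x = x and e = b] by (cases "norm x \<le> R") auto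
    have "(LINT x|lborel. \<theta> x * G x) = - (LINT x|lborel. dir_deriv b \<theta> x * g a x)"
      using wderivD(3)[OF G \<theta>(1)] unfolding eq by linarith
    also have "\<dots> = (LINT x|lborel. dir_deriv a (dir_deriv b \<theta>) x * u x)"
      using wderivD(3)[OF u_wderiv[OF a] t] by simp
    finally show ?thesis .
  qed
  have l: "loc_int (\<lambda>x. \<eta> x * Gab x + (- 1) * (\<eta> x * Gba x))"
    by (rule loc_int_add[OF loc_int_test_mult[OF wderivD(2)[OF Ga] \<eta>(1)] loc_int_cmult[OF loc_int_test_mult[OF wderivD(2)[OF Gb] \<eta>(1)]]])
  have "AE x in lborel. \<eta> x * Gab x + (- 1) * (\<eta> x * Gba x) = 0"
  proof (rule fundamental_lemma[OF l])
    fix \<phi> :: "'a \<Rightarrow> real" assume \<phi>: "\<phi> \<in> test_functions"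
    have t: "(\<lambda>x. \<phi> x * \<eta> x) \<in> test_functions" by (rule test_functions_mult[OF \<phi> \<eta>(1)])
    have z: "\<phi> x * \<eta> x = 0" if "norm x > R" for x using \<eta>(2)[OF that] by simp
    have i: "integrable lborel (\<lambda>x. (\<phi> x * \<eta> x) * Gab x)" "integrable lborel (\<lambda>x. (\<phi> x * \<eta> x) * Gba x)"
      by (rule loc_int_test_integrable[OF wderivD(2)[OF Ga] t] loc_int_test_integrable[OF wderivD(2)[OF Gb] t])+
    have "(LINT x|lborel. \<phi> x * (\<eta> x * Gab x + (- 1) * (\<eta> x * Gba x))) =
        (LINT x|lborel. (\<phi> x * \<eta> x) * Gab x - (\<phi> x * \<eta> x) * Gba x)"
      by (intro Bochner_Integration.integral_cong refl) (simp add: algebra_simps)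
    also have "\<dots> = (LINT x|lborel. (\<phi> x * \<eta> x) * Gab x) - (LINT x|lborel. (\<phi> x * \<eta> x) * Gba x)"
      by (rule Bochner_Integration.integral_diff[OF i])
    also have "\<dots> = (LINT x|lborel. dir_deriv a (dir_deriv b (\<lambda>x. \<phi> x * \<eta> x)) x * u x) -
        (LINT x|lborel. dir_deriv b (dir_deriv a (\<lambda>x. \<phi> x * \<eta> x)) x * u x)"
      using key[OF t z Ga a] key[OF t z Gb b] by simp
    also have "\<dots> = 0"
      by (simp add: second_derivative_symmetric[OF test_functions_Ck[OF t]])
    finally show "(LINT x|lborel. \<phi> x * (\<eta> x * Gab x + (- 1) * (\<eta> x * Gba x))) = 0" .
  qed
  then show ?thesis by eventually_elim linarith
qed

lemma bounded_gradient_product_integrable: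
  assumes "a \<in> Basis" "b \<in> Basis" and [measurable]: "m \<in> borel_measurable borel" and m: "\<And>x. \<bar>m x\<bar> \<le> C"
  shows "integrable lborel (\<lambda>x. m x * (g a x * g b x))"
proof (rule Bochner_Integration.integrable_bound)
  have [measurable]: "g a \<in> borel_measurable borel" "g b \<in> borel_measurable borel" using assms g_measurable by auto
  show "(\<lambda>x. m x * (g a x * g b x)) \<in> borel_measurable lborel" by measurable
  show "integrable lborel (\<lambda>x. C * (\<bar>g a x\<bar> powr 2 + \<bar>g b x\<bar> powr 2))"
    using g_sq assms by simp
  have C: "C \<ge> 0" using m[of 0] by linarith
  have "norm (m x * (g a x * g b x)) \<le> norm (C * (\<bar>g a x\<bar> powr 2 + \<bar>g b x\<bar> powr 2))" for x
  proof -
    have "\<bar>g a x * g b x\<bar> \<le> \<bar>g a x\<bar> powr 2 + \<bar>g b x\<bar> powr 2"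
      using abs_sgn_powr_mult_le[of 2 "g a x" "g b x"] by simp
    then have "\<bar>m x\<bar> * \<bar>g a x * g b x\<bar> \<le> C * (\<bar>g a x\<bar> powr 2 + \<bar>g b x\<bar> powr 2)"
      using m[of x] C by (intro mult_mono) auto
    then show ?thesis using C by (simp add: abs_mult)
  qed
  then show "AE x in lborel. norm (m x * (g a x * g b x)) \<le> norm (C * (\<bar>g a x\<bar> powr 2 + \<bar>g b x\<bar> powr 2))" by simp
qed

text \<open>
  The derivative of \<open>Y \<cdot> \<nabla>u\<close> contains a first order part, which is kept, and the Hessian part. In the
  product with \<open>\<nabla>u\<close>, symmetry of the Hessian turns the latter into \<open>Y \<cdot> \<nabla>(|\<nabla>u|\<^sup>2 / 2)\<close>, to which the
  chain rule with exponent \<open>2\<close> applies.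
\<close>

lemma gradient_term:
  assumes Y: "\<And>b. b \<in> Basis \<Longrightarrow> Y b \<in> test_functions"
    and H: "admissible (\<lambda>x. \<Sum>b\<in>Basis. Y b x * g b x) H"
  shows "(\<Sum>a\<in>Basis. LINT x|lborel. g a x * H a x) =
    (\<Sum>a\<in>Basis. \<Sum>b\<in>Basis. (LINT x|lborel. dir_deriv a (Y b) x * (g a x * g b x))
       - (LINT x|lborel. dir_deriv b (Y b) x * (g a x * g a x)) / 2)"
proof -
  have "\<exists>R. \<forall>x. norm x > R \<longrightarrow> Y b x = 0" if "b \<in> Basis" for b
    using Y[OF that] by (simp add: test_functions_iff bounded_support_def)
  then obtain Rb where Rb: "\<And>b x. b \<in> Basis \<Longrightarrow> norm x > Rb b \<Longrightarrow> Y b x = 0" by metis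
  define R where "R = Max (Rb ` Basis)"
  have R: "Y b x = 0" if "b \<in> Basis" "norm x > R" for b x
  proof -
    have "Rb b \<le> R" unfolding R_def using that by simp
    then show ?thesis using Rb[OF that(1)] that(2) by simp
  qed
  obtain \<kappa> :: "'a \<Rightarrow> real" where \<kappa>: "\<kappa> \<in> test_functions" "\<And>x. norm x \<le> R \<Longrightarrow> \<kappa> x = 1"
    using cutoff_exists[of R] by blast
  obtain G where G: "\<And>b. b \<in> Basis \<Longrightarrow> admissible (\<lambda>x. \<kappa> x * g b x) (G b)"
    using cutoff_gradient_admissible[OF \<kappa>(1)] by metis
  have Gd: "wderiv a (\<lambda>x. \<kappa> x * g b x) (G b a)" and Gsq: "integrable lborel (\<lambda>x. \<bar>G b a x\<bar> powr 2)"
    if "a \<in> Basis" "b \<in> Basis" for a b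
    using G[OF that(2)] that(1) by (auto simp: admissible_def partials_def)
  have Y\<kappa>: "Y b x * (\<kappa> x * t) = Y b x * t" if "b \<in> Basis" for b x t
    using R[OF that, of x] \<kappa>(2)[of x] by (cases "norm x \<le> R") auto
  have DY\<kappa>: "dir_deriv a (Y b) x * (\<kappa> x * t) = dir_deriv a (Y b) x * t" if "b \<in> Basis" for a b x t
    using dir_deriv_eq_0_outside[OF R[OF that], where x = x and e = a] \<kappa>(2)[of x] by (cases "norm x \<le> R") auto
  have Hd: "wderiv a (\<lambda>x. \<Sum>b\<in>Basis. Y b x * g b x) (H a)" if "a \<in> Basis" for a
    using H that by (simp add: admissible_def partials_def)
  have D: "wderiv a (\<lambda>x. \<Sum>b\<in>Basis. Y b x * g b x) (\<lambda>x. \<Sum>b\<in>Basis. Y b x * G b a x + dir_deriv a (Y b) x * g b x)"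
    if a: "a \<in> Basis" for a
  proof -
    have "wderiv a (\<lambda>x. \<Sum>b\<in>Basis. Y b x * (\<kappa> x * g b x)) (\<lambda>x. \<Sum>b\<in>Basis. Y b x * G b a x + dir_deriv a (Y b) x * (\<kappa> x * g b x))"
      by (rule wderiv_sum) (rule wderiv_test_mult[OF Gd[OF a] Y])
    then show ?thesis by (simp only: Y\<kappa> DY\<kappa> cong: sum.cong)
  qed
  \<comment> \<open>\<open>G b a\<close> is the derivative of \<open>g b\<close> in direction \<open>a\<close>; by symmetry it may be replaced by the derivative of
    \<open>g a\<close> in direction \<open>b\<close>, and then the product with \<open>g a\<close> is a derivative of \<open>(g a)\<^sup>2 / 2\<close>.\<close>
  have hess: "integrable lborel (\<lambda>x. g a x * (Y b x * G b a x))"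
      "(LINT x|lborel. g a x * (Y b x * G b a x)) = - (LINT x|lborel. dir_deriv b (Y b) x * (g a x * g a x)) / 2"
    if a: "a \<in> Basis" and b: "b \<in> Basis" for a b
  proof -
    have [measurable]: "g a \<in> borel_measurable borel" "G a b \<in> borel_measurable borel" "G b a \<in> borel_measurable borel" "Y b \<in> borel_measurable borel"
      using g_measurable[OF a] admissible_measurable(2)[OF G[OF a] b] admissible_measurable(2)[OF G[OF b] a] test_functions_measurable[OF Y[OF b]] by auto
    have sym: "AE x in lborel. Y b x * G a b x = Y b x * G b a x"
      by (rule weak_hessian_symmetric[OF a b Gd[OF b a] Gd[OF a b] \<kappa>(2) Y[OF b] R[OF b]])
    obtain C where C: "\<And>x. \<bar>\<kappa> x\<bar> \<le> C" using test_functions_bounded[OF \<kappa>(1)] by auto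
    have l1: "loc_int (\<lambda>x. \<bar>\<kappa> x * g a x\<bar> powr 2)"
    proof (rule integrable_imp_loc_int, rule Bochner_Integration.integrable_bound)
      show "integrable lborel (\<lambda>x. (C powr 2) * \<bar>g a x\<bar> powr 2)" using g_sq[OF a] by simp
      have "\<bar>\<kappa> x * g a x\<bar> powr 2 \<le> (C powr 2) * \<bar>g a x\<bar> powr 2" for x
      proof -
        have "\<bar>\<kappa> x * g a x\<bar> powr 2 \<le> (C * \<bar>g a x\<bar>) powr 2"
          using C[of x] by (intro powr_mono2) (simp_all add: abs_mult mult_right_mono)
        also have "\<dots> = C powr 2 * \<bar>g a x\<bar> powr 2" by (rule powr_mult)
        finally show ?thesis .
      qed
      then show "AE x in lborel. norm (\<bar>\<kappa> x * g a x\<bar> powr 2) \<le> norm ((C powr 2) * \<bar>g a x\<bar> powr 2)" by simp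
      have [measurable]: "\<kappa> \<in> borel_measurable borel" by (rule test_functions_measurable[OF \<kappa>(1)])
      show "(\<lambda>x. \<bar>\<kappa> x * g a x\<bar> powr 2) \<in> borel_measurable lborel" by measurable
    qed
    have l2: "loc_int (\<lambda>x. \<bar>G a b x\<bar> powr 2)" by (rule integrable_imp_loc_int[OF Gsq[OF b a]])
    have two: "(2::real) > 1" by simp
    note cr = weak_chain_rule[OF two Gd[OF b a] l1 l2 test_Ck1[OF Y[OF b]]]
    have eq1: "Y b x * sgn_powr 2 (\<kappa> x * g a x) * G a b x = g a x * (Y b x * G a b x)" for x
    proof -
      have "Y b x * sgn_powr 2 (\<kappa> x * g a x) * G a b x = (Y b x * (\<kappa> x * g a x)) * G a b x" by simp
      then show ?thesis unfolding Y\<kappa>[OF b] by (simp only: mult_ac)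
    qed
    have eq2: "dir_deriv b (Y b) x * \<bar>\<kappa> x * g a x\<bar> powr 2 = dir_deriv b (Y b) x * (g a x * g a x)" for x
    proof -
      have "dir_deriv b (Y b) x * \<bar>\<kappa> x * g a x\<bar> powr 2 = dir_deriv b (Y b) x * (\<kappa> x * (g a x * (\<kappa> x * g a x)))"
        by (simp add: power2_eq_square mult.assoc)
      also have "\<dots> = dir_deriv b (Y b) x * (g a x * (\<kappa> x * g a x))" by (rule DY\<kappa>[OF b])
      also have "\<dots> = dir_deriv b (Y b) x * (\<kappa> x * (g a x * g a x))" by (simp only: mult_ac)
      also have "\<dots> = dir_deriv b (Y b) x * (g a x * g a x)" by (rule DY\<kappa>[OF b])
      finally show ?thesis .
    qed
    have AE: "AE x in lborel. g a x * (Y b x * G a b x) = g a x * (Y b x * G b a x)"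
      using sym by eventually_elim (simp only:)
    have i: "integrable lborel (\<lambda>x. g a x * (Y b x * G a b x))" using cr(1) unfolding eq1 .
    show "integrable lborel (\<lambda>x. g a x * (Y b x * G b a x))"
      by (rule integrable_cong_AE_imp[OF i _ AE]) measurable
    have "(LINT x|lborel. g a x * (Y b x * G b a x)) = (LINT x|lborel. g a x * (Y b x * G a b x))"
      by (rule integral_cong_AE[OF _ _ AE, symmetric]) measurable
    then show "(LINT x|lborel. g a x * (Y b x * G b a x)) = - (LINT x|lborel. dir_deriv b (Y b) x * (g a x * g a x)) / 2"
      using cr(2) unfolding eq1 eq2 by simp
  qed
  have mix: "integrable lborel (\<lambda>x. dir_deriv a (Y b) x * (g a x * g b x))" if a: "a \<in> Basis" and b: "b \<in> Basis" for a b
  proof -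
    have t: "dir_deriv a (Y b) \<in> test_functions" by (rule test_functions_dir_deriv[OF Y[OF b]])
    obtain C where "\<And>x. \<bar>dir_deriv a (Y b) x\<bar> \<le> C" using test_functions_bounded[OF t] by auto
    then show ?thesis by (rule bounded_gradient_product_integrable[OF a b test_functions_measurable[OF t]])
  qed
  have "(LINT x|lborel. g a x * H a x) = (\<Sum>b\<in>Basis. (LINT x|lborel. dir_deriv a (Y b) x * (g a x * g b x))
       - (LINT x|lborel. dir_deriv b (Y b) x * (g a x * g a x)) / 2)" if a: "a \<in> Basis" for a
  proof -
    have AE: "AE x in lborel. H a x = (\<Sum>b\<in>Basis. Y b x * G b a x + dir_deriv a (Y b) x * g b x)"
      by (rule wderiv_unique[OF Hd[OF a] D[OF a]])
    have m: "g a \<in> borel_measurable borel" "H a \<in> borel_measurable borel"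
      "(\<lambda>x. \<Sum>b\<in>Basis. Y b x * G b a x + dir_deriv a (Y b) x * g b x) \<in> borel_measurable borel"
      using g_measurable[OF a] loc_int_measurable[OF wderivD(2)[OF Hd[OF a]]] loc_int_measurable[OF wderivD(2)[OF D[OF a]]] by auto
    have "(LINT x|lborel. g a x * H a x) = (LINT x|lborel. g a x * (\<Sum>b\<in>Basis. Y b x * G b a x + dir_deriv a (Y b) x * g b x))"
    proof (rule integral_cong_AE)
      show "AE x in lborel. g a x * H a x = g a x * (\<Sum>b\<in>Basis. Y b x * G b a x + dir_deriv a (Y b) x * g b x)"
        using AE by eventually_elim simp
    qed (use m in measurable)
    also have "\<dots> = (LINT x|lborel. (\<Sum>b\<in>Basis. g a x * (Y b x * G b a x) + dir_deriv a (Y b) x * (g a x * g b x)))"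
      by (intro Bochner_Integration.integral_cong refl) (simp add: sum_distrib_left distrib_left mult_ac)
    also have "\<dots> = (\<Sum>b\<in>Basis. LINT x|lborel. g a x * (Y b x * G b a x) + dir_deriv a (Y b) x * (g a x * g b x))"
      by (rule Bochner_Integration.integral_sum) (rule Bochner_Integration.integrable_add[OF hess(1)[OF a] mix[OF a]])
    also have "\<dots> = (\<Sum>b\<in>Basis. (LINT x|lborel. dir_deriv a (Y b) x * (g a x * g b x))
       - (LINT x|lborel. dir_deriv b (Y b) x * (g a x * g a x)) / 2)"
    proof (rule sum.cong[OF refl])
      fix b :: 'a assume b: "b \<in> Basis"
      show "(LINT x|lborel. g a x * (Y b x * G b a x) + dir_deriv a (Y b) x * (g a x * g b x)) =
          (LINT x|lborel. dir_deriv a (Y b) x * (g a x * g b x)) - (LINT x|lborel. dir_deriv b (Y b) x * (g a x * g a x)) / 2"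
        using Bochner_Integration.integral_add[OF hess(1)[OF a b] mix[OF a b]] hess(2)[OF a b] by simp
    qed
    finally show ?thesis .
  qed
  then show ?thesis by (intro sum.cong refl)
qed

end

section \<open>The nonlocal term of the Pohozaev identity\<close>

text \<open>A smooth regularisation of \<open>|z|\<^sup>-\<^sup>m\<close>.\<close>

definition reg_kernel :: "real \<Rightarrow> real \<Rightarrow> 'a::euclidean_space \<Rightarrow> real" where
  "reg_kernel m \<delta> z = (z \<bullet> z + \<delta>\<^sup>2) powr (- (m / 2))"

lemma reg_kernel_measurable [measurable]: "reg_kernel m \<delta> \<in> borel_measurable borel"
  unfolding reg_kernel_def[abs_def] by measurable

lemma reg_kernel_nonneg: "0 \<le> reg_kernel m \<delta> z"
  by (simp add: reg_kernel_def)

lemma powr_half_inner: "m > 0 \<Longrightarrow> (z \<bullet> z) powr (- (m / 2)) = 1 / norm z powr m"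
proof -
  have "(z \<bullet> z) powr (- (m / 2)) = ((norm z) powr 2) powr (- (m / 2))"
    by (simp add: power2_norm_eq_inner)
  also have "\<dots> = norm z powr (- m)" unfolding powr_powr by (simp add: mult.commute)
  finally show ?thesis by (simp add: powr_minus_divide)
qed

lemma reg_kernel_le: "m > 0 \<Longrightarrow> z \<noteq> 0 \<Longrightarrow> reg_kernel m \<delta> z \<le> 1 / norm z powr m"
  unfolding powr_half_inner[symmetric] reg_kernel_def by (intro powr_mono2') auto

lemma reg_kernel_tendsto:
  assumes m: "m > 0" and z: "z \<noteq> 0" and \<delta>: "\<delta> \<longlonglongrightarrow> 0"
  shows "(\<lambda>n. reg_kernel m (\<delta> n) z) \<longlonglongrightarrow> 1 / norm z powr m"
proof -
  have "(\<lambda>n. (z \<bullet> z + (\<delta> n)\<^sup>2) powr (- (m / 2))) \<longlonglongrightarrow> (z \<bullet> z + 0\<^sup>2) powr (- (m / 2))"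
    using z by (intro tendsto_powr tendsto_add tendsto_power tendsto_const \<delta>) auto
  then show ?thesis using powr_half_inner[OF m, of z] by (simp add: reg_kernel_def)
qed

lemma reg_kernel_deriv:
  assumes \<delta>: "\<delta> > 0"
  shows "((\<lambda>x. reg_kernel m \<delta> (x - y)) has_derivative
    (\<lambda>v. - m * ((x - y) \<bullet> v) / ((x - y) \<bullet> (x - y) + \<delta>\<^sup>2) * reg_kernel m \<delta> (x - y))) (at x)"
proof -
  define s where "s x = (x - y) \<bullet> (x - y) + \<delta>\<^sup>2" for x
  have s: "s x > 0" for x unfolding s_def using \<delta> by (simp add: add_nonneg_pos)
  have "((\<lambda>x. x - y) has_derivative (\<lambda>v. v)) (at x)"
    using has_derivative_diff[OF has_derivative_ident has_derivative_const[of y]] by simp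
  from has_derivative_add[OF has_derivative_inner[OF this this] has_derivative_const[of "\<delta>\<^sup>2"]]
  have ds: "(s has_derivative (\<lambda>v. 2 * ((x - y) \<bullet> v))) (at x)"
    unfolding s_def[abs_def] by (simp add: inner_commute)
  have "((\<lambda>t. t powr (- (m / 2))) has_real_derivative (- (m / 2)) * s x powr (- (m / 2) - 1)) (at (s x))"
    by (rule has_real_derivative_powr[OF s])
  from DERIV_compose_FDERIV[OF this ds]
  have "((\<lambda>x. s x powr (- (m / 2))) has_derivative (\<lambda>v. 2 * ((x - y) \<bullet> v) * ((- (m / 2)) * s x powr (- (m / 2) - 1)))) (at x)" .
  moreover have "2 * ((x - y) \<bullet> v) * ((- (m / 2)) * s x powr (- (m / 2) - 1)) = - m * ((x - y) \<bullet> v) / s x * s x powr (- (m / 2))" for v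
    using s[of x] by (simp add: powr_diff)
  ultimately show ?thesis unfolding reg_kernel_def s_def by simp
qed

lemma reg_kernel_Ck1:
  assumes \<delta>: "\<delta> > 0"
  shows "Ck (Suc 0) (\<lambda>x. reg_kernel m \<delta> (x - y))"
proof (rule Ck_SucI[OF reg_kernel_deriv[OF \<delta>]])
  fix v
  have s: "(x - y) \<bullet> (x - y) + \<delta>\<^sup>2 > 0" for x using \<delta> by (simp add: add_nonneg_pos)
  then have s: "(x - y) \<bullet> (x - y) + \<delta>\<^sup>2 \<noteq> 0" for x by (metis less_irrefl)
  have "continuous_on UNIV (\<lambda>x. - m * ((x - y) \<bullet> v) / ((x - y) \<bullet> (x - y) + \<delta>\<^sup>2) * ((x - y) \<bullet> (x - y) + \<delta>\<^sup>2) powr (- (m / 2)))"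
    using s by (intro continuous_on_mult continuous_on_divide continuous_on_powr continuous_on_add continuous_on_inner
        continuous_on_diff continuous_on_const continuous_on_id) auto
  then show "Ck 0 (\<lambda>x. - m * ((x - y) \<bullet> v) / ((x - y) \<bullet> (x - y) + \<delta>\<^sup>2) * reg_kernel m \<delta> (x - y))"
    by (simp add: reg_kernel_def)
qed

lemma AE_pair_neq: "AE z in lborel \<Otimes>\<^sub>M lborel. fst z \<noteq> (snd z :: 'a::euclidean_space)"
proof (rule lborel_pair.AE_pair_measure)
  show "{z \<in> space (lborel \<Otimes>\<^sub>M lborel). fst z \<noteq> (snd z :: 'a)} \<in> sets (lborel \<Otimes>\<^sub>M lborel)"
    by measurable
  show "AE x in lborel. AE y in lborel. fst (x, y) \<noteq> (snd (x, y) :: 'a)"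
  proof (rule AE_I2)
    fix x :: 'a
    show "AE y in lborel. fst (x, y) \<noteq> snd (x, y)"
      using AE_lborel_singleton[of x] by eventually_elim simp
  qed
qed

context choquard_solution
begin

text \<open>The density whose potential enters the equation.\<close>

definition f :: "'a \<Rightarrow> real" where "f x = \<bar>u x\<bar> powr p"

lemma f_measurable [measurable]: "f \<in> borel_measurable borel"
  unfolding f_def[abs_def] by measurable

lemma f_nonneg: "f x \<ge> 0" by (simp add: f_def)

lemma kernel_nonneg: "riesz_kernel \<alpha> (z::'a) \<ge> 0"
  by (rule riesz_kernel_nonneg[OF \<alpha>])

lemma k_eq_integral: "k x = (LINT y|lborel. riesz_kernel \<alpha> (x - y) * f y)"
  unfolding k_def riesz_potential_lborel f_def[symmetric]
  by (subst integral_eq_nn_integral) (auto simp: kernel_nonneg f_nonneg)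

text \<open>
  The nonlocal term as a double integral, which is the form in which the variables can be exchanged.
\<close>

lemma pair_integral:
  assumes [measurable]: "s \<in> borel_measurable borel"
    and fin: "(\<integral>\<^sup>+x. riesz_potential \<alpha> f x * ennreal \<bar>s x\<bar> \<partial>lborel) < \<infinity>"
  shows "integrable (lborel \<Otimes>\<^sub>M lborel) (\<lambda>(x, y). riesz_kernel \<alpha> (x - y) * f y * s x)"
    and "(LINT z|(lborel \<Otimes>\<^sub>M lborel). (case z of (x, y) \<Rightarrow> riesz_kernel \<alpha> (x - y) * f y * s x)) = (LINT x|lborel. k x * s x)"
proof -
  have m: "(\<lambda>(x, y). riesz_kernel \<alpha> (x - y) * f y * s x) \<in> borel_measurable (lborel \<Otimes>\<^sub>M lborel)" by measurable
  have "(\<integral>\<^sup>+z. ennreal (norm (case z of (x, y) \<Rightarrow> riesz_kernel \<alpha> (x - y) * f y * s x)) \<partial>(lborel \<Otimes>\<^sub>M lborel)) =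
      (\<integral>\<^sup>+x. \<integral>\<^sup>+y. ennreal (norm (riesz_kernel \<alpha> (x - y) * f y * s x)) \<partial>lborel \<partial>lborel)"
    by (subst lborel.nn_integral_fst[symmetric]) (simp_all add: split_beta')
  also have "\<dots> = (\<integral>\<^sup>+x. riesz_potential \<alpha> f x * ennreal \<bar>s x\<bar> \<partial>lborel)"
  proof (rule nn_integral_cong)
    fix x
    have "(\<integral>\<^sup>+y. ennreal (norm (riesz_kernel \<alpha> (x - y) * f y * s x)) \<partial>lborel) =
        (\<integral>\<^sup>+y. ennreal (riesz_kernel \<alpha> (x - y) * f y) * ennreal \<bar>s x\<bar> \<partial>lborel)"
      by (rule nn_integral_cong) (simp add: abs_mult kernel_nonneg f_nonneg ennreal_mult)
    also have "\<dots> = riesz_potential \<alpha> f x * ennreal \<bar>s x\<bar>"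
      unfolding riesz_potential_lborel by (rule nn_integral_multc) measurable
    finally show "(\<integral>\<^sup>+y. ennreal (norm (riesz_kernel \<alpha> (x - y) * f y * s x)) \<partial>lborel) = riesz_potential \<alpha> f x * ennreal \<bar>s x\<bar>" .
  qed
  also have "\<dots> < \<infinity>" by (rule fin)
  finally show int: "integrable (lborel \<Otimes>\<^sub>M lborel) (\<lambda>(x, y). riesz_kernel \<alpha> (x - y) * f y * s x)"
    by (rule integrableI_bounded[OF m])
  have "(LINT x|lborel. LINT y|lborel. riesz_kernel \<alpha> (x - y) * f y * s x) =
      (LINT z|(lborel \<Otimes>\<^sub>M lborel). (case z of (x, y) \<Rightarrow> riesz_kernel \<alpha> (x - y) * f y * s x))"
    by (rule lborel_pair.integral_fst[OF int])
  then show "(LINT z|(lborel \<Otimes>\<^sub>M lborel). (case z of (x, y) \<Rightarrow> riesz_kernel \<alpha> (x - y) * f y * s x)) = (LINT x|lborel. k x * s x)"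
    by (simp add: k_eq_integral)
qed

lemma potential_pairing_finite:
  assumes w: "w \<in> borel_measurable borel" and "coulomb_energy \<alpha> p w < \<infinity>"
  shows "(\<integral>\<^sup>+x. riesz_potential \<alpha> f x * ennreal (\<bar>w x\<bar> powr p) \<partial>lborel) < \<infinity>"
proof -
  obtain C where C: "C < \<infinity>" "(\<integral>\<^sup>+x. riesz_potential \<alpha> (\<lambda>y. \<bar>u y\<bar> powr p) x * ennreal (\<bar>w x\<bar> powr p) \<partial>lborel) \<le>
     C * (coulomb_energy \<alpha> p u + coulomb_energy \<alpha> p w)"
    using potential_energy_bound w by blast
  have "C * (coulomb_energy \<alpha> p u + coulomb_energy \<alpha> p w) < \<infinity>"
    using C(1) u_coulomb assms(2) by (simp add: ennreal_mult_less_top)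
  with C(2) show ?thesis unfolding f_def[abs_def] by (rule le_less_trans)
qed

text \<open>
  The integrand of the double integral that represents the nonlocal energy. Its
  multiples dominate all integrands on the right-hand side of the symmetrised identity.
\<close>

definition J :: "'a \<times> 'a \<Rightarrow> real" where
  "J = (\<lambda>(x, y). riesz_kernel \<alpha> (x - y) * f y * f x)"

lemma J_integrable: "integrable (lborel \<Otimes>\<^sub>M lborel) J"
  and J_integral: "(LINT z|(lborel \<Otimes>\<^sub>M lborel). J z) = (LINT x|lborel. k x * \<bar>u x\<bar> powr p)"
proof -
  have "(\<integral>\<^sup>+x. riesz_potential \<alpha> f x * ennreal \<bar>f x\<bar> \<partial>lborel) < \<infinity>"
    using potential_pairing_finite[OF u_measurable u_coulomb] unfolding f_def by simp
  from pair_integral[OF f_measurable this]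
  show "integrable (lborel \<Otimes>\<^sub>M lborel) J" "(LINT z|(lborel \<Otimes>\<^sub>M lborel). J z) = (LINT x|lborel. k x * \<bar>u x\<bar> powr p)"
    unfolding J_def by (simp_all add: f_def)
qed

lemma J_nonneg: "J z \<ge> 0"
  unfolding J_def by (simp add: split_beta' kernel_nonneg f_nonneg)

end

context choquard_regular
begin

text \<open>
  For \<open>\<delta> > 0\<close> the regularised kernel times a component of \<open>Y\<close> is continuously differentiable with bounded
  support, hence a legitimate weight in the chain rule for \<open>|u|\<^sup>p\<close>.
\<close>

lemma regularised_chain_rule:
  fixes codim :: real
  assumes Y: "\<And>b. b \<in> Basis \<Longrightarrow> Y b \<in> test_functions" and \<delta>: "\<delta> > 0"
  shows "p * (LINT x|lborel. reg_kernel codim \<delta> (x - y) * (sgn_powr p (u x) * (\<Sum>b\<in>Basis. Y b x * g b x))) =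
    - (LINT x|lborel. reg_kernel codim \<delta> (x - y) * f x *
        ((\<Sum>b\<in>Basis. dir_deriv b (Y b) x) - codim * ((\<Sum>b\<in>Basis. ((x - y) \<bullet> b) * Y b x) / ((x - y) \<bullet> (x - y) + \<delta>\<^sup>2))))"
proof -
  define K where "K x = reg_kernel codim \<delta> (x - y)" for x
  have K: "Ck (Suc 0) K" unfolding K_def[abs_def] by (rule reg_kernel_Ck1[OF \<delta>])
  define \<eta> where "\<eta> b x = K x * Y b x" for b x
  have \<eta>: "Ck (Suc 0) (\<eta> b)" if "b \<in> Basis" for b
    unfolding \<eta>_def[abs_def] by (rule Ck_mult[OF K test_functions_Ck[OF Y[OF that]]])
  have \<eta>b: "bounded_support (\<eta> b)" if "b \<in> Basis" for b
    using Y[OF that] unfolding \<eta>_def[abs_def] test_functions_iff bounded_support_def by auto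
  have D: "dir_deriv b (\<eta> b) x * f x = K x * f x * (dir_deriv b (Y b) x - codim * ((((x - y) \<bullet> b) * Y b x) / ((x - y) \<bullet> (x - y) + \<delta>\<^sup>2)))"
    if b: "b \<in> Basis" for b x
  proof -
    have "dir_deriv b (\<eta> b) x = K x * dir_deriv b (Y b) x + dir_deriv b K x * Y b x"
      unfolding \<eta>_def[abs_def] by (rule dir_deriv_bilinear[OF bounded_bilinear_mult K test_Ck1(1)[OF Y[OF b]]])
    moreover have "dir_deriv b K x = - codim * ((x - y) \<bullet> b) / ((x - y) \<bullet> (x - y) + \<delta>\<^sup>2) * K x"
      unfolding K_def[abs_def] by (rule dir_derivI[OF reg_kernel_deriv[OF \<delta>]])
    moreover have "(k * A + (- m * t / n * k) * y') * h = k * h * (A - m * ((t * y') / n))" for k A m t n y' h :: real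
      by (simp add: algebra_simps)
    ultimately show ?thesis by (simp only:)
  qed
  have i: "integrable lborel (\<lambda>x. \<eta> b x * sgn_powr p (u x) * g b x)"
    and e: "p * (LINT x|lborel. \<eta> b x * sgn_powr p (u x) * g b x) = - (LINT x|lborel. dir_deriv b (\<eta> b) x * f x)"
    if b: "b \<in> Basis" for b
    using weak_chain_rule[OF p u_wderiv[OF b] u_loc_int(2) gradient_loc_int(2)[OF b] \<eta>[OF b] \<eta>b[OF b]] unfolding f_def by auto
  have lf: "loc_int f" using u_loc_int(2) unfolding f_def[abs_def] .
  have j: "integrable lborel (\<lambda>x. dir_deriv b (\<eta> b) x * f x)" if b: "b \<in> Basis" for b
  proof -
    obtain C where C: "\<And>x v. \<bar>dir_deriv v (\<eta> b) x\<bar> \<le> C * norm v" using Ck1_bounded_derivative[OF \<eta>[OF b] \<eta>b[OF b]] by blast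
    show ?thesis
      by (rule loc_int_mult_integrable[OF lf Ck_measurable[OF Ck_dir_deriv[OF \<eta>[OF b]]] C bounded_support_dir_deriv[OF \<eta>b[OF b]]])
  qed
  have "(LINT x|lborel. K x * (sgn_powr p (u x) * (\<Sum>b\<in>Basis. Y b x * g b x))) =
      (LINT x|lborel. (\<Sum>b\<in>Basis. \<eta> b x * sgn_powr p (u x) * g b x))"
    by (intro Bochner_Integration.integral_cong refl) (simp add: sum_distrib_left \<eta>_def mult_ac)
  also have "\<dots> = (\<Sum>b\<in>Basis. LINT x|lborel. \<eta> b x * sgn_powr p (u x) * g b x)"
    by (rule Bochner_Integration.integral_sum) (rule i)
  finally have "p * (LINT x|lborel. K x * (sgn_powr p (u x) * (\<Sum>b\<in>Basis. Y b x * g b x))) =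
      (\<Sum>b\<in>Basis. - (LINT x|lborel. dir_deriv b (\<eta> b) x * f x))"
    by (simp add: sum_distrib_left e)
  also have "\<dots> = - (LINT x|lborel. (\<Sum>b\<in>Basis. dir_deriv b (\<eta> b) x * f x))"
    by (subst Bochner_Integration.integral_sum) (simp_all add: j sum_negf)
  also have "(LINT x|lborel. (\<Sum>b\<in>Basis. dir_deriv b (\<eta> b) x * f x)) =
      (LINT x|lborel. K x * f x * ((\<Sum>b\<in>Basis. dir_deriv b (Y b) x) - codim * ((\<Sum>b\<in>Basis. ((x - y) \<bullet> b) * Y b x) / ((x - y) \<bullet> (x - y) + \<delta>\<^sup>2))))"
  proof (intro Bochner_Integration.integral_cong refl)
    fix x
    show "(\<Sum>b\<in>Basis. dir_deriv b (\<eta> b) x * f x) =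
      K x * f x * ((\<Sum>b\<in>Basis. dir_deriv b (Y b) x) - codim * ((\<Sum>b\<in>Basis. ((x - y) \<bullet> b) * Y b x) / ((x - y) \<bullet> (x - y) + \<delta>\<^sup>2)))"
      by (simp only: D cong: sum.cong) (simp only: sum_distrib_left[symmetric] sum_subtractf sum_divide_distrib)
  qed
  finally show ?thesis unfolding K_def .
qed

text \<open>
  Integrating the regularised chain rule over \<open>y\<close> against \<open>|u(y)|\<^sup>p\<close> produces, besides the divergence of \<open>Y\<close>,
  the quotient \<open>((x - y) \<cdot> Y(x)) / (|x - y|\<^sup>2 + \<delta>\<^sup>2)\<close>, which is not bounded uniformly in \<open>\<delta>\<close>. Exchanging the
  variables and taking the mean replaces \<open>Y(x)\<close> by half of \<open>Y(x) - Y(y)\<close>. As \<open>Y\<close> is Lipschitz continuous, the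
  quotient is now bounded, and dominated convergence lets \<open>\<delta> \<rightarrow> 0\<close>.
\<close>

lemma nonlocal_term:
  fixes codim :: real
  assumes codim: "codim = real DIM('a) - \<alpha>"
    and Y: "\<And>b. b \<in> Basis \<Longrightarrow> Y b \<in> test_functions"
    and L: "\<And>b x y. b \<in> Basis \<Longrightarrow> \<bar>Y b x - Y b y\<bar> \<le> L b * norm (x - y)"
    and H: "admissible (\<lambda>x. \<Sum>b\<in>Basis. Y b x * g b x) H"
  shows "p * (LINT x|lborel. k x * sgn_powr p (u x) * (\<Sum>b\<in>Basis. Y b x * g b x)) =
    - (LINT z|(lborel \<Otimes>\<^sub>M lborel). J z * ((\<Sum>b\<in>Basis. dir_deriv b (Y b) (fst z)) -
        codim / 2 * ((\<Sum>b\<in>Basis. ((fst z - snd z) \<bullet> b) * (Y b (fst z) - Y b (snd z))) / ((fst z - snd z) \<bullet> (fst z - snd z)))))"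
proof -
  define P where "P = (lborel \<Otimes>\<^sub>M lborel :: ('a \<times> 'a) measure)"
  define W where "W x = (\<Sum>b\<in>Basis. Y b x * g b x)" for x
  define s where "s x = sgn_powr p (u x) * W x" for x
  define c where "c = riesz_const DIM('a) \<alpha>"
  define dv where "dv x = (\<Sum>b\<in>Basis. dir_deriv b (Y b) x)" for x
  define \<delta> where "\<delta> n = inverse (real (Suc n))" for n
  have \<delta>: "\<delta> n > 0" for n by (simp add: \<delta>_def)
  have \<delta>0: "\<delta> \<longlonglongrightarrow> 0" unfolding \<delta>_def by (rule LIMSEQ_inverse_real_of_nat)
  have c: "c > 0" unfolding c_def by (rule riesz_const_pos[OF \<alpha>])
  have m: "codim > 0" using \<alpha> codim by simp
  define K where "K n z = c * reg_kernel codim (\<delta> n) z" for n and z :: 'a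
  define N2 where "N2 n z = z \<bullet> z + (\<delta> n)\<^sup>2" for n and z :: 'a
  define T where "T n x y = (\<Sum>b\<in>Basis. ((x - y) \<bullet> b) * Y b x) / N2 n (x - y)" for n x y
  define \<rho> where "\<rho> n x y = (\<Sum>b\<in>Basis. ((x - y) \<bullet> b) * (Y b x - Y b y)) / N2 n (x - y)" for n x y
  define \<rho>0 where "\<rho>0 x y = (\<Sum>b\<in>Basis. ((x - y) \<bullet> b) * (Y b x - Y b y)) / ((x - y) \<bullet> (x - y))" for x y
  have Ym: "Y b \<in> borel_measurable borel" "dir_deriv b (Y b) \<in> borel_measurable borel" if "b \<in> Basis" for b
    using test_functions_measurable[OF Y[OF that]] test_functions_measurable[OF test_functions_dir_deriv[OF Y[OF that]]] by auto
  have Wm [measurable]: "W \<in> borel_measurable borel"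
    unfolding W_def[abs_def] by (rule admissible_measurable(1)[OF H])
  have sm [measurable]: "s \<in> borel_measurable borel" unfolding s_def[abs_def] by measurable
  have dvm [measurable]: "dv \<in> borel_measurable borel"
    unfolding dv_def[abs_def] by (rule borel_measurable_sum) (rule Ym(2))
  have Km [measurable]: "K n \<in> borel_measurable borel" for n unfolding K_def[abs_def] by measurable
  have N2m [measurable]: "N2 n \<in> borel_measurable borel" for n unfolding N2_def[abs_def] by measurable
  have Y1: "(\<lambda>z. Y b (fst z)) \<in> borel_measurable P" "(\<lambda>z. Y b (snd z)) \<in> borel_measurable P" if "b \<in> Basis" for b
    unfolding P_def using Ym(1)[OF that] by measurable
  have Tm [measurable]: "(\<lambda>z. T n (fst z) (snd z)) \<in> borel_measurable P"
    and \<rho>m [measurable]: "(\<lambda>z. \<rho> n (fst z) (snd z)) \<in> borel_measurable P"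
    and \<rho>0m [measurable]: "(\<lambda>z. \<rho>0 (fst z) (snd z)) \<in> borel_measurable P" for n
  proof -
    have in_m: "(\<lambda>z. (fst z - snd z) \<bullet> b) \<in> borel_measurable P" for b :: 'a unfolding P_def by measurable
    have N2P: "(\<lambda>z. N2 n (fst z - snd z)) \<in> borel_measurable P" unfolding P_def by measurable
    have N0P: "(\<lambda>z. (fst z - snd z) \<bullet> (fst z - snd z)) \<in> borel_measurable P" unfolding P_def by measurable
    show "(\<lambda>z. T n (fst z) (snd z)) \<in> borel_measurable P" unfolding T_def
      by (rule borel_measurable_divide[OF borel_measurable_sum[OF borel_measurable_times[OF in_m Y1(1)]] N2P])
    show "(\<lambda>z. \<rho> n (fst z) (snd z)) \<in> borel_measurable P" unfolding \<rho>_def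
      by (rule borel_measurable_divide[OF borel_measurable_sum[OF borel_measurable_times[OF in_m borel_measurable_diff[OF Y1]]] N2P])
    show "(\<lambda>z. \<rho>0 (fst z) (snd z)) \<in> borel_measurable P" unfolding \<rho>0_def
      by (rule borel_measurable_divide[OF borel_measurable_sum[OF borel_measurable_times[OF in_m borel_measurable_diff[OF Y1]]] N0P])
  qed
  have KI: "0 \<le> K n z" "z \<noteq> 0 \<Longrightarrow> K n z \<le> riesz_kernel \<alpha> z" for n z
  proof -
    show "0 \<le> K n z" using c by (simp add: K_def reg_kernel_nonneg)
    assume "z \<noteq> 0"
    then show "K n z \<le> riesz_kernel \<alpha> z"
      using mult_left_mono[OF reg_kernel_le[OF m, of z "\<delta> n"], of c] c by (simp add: K_def riesz_kernel_def c_def codim)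
  qed
  have Klim: "(\<lambda>n. K n z) \<longlonglongrightarrow> riesz_kernel \<alpha> z" if "z \<noteq> 0" for z
    using tendsto_mult_left[OF reg_kernel_tendsto[OF m that \<delta>0], of c] by (simp add: K_def riesz_kernel_def c_def codim)
  have N2pos: "N2 n z > 0" for n z unfolding N2_def using \<delta>[of n] by (simp add: add_nonneg_pos)
  have N2lim: "(\<lambda>n. N2 n z) \<longlonglongrightarrow> z \<bullet> z" for z
    using tendsto_add[OF tendsto_const[of "z \<bullet> z"] tendsto_power[OF \<delta>0, of 2]] by (simp add: N2_def)
  \<comment> \<open>The bound on \<open>T n\<close> degenerates as \<open>n\<close> grows, but it is only used for integrability at fixed \<open>n\<close>. The bound
    on \<open>\<rho> n\<close> is uniform, as needed for the limit.\<close>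
  have "\<exists>C\<ge>0. \<forall>x. \<bar>dir_deriv b (Y b) x\<bar> \<le> C \<and> \<bar>Y b x\<bar> \<le> C" if b: "b \<in> Basis" for b
  proof -
    obtain C1 where C1: "C1 \<ge> 0" "\<And>x. \<bar>dir_deriv b (Y b) x\<bar> \<le> C1"
      using test_functions_bounded[OF test_functions_dir_deriv[OF Y[OF b]], of b] by auto
    obtain C2 where C2: "\<And>x. \<bar>Y b x\<bar> \<le> C2" using test_functions_bounded[OF Y[OF b]] by auto
    show ?thesis
    proof (intro exI[of _ "max C1 C2"] conjI allI)
      show "0 \<le> max C1 C2" using C1(1) by simp
      show "\<bar>dir_deriv b (Y b) x\<bar> \<le> max C1 C2" "\<bar>Y b x\<bar> \<le> max C1 C2" for x
        using C1(2)[of x] C2[of x] by linarith+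
    qed
  qed
  then obtain C where C: "\<And>b. b \<in> Basis \<Longrightarrow> C b \<ge> 0" "\<And>b x. b \<in> Basis \<Longrightarrow> \<bar>dir_deriv b (Y b) x\<bar> \<le> C b"
    "\<And>b x. b \<in> Basis \<Longrightarrow> \<bar>Y b x\<bar> \<le> C b" by metis
  define CC where "CC = (\<Sum>b\<in>Basis. C b)"
  define LL where "LL = (\<Sum>b\<in>Basis. \<bar>L b\<bar>)"
  have CC: "CC \<ge> 0" unfolding CC_def by (rule sum_nonneg) (rule C(1))
  have dv_bound: "\<bar>dv x\<bar> \<le> CC" for x
    unfolding dv_def CC_def by (rule order_trans[OF sum_abs sum_mono]) (rule C(2))
  have T_bound: "\<bar>T n x y\<bar> \<le> CC / \<delta> n" for n x y
  proof -
    have "\<bar>\<Sum>b\<in>Basis. ((x - y) \<bullet> b) * Y b x\<bar> \<le> (\<Sum>b\<in>Basis. norm (x - y) * C b)"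
    proof (rule order_trans[OF sum_abs sum_mono])
      fix b :: 'a assume b: "b \<in> Basis"
      show "\<bar>((x - y) \<bullet> b) * Y b x\<bar> \<le> norm (x - y) * C b"
        unfolding abs_mult by (rule mult_mono[OF Basis_le_norm[OF b] C(3)[OF b]]) simp_all
    qed
    then have 1: "\<bar>\<Sum>b\<in>Basis. ((x - y) \<bullet> b) * Y b x\<bar> \<le> norm (x - y) * CC"
      unfolding CC_def sum_distrib_left .
    have "norm (x - y) * \<delta> n \<le> N2 n (x - y)"
    proof -
      have "2 * (norm (x - y) * \<delta> n) \<le> (norm (x - y))\<^sup>2 + (\<delta> n)\<^sup>2"
        using sum_squares_bound[of "norm (x - y)" "\<delta> n"] by simp
      moreover have "0 \<le> norm (x - y) * \<delta> n" using \<delta>[of n] by simp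
      ultimately show ?thesis unfolding N2_def power2_norm_eq_inner by linarith
    qed
    then have "norm (x - y) * \<delta> n * CC \<le> N2 n (x - y) * CC" using CC by (rule mult_right_mono)
    then have "(norm (x - y) * CC) / N2 n (x - y) \<le> CC / \<delta> n"
      using N2pos[of n "x - y"] \<delta>[of n] by (simp add: divide_le_eq le_divide_eq mult_ac)
    moreover have "\<bar>T n x y\<bar> \<le> (norm (x - y) * CC) / N2 n (x - y)"
      unfolding T_def abs_divide using 1 N2pos[of n "x - y"] by (simp add: divide_right_mono)
    ultimately show ?thesis by linarith
  qed
  have num: "\<bar>\<Sum>b\<in>Basis. ((x - y) \<bullet> b) * (Y b x - Y b y)\<bar> \<le> LL * ((x - y) \<bullet> (x - y))" for x y
  proof -
    have "\<bar>\<Sum>b\<in>Basis. ((x - y) \<bullet> b) * (Y b x - Y b y)\<bar> \<le> (\<Sum>b\<in>Basis. norm (x - y) * (\<bar>L b\<bar> * norm (x - y)))"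
    proof (rule order_trans[OF sum_abs sum_mono])
      fix b :: 'a assume b: "b \<in> Basis"
      have "L b * norm (x - y) \<le> \<bar>L b\<bar> * norm (x - y)" by (rule mult_right_mono) auto
      then have "\<bar>Y b x - Y b y\<bar> \<le> \<bar>L b\<bar> * norm (x - y)" using L[OF b, of x y] by linarith
      then show "\<bar>((x - y) \<bullet> b) * (Y b x - Y b y)\<bar> \<le> norm (x - y) * (\<bar>L b\<bar> * norm (x - y))"
        unfolding abs_mult by (rule mult_mono[OF Basis_le_norm[OF b]]) simp_all
    qed
    also have "\<dots> = LL * (norm (x - y))\<^sup>2" unfolding LL_def sum_distrib_right
      by (rule sum.cong[OF refl]) (simp only: power2_eq_square mult_ac)
    finally show ?thesis unfolding power2_norm_eq_inner .
  qed
  have LL: "LL \<ge> 0" unfolding LL_def by (rule sum_nonneg) simp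
  have \<rho>_bound: "\<bar>\<rho> n x y\<bar> \<le> LL" for n x y
  proof -
    have "LL * ((x - y) \<bullet> (x - y)) \<le> LL * N2 n (x - y)"
      unfolding N2_def using LL by (intro mult_left_mono) auto
    then have "\<bar>\<Sum>b\<in>Basis. ((x - y) \<bullet> b) * (Y b x - Y b y)\<bar> \<le> LL * N2 n (x - y)" using num[of x y] by linarith
    then show ?thesis unfolding \<rho>_def abs_divide using N2pos[of n "x - y"] by (simp add: divide_le_eq)
  qed
  have \<rho>lim: "(\<lambda>n. \<rho> n x y) \<longlonglongrightarrow> \<rho>0 x y" if "x \<noteq> y" for x y
    unfolding \<rho>_def \<rho>0_def using that by (intro tendsto_divide tendsto_const N2lim) auto
  \<comment> \<open>All integrands are dominated by a multiple of \<open>J\<close> or by the integrand of the nonlocal term.\<close>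
  define F where "F z = f (fst z) * f (snd z)" for z :: "'a \<times> 'a"
  have Fm [measurable]: "F \<in> borel_measurable P" unfolding F_def[abs_def] P_def by measurable
  have KP [measurable]: "(\<lambda>z. K n (fst z - snd z)) \<in> borel_measurable P" for n unfolding P_def by measurable
  have JF: "J z = riesz_kernel \<alpha> (fst z - snd z) * F z" for z
    unfolding J_def F_def by (simp add: split_beta' mult_ac)
  have F0: "F z \<ge> 0" for z unfolding F_def by (simp add: f_nonneg)
  have JP: "integrable P J" unfolding P_def by (rule J_integrable)
  have ne: "AE z in P. fst z \<noteq> snd z" unfolding P_def by (rule AE_pair_neq)
  have KFJ: "K n (fst z - snd z) * F z \<le> J z" if "fst z \<noteq> snd z" for n z
    unfolding JF using that by (intro mult_right_mono KI F0) auto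
  have dominated: "integrable P (\<lambda>z. K n (fst z - snd z) * F z * h z)"
    if [measurable]: "h \<in> borel_measurable P" and h: "\<And>z. \<bar>h z\<bar> \<le> B" for h n B
  proof (rule Bochner_Integration.integrable_bound[OF integrable_mult_right[OF JP, of B]])
    show "AE z in P. norm (K n (fst z - snd z) * F z * h z) \<le> norm (B * J z)"
      using ne
    proof eventually_elim
      case (elim z)
      have "\<bar>K n (fst z - snd z) * F z\<bar> = K n (fst z - snd z) * F z" using KI(1) F0 by simp
      then have "norm (K n (fst z - snd z) * F z * h z) = K n (fst z - snd z) * F z * \<bar>h z\<bar>"
        by (simp add: abs_mult)
      also have "\<dots> \<le> J z * B" using KFJ[OF elim, of n] h[of z] J_nonneg[of z] by (intro mult_mono) auto
      finally show ?case using abs_ge_self[of "B * J z"] by (simp add: mult.commute)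
    qed
  qed measurable
  have dvP [measurable]: "(\<lambda>z. dv (fst z)) \<in> borel_measurable P" unfolding P_def by measurable
  have W_eq: "(\<lambda>x. \<Sum>b\<in>Basis. Y b x * g b x) = W" by (simp add: W_def fun_eq_iff)
  have Wc: "coulomb_energy \<alpha> p W < \<infinity>" using H unfolding admissible_def W_eq by blast
  have fin: "(\<integral>\<^sup>+x. riesz_potential \<alpha> f x * ennreal \<bar>s x\<bar> \<partial>lborel) < \<infinity>"
  proof -
    have "(\<integral>\<^sup>+x. riesz_potential \<alpha> f x * ennreal \<bar>s x\<bar> \<partial>lborel) \<le>
        (\<integral>\<^sup>+x. riesz_potential \<alpha> f x * ennreal (\<bar>u x\<bar> powr p) + riesz_potential \<alpha> f x * ennreal (\<bar>W x\<bar> powr p) \<partial>lborel)"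
    proof (rule nn_integral_mono)
      fix x
      have "ennreal \<bar>s x\<bar> \<le> ennreal (\<bar>u x\<bar> powr p) + ennreal (\<bar>W x\<bar> powr p)"
        unfolding s_def ennreal_plus[OF powr_ge_zero powr_ge_zero, symmetric]
        by (rule ennreal_leI[OF abs_sgn_powr_mult_le[OF p]])
      then show "riesz_potential \<alpha> f x * ennreal \<bar>s x\<bar> \<le>
          riesz_potential \<alpha> f x * ennreal (\<bar>u x\<bar> powr p) + riesz_potential \<alpha> f x * ennreal (\<bar>W x\<bar> powr p)"
        unfolding distrib_left[symmetric] by (rule mult_left_mono) simp
    qed
    also have "\<dots> = (\<integral>\<^sup>+x. riesz_potential \<alpha> f x * ennreal (\<bar>u x\<bar> powr p) \<partial>lborel) + (\<integral>\<^sup>+x. riesz_potential \<alpha> f x * ennreal (\<bar>W x\<bar> powr p) \<partial>lborel)"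
      by (rule nn_integral_add) measurable
    also have "\<dots> < \<infinity>"
      using potential_pairing_finite[OF u_measurable u_coulomb] potential_pairing_finite[OF Wm Wc] by simp
    finally show ?thesis .
  qed
  define A where "A z = riesz_kernel \<alpha> (fst z - snd z) * f (snd z) * s (fst z)" for z
  have A: "integrable P A" "(LINT z|P. A z) = (LINT x|lborel. k x * s x)"
    using pair_integral[OF sm fin] unfolding A_def[abs_def] P_def by (simp_all add: split_beta')
  define An where "An n z = K n (fst z - snd z) * f (snd z) * s (fst z)" for n z
  have Anm [measurable]: "An n \<in> borel_measurable P" for n unfolding An_def[abs_def] P_def by measurable
  have An_le: "AE z in P. norm (An n z) \<le> \<bar>A z\<bar>" for n
    using ne
  proof eventually_elim
    case (elim z)
    then have "K n (fst z - snd z) \<le> riesz_kernel \<alpha> (fst z - snd z)" by (intro KI(2)) simp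
    then show ?case
      unfolding An_def A_def using KI(1)[of n "fst z - snd z"] f_nonneg[of "snd z"] kernel_nonneg[of "fst z - snd z"]
      by (simp add: abs_mult mult_right_mono)
  qed
  have An: "integrable P (An n)" for n
    by (rule Bochner_Integration.integrable_bound[OF integrable_abs[OF A(1)] Anm]) (use An_le[of n] in simp)
  \<comment> \<open>The identity for \<open>\<delta> > 0\<close>, already in its symmetrised form.\<close>
  have step: "p * (LINT z|P. An n z) = - (LINT z|P. K n (fst z - snd z) * F z * (dv (fst z) - codim / 2 * \<rho> n (fst z) (snd z)))" for n
  proof -
    have hb: "\<bar>dv (fst z) - codim * T n (fst z) (snd z)\<bar> \<le> CC + codim * (CC / \<delta> n)" for z
    proof -
      have "codim * \<bar>T n (fst z) (snd z)\<bar> \<le> codim * (CC / \<delta> n)" using m T_bound by (intro mult_left_mono) auto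
      then have "\<bar>codim * T n (fst z) (snd z)\<bar> \<le> codim * (CC / \<delta> n)" using m by (simp add: abs_mult)
      then show ?thesis using dv_bound[of "fst z"] by linarith
    qed
    have iB: "integrable P (\<lambda>z. K n (fst z - snd z) * F z * (dv (fst z) - codim * T n (fst z) (snd z)))"
      by (rule dominated[OF _ hb]) measurable
    have "p * (LINT x|lborel. An n (x, y)) = - (LINT x|lborel. K n (x - y) * F (x, y) * (dv x - codim * T n x y))" for y
    proof -
      have "(LINT x|lborel. An n (x, y)) =
          (LINT x|lborel. (c * f y) * (reg_kernel codim (\<delta> n) (x - y) * (sgn_powr p (u x) * (\<Sum>b\<in>Basis. Y b x * g b x))))"
        unfolding An_def K_def s_def W_def fst_conv snd_conv
        by (intro Bochner_Integration.integral_cong refl) (simp only: mult_ac)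
      then have "p * (LINT x|lborel. An n (x, y)) =
          (c * f y) * (p * (LINT x|lborel. reg_kernel codim (\<delta> n) (x - y) * (sgn_powr p (u x) * (\<Sum>b\<in>Basis. Y b x * g b x))))"
        by simp
      also have "\<dots> = (c * f y) * (- (LINT x|lborel. reg_kernel codim (\<delta> n) (x - y) * f x * (dv x - codim * T n x y)))"
      proof -
        have "p * (LINT x|lborel. reg_kernel codim (\<delta> n) (x - y) * (sgn_powr p (u x) * (\<Sum>b\<in>Basis. Y b x * g b x))) =
            - (LINT x|lborel. reg_kernel codim (\<delta> n) (x - y) * f x * (dv x - codim * T n x y))"
          unfolding dv_def T_def N2_def by (rule regularised_chain_rule[OF _ \<delta>]) (rule Y)
        then show ?thesis by (simp only:)
      qed
      also have "\<dots> = - (LINT x|lborel. (c * f y) * (reg_kernel codim (\<delta> n) (x - y) * f x * (dv x - codim * T n x y)))"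
        by simp
      also have "(LINT x|lborel. (c * f y) * (reg_kernel codim (\<delta> n) (x - y) * f x * (dv x - codim * T n x y))) =
          (LINT x|lborel. K n (x - y) * F (x, y) * (dv x - codim * T n x y))"
        unfolding K_def F_def fst_conv snd_conv
        by (intro Bochner_Integration.integral_cong refl) (simp only: mult_ac)
      finally show ?thesis .
    qed
    then have "(LINT y|lborel. p * (LINT x|lborel. An n (x, y))) = (LINT y|lborel. - (LINT x|lborel. K n (x - y) * F (x, y) * (dv x - codim * T n x y)))"
      by (simp only:)
    moreover have "(LINT y|lborel. LINT x|lborel. An n (x, y)) = (LINT z|P. An n z)"
      using lborel_pair.integral_snd[of "\<lambda>x y. An n (x, y)"] An[of n] unfolding P_def by simp
    moreover have "(LINT y|lborel. LINT x|lborel. K n (x - y) * F (x, y) * (dv x - codim * T n x y)) =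
        (LINT z|P. K n (fst z - snd z) * F z * (dv (fst z) - codim * T n (fst z) (snd z)))"
      using lborel_pair.integral_snd[of "\<lambda>x y. K n (x - y) * F (x, y) * (dv x - codim * T n x y)"] iB
      unfolding P_def by (simp add: split_beta')
    ultimately have 1: "p * (LINT z|P. An n z) = - (LINT z|P. K n (fst z - snd z) * F z * (dv (fst z) - codim * T n (fst z) (snd z)))"
      by simp
    have i1: "integrable P (\<lambda>z. K n (fst z - snd z) * F z * dv (fst z))"
      by (rule dominated[OF _ dv_bound]) measurable
    have i2: "integrable P (\<lambda>z. K n (fst z - snd z) * F z * T n (fst z) (snd z))"
      by (rule dominated[OF _ T_bound]) measurable
    have i3: "integrable P (\<lambda>z. K n (fst z - snd z) * F z * \<rho> n (fst z) (snd z))"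
      by (rule dominated[OF _ \<rho>_bound]) measurable
    define S where "S z = K n (fst z - snd z) * F z * T n (fst z) (snd z)" for z
    have S: "integrable P S" using i2 unfolding S_def[abs_def] .
    \<comment> \<open>Kernel and density are symmetric in the two variables while \<open>x - y\<close> changes its sign, so the terms with
      \<open>Y(x)\<close> and \<open>Y(y)\<close> combine to a difference.\<close>
    have swap: "S z + S (snd z, fst z) = K n (fst z - snd z) * F z * \<rho> n (fst z) (snd z)" for z
    proof -
      obtain x y where z: "z = (x, y)" by (cases z)
      have 1: "K n (y - x) = K n (x - y)" "N2 n (y - x) = N2 n (x - y)"
        unfolding K_def N2_def reg_kernel_def by (simp_all add: inner_diff inner_commute algebra_simps)
      have 2: "F (y, x) = F (x, y)" by (simp add: F_def mult.commute)
      have "(\<Sum>b\<in>Basis. ((y - x) \<bullet> b) * Y b y) = - (\<Sum>b\<in>Basis. ((x - y) \<bullet> b) * Y b y)"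
        unfolding sum_negf[symmetric] by (rule sum.cong[OF refl]) (simp add: inner_diff_left algebra_simps)
      then have "T n x y + T n y x = \<rho> n x y"
        unfolding T_def \<rho>_def 1 by (simp add: right_diff_distrib sum_subtractf diff_divide_distrib)
      then show ?thesis unfolding z S_def by (simp only: fst_conv snd_conv 1 2 distrib_left[symmetric])
    qed
    have "(LINT z|P. S (snd z, fst z)) = (LINT z|P. S z)" "integrable P (\<lambda>z. S (snd z, fst z))"
      using lborel_pair.integral_product_swap[of S] lborel_pair.integrable_product_swap[of S] S
      unfolding P_def by (auto simp: split_beta' integrable_iff_bounded)
    then have "2 * (LINT z|P. S z) = (LINT z|P. K n (fst z - snd z) * F z * \<rho> n (fst z) (snd z))"
      using Bochner_Integration.integral_add[OF S, of "\<lambda>z. S (snd z, fst z)"] unfolding swap by simp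
    moreover have "(LINT z|P. K n (fst z - snd z) * F z * (dv (fst z) - codim * T n (fst z) (snd z))) =
        (LINT z|P. K n (fst z - snd z) * F z * dv (fst z)) - codim * (LINT z|P. S z)"
    proof -
      have "(LINT z|P. K n (fst z - snd z) * F z * (dv (fst z) - codim * T n (fst z) (snd z))) =
          (LINT z|P. K n (fst z - snd z) * F z * dv (fst z) - codim * S z)"
        by (rule Bochner_Integration.integral_cong[OF refl]) (simp add: S_def algebra_simps)
      then show ?thesis using Bochner_Integration.integral_diff[OF i1 integrable_mult_right[OF S, of codim]] by simp
    qed
    moreover have "(LINT z|P. K n (fst z - snd z) * F z * (dv (fst z) - codim / 2 * \<rho> n (fst z) (snd z))) =
        (LINT z|P. K n (fst z - snd z) * F z * dv (fst z)) - codim / 2 * (LINT z|P. K n (fst z - snd z) * F z * \<rho> n (fst z) (snd z))"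
    proof -
      have "(LINT z|P. K n (fst z - snd z) * F z * (dv (fst z) - codim / 2 * \<rho> n (fst z) (snd z))) =
          (LINT z|P. K n (fst z - snd z) * F z * dv (fst z) - codim / 2 * (K n (fst z - snd z) * F z * \<rho> n (fst z) (snd z)))"
        by (rule Bochner_Integration.integral_cong[OF refl]) (simp add: algebra_simps)
      then show ?thesis using Bochner_Integration.integral_diff[OF i1 integrable_mult_right[OF i3, of "codim / 2"]] by simp
    qed
    ultimately show ?thesis using 1 by simp
  qed
  have lim1: "(\<lambda>n. LINT z|P. An n z) \<longlonglongrightarrow> (LINT z|P. A z)"
  proof (rule integral_dominated_convergence[where w = "\<lambda>z. \<bar>A z\<bar>"])
    show "AE z in P. (\<lambda>n. An n z) \<longlonglongrightarrow> A z"
      using ne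
    proof eventually_elim
      case (elim z)
      then have "(\<lambda>n. K n (fst z - snd z)) \<longlonglongrightarrow> riesz_kernel \<alpha> (fst z - snd z)" by (intro Klim) simp
      then show ?case unfolding An_def A_def by (intro tendsto_mult_right)
    qed
    show "A \<in> borel_measurable P" using A(1) by (rule borel_measurable_integrable)
    show "integrable P (\<lambda>z. \<bar>A z\<bar>)" by (rule integrable_abs[OF A(1)])
    show "AE z in P. norm (An n z) \<le> \<bar>A z\<bar>" for n by (rule An_le)
  qed (rule Anm)
  have lim2: "(\<lambda>n. LINT z|P. K n (fst z - snd z) * F z * (dv (fst z) - codim / 2 * \<rho> n (fst z) (snd z))) \<longlonglongrightarrow>
      (LINT z|P. J z * (dv (fst z) - codim / 2 * \<rho>0 (fst z) (snd z)))"
  proof (rule integral_dominated_convergence[where w = "\<lambda>z. (CC + codim / 2 * LL) * J z"])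
    show "integrable P (\<lambda>z. (CC + codim / 2 * LL) * J z)" by (rule integrable_mult_right[OF JP])
    show "AE z in P. (\<lambda>n. K n (fst z - snd z) * F z * (dv (fst z) - codim / 2 * \<rho> n (fst z) (snd z))) \<longlonglongrightarrow>
        J z * (dv (fst z) - codim / 2 * \<rho>0 (fst z) (snd z))"
      using ne
    proof eventually_elim
      case (elim z)
      then have "(\<lambda>n. K n (fst z - snd z)) \<longlonglongrightarrow> riesz_kernel \<alpha> (fst z - snd z)" by (intro Klim) simp
      then show ?case unfolding JF
        by (intro tendsto_mult tendsto_diff tendsto_const \<rho>lim elim)
    qed
    show "AE z in P. norm (K n (fst z - snd z) * F z * (dv (fst z) - codim / 2 * \<rho> n (fst z) (snd z))) \<le> (CC + codim / 2 * LL) * J z" for n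
      using ne
    proof eventually_elim
      case (elim z)
      have "codim / 2 * \<bar>\<rho> n (fst z) (snd z)\<bar> \<le> codim / 2 * LL" using m by (intro mult_left_mono \<rho>_bound) auto
      then have "\<bar>codim / 2 * \<rho> n (fst z) (snd z)\<bar> \<le> codim / 2 * LL" using m by (simp add: abs_mult)
      then have "\<bar>dv (fst z) - codim / 2 * \<rho> n (fst z) (snd z)\<bar> \<le> CC + codim / 2 * LL" using dv_bound[of "fst z"] by linarith
      then have "K n (fst z - snd z) * F z * \<bar>dv (fst z) - codim / 2 * \<rho> n (fst z) (snd z)\<bar> \<le> J z * (CC + codim / 2 * LL)"
        using KFJ[OF elim, of n] J_nonneg[of z] by (intro mult_mono) auto
      moreover have "\<bar>K n (fst z - snd z) * F z\<bar> = K n (fst z - snd z) * F z" using KI(1) F0 by simp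
      ultimately show ?case unfolding real_norm_def abs_mult[of "K n (fst z - snd z) * F z"] by (simp only: mult.commute[of "J z"])
    qed
    show "(\<lambda>z. J z * (dv (fst z) - codim / 2 * \<rho>0 (fst z) (snd z))) \<in> borel_measurable P"
      using borel_measurable_integrable[OF JP] by measurable
    show "(\<lambda>z. K n (fst z - snd z) * F z * (dv (fst z) - codim / 2 * \<rho> n (fst z) (snd z))) \<in> borel_measurable P" for n
      by measurable
  qed
  have "(\<lambda>n. p * (LINT z|P. An n z)) \<longlonglongrightarrow> - (LINT z|P. J z * (dv (fst z) - codim / 2 * \<rho>0 (fst z) (snd z)))"
    unfolding step by (rule tendsto_minus[OF lim2])
  from LIMSEQ_unique[OF tendsto_mult_left[OF lim1] this]
  have "p * (LINT x|lborel. k x * s x) = - (LINT z|P. J z * (dv (fst z) - codim / 2 * \<rho>0 (fst z) (snd z)))"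
    unfolding A(2) .
  then show ?thesis unfolding s_def W_def dv_def \<rho>0_def P_def mult.assoc .
qed

end

section \<open>The Nehari and Pohozaev identities\<close>

context choquard_solution
begin

definition dirichlet :: real where
  "dirichlet = (\<Sum>b\<in>Basis. LINT x|lborel. \<bar>g b x\<bar> powr 2)"

definition nonlocal :: real where
  "nonlocal = (LINT x|lborel. k x * \<bar>u x\<bar> powr p)"

definition power_energy :: real where
  "power_energy = (LINT x|lborel. \<bar>u x\<bar> powr q)"

lemma energies_nonneg: "dirichlet \<ge> 0" "nonlocal \<ge> 0"
  unfolding dirichlet_def nonlocal_def
  by (auto intro!: sum_nonneg Bochner_Integration.integral_nonneg simp: k_nonneg)

text \<open>
  Test the equation with \<open>u\<close>.
\<close>

lemma nehari: "dirichlet + nonlocal = power_energy"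
proof -
  have "(LINT x|lborel. g b x * g b x) = (LINT x|lborel. \<bar>g b x\<bar> powr 2)" for b
    by (intro Bochner_Integration.integral_cong refl) (simp add: power2_eq_square)
  moreover have "k x * sgn_powr p (u x) * u x = k x * \<bar>u x\<bar> powr p" for x
    unfolding mult.assoc sgn_powr_mult_self ..
  ultimately show ?thesis
    using testable_solution
    unfolding testable_def dirichlet_def nonlocal_def power_energy_def sgn_powr_mult_self by (simp only:)
qed

end

context choquard_regular
begin

text \<open>
  Test the equation with \<open>Y n \<cdot> \<nabla>u\<close>, where \<open>Y n (x) = X (c x) / c\<close> for a cut-off \<open>X\<close> of the identity field and
  \<open>c = 1 / (n + 1)\<close>. The derivatives of \<open>Y n\<close> at \<open>x\<close> are those of \<open>X\<close> at \<open>c x\<close>; they are bounded uniformly in \<open>n\<close> and converge to those of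
  the identity field, whose divergence is \<open>N\<close> and whose difference quotient
  \<open>(x - y) \<cdot> (Y(x) - Y(y)) / |x - y|\<^sup>2\<close> is \<open>1\<close>. Hence the three terms tend to \<open>(1 - N/2)\<close> times the Dirichlet
  integral, to \<open>- (N - (N - \<alpha>)/2)/p = - (N + \<alpha>)/(2p)\<close> times the nonlocal energy and to \<open>- N/q\<close> times the
  integral of \<open>|u|\<^sup>q\<close>.
\<close>

lemma pohozaev:
  "(1 - real DIM('a) / 2) * dirichlet - (real DIM('a) + \<alpha>) / (2 * p) * nonlocal = - (real DIM('a) / q) * power_energy"
proof -
  define N where "N = real DIM('a)"
  define P where "P = (lborel \<Otimes>\<^sub>M lborel :: ('a \<times> 'a) measure)"
  obtain \<zeta> :: "'a \<Rightarrow> real" where \<zeta>: "\<zeta> \<in> test_functions" "\<And>x. norm x \<le> 1 \<Longrightarrow> \<zeta> x = 1"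
    using cutoff_exists[of 1] by blast
  \<comment> \<open>The identity field, cut off at the unit scale, and its rescalings.\<close>
  define X where "X b x = \<zeta> x * (x \<bullet> b)" for b x :: 'a
  have X: "X b \<in> test_functions" for b
    unfolding X_def[abs_def]
  proof (rule test_functions_bilinear[OF bounded_bilinear_mult])
    show "Ck k \<zeta>" for k by (rule test_functions_Ck[OF \<zeta>(1)])
    show "Ck k (\<lambda>x. x \<bullet> b)" for k by (rule Ck_bounded_linear[OF bounded_linear_inner_left])
    show "bounded_support \<zeta> \<or> bounded_support (\<lambda>x. x \<bullet> b)" using \<zeta>(1) by (simp add: test_functions_iff)
  qed
  have X1: "X b x = x \<bullet> b" if "norm x \<le> 1" for b x using \<zeta>(2)[OF that] by (simp add: X_def)
  define c where "c n = inverse (real (Suc n))" for n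
  have c: "c n > 0" for n by (simp add: c_def)
  have c0: "c \<longlonglongrightarrow> 0" unfolding c_def by (rule LIMSEQ_inverse_real_of_nat)
  define Y where "Y n b x = inverse (c n) * X b (0 + c n *\<^sub>R x)" for n b x
  have XA: "(\<lambda>x. X b (0 + c n *\<^sub>R x)) \<in> test_functions" for n b
    using c[of n] by (intro test_functions_affine[OF X]) simp
  have Y: "Y n b \<in> test_functions" for n b
    unfolding Y_def[abs_def]
  proof (rule test_functions_bilinear[OF bounded_bilinear_mult Ck_const test_functions_Ck[OF XA]])
    show "bounded_support (\<lambda>x::'a. inverse (c n)) \<or> bounded_support (\<lambda>x. X b (0 + c n *\<^sub>R x))"
      using XA[of b n] by (simp add: test_functions_iff)
  qed
  have DY: "dir_deriv a (Y n b) x = dir_deriv a (X b) (c n *\<^sub>R x)" for n a b x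
  proof -
    have "dir_deriv a (Y n b) x = inverse (c n) * dir_deriv a (\<lambda>x. X b (0 + c n *\<^sub>R x)) x + dir_deriv a (\<lambda>x::'a. inverse (c n)) x * X b (0 + c n *\<^sub>R x)"
      unfolding Y_def[abs_def]
      by (rule dir_deriv_bilinear[OF bounded_bilinear_mult Ck_const test_functions_Ck[OF XA]])
    moreover have "dir_deriv a (\<lambda>x::'a. inverse (c n)) x = 0" by (rule dir_derivI[OF has_derivative_const])
    moreover have "dir_deriv a (\<lambda>x. X b (0 + c n *\<^sub>R x)) x = c n * dir_deriv a (X b) (0 + c n *\<^sub>R x)"
      by (subst dir_deriv_affine[OF test_functions_Ck[OF X]]) simp
    ultimately show ?thesis using c[of n] by simp
  qed
  have DX0: "dir_deriv a (X b) 0 = a \<bullet> b" for a b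
  proof -
    have "((\<lambda>x. x \<bullet> b) has_derivative (\<lambda>v. v \<bullet> b)) (at 0)"
      by (rule bounded_linear_imp_has_derivative[OF bounded_linear_inner_left])
    then have "(X b has_derivative (\<lambda>v. v \<bullet> b)) (at 0)"
    proof (rule has_derivative_transform_within_open[of _ _ _ _ "ball 0 1"])
      show "x \<in> ball 0 1 \<Longrightarrow> x \<bullet> b = X b x" for x by (simp add: X1)
    qed auto
    then show ?thesis by (rule dir_derivI)
  qed
  have DYlim: "(\<lambda>n. dir_deriv a (Y n b) x) \<longlonglongrightarrow> a \<bullet> b" for a b x
  proof -
    have "isCont (dir_deriv a (X b)) 0"
      using Ck_imp_continuous[OF test_functions_Ck[OF test_functions_dir_deriv[OF X]]]
      by (simp add: continuous_on_eq_continuous_at)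
    moreover have "(\<lambda>n. c n *\<^sub>R x) \<longlonglongrightarrow> 0"
      using tendsto_scaleR[OF c0 tendsto_const[of x]] by simp
    ultimately show ?thesis unfolding DY DX0[symmetric] by (rule isCont_tendsto_compose)
  qed
  have "\<exists>K\<ge>0. (\<forall>x v. \<bar>dir_deriv v (X b) x\<bar> \<le> K * norm v) \<and> (\<forall>x h. \<bar>X b (x + h) - X b x\<bar> \<le> K * norm h)" for b
    by (rule Ck1_bounded_derivative[OF test_Ck1[OF X]])
  then obtain K where K: "\<And>b. K b \<ge> 0" "\<And>b x v. \<bar>dir_deriv v (X b) x\<bar> \<le> K b * norm v"
    "\<And>b x h. \<bar>X b (x + h) - X b x\<bar> \<le> K b * norm h" by metis
  have DYb: "\<bar>dir_deriv a (Y n b) x\<bar> \<le> K b" if "a \<in> Basis" for a b n x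
    using K(2)[of a b "c n *\<^sub>R x"] that unfolding DY by simp
  have L: "\<bar>Y n b x - Y n b y\<bar> \<le> K b * norm (x - y)" for n b x y
  proof -
    have "\<bar>X b (c n *\<^sub>R y + c n *\<^sub>R (x - y)) - X b (c n *\<^sub>R y)\<bar> \<le> K b * norm (c n *\<^sub>R (x - y))" by (rule K(3))
    moreover have "c n *\<^sub>R y + c n *\<^sub>R (x - y) = c n *\<^sub>R x" by (simp add: scaleR_right_diff_distrib)
    moreover have "K b * norm (c n *\<^sub>R (x - y)) = c n * (K b * norm (x - y))" using c[of n] by simp
    ultimately have "\<bar>X b (c n *\<^sub>R x) - X b (c n *\<^sub>R y)\<bar> \<le> c n * (K b * norm (x - y))"
      by (simp only:)
    then have "inverse (c n) * \<bar>X b (c n *\<^sub>R x) - X b (c n *\<^sub>R y)\<bar> \<le> inverse (c n) * (c n * (K b * norm (x - y)))"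
      using c[of n] by (intro mult_left_mono) auto
    moreover have "\<bar>Y n b x - Y n b y\<bar> = inverse (c n) * \<bar>X b (c n *\<^sub>R x) - X b (c n *\<^sub>R y)\<bar>"
      unfolding Y_def right_diff_distrib[symmetric] abs_mult using c[of n] by simp
    ultimately show ?thesis using c[of n] by (simp add: mult.assoc[symmetric])
  qed
  have Ylim: "(\<lambda>n. Y n b x) \<longlonglongrightarrow> x \<bullet> b" for b x
  proof -
    have "(\<lambda>n. c n * norm x) \<longlonglongrightarrow> 0" by (rule tendsto_mult_left_zero[OF c0])
    then have "\<forall>\<^sub>F n in sequentially. c n * norm x < 1" by (rule order_tendstoD) simp
    then have "\<forall>\<^sub>F n in sequentially. x \<bullet> b = Y n b x"
    proof eventually_elim
      case (elim n)
      then show ?case using X1[of "c n *\<^sub>R x" b] c[of n] by (simp add: Y_def)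
    qed
    then show ?thesis by (rule Lim_transform_eventually[OF tendsto_const])
  qed
  have sumB: "(\<Sum>b\<in>(Basis::'a set). b \<bullet> b) = N" unfolding N_def by simp
  have DYm: "dir_deriv a (Y n b) \<in> borel_measurable borel" for a n b
    by (rule test_functions_measurable[OF test_functions_dir_deriv[OF Y]])
  define W where "W n x = (\<Sum>b\<in>Basis. Y n b x * g b x)" for n x
  have "\<exists>H. admissible (W n) H" for n unfolding W_def[abs_def] by (rule field_admissible[OF Y])
  then obtain H where H: "\<And>n. admissible (W n) (H n)" by metis
  have "bounded_support (W n)" for n
  proof -
    have "\<exists>R. \<forall>x. norm x > R \<longrightarrow> Y n b x = 0" for b using Y[of n b] by (simp add: test_functions_iff bounded_support_def)
    then obtain Rb where Rb: "\<And>b x. norm x > Rb b \<Longrightarrow> Y n b x = 0" by metis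
    have "W n x = 0" if x: "norm x > Max (Rb ` Basis)" for x
      unfolding W_def
    proof (rule sum.neutral, intro ballI)
      fix b :: 'a assume "b \<in> Basis"
      then have "Rb b \<le> Max (Rb ` Basis)" by simp
      then show "Y n b x * g b x = 0" using Rb[of b x] x by simp
    qed
    then show ?thesis unfolding bounded_support_def by blast
  qed
  then have test: "testable (W n) (H n)" for n by (intro testable_bounded_support H)
  define T1 where "T1 n = (\<Sum>a\<in>Basis. LINT x|lborel. g a x * H n a x)" for n
  have lim1: "T1 \<longlonglongrightarrow> (\<Sum>a\<in>Basis. \<Sum>b\<in>Basis. (LINT x|lborel. (a \<bullet> b) * (g a x * g b x)) - (LINT x|lborel. (b \<bullet> b) * (g a x * g a x)) / 2)"
  proof -
    have T1: "T1 n = (\<Sum>a\<in>Basis. \<Sum>b\<in>Basis. (LINT x|lborel. dir_deriv a (Y n b) x * (g a x * g b x))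
       - (LINT x|lborel. dir_deriv b (Y n b) x * (g a x * g a x)) / 2)" for n
      unfolding T1_def by (rule gradient_term[OF Y H[unfolded W_def[abs_def]]])
    have l: "(\<lambda>n. LINT x|lborel. dir_deriv e (Y n d) x * (g a x * g b x)) \<longlonglongrightarrow> (LINT x|lborel. (e \<bullet> d) * (g a x * g b x))"
      if "a \<in> Basis" "b \<in> Basis" "e \<in> Basis" for a b d e
    proof (rule integral_dominated_convergence[where w = "\<lambda>x. \<bar>K d * (g a x * g b x)\<bar>"])
      have m: "g a \<in> borel_measurable borel" "g b \<in> borel_measurable borel" using that g_measurable by auto
      show "(\<lambda>x. (e \<bullet> d) * (g a x * g b x)) \<in> borel_measurable lborel" using m by measurable
      show "(\<lambda>x. dir_deriv e (Y n d) x * (g a x * g b x)) \<in> borel_measurable lborel" for n using m DYm[of e n d] by measurable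
      have "integrable lborel (\<lambda>x. K d * (g a x * g b x))"
        by (rule bounded_gradient_product_integrable[OF that(1,2), where C = "\<bar>K d\<bar>"]) auto
      then show "integrable lborel (\<lambda>x. \<bar>K d * (g a x * g b x)\<bar>)" by (rule integrable_abs)
      show "AE x in lborel. (\<lambda>n. dir_deriv e (Y n d) x * (g a x * g b x)) \<longlonglongrightarrow> (e \<bullet> d) * (g a x * g b x)"
        by (intro AE_I2 tendsto_mult_right DYlim)
      show "AE x in lborel. norm (dir_deriv e (Y n d) x * (g a x * g b x)) \<le> \<bar>K d * (g a x * g b x)\<bar>" for n
      proof (rule AE_I2)
        fix x
        show "norm (dir_deriv e (Y n d) x * (g a x * g b x)) \<le> \<bar>K d * (g a x * g b x)\<bar>"
          unfolding real_norm_def abs_mult[of "dir_deriv e (Y n d) x"] abs_mult[of "K d"] using DYb[OF that(3), of n d x] K(1)[of d]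
          by (intro mult_right_mono) auto
      qed
    qed
    show ?thesis
      unfolding T1[abs_def]
    proof (rule tendsto_sum, rule tendsto_sum)
      fix a b :: 'a assume a: "a \<in> Basis" and b: "b \<in> Basis"
      show "(\<lambda>n. (LINT x|lborel. dir_deriv a (Y n b) x * (g a x * g b x)) - (LINT x|lborel. dir_deriv b (Y n b) x * (g a x * g a x)) / 2)
          \<longlonglongrightarrow> (LINT x|lborel. (a \<bullet> b) * (g a x * g b x)) - (LINT x|lborel. (b \<bullet> b) * (g a x * g a x)) / 2"
        by (rule tendsto_diff[OF l[OF a b a] tendsto_divide[OF l[OF a a b] tendsto_const]]) simp
    qed
  qed
  have val1: "(\<Sum>a\<in>Basis. \<Sum>b\<in>Basis. (LINT x|lborel. (a \<bullet> b) * (g a x * g b x)) - (LINT x|lborel. (b \<bullet> b) * (g a x * g a x)) / 2) =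
      (1 - N / 2) * dirichlet"
  proof -
    have sq: "(LINT x|lborel. g a x * g a x) = (LINT x|lborel. \<bar>g a x\<bar> powr 2)" for a
      by (intro Bochner_Integration.integral_cong refl) (simp add: power2_eq_square)
    have "(\<Sum>b\<in>Basis. (LINT x|lborel. (a \<bullet> b) * (g a x * g b x)) - (LINT x|lborel. (b \<bullet> b) * (g a x * g a x)) / 2) =
        (1 - N / 2) * (LINT x|lborel. \<bar>g a x\<bar> powr 2)" if a: "a \<in> Basis" for a
    proof -
      have "(\<Sum>b\<in>Basis. LINT x|lborel. (a \<bullet> b) * (g a x * g b x)) = (\<Sum>b\<in>Basis. if b = a then (LINT x|lborel. g a x * g a x) else 0)"
        using a by (intro sum.cong refl) (auto simp: inner_Basis)
      also have "\<dots> = (LINT x|lborel. \<bar>g a x\<bar> powr 2)" using a by (simp add: sq)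
      finally have 1: "(\<Sum>b\<in>Basis. LINT x|lborel. (a \<bullet> b) * (g a x * g b x)) = (LINT x|lborel. \<bar>g a x\<bar> powr 2)" .
      have 2: "(\<Sum>b\<in>(Basis::'a set). (LINT x|lborel. (b \<bullet> b) * (g a x * g a x)) / 2) = N / 2 * (LINT x|lborel. \<bar>g a x\<bar> powr 2)"
      proof -
        have "(\<Sum>b\<in>(Basis::'a set). (LINT x|lborel. (b \<bullet> b) * (g a x * g a x)) / 2) = (\<Sum>b\<in>(Basis::'a set). (LINT x|lborel. \<bar>g a x\<bar> powr 2) / 2)"
        proof (rule sum.cong[OF refl])
          fix b :: 'a assume "b \<in> Basis"
          then have "b \<bullet> b = 1" by simp
          then show "(LINT x|lborel. (b \<bullet> b) * (g a x * g a x)) / 2 = (LINT x|lborel. \<bar>g a x\<bar> powr 2) / 2"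
            by (simp only: mult_1 sq)
        qed
        also have "\<dots> = N / 2 * (LINT x|lborel. \<bar>g a x\<bar> powr 2)" by (simp add: N_def)
        finally show ?thesis .
      qed
      show ?thesis unfolding sum_subtractf 1 2 by (simp add: left_diff_distrib)
    qed
    then show ?thesis unfolding dirichlet_def sum_distrib_left by (intro sum.cong refl)
  qed
  define T2 where "T2 n = (LINT x|lborel. k x * sgn_powr p (u x) * W n x)" for n
  define \<rho> where "\<rho> n z = (\<Sum>b\<in>Basis. ((fst z - snd z) \<bullet> b) * (Y n b (fst z) - Y n b (snd z))) / ((fst z - snd z) \<bullet> (fst z - snd z))" for n and z :: "'a \<times> 'a"
  define dv where "dv n x = (\<Sum>b\<in>Basis. dir_deriv b (Y n b) x)" for n x
  define KK where "KK = (\<Sum>b\<in>(Basis::'a set). K b)"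
  have KK: "KK \<ge> 0" unfolding KK_def by (rule sum_nonneg) (rule K(1))
  have dvb: "\<bar>dv n x\<bar> \<le> KK" for n x
    unfolding dv_def KK_def by (rule order_trans[OF sum_abs sum_mono]) (rule DYb)
  have dvm: "dv n \<in> borel_measurable borel" for n
    unfolding dv_def[abs_def] by (rule borel_measurable_sum) (rule DYm)
  have dvlim: "(\<lambda>n. dv n x) \<longlonglongrightarrow> N" for x
    unfolding dv_def sumB[symmetric] by (intro tendsto_sum DYlim)
  have \<rho>b: "\<bar>\<rho> n z\<bar> \<le> KK" for n z
  proof -
    define d where "d = fst z - snd z"
    have "\<bar>\<Sum>b\<in>Basis. (d \<bullet> b) * (Y n b (fst z) - Y n b (snd z))\<bar> \<le> (\<Sum>b\<in>Basis. norm d * (K b * norm d))"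
    proof (rule order_trans[OF sum_abs sum_mono])
      fix b :: 'a assume b: "b \<in> Basis"
      show "\<bar>(d \<bullet> b) * (Y n b (fst z) - Y n b (snd z))\<bar> \<le> norm d * (K b * norm d)"
        unfolding abs_mult d_def by (rule mult_mono[OF Basis_le_norm[OF b] L]) simp_all
    qed
    also have "\<dots> = KK * (norm d)\<^sup>2" unfolding KK_def sum_distrib_right
      by (rule sum.cong[OF refl]) (simp only: power2_eq_square mult_ac)
    finally have "\<bar>\<Sum>b\<in>Basis. (d \<bullet> b) * (Y n b (fst z) - Y n b (snd z))\<bar> \<le> KK * (d \<bullet> d)" unfolding power2_norm_eq_inner .
    then show ?thesis
      unfolding \<rho>_def d_def[symmetric] abs_divide using KK by (cases "d = 0") (simp_all add: divide_le_eq)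
  qed
  have \<rho>lim: "(\<lambda>n. \<rho> n z) \<longlonglongrightarrow> 1" if "fst z \<noteq> snd z" for z
  proof -
    define d where "d = fst z - snd z"
    have d: "d \<bullet> d \<noteq> 0" using that by (simp add: d_def)
    have "(\<lambda>n. \<rho> n z) \<longlonglongrightarrow> (\<Sum>b\<in>Basis. (d \<bullet> b) * (fst z \<bullet> b - snd z \<bullet> b)) / (d \<bullet> d)"
      unfolding \<rho>_def d_def[symmetric] by (intro tendsto_divide tendsto_sum tendsto_mult tendsto_diff tendsto_const Ylim d)
    moreover have "(\<Sum>b\<in>Basis. (d \<bullet> b) * (fst z \<bullet> b - snd z \<bullet> b)) = d \<bullet> d"
      unfolding inner_diff_left[symmetric] d_def[symmetric] by (rule euclidean_inner[symmetric])
    ultimately show ?thesis using d by simp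
  qed
  have \<rho>m: "\<rho> n \<in> borel_measurable P" for n
  proof -
    have "(\<lambda>z. (fst z - snd z) \<bullet> b) \<in> borel_measurable P" "(\<lambda>z. Y n b (fst z) - Y n b (snd z)) \<in> borel_measurable P"
      "(\<lambda>z. (fst z - snd z) \<bullet> (fst z - snd z)) \<in> borel_measurable P" for b :: 'a
      using test_functions_measurable[OF Y, of n b] unfolding P_def by measurable
    then show ?thesis unfolding \<rho>_def[abs_def]
      by (intro borel_measurable_divide borel_measurable_sum borel_measurable_times)
  qed
  define D where "D = (LINT z|P. J z * (N - (N - \<alpha>) / 2 * 1))"
  have T2: "p * T2 n = - (LINT z|P. J z * (dv n (fst z) - (N - \<alpha>) / 2 * \<rho> n z))" for n
    unfolding T2_def W_def dv_def \<rho>_def P_def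
    by (rule nonlocal_term[OF _ Y L H[unfolded W_def[abs_def]]]) (simp add: N_def)
  have JP: "integrable P J" unfolding P_def by (rule J_integrable)
  have lim2: "(\<lambda>n. LINT z|P. J z * (dv n (fst z) - (N - \<alpha>) / 2 * \<rho> n z)) \<longlonglongrightarrow> D"
    unfolding D_def
  proof (rule integral_dominated_convergence[where w = "\<lambda>z. (KK + (N - \<alpha>) / 2 * KK) * J z"])
    show "integrable P (\<lambda>z. (KK + (N - \<alpha>) / 2 * KK) * J z)" by (rule integrable_mult_right[OF JP])
    show "(\<lambda>z. J z * (N - (N - \<alpha>) / 2 * 1)) \<in> borel_measurable P" using borel_measurable_integrable[OF JP] by measurable
    have "(\<lambda>z. dv n (fst z)) \<in> borel_measurable P" for n using dvm[of n] unfolding P_def by measurable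
    then show "(\<lambda>z. J z * (dv n (fst z) - (N - \<alpha>) / 2 * \<rho> n z)) \<in> borel_measurable P" for n
      by (intro borel_measurable_times borel_measurable_diff borel_measurable_integrable[OF JP] borel_measurable_const \<rho>m)
    have "AE z in P. fst z \<noteq> snd z" unfolding P_def by (rule AE_pair_neq)
    then show "AE z in P. (\<lambda>n. J z * (dv n (fst z) - (N - \<alpha>) / 2 * \<rho> n z)) \<longlonglongrightarrow> J z * (N - (N - \<alpha>) / 2 * 1)"
      by eventually_elim (intro tendsto_mult tendsto_diff tendsto_const dvlim \<rho>lim)
    show "AE z in P. norm (J z * (dv n (fst z) - (N - \<alpha>) / 2 * \<rho> n z)) \<le> (KK + (N - \<alpha>) / 2 * KK) * J z" for n
    proof (rule AE_I2)
      fix z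
      have m: "0 \<le> (N - \<alpha>) / 2" using \<alpha> by (simp add: N_def)
      have "(N - \<alpha>) / 2 * \<bar>\<rho> n z\<bar> \<le> (N - \<alpha>) / 2 * KK" by (rule mult_left_mono[OF \<rho>b m])
      then have "\<bar>(N - \<alpha>) / 2 * \<rho> n z\<bar> \<le> (N - \<alpha>) / 2 * KK" unfolding abs_mult using m by simp
      then have "\<bar>dv n (fst z) - (N - \<alpha>) / 2 * \<rho> n z\<bar> \<le> KK + (N - \<alpha>) / 2 * KK" using dvb[of n "fst z"] by linarith
      from mult_left_mono[OF this J_nonneg[of z]]
      show "norm (J z * (dv n (fst z) - (N - \<alpha>) / 2 * \<rho> n z)) \<le> (KK + (N - \<alpha>) / 2 * KK) * J z"
        unfolding real_norm_def abs_mult[of "J z"] using J_nonneg[of z] by (simp add: mult.commute[of "J z"])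
    qed
  qed
  have val2: "D = (N + \<alpha>) / 2 * nonlocal"
  proof -
    have "D = (LINT z|P. J z) * (N - (N - \<alpha>) / 2 * 1)" unfolding D_def by simp
    moreover have "(LINT z|P. J z) = nonlocal" unfolding P_def J_integral nonlocal_def ..
    ultimately show ?thesis by (simp add: field_simps)
  qed
  have "(\<lambda>n. p * T2 n) \<longlonglongrightarrow> - D" unfolding T2 by (rule tendsto_minus[OF lim2])
  then have "(\<lambda>n. (p * T2 n) / p) \<longlonglongrightarrow> - D / p" using p by (intro tendsto_divide tendsto_const) auto
  then have lim2': "T2 \<longlonglongrightarrow> - D / p" using p by simp
  define T3 where "T3 n = (LINT x|lborel. sgn_powr q (u x) * W n x)" for n
  have T3: "q * T3 n = - (LINT x|lborel. dv n x * \<bar>u x\<bar> powr q)" for n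
    unfolding T3_def W_def dv_def by (rule power_term[OF Y])
  have lim3: "(\<lambda>n. LINT x|lborel. dv n x * \<bar>u x\<bar> powr q) \<longlonglongrightarrow> (LINT x|lborel. N * \<bar>u x\<bar> powr q)"
  proof (rule integral_dominated_convergence[where w = "\<lambda>x. KK * \<bar>u x\<bar> powr q"])
    show "integrable lborel (\<lambda>x. KK * \<bar>u x\<bar> powr q)" by (rule integrable_mult_right[OF u_q])
    show "(\<lambda>x. N * \<bar>u x\<bar> powr q) \<in> borel_measurable lborel" by measurable
    show "(\<lambda>x. dv n x * \<bar>u x\<bar> powr q) \<in> borel_measurable lborel" for n using dvm[of n] by measurable
    show "AE x in lborel. (\<lambda>n. dv n x * \<bar>u x\<bar> powr q) \<longlonglongrightarrow> N * \<bar>u x\<bar> powr q"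
      by (intro AE_I2 tendsto_mult_right dvlim)
    show "AE x in lborel. norm (dv n x * \<bar>u x\<bar> powr q) \<le> KK * \<bar>u x\<bar> powr q" for n
      using dvb[of n] by (intro AE_I2) (simp add: abs_mult mult_right_mono)
  qed
  have "(\<lambda>n. q * T3 n) \<longlonglongrightarrow> - (N * power_energy)"
    unfolding T3 using tendsto_minus[OF lim3] by (simp add: power_energy_def)
  then have "(\<lambda>n. (q * T3 n) / q) \<longlonglongrightarrow> - (N * power_energy) / q" using q by (intro tendsto_divide tendsto_const) auto
  then have lim3': "T3 \<longlonglongrightarrow> - (N * power_energy) / q" using q by simp
  have eq: "T1 n + T2 n = T3 n" for n
    using test[of n] unfolding testable_def T1_def T2_def T3_def .
  have "T3 \<longlonglongrightarrow> (1 - N / 2) * dirichlet + - D / p"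
    using tendsto_add[OF lim1[unfolded val1] lim2'] unfolding eq .
  from LIMSEQ_unique[OF this lim3'] show ?thesis
    unfolding val2 N_def[symmetric] using p q by (simp add: field_simps)
qed

end

section \<open>Excluded exponents force the solution to vanish\<close>

context choquard_solution
begin

text \<open>
  If \<open>u\<close> does not vanish, then the potential is zero at some point \<open>x\<close> where \<open>u(x) \<noteq> 0\<close>. As the kernel is
  positive, this forces \<open>|u|\<^sup>p\<close> to vanish almost everywhere.
\<close>

lemma nonlocal_zero_imp_zero:
  assumes "nonlocal = 0"
  shows "AE x in lborel. u x = 0"
proof -
  have AE0: "AE x in lborel. k x * \<bar>u x\<bar> powr p = 0"
    using assms integral_nonneg_eq_0_iff_AE[OF k_u_integrable] by (simp add: nonlocal_def k_nonneg)
  have "(\<integral>\<^sup>+x. riesz_potential \<alpha> f x * ennreal (\<bar>u x\<bar> powr p) \<partial>lborel) < \<infinity>"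
    by (rule potential_pairing_finite[OF u_measurable u_coulomb])
  then have fin: "AE x in lborel. riesz_potential \<alpha> f x * ennreal (\<bar>u x\<bar> powr p) \<noteq> \<infinity>"
    by (intro nn_integral_PInf_AE) auto
  have AE1: "AE x in lborel. u x \<noteq> 0 \<longrightarrow> riesz_potential \<alpha> f x = 0"
    using AE0 fin
  proof eventually_elim
    case (elim x)
    show ?case
    proof
      assume "u x \<noteq> 0"
      then have pos: "\<bar>u x\<bar> powr p > 0" by simp
      then have "k x = 0" using elim(1) by simp
      moreover have "riesz_potential \<alpha> f x \<noteq> \<infinity>"
        using elim(2) pos by (auto simp: ennreal_mult_eq_top_iff)
      ultimately show "riesz_potential \<alpha> f x = 0"
        unfolding k_def f_def[abs_def, symmetric] by (auto simp: enn2real_eq_0_iff)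
    qed
  qed
  show ?thesis
  proof (rule ccontr)
    assume nz: "\<not> (AE x in lborel. u x = 0)"
    have "\<exists>x. u x \<noteq> 0 \<and> riesz_potential \<alpha> f x = 0"
    proof (rule ccontr)
      assume none: "\<nexists>x. u x \<noteq> 0 \<and> riesz_potential \<alpha> f x = 0"
      have "AE x in lborel. u x = 0" using AE1 by eventually_elim (use none in blast)
      with nz show False by blast
    qed
    then obtain x where "riesz_potential \<alpha> f x = 0" by blast
    then have "(\<integral>\<^sup>+y. ennreal (riesz_kernel \<alpha> (x - y) * f y) \<partial>lborel) = 0"
      by (simp add: riesz_potential_lborel)
    then have "AE y in lborel. ennreal (riesz_kernel \<alpha> (x - y) * f y) = 0"
      by (subst (asm) nn_integral_0_iff_AE) auto
    then have "AE y in lborel. u y = 0"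
      using AE_lborel_singleton[of x]
    proof eventually_elim
      case (elim y)
      have "riesz_kernel \<alpha> (x - y) > 0" using elim(2) by (intro riesz_kernel_pos[OF \<alpha>]) simp
      moreover have "riesz_kernel \<alpha> (x - y) * f y \<le> 0" using elim(1) by (simp add: ennreal_eq_0_iff)
      ultimately have "f y \<le> 0" by (simp add: mult_le_0_iff)
      then show "u y = 0" using p by (simp add: f_def)
    qed
    with nz show False by simp
  qed
qed

text \<open>
  A solution with vanishing gradient is invariant under translations in the direction of a basis vector, while
  it tends to zero along suitable translates because it is \<open>q\<close>-integrable.
\<close>

lemma dirichlet_zero_imp_zero:
  assumes "dirichlet = 0"
  shows "AE x in lborel. u x = 0"
proof -
  obtain b :: 'a where b: "b \<in> Basis" using nonempty_Basis by blast
  have "(LINT x|lborel. \<bar>g b x\<bar> powr 2) = 0"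
    using assms b unfolding dirichlet_def by (subst (asm) sum_nonneg_eq_0_iff) auto
  then have "AE x in lborel. \<bar>g b x\<bar> powr 2 = 0"
    using integral_nonneg_eq_0_iff_AE[OF g_sq[OF b]] by simp
  then have g0: "AE x in lborel. g b x = 0" by eventually_elim simp
  have d: "wderiv b u (g b)" using u_partials b by (simp add: partials_def)
  have d0: "wderiv b u (\<lambda>x. 0)" by (rule wderiv_cong_AE[OF d _ _ _ g0]) simp_all
  have "AE x in lborel. u (x + t *\<^sub>R b) = u x" for t
    using wderiv_difference[OF d0, of t] by (simp add: line_avg_def avg_def)
  then have inv: "AE x in lborel. \<forall>n::nat. u (x + real n *\<^sub>R b) = u x"
    by (simp add: AE_all_countable)
  obtain s :: "nat \<Rightarrow> nat" where "AE x in lborel. (\<lambda>n. u (x + real (s n) *\<^sub>R b)) \<longlonglongrightarrow> 0"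
    using translates_tendsto_zero[OF b] by blast
  then show ?thesis using inv
  proof eventually_elim
    case (elim x)
    then have "(\<lambda>n. u x) \<longlonglongrightarrow> 0" by simp
    then show ?case by (simp add: LIMSEQ_const_iff)
  qed
qed

end

context choquard_regular
begin

text \<open>
  With \<open>r = 1/q\<close>, the two identities combine to a vanishing sum of two multiples of nonnegative energies whose
  coefficients \<open>a - r\<close> and \<open>b - r\<close> have the same weak sign, and only one of them can be zero.
\<close>

lemma trivial_if_exponents_excluded:
  fixes N :: real
  assumes N: "N = real DIM('a)"
    and cond: "(1 / p > max (N - 2) 0 / (N + \<alpha>) \<and>
            1 / q \<notin> {1 / 2 - 1 / N <..< 1 / (2 * p) + \<alpha> / (2 * N * p)}) \<or>
         (1 / p < max (N - 2) 0 / (N + \<alpha>) \<and>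
            1 / q \<notin> {1 / (2 * p) + \<alpha> / (2 * N * p) <..< 1 / 2 - 1 / N})"
  shows "AE x in lborel. u x = 0"
proof -
  define a where "a = 1 / 2 - 1 / N"
  define b where "b = 1 / (2 * p) + \<alpha> / (2 * N * p)"
  define r where "r = 1 / q"
  have N1: "N \<ge> 1" unfolding N using DIM_positive[where 'a = 'a] by linarith
  have N\<alpha>: "N + \<alpha> > 0" using N1 \<alpha> by simp
  have p0: "p > 0" using p by simp
  note nn = energies_nonneg
  have "N * ((a - r) * dirichlet + (b - r) * nonlocal) =
      - ((1 - N / 2) * dirichlet - (N + \<alpha>) / (2 * p) * nonlocal) - (N / q) * (dirichlet + nonlocal)"
    using N1 p0 q by (simp add: a_def b_def r_def field_simps)
  also have "\<dots> = 0" using pohozaev nehari by (simp add: N)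
  finally have key: "(a - r) * dirichlet + (b - r) * nonlocal = 0" using N1 by simp
  \<comment> \<open>The sign of \<open>b - a\<close> is what the first inequality of each case of the hypothesis is about.\<close>
  have ab: "2 * N * (b - a) = (N + \<alpha>) * (1 / p - (N - 2) / (N + \<alpha>))"
  proof -
    have "2 * N * b = (N + \<alpha>) * (1 / p)" using N1 p0 by (simp add: b_def field_simps)
    moreover have "2 * N * a = N - 2" using N1 by (simp add: a_def field_simps)
    moreover have "(N + \<alpha>) * ((N - 2) / (N + \<alpha>)) = N - 2" using N\<alpha> by simp
    ultimately show ?thesis by (simp only: right_diff_distrib)
  qed
  have zero: "dirichlet = 0 \<or> nonlocal = 0"
  proof -
    consider "b > a" "r \<le> a \<or> r \<ge> b" | "a > b" "r \<le> b \<or> r \<ge> a"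
    proof (cases "1 / p > max (N - 2) 0 / (N + \<alpha>) \<and> r \<notin> {a<..<b}")
      case True
      have "(N - 2) / (N + \<alpha>) \<le> max (N - 2) 0 / (N + \<alpha>)" using N\<alpha> by (intro divide_right_mono) auto
      then have "(N + \<alpha>) * (1 / p - (N - 2) / (N + \<alpha>)) > 0" using True N\<alpha> by (intro mult_pos_pos) linarith+
      then have "2 * N * (b - a) > 0" unfolding ab .
      then have "b - a > 0" by (rule zero_less_mult_pos) (use N1 in simp)
      then have "b > a" by simp
      then show ?thesis using True that(1) by (auto simp: not_less)
    next
      case False
      then have c: "1 / p < max (N - 2) 0 / (N + \<alpha>)" "r \<notin> {b<..<a}"
        using cond unfolding a_def b_def r_def by blast+
      \<comment> \<open>Otherwise the positive part is zero, which would make \<open>1/p\<close> negative.\<close>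
      have "N > 2"
      proof (rule ccontr)
        assume "\<not> N > 2"
        then have "1 / p < 0" using c(1) by (simp add: max_def split: if_splits)
        then show False using p0 by simp
      qed
      then have "(N + \<alpha>) * (1 / p - (N - 2) / (N + \<alpha>)) < 0" using c(1) N\<alpha> by (intro mult_pos_neg) (auto simp: max_def)
      then have "2 * N * (a - b) > 0" using ab by (simp add: algebra_simps)
      then have "a - b > 0" by (rule zero_less_mult_pos) (use N1 in simp)
      then have "a > b" by simp
      then show ?thesis using c(2) that(2) by (auto simp: not_less)
    qed
    then show ?thesis
    proof cases
      case 1
      then show ?thesis
      proof (elim disjE)
        assume r: "r \<le> a"
        then have "(a - r) * dirichlet \<ge> 0" "(b - r) * nonlocal \<ge> 0" "b - r > 0" using 1(1) nn by auto
        then have "(b - r) * nonlocal = 0" using key by linarith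
        then show ?thesis using \<open>b - r > 0\<close> by simp
      next
        assume r: "r \<ge> b"
        then have "(r - a) * dirichlet \<ge> 0" "(r - b) * nonlocal \<ge> 0" "r - a > 0" using 1(1) nn by auto
        moreover have "(r - a) * dirichlet + (r - b) * nonlocal = 0" using key by (simp add: algebra_simps)
        ultimately have "(r - a) * dirichlet = 0" by linarith
        then show ?thesis using \<open>r - a > 0\<close> by simp
      qed
    next
      case 2
      then show ?thesis
      proof (elim disjE)
        assume r: "r \<le> b"
        then have "(a - r) * dirichlet \<ge> 0" "(b - r) * nonlocal \<ge> 0" "a - r > 0" using 2(1) nn by auto
        then have "(a - r) * dirichlet = 0" using key by linarith
        then show ?thesis using \<open>a - r > 0\<close> by simp
      next
        assume r: "r \<ge> a"
        then have "(r - a) * dirichlet \<ge> 0" "(r - b) * nonlocal \<ge> 0" "r - b > 0" using 2(1) nn by auto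
        moreover have "(r - a) * dirichlet + (r - b) * nonlocal = 0" using key by (simp add: algebra_simps)
        ultimately have "(r - b) * nonlocal = 0" by linarith
        then show ?thesis using \<open>r - b > 0\<close> by simp
      qed
    qed
  qed
  then show ?thesis using dirichlet_zero_imp_zero nonlocal_zero_imp_zero by blast
qed

end

section \<open>From Lebesgue measurable functions to Borel representatives\<close>

lemma borel_representative:
  fixes f :: "'a::euclidean_space \<Rightarrow> real"
  assumes "f \<in> borel_measurable lebesgue"
  shows "\<exists>f' \<in> borel_measurable borel. AE x in lborel. f x = f' x"
  using completion_ex_borel_measurable_real[OF assms] by auto

text \<open>
  Passing to a Borel representative changes neither integrability nor the integral, and completing the
  measure does not either.
\<close>

lemma lebesgue_eq_lborel_integral:
  fixes f f' :: "'a::euclidean_space \<Rightarrow> real"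
  assumes f: "f \<in> borel_measurable lebesgue" and f': "f' \<in> borel_measurable borel"
    and AE: "AE x in lborel. f x = f' x"
  shows "(LINT x|lebesgue. f x) = (LINT x|lborel. f' x)"
    and "integrable lebesgue f \<longleftrightarrow> integrable lborel f'"
proof -
  have m: "f' \<in> borel_measurable lebesgue" "f' \<in> borel_measurable lborel"
    using f' by (simp_all add: measurable_completion)
  have AE': "AE x in lebesgue. f x = f' x" using AE by (rule AE_completion)
  show "(LINT x|lebesgue. f x) = (LINT x|lborel. f' x)"
    using integral_cong_AE[OF f m(1) AE'] integral_completion[OF m(2)] by simp
  show "integrable lebesgue f \<longleftrightarrow> integrable lborel f'"
    using integrable_cong_AE[OF f m(1) AE'] integrable_completion[OF m(2)] by simp
qed

lemma lebesgue_measurable_borel: "f \<in> borel_measurable borel \<Longrightarrow> f \<in> borel_measurable lebesgue"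
  for f :: "'a::euclidean_space \<Rightarrow> 'b::euclidean_space"
  by (simp add: measurable_completion)

lemma loc_int_representative:
  fixes f f' :: "'a::euclidean_space \<Rightarrow> real"
  assumes f: "locally_integrable f" and f': "f' \<in> borel_measurable borel"
    and AE: "AE x in lborel. f x = f' x"
  shows "loc_int f'"
  unfolding loc_int_def
proof (intro conjI allI)
  fix R :: real
  have "f absolutely_integrable_on cball 0 R" using f by (auto simp: locally_integrable_def)
  then have int: "integrable lebesgue (\<lambda>x. indicator (cball 0 R) x * f x)"
    by (simp add: set_integrable_def)
  have "AE x in lborel. indicator (cball 0 R) x * f x = indicator (cball 0 R) x * f' x"
    using AE by eventually_elim simp
  moreover have "(\<lambda>x. indicator (cball 0 R) x * f' x) \<in> borel_measurable borel" using f' by measurable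
  ultimately show "integrable lborel (\<lambda>x. indicator (cball 0 R) x * f' x)"
    using lebesgue_eq_lborel_integral(2)[OF borel_measurable_integrable[OF int]] int by blast
qed (rule f')

lemma locally_integrable_inner:
  fixes G :: "'a::euclidean_space \<Rightarrow> 'b::euclidean_space"
  assumes "locally_integrable G"
  shows "locally_integrable (\<lambda>x. G x \<bullet> b)"
  unfolding locally_integrable_def
proof (intro conjI allI impI)
  show "(\<lambda>x. G x \<bullet> b) \<in> borel_measurable lebesgue"
    by (rule borel_measurable_inner[OF _ borel_measurable_const]) (use assms in \<open>simp add: locally_integrable_def\<close>)
  fix K :: "'a set" assume "compact K"
  then have "integrable lebesgue (\<lambda>x. indicator K x *\<^sub>R G x)" using assms by (simp add: locally_integrable_def set_integrable_def)
  then have "integrable lebesgue (\<lambda>x. (indicator K x *\<^sub>R G x) \<bullet> b)" by (intro integrable_inner_left)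
  then show "(\<lambda>x. G x \<bullet> b) absolutely_integrable_on K" by (simp add: set_integrable_def)
qed

lemma gradient_inner_Basis:
  "b \<in> Basis \<Longrightarrow> gradient \<phi> x \<bullet> b = dir_deriv b \<phi> x"
  by (simp add: gradient_def dir_deriv_def)

text \<open>
  The vector-valued identity for the gradient is read off in components. Both vector-valued integrands
  have to be shown integrable first, componentwise, for inner products to commute with the integral.
\<close>

lemma weak_gradient_representative:
  fixes v v' :: "'a::euclidean_space \<Rightarrow> real"
  assumes vG: "has_weak_gradient v G" and b: "b \<in> Basis"
    and v': "v' \<in> borel_measurable borel" "AE x in lborel. v x = v' x"
    and G': "\<And>b. b \<in> Basis \<Longrightarrow> G' b \<in> borel_measurable borel" "\<And>b. b \<in> Basis \<Longrightarrow> AE x in lborel. G x \<bullet> b = G' b x"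
  shows "wderiv b v' (G' b)"
proof -
  have lv: "locally_integrable v" and lG: "locally_integrable G"
    and ibp: "\<And>\<phi>. \<phi> \<in> test_functions \<Longrightarrow>
      (LINT x|lebesgue. v x *\<^sub>R gradient \<phi> x) = - (LINT x|lebesgue. \<phi> x *\<^sub>R G x)"
    using vG by (auto simp: has_weak_gradient_def)
  have vm: "v \<in> borel_measurable lebesgue" and Gm: "G \<in> borel_measurable lebesgue" using lv lG by (auto simp: locally_integrable_def)
  have v'l: "loc_int v'" by (rule loc_int_representative[OF lv v'])
  have G'l: "loc_int (G' c)" if c: "c \<in> Basis" for c
    by (rule loc_int_representative[OF locally_integrable_inner[OF lG] G'[OF c]])
  have "(LINT x|lborel. dir_deriv b \<phi> x * v' x) = - (LINT x|lborel. \<phi> x * G' b x)" if \<phi>: "\<phi> \<in> test_functions" for \<phi>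
  proof -
    have \<phi>m: "\<phi> \<in> borel_measurable borel" "dir_deriv c \<phi> \<in> borel_measurable borel" for c
      using \<phi> test_functions_dir_deriv[OF \<phi>] test_functions_measurable by auto
    note \<phi>l = lebesgue_measurable_borel[OF \<phi>m(1)] lebesgue_measurable_borel[OF \<phi>m(2)]
    have 1: "integrable lebesgue (\<lambda>x. dir_deriv c \<phi> x * v x)" "(LINT x|lebesgue. dir_deriv c \<phi> x * v x) = (LINT x|lborel. dir_deriv c \<phi> x * v' x)" for c
    proof -
      have AE: "AE x in lborel. dir_deriv c \<phi> x * v x = dir_deriv c \<phi> x * v' x" using v'(2) by eventually_elim simp
      have m1: "(\<lambda>x. dir_deriv c \<phi> x * v x) \<in> borel_measurable lebesgue" by (rule borel_measurable_times[OF \<phi>l(2) vm])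
      have m2: "(\<lambda>x. dir_deriv c \<phi> x * v' x) \<in> borel_measurable borel" by (rule borel_measurable_times[OF \<phi>m(2) v'(1)])
      show "integrable lebesgue (\<lambda>x. dir_deriv c \<phi> x * v x)"
        using lebesgue_eq_lborel_integral(2)[OF m1 m2 AE] loc_int_test_integrable[OF v'l test_functions_dir_deriv[OF \<phi>]] by blast
      show "(LINT x|lebesgue. dir_deriv c \<phi> x * v x) = (LINT x|lborel. dir_deriv c \<phi> x * v' x)"
        by (rule lebesgue_eq_lborel_integral(1)[OF m1 m2 AE])
    qed
    have 2: "integrable lebesgue (\<lambda>x. \<phi> x * (G x \<bullet> c))" "(LINT x|lebesgue. \<phi> x * (G x \<bullet> c)) = (LINT x|lborel. \<phi> x * G' c x)"
      if c: "c \<in> Basis" for c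
    proof -
      have AE: "AE x in lborel. \<phi> x * (G x \<bullet> c) = \<phi> x * G' c x" using G'(2)[OF c] by eventually_elim simp
      have m1: "(\<lambda>x. \<phi> x * (G x \<bullet> c)) \<in> borel_measurable lebesgue"
        by (rule borel_measurable_times[OF \<phi>l(1) borel_measurable_inner[OF Gm borel_measurable_const]])
      have m2: "(\<lambda>x. \<phi> x * G' c x) \<in> borel_measurable borel" by (rule borel_measurable_times[OF \<phi>m(1) G'(1)[OF c]])
      show "integrable lebesgue (\<lambda>x. \<phi> x * (G x \<bullet> c))"
        using lebesgue_eq_lborel_integral(2)[OF m1 m2 AE] loc_int_test_integrable[OF G'l[OF c] \<phi>] by blast
      show "(LINT x|lebesgue. \<phi> x * (G x \<bullet> c)) = (LINT x|lborel. \<phi> x * G' c x)"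
        by (rule lebesgue_eq_lborel_integral(1)[OF m1 m2 AE])
    qed
    have i1: "integrable lebesgue (\<lambda>x. v x *\<^sub>R gradient \<phi> x)"
    proof -
      have "integrable lebesgue (\<lambda>x. \<Sum>c\<in>Basis. (dir_deriv c \<phi> x * v x) *\<^sub>R c)"
        by (intro Bochner_Integration.integrable_sum integrable_scaleR_left 1(1))
      moreover have "(\<Sum>c\<in>Basis. (dir_deriv c \<phi> x * v x) *\<^sub>R c) = v x *\<^sub>R gradient \<phi> x" for x
        by (simp add: gradient_def dir_deriv_def scaleR_sum_right mult.commute)
      ultimately show ?thesis by simp
    qed
    have i2: "integrable lebesgue (\<lambda>x. \<phi> x *\<^sub>R G x)"
    proof -
      have "integrable lebesgue (\<lambda>x. \<Sum>c\<in>Basis. (\<phi> x * (G x \<bullet> c)) *\<^sub>R c)"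
        by (intro Bochner_Integration.integrable_sum integrable_scaleR_left 2(1))
      moreover have "(\<Sum>c\<in>Basis. (\<phi> x * (G x \<bullet> c)) *\<^sub>R c) = \<phi> x *\<^sub>R G x" for x
        using euclidean_representation[of "\<phi> x *\<^sub>R G x"] by simp
      ultimately show ?thesis by simp
    qed
    have "(LINT x|lebesgue. (v x *\<^sub>R gradient \<phi> x) \<bullet> b) = - (LINT x|lebesgue. (\<phi> x *\<^sub>R G x) \<bullet> b)"
      using ibp[OF \<phi>] i1 i2 by (simp add: integral_inner_left del: inner_scaleR_left)
    then have "(LINT x|lebesgue. dir_deriv b \<phi> x * v x) = - (LINT x|lebesgue. \<phi> x * (G x \<bullet> b))"
      by (simp add: gradient_inner_Basis[OF b] mult.commute)
    then show ?thesis using 1(2)[of b] 2(2)[OF b] by simp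
  qed
  then show ?thesis using v'l G'l[OF b] by (simp add: wderiv_def)
qed

lemma coulomb_sobolev_representative:
  fixes v :: "'a::euclidean_space \<Rightarrow> real"
  assumes v: "v \<in> coulomb_sobolev \<alpha> p" "v \<in> Lp q"
  shows "\<exists>v' H. v' \<in> borel_measurable borel \<and> (AE x in lborel. v x = v' x) \<and>
    (\<forall>b\<in>Basis. H b \<in> borel_measurable borel \<and> (AE x in lborel. weak_grad v x \<bullet> b = H b x)) \<and> partials v' H \<and>
    (\<forall>b\<in>Basis. integrable lborel (\<lambda>x. \<bar>H b x\<bar> powr 2)) \<and> integrable lborel (\<lambda>x. \<bar>v' x\<bar> powr q) \<and>
    coulomb_energy \<alpha> p v' < \<infinity>"
proof -
  have vm: "v \<in> borel_measurable lebesgue" and wd: "weakly_differentiable v" and G2: "weak_grad v \<in> Lp 2"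
    and ce: "coulomb_energy \<alpha> p v < \<infinity>"
    using v(1) unfolding coulomb_sobolev_def coulomb_energy_def by (auto simp: nn_integral_completion)
  have wg: "has_weak_gradient v (weak_grad v)"
    using wd unfolding weakly_differentiable_def weak_grad_def by (rule someI_ex)
  have Gm: "weak_grad v \<in> borel_measurable lebesgue" and Gi: "integrable lebesgue (\<lambda>x. norm (weak_grad v x) powr 2)"
    using G2 by (auto simp: Lp_def)
  obtain v' where v': "v' \<in> borel_measurable borel" "AE x in lborel. v x = v' x" using borel_representative[OF vm] by blast
  have "\<exists>h \<in> borel_measurable borel. AE x in lborel. weak_grad v x \<bullet> b = h x" for b
    by (rule borel_representative) (rule borel_measurable_inner[OF Gm borel_measurable_const])
  then obtain H where H: "\<And>b. H b \<in> borel_measurable borel" "\<And>b. AE x in lborel. weak_grad v x \<bullet> b = H b x" by metis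
  have "partials v' H" unfolding partials_def
  proof
    fix b :: 'a assume b: "b \<in> Basis"
    show "wderiv b v' (H b)" by (rule weak_gradient_representative[OF wg b v' H])
  qed
  moreover have "integrable lborel (\<lambda>x. \<bar>H b x\<bar> powr 2)" if b: "b \<in> Basis" for b
  proof -
    have m1: "(\<lambda>x. \<bar>weak_grad v x \<bullet> b\<bar> powr 2) \<in> borel_measurable lebesgue"
      using borel_measurable_inner[OF Gm borel_measurable_const[of b]] by measurable
    have m2: "(\<lambda>x. \<bar>H b x\<bar> powr 2) \<in> borel_measurable borel" using H(1)[of b] by measurable
    have AE: "AE x in lborel. \<bar>weak_grad v x \<bullet> b\<bar> powr 2 = \<bar>H b x\<bar> powr 2" using H(2)[of b] by eventually_elim simp
    have "integrable lebesgue (\<lambda>x. \<bar>weak_grad v x \<bullet> b\<bar> powr 2)"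
    proof (rule Bochner_Integration.integrable_bound[OF Gi m1])
      have "\<bar>weak_grad v x \<bullet> b\<bar> powr 2 \<le> norm (weak_grad v x) powr 2" for x
        by (rule powr_mono2) (simp_all add: Basis_le_norm[OF b])
      then show "AE x in lebesgue. norm (\<bar>weak_grad v x \<bullet> b\<bar> powr 2) \<le> norm (norm (weak_grad v x) powr 2)" by simp
    qed
    then show ?thesis using lebesgue_eq_lborel_integral(2)[OF m1 m2 AE] by blast
  qed
  moreover have "integrable lborel (\<lambda>x. \<bar>v' x\<bar> powr q)"
  proof -
    have i: "integrable lebesgue (\<lambda>x. \<bar>v x\<bar> powr q)" using v(2) by (simp add: Lp_def)
    have m2: "(\<lambda>x. \<bar>v' x\<bar> powr q) \<in> borel_measurable borel" using v'(1) by measurable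
    have AE: "AE x in lborel. \<bar>v x\<bar> powr q = \<bar>v' x\<bar> powr q" using v'(2) by eventually_elim simp
    show ?thesis using lebesgue_eq_lborel_integral(2)[OF borel_measurable_integrable[OF i] m2 AE] i by blast
  qed
  moreover have "coulomb_energy \<alpha> p v' < \<infinity>" using ce coulomb_energy_cong_AE[OF v'(2)] by simp
  ultimately show ?thesis using v' H by blast
qed

theorem proposition5p6:
  fixes \<alpha> p q N :: real
  assumes N: "N = real DIM('a::euclidean_space)"
    and "0 < \<alpha>" and "\<alpha> < N" and "p > 1" and "q > 1"
    and "(1 / p > max (N - 2) 0 / (N + \<alpha>) \<and>
            1 / q \<notin> {1 / 2 - 1 / N <..< 1 / (2 * p) + \<alpha> / (2 * N * p)}) \<or>
         (1 / p < max (N - 2) 0 / (N + \<alpha>) \<and>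
            1 / q \<notin> {1 / (2 * p) + \<alpha> / (2 * N * p) <..< 1 / 2 - 1 / N})"
  shows "\<not> (\<exists>u :: 'a \<Rightarrow> real.
            u \<in> coulomb_sobolev \<alpha> p \<inter> Lp q \<and>
            grad_loc_in u (coulomb_sobolev \<alpha> p \<inter> Lp q) \<and>
            weak_solution \<alpha> p q u \<and>
            \<not> (AE x in lebesgue. u x = 0))"
proof
  assume "\<exists>u :: 'a \<Rightarrow> real.
            u \<in> coulomb_sobolev \<alpha> p \<inter> Lp q \<and>
            grad_loc_in u (coulomb_sobolev \<alpha> p \<inter> Lp q) \<and>
            weak_solution \<alpha> p q u \<and>
            \<not> (AE x in lebesgue. u x = 0)"
  then obtain u0 :: "'a \<Rightarrow> real" where u0: "u0 \<in> coulomb_sobolev \<alpha> p" "u0 \<in> Lp q"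
    and reg: "grad_loc_in u0 (coulomb_sobolev \<alpha> p \<inter> Lp q)"
    and sol: "weak_solution \<alpha> p q u0" and nontrivial: "\<not> (AE x in lebesgue. u0 x = 0)" by blast
  obtain u g where u: "u \<in> borel_measurable borel" "AE x in lborel. u0 x = u x"
    and g: "\<And>b. b \<in> Basis \<Longrightarrow> g b \<in> borel_measurable borel" "\<And>b. b \<in> Basis \<Longrightarrow> AE x in lborel. weak_grad u0 x \<bullet> b = g b x"
    and ug: "partials u g" "\<And>b. b \<in> Basis \<Longrightarrow> integrable lborel (\<lambda>x. \<bar>g b x\<bar> powr 2)"
      "integrable lborel (\<lambda>x. \<bar>u x\<bar> powr q)" "coulomb_energy \<alpha> p u < \<infinity>"
    using coulomb_sobolev_representative[OF u0] by blast
  have AEg: "AE x in lborel. \<forall>b\<in>Basis. weak_grad u0 x \<bullet> b = g b x"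
    by (rule AE_finite_allI[OF finite_Basis g(2)])
  have pot: "riesz_potential \<alpha> (\<lambda>y. \<bar>u0 y\<bar> powr p) x = riesz_potential \<alpha> (\<lambda>y. \<bar>u y\<bar> powr p) x" for x
    unfolding riesz_potential_lborel
    by (rule nn_integral_cong_AE) (use u(2) in eventually_elim, simp)
  have weak_eq: "(\<Sum>b\<in>Basis. LINT x|lborel. g b x * dir_deriv b \<phi> x) +
      (LINT x|lborel. enn2real (riesz_potential \<alpha> (\<lambda>y. \<bar>u y\<bar> powr p) x) * sgn_powr p (u x) * \<phi> x) =
      (LINT x|lborel. sgn_powr q (u x) * \<phi> x)" if \<phi>: "\<phi> \<in> test_functions" for \<phi>
  proof -
    have \<phi>m [measurable]: "\<phi> \<in> borel_measurable borel" "dir_deriv b \<phi> \<in> borel_measurable borel" for b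
      using \<phi> test_functions_dir_deriv[OF \<phi>] test_functions_measurable by auto
    have um [measurable]: "u \<in> borel_measurable borel" by (rule u(1))
    define D where "D x = weak_grad u0 x \<bullet> gradient \<phi> x" for x
    define V where "V x = enn2real (riesz_potential \<alpha> (\<lambda>y. \<bar>u0 y\<bar> powr p) x) * \<bar>u0 x\<bar> powr (p - 2) * u0 x * \<phi> x" for x
    define F where "F x = \<bar>u0 x\<bar> powr (q - 2) * u0 x * \<phi> x" for x
    have int: "integrable lebesgue D" "integrable lebesgue V" "integrable lebesgue F"
      and eq: "(LINT x|lebesgue. D x) + (LINT x|lebesgue. V x) = (LINT x|lebesgue. F x)"
      using sol \<phi> unfolding weak_solution_def Let_def D_def[abs_def] V_def[abs_def] F_def[abs_def] by blast+
    have m1: "(\<lambda>x. \<Sum>b\<in>Basis. g b x * dir_deriv b \<phi> x) \<in> borel_measurable borel"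
      by (rule borel_measurable_sum) (rule borel_measurable_times[OF g(1) \<phi>m(2)])
    have "AE x in lborel. D x = (\<Sum>b\<in>Basis. g b x * dir_deriv b \<phi> x)"
      using AEg
    proof eventually_elim
      case (elim x)
      have "D x = (\<Sum>b\<in>Basis. (weak_grad u0 x \<bullet> b) * (gradient \<phi> x \<bullet> b))" unfolding D_def by (rule euclidean_inner)
      also have "\<dots> = (\<Sum>b\<in>Basis. g b x * dir_deriv b \<phi> x)"
        by (rule sum.cong[OF refl]) (use elim in \<open>simp add: gradient_inner_Basis\<close>)
      finally show ?case .
    qed
    from lebesgue_eq_lborel_integral(1)[OF borel_measurable_integrable[OF int(1)] m1 this]
    have "(LINT x|lebesgue. D x) = (LINT x|lborel. (\<Sum>b\<in>Basis. g b x * dir_deriv b \<phi> x))" .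
    also have "\<dots> = (\<Sum>b\<in>Basis. LINT x|lborel. g b x * dir_deriv b \<phi> x)"
    proof (rule Bochner_Integration.integral_sum)
      fix b :: 'a assume b: "b \<in> Basis"
      have "loc_int (g b)" using ug(1) b wderivD(2) unfolding partials_def by blast
      from loc_int_test_integrable[OF this test_functions_dir_deriv[OF \<phi>]]
      show "integrable lborel (\<lambda>x. g b x * dir_deriv b \<phi> x)" by (simp add: mult.commute)
    qed
    finally have 1: "(LINT x|lebesgue. D x) = (\<Sum>b\<in>Basis. LINT x|lborel. g b x * dir_deriv b \<phi> x)" .
    have 2: "(LINT x|lebesgue. V x) = (LINT x|lborel. enn2real (riesz_potential \<alpha> (\<lambda>y. \<bar>u y\<bar> powr p) x) * sgn_powr p (u x) * \<phi> x)"
    proof (rule lebesgue_eq_lborel_integral(1)[OF borel_measurable_integrable[OF int(2)]])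
      show "AE x in lborel. V x = enn2real (riesz_potential \<alpha> (\<lambda>y. \<bar>u y\<bar> powr p) x) * sgn_powr p (u x) * \<phi> x"
        using u(2) by eventually_elim (simp add: V_def pot sgn_powr_def)
    qed measurable
    have 3: "(LINT x|lebesgue. F x) = (LINT x|lborel. sgn_powr q (u x) * \<phi> x)"
    proof (rule lebesgue_eq_lborel_integral(1)[OF borel_measurable_integrable[OF int(3)]])
      show "AE x in lborel. F x = sgn_powr q (u x) * \<phi> x"
        using u(2) by eventually_elim (simp add: F_def sgn_powr_def)
    qed measurable
    show ?thesis using eq unfolding 1 2 3 .
  qed
  interpret S: choquard_solution \<alpha> p q u g
    by (rule choquard_solution.intro) (use assms ug weak_eq in simp_all)
  interpret R: choquard_regular \<alpha> p q u g
  proof (unfold_locales)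
    fix \<psi> :: "'a \<Rightarrow> 'a" assume \<psi>: "\<psi> \<in> test_functions"
    have "(\<lambda>x. \<psi> x \<bullet> weak_grad u0 x) \<in> coulomb_sobolev \<alpha> p" "(\<lambda>x. \<psi> x \<bullet> weak_grad u0 x) \<in> Lp q"
      using reg \<psi> by (auto simp: grad_loc_in_def)
    from coulomb_sobolev_representative[OF this] obtain w H where
      w: "AE x in lborel. \<psi> x \<bullet> weak_grad u0 x = w x" and adm: "partials w H"
      "\<forall>b\<in>Basis. integrable lborel (\<lambda>x. \<bar>H b x\<bar> powr 2)" "integrable lborel (\<lambda>x. \<bar>w x\<bar> powr q)"
      "coulomb_energy \<alpha> p w < \<infinity>" by blast
    have "AE x in lborel. w x = (\<Sum>b\<in>Basis. (\<psi> x \<bullet> b) * g b x)"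
      using w AEg
    proof eventually_elim
      case (elim x)
      have "w x = (\<Sum>b\<in>Basis. (\<psi> x \<bullet> b) * (weak_grad u0 x \<bullet> b))" unfolding elim(1)[symmetric] by (rule euclidean_inner)
      also have "\<dots> = (\<Sum>b\<in>Basis. (\<psi> x \<bullet> b) * g b x)" by (rule sum.cong[OF refl]) (use elim(2) in simp)
      finally show ?case .
    qed
    moreover have "S.admissible w H" using adm by (simp add: S.admissible_def)
    ultimately show "\<exists>w H. S.admissible w H \<and> (AE x in lborel. w x = (\<Sum>b\<in>Basis. (\<psi> x \<bullet> b) * g b x))" by blast
  qed
  have "AE x in lborel. u x = 0" by (rule R.trivial_if_exponents_excluded[OF assms(1,6)])
  then have "AE x in lborel. u0 x = 0" using u(2) by eventually_elim simp
  then show False using nontrivial AE_completion by blast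
qed

end
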